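(* Let $\mathscr{A}$ be a BK-tuple of finite sets in a lattice $M$. The mixed discriminant of $\mathscr{A}$ is (1) empty if $\mathscr{A}$ is not simple; (2) a hypersurface if $\mathscr{A}$ is simple and not prelinear; (3) an irreducible algebraic set of codimension two if $\mathscr{A}$ is simple and prelinear. Moreover, if $\mathscr{A}$ is simple, then the mixed discriminant of $\mathscr{A}$ equals the Cayley discriminant of $\mathscr{A}$.
   Context: Let $M\simeq\mathbb{Z}^n$ and let $T\simeq(\mathbb{C}^\times)^n$ be the torus with character lattice $M$. For a finite nonempty $A\subset M$, $\mathbb{C}_A$ is the space of Laurent polynomials $\sum_{a\in A}c_ax^a$; for $\mathscr{A}=(A_1,\ldots,A_k)$, $\mathbb{C}_{\mathscr{A}}=\bigoplus_i\mathbb{C}_{A_i}$. Subtuples correspond to subsets of $\{1,\ldots,k\}$. The linear span $\langle\mathscr{B}\rangle$ of a (sub)tuple is the sublattice generated by all differences $a-a'$ with $a,a'$ in the same set of $\mathscr{B}$; $\overline{\langle\mathscr{B}\rangle}$ is its saturation (the maximal sublattice of the same dimension containing it). Standing assumption: $\langle\mathscr{A}\rangle=M$. The defect is $\delta(\mathscr{B})=\dim\langle\mathscr{B}\rangle-|\mathscr{B}|$. A tuple is independent if all its subtuples have non-negative defect; a BK-tuple is an independent tuple of zero defect (the empty subtuple is a BK-subtuple). A BK-tuple is simple if it is not a union of its proper BK-subtuples. A simple BK-tuple $\mathscr{B}$ has a largest (by inclusion) proper BK-subtuple $\mathscr{K}$ (possibly empty); $\mathscr{B}$ is prelinear if the tuple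 of images of the sets of $\mathscr{B}\setminus\mathscr{K}$ under the projection $M\to M/\overline{\langle\mathscr{K}\rangle}$ is linear. A BK-tuple $\mathscr{C}=(C_1,\ldots,C_m)$ is linear if there are translations of the sets $C_i$ and a lattice isomorphism $\langle\mathscr{C}\rangle\to\mathbb{Z}^m$ mapping every translated $C_i$ into the standard simplex $\{0,e_1,\ldots,e_m\}$. A degenerate root of $(f_1,\ldots,f_k)\in\mathbb{C}_{\mathscr{A}}$ is a point $x\in T$ with $f_1(x)=\cdots=f_k(x)=0$ and $df_1\wedge\cdots\wedge df_k(x)=0$; it is a non-degenerate multiple root if in addition no proper subtuple of $df_1(x),\ldots,df_k(x)$ is linearly dependent. The mixed discriminant of $\mathscr{A}$ is the Zariski closure in $\mathbb{C}_{\mathscr{A}}$ of the set of systems having a non-degenerate multiple root. The Cayley set is $cay(\mathscr{A})=\bigcup_{i}A_i\times\{e_i\}\subset M\times\mathbb{Z}^{k}$, and the Cayley discriminant of $\mathscr{A}$ is the preimage in $\mathbb{C}_{\mathscr{A}}$, under the isomorphism $(f_1,\ldots,f_k)\mapsto\sum_{i}\lambda_if_i(x)\in\mathbb{C}_{cay(\mathscr{A})}$, of the closure of the set of polynomials in $\mathbb{C}_{cay(\mathscr{A})}$ having a zero in $T\times(\mathbb{C}^\times)^k$ at which the differential vanishes. A hypersurface is an irreducible algebraic set of codimension one. *)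

theory Defs
  imports
    "HOL-Analysis.Analysis"
    "HOL-Algebra.Free_Abelian_Groups"
    "HOL-Combinatorics.Permutations"
begin

section \<open>Tuples of finite sets in a lattice\<close>

text \<open>
  The lattice \<open>Z^n\<close> is the free Abelian group on \<open>{..<n}\<close>, with standard basis
  \<open>frag_of 0, \<dots>, frag_of (n - 1)\<close>. HOL-Algebra writes its group operation multiplicatively.
  A tuple of sets in a group is a function \<open>A\<close> of the index together with a finite index set;
  subtuples are given by subsets of that index set.
\<close>

abbreviation int_lattice :: "nat \<Rightarrow> (nat \<Rightarrow>\<^sub>0 int) monoid" where
  "int_lattice n \<equiv> free_Abelian_group {..<n}"

definition tuple_span :: "('a, 'b) monoid_scheme \<Rightarrow> ('k \<Rightarrow> 'a set) \<Rightarrow> 'k set \<Rightarrow> 'a set" where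
  "tuple_span G A B = generate G (\<Union>i\<in>B. {a \<otimes>\<^bsub>G\<^esub> inv\<^bsub>G\<^esub> a' | a a'. a \<in> A i \<and> a' \<in> A i})"

definition lattice_dim :: "('a, 'b) monoid_scheme \<Rightarrow> 'a set \<Rightarrow> nat" where
  "lattice_dim G L = (THE r. G\<lparr>carrier := L\<rparr> \<cong> int_lattice r)"

definition saturation :: "('a, 'b) monoid_scheme \<Rightarrow> 'a set \<Rightarrow> 'a set" where
  "saturation G L =
     (GREATEST L'. subgroup L' G \<and> L \<subseteq> L' \<and> lattice_dim G L' = lattice_dim G L)"

definition defect :: "('a, 'b) monoid_scheme \<Rightarrow> ('k \<Rightarrow> 'a set) \<Rightarrow> 'k set \<Rightarrow> int" where
  "defect G A B = int (lattice_dim G (tuple_span G A B)) - int (card B)"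

definition independent_tuple :: "('a, 'b) monoid_scheme \<Rightarrow> ('k \<Rightarrow> 'a set) \<Rightarrow> 'k set \<Rightarrow> bool" where
  "independent_tuple G A B \<longleftrightarrow> (\<forall>C\<subseteq>B. defect G A C \<ge> 0)"

definition BK_tuple :: "('a, 'b) monoid_scheme \<Rightarrow> ('k \<Rightarrow> 'a set) \<Rightarrow> 'k set \<Rightarrow> bool" where
  "BK_tuple G A B \<longleftrightarrow> independent_tuple G A B \<and> defect G A B = 0"

text \<open>The empty tuple, being the union of the empty family, is not simple.\<close>

definition simple_BK_tuple :: "('a, 'b) monoid_scheme \<Rightarrow> ('k \<Rightarrow> 'a set) \<Rightarrow> 'k set \<Rightarrow> bool" where
  "simple_BK_tuple G A B \<longleftrightarrow>
     BK_tuple G A B \<and> \<not> (\<exists>\<F> \<subseteq> {C. C \<subset> B \<and> BK_tuple G A C}. \<Union>\<F> = B)"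

definition linear_BK_tuple :: "('a, 'b) monoid_scheme \<Rightarrow> ('k \<Rightarrow> 'a set) \<Rightarrow> 'k set \<Rightarrow> bool" where
  "linear_BK_tuple G C J \<longleftrightarrow>
     BK_tuple G C J \<and>
     (\<exists>t \<phi>. (\<forall>i\<in>J. t i \<in> carrier G) \<and>
        \<phi> \<in> iso (G\<lparr>carrier := tuple_span G C J\<rparr>) (int_lattice (card J)) \<and>
        (\<forall>i\<in>J. \<forall>c\<in>C i. c \<otimes>\<^bsub>G\<^esub> t i \<in> tuple_span G C J \<and>
                      \<phi> (c \<otimes>\<^bsub>G\<^esub> t i) \<in> insert 0 (frag_of ` {..<card J})))"

definition largest_proper_BK :: "('a, 'b) monoid_scheme \<Rightarrow> ('k \<Rightarrow> 'a set) \<Rightarrow> 'k set \<Rightarrow> 'k set" where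
  "largest_proper_BK G A B = (GREATEST K. K \<subset> B \<and> BK_tuple G A K)"

definition prelinear :: "('a, 'b) monoid_scheme \<Rightarrow> ('k \<Rightarrow> 'a set) \<Rightarrow> 'k set \<Rightarrow> bool" where
  "prelinear G A B \<longleftrightarrow>
     simple_BK_tuple G A B \<and>
     (let K = largest_proper_BK G A B;
          S = saturation G (tuple_span G A K)
      in linear_BK_tuple (G Mod S) (\<lambda>i. (\<lambda>a. S #>\<^bsub>G\<^esub> a) ` A i) (B - K))"


section \<open>Zariski topology on a complex affine space\<close>

text \<open>
  The affine space with coordinates indexed by \<open>J\<close>; a vector is a function on the whole index
  type that vanishes outside \<open>J\<close>.
\<close>

definition coeff_space :: "'j set \<Rightarrow> ('j \<Rightarrow> complex) set" where
  "coeff_space J = {c. \<forall>j. j \<notin> J \<longrightarrow> c j = 0}"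

inductive_set polynomial_functions :: "(('j \<Rightarrow> complex) \<Rightarrow> complex) set" where
  const: "(\<lambda>c. z) \<in> polynomial_functions"
| coord: "(\<lambda>c. c j) \<in> polynomial_functions"
| add: "\<lbrakk>p \<in> polynomial_functions; q \<in> polynomial_functions\<rbrakk>
         \<Longrightarrow> (\<lambda>c. p c + q c) \<in> polynomial_functions"
| mult: "\<lbrakk>p \<in> polynomial_functions; q \<in> polynomial_functions\<rbrakk>
         \<Longrightarrow> (\<lambda>c. p c * q c) \<in> polynomial_functions"

definition zariski :: "'j set \<Rightarrow> ('j \<Rightarrow> complex) topology" where
  "zariski J = topology (\<lambda>U. \<exists>F \<subseteq> polynomial_functions. U = {c \<in> coeff_space J. \<exists>p\<in>F. p c \<noteq> 0})"

lemma istopology_zariski: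
  "istopology (\<lambda>U. \<exists>F \<subseteq> polynomial_functions. U = {c \<in> coeff_space J. \<exists>p\<in>F. p c \<noteq> 0})"
  unfolding istopology_def
proof (intro conjI allI impI)
  fix S T :: "('a \<Rightarrow> complex) set"
  assume "\<exists>F \<subseteq> polynomial_functions. S = {c \<in> coeff_space J. \<exists>p\<in>F. p c \<noteq> 0}"
  then obtain F where F: "F \<subseteq> polynomial_functions" "S = {c \<in> coeff_space J. \<exists>p\<in>F. p c \<noteq> 0}"
    by blast
  assume "\<exists>F \<subseteq> polynomial_functions. T = {c \<in> coeff_space J. \<exists>p\<in>F. p c \<noteq> 0}"
  then obtain H where H: "H \<subseteq> polynomial_functions" "T = {c \<in> coeff_space J. \<exists>p\<in>H. p c \<noteq> 0}"
    by blast
  let ?P = "(\<lambda>(p, q) c. p c * q c) ` (F \<times> H)"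
  have "?P \<subseteq> polynomial_functions"
    using F(1) H(1) by (auto intro: polynomial_functions.mult)
  moreover have "S \<inter> T = {c \<in> coeff_space J. \<exists>p\<in>?P. p c \<noteq> 0}"
    unfolding F(2) H(2) by auto
  ultimately show "\<exists>F \<subseteq> polynomial_functions. S \<inter> T = {c \<in> coeff_space J. \<exists>p\<in>F. p c \<noteq> 0}"
    by blast
next
  fix \<K> :: "('a \<Rightarrow> complex) set set"
  let ?R = "\<lambda>S F. F \<subseteq> polynomial_functions \<and> S = {c \<in> coeff_space J. \<exists>p\<in>F. p c \<noteq> 0}"
  assume "\<forall>S\<in>\<K>. \<exists>F \<subseteq> polynomial_functions. S = {c \<in> coeff_space J. \<exists>p\<in>F. p c \<noteq> 0}"
  then have "\<forall>S\<in>\<K>. \<exists>F. ?R S F" .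
  then obtain F where F: "\<forall>S\<in>\<K>. ?R S (F S)"
    using bchoice[of \<K> ?R] by blast
  have mem: "c \<in> S \<longleftrightarrow> c \<in> coeff_space J \<and> (\<exists>p\<in>F S. p c \<noteq> 0)" if "S \<in> \<K>" for S c
  proof -
    have "S = {c \<in> coeff_space J. \<exists>p\<in>F S. p c \<noteq> 0}"
      using F that by blast
    then have "c \<in> S \<longleftrightarrow> c \<in> {c \<in> coeff_space J. \<exists>p\<in>F S. p c \<noteq> 0}"
      by (rule arg_cong)
    then show ?thesis by blast
  qed
  have "\<Union>\<K> = {c \<in> coeff_space J. \<exists>p\<in>(\<Union>S\<in>\<K>. F S). p c \<noteq> 0}"
    using mem by blast
  moreover have "(\<Union>S\<in>\<K>. F S) \<subseteq> polynomial_functions"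
    using F by blast
  ultimately show "\<exists>F \<subseteq> polynomial_functions. \<Union>\<K> = {c \<in> coeff_space J. \<exists>p\<in>F. p c \<noteq> 0}"
    by blast
qed

lemma openin_zariski:
  "openin (zariski J) U \<longleftrightarrow>
     (\<exists>F \<subseteq> polynomial_functions. U = {c \<in> coeff_space J. \<exists>p\<in>F. p c \<noteq> 0})"
  unfolding zariski_def by (simp add: topology_inverse'[OF istopology_zariski])

lemma topspace_zariski [simp]: "topspace (zariski J) = coeff_space J"
proof
  show "topspace (zariski J) \<subseteq> coeff_space J"
    using openin_topspace[of "zariski J"] unfolding openin_zariski by auto
  have "openin (zariski J) (coeff_space J)"
    unfolding openin_zariski
    by (rule exI[of _ "{\<lambda>c. 1}"]) (auto intro: polynomial_functions.const)
  then show "coeff_space J \<subseteq> topspace (zariski J)"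
    by (rule openin_subset)
qed

lemma closedin_zariski:
  "closedin (zariski J) Z \<longleftrightarrow>
     (\<exists>F \<subseteq> polynomial_functions. Z = {c \<in> coeff_space J. \<forall>p\<in>F. p c = 0})"
proof
  assume "closedin (zariski J) Z"
  then obtain F where F: "Z \<subseteq> coeff_space J" "F \<subseteq> polynomial_functions"
      "coeff_space J - Z = {c \<in> coeff_space J. \<exists>p\<in>F. p c \<noteq> 0}"
    unfolding closedin_def openin_zariski by auto
  then have "Z = {c \<in> coeff_space J. \<forall>p\<in>F. p c = 0}" by blast
  with F(2) show "\<exists>F \<subseteq> polynomial_functions. Z = {c \<in> coeff_space J. \<forall>p\<in>F. p c = 0}" by blast
next
  assume "\<exists>F \<subseteq> polynomial_functions. Z = {c \<in> coeff_space J. \<forall>p\<in>F. p c = 0}"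
  then obtain F where F: "F \<subseteq> polynomial_functions" "Z = {c \<in> coeff_space J. \<forall>p\<in>F. p c = 0}"
    by blast
  then have "coeff_space J - Z = {c \<in> coeff_space J. \<exists>p\<in>F. p c \<noteq> 0}" by blast
  with F show "closedin (zariski J) Z"
    unfolding closedin_def openin_zariski by auto
qed

definition irreducible_closedin :: "'a topology \<Rightarrow> 'a set \<Rightarrow> bool" where
  "irreducible_closedin X Z \<longleftrightarrow>
     closedin X Z \<and> Z \<noteq> {} \<and>
     (\<forall>U V. closedin X U \<and> closedin X V \<and> Z = U \<union> V \<longrightarrow> Z = U \<or> Z = V)"

text \<open>
  Codimension of an irreducible closed set: the supremum of the lengths of strictly increasing
  chains of irreducible closed sets starting at it.
\<close>

definition codimension :: "'a topology \<Rightarrow> 'a set \<Rightarrow> enat" where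
  "codimension X Z =
     (SUP d \<in> {d. \<exists>C. C 0 = Z \<and> (\<forall>i\<le>d. irreducible_closedin X (C i)) \<and> (\<forall>i<d. C i \<subset> C (Suc i))}.
        enat d)"

definition hypersurface :: "'a topology \<Rightarrow> 'a set \<Rightarrow> bool" where
  "hypersurface X Z \<longleftrightarrow> irreducible_closedin X Z \<and> codimension X Z = 1"


section \<open>Laurent polynomials and their differentials\<close>

definition torus :: "nat \<Rightarrow> (nat \<Rightarrow> complex) set" where
  "torus n = {..<n} \<rightarrow>\<^sub>E (UNIV - {0})"

definition character :: "nat \<Rightarrow> (nat \<Rightarrow>\<^sub>0 int) \<Rightarrow> (nat \<Rightarrow> complex) \<Rightarrow> complex" where
  "character n a x = (\<Prod>i<n. x i powi Poly_Mapping.lookup a i)"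

definition laurent ::
  "nat \<Rightarrow> (nat \<Rightarrow>\<^sub>0 int) set \<Rightarrow> ((nat \<Rightarrow>\<^sub>0 int) \<Rightarrow> complex) \<Rightarrow> (nat \<Rightarrow> complex) \<Rightarrow> complex" where
  "laurent n S c x = (\<Sum>a\<in>S. c a * character n a x)"

text \<open>The differential of \<open>f\<close> at \<open>x\<close>, as a linear form in the tangent vector \<open>v\<close>.\<close>

definition differential ::
  "nat \<Rightarrow> ((nat \<Rightarrow> complex) \<Rightarrow> complex) \<Rightarrow> (nat \<Rightarrow> complex) \<Rightarrow> (nat \<Rightarrow> complex) \<Rightarrow> complex" where
  "differential n f x v = (\<Sum>j<n. deriv (\<lambda>z. f (x(j := z))) (x j) * v j)"

text \<open>
  The exterior product of the linear forms \<open>\<omega> 0, \<dots>, \<omega> (k - 1)\<close>, as the alternating form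
  sending \<open>v\<close> to the determinant of the matrix \<open>\<omega> i (v j)\<close>.
\<close>

definition wedge :: "nat \<Rightarrow> (nat \<Rightarrow> 'v \<Rightarrow> complex) \<Rightarrow> (nat \<Rightarrow> 'v) \<Rightarrow> complex" where
  "wedge k \<omega> v = (\<Sum>p | p permutes {..<k}. of_int (sign p) * (\<Prod>i<k. \<omega> i (v (p i))))"

definition linearly_dependent_forms :: "'k set \<Rightarrow> ('k \<Rightarrow> 'v \<Rightarrow> complex) \<Rightarrow> bool" where
  "linearly_dependent_forms S \<omega> \<longleftrightarrow>
     (\<exists>u. (\<exists>i\<in>S. u i \<noteq> 0) \<and> (\<forall>v. (\<Sum>i\<in>S. u i * \<omega> i v) = 0))"


section \<open>The mixed discriminant and the Cayley discriminant\<close>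

text \<open>
  A system \<open>(f\<^sub>0, \<dots>, f\<^sub>k\<^sub>-\<^sub>1)\<close> with supports \<open>A 0, \<dots>, A (k - 1)\<close> is given by its
  coefficients: \<open>c (i, a)\<close> is the coefficient of \<open>x^a\<close> in \<open>f\<^sub>i\<close>.
\<close>

definition system_index :: "nat \<Rightarrow> (nat \<Rightarrow> 'a set) \<Rightarrow> (nat \<times> 'a) set" where
  "system_index k A = (SIGMA i:{..<k}. A i)"

definition system_poly ::
  "nat \<Rightarrow> (nat \<Rightarrow> (nat \<Rightarrow>\<^sub>0 int) set) \<Rightarrow> (nat \<times> (nat \<Rightarrow>\<^sub>0 int) \<Rightarrow> complex) \<Rightarrow>
   nat \<Rightarrow> (nat \<Rightarrow> complex) \<Rightarrow> complex" where
  "system_poly n A c i = laurent n (A i) (\<lambda>a. c (i, a))"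

definition degenerate_root ::
  "nat \<Rightarrow> nat \<Rightarrow> (nat \<Rightarrow> (nat \<Rightarrow>\<^sub>0 int) set) \<Rightarrow> (nat \<times> (nat \<Rightarrow>\<^sub>0 int) \<Rightarrow> complex) \<Rightarrow>
   (nat \<Rightarrow> complex) \<Rightarrow> bool" where
  "degenerate_root n k A c x \<longleftrightarrow>
     x \<in> torus n \<and> (\<forall>i<k. system_poly n A c i x = 0) \<and>
     (\<forall>v. wedge k (\<lambda>i. differential n (system_poly n A c i) x) v = 0)"

definition nondegenerate_multiple_root ::
  "nat \<Rightarrow> nat \<Rightarrow> (nat \<Rightarrow> (nat \<Rightarrow>\<^sub>0 int) set) \<Rightarrow> (nat \<times> (nat \<Rightarrow>\<^sub>0 int) \<Rightarrow> complex) \<Rightarrow>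
   (nat \<Rightarrow> complex) \<Rightarrow> bool" where
  "nondegenerate_multiple_root n k A c x \<longleftrightarrow>
     degenerate_root n k A c x \<and>
     (\<forall>S. S \<subset> {..<k} \<longrightarrow>
        \<not> linearly_dependent_forms S (\<lambda>i. differential n (system_poly n A c i) x))"

definition mixed_discriminant ::
  "nat \<Rightarrow> nat \<Rightarrow> (nat \<Rightarrow> (nat \<Rightarrow>\<^sub>0 int) set) \<Rightarrow> (nat \<times> (nat \<Rightarrow>\<^sub>0 int) \<Rightarrow> complex) set" where
  "mixed_discriminant n k A =
     Abstract_Topology.closure_of (zariski (system_index k A))
       {c \<in> coeff_space (system_index k A). \<exists>x. nondegenerate_multiple_root n k A c x}"

text \<open>
  The lattice \<open>Z^n \<times> Z^k\<close> is identified with \<open>Z^(n+k)\<close>, so that \<open>e\<^sub>i\<close> in the second factor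
  (\<open>i < k\<close>) becomes \<open>frag_of (n + i)\<close>, and the variable \<open>\<lambda>\<^sub>i\<close> is the torus coordinate \<open>n + i\<close>.
\<close>

definition cayley_set :: "nat \<Rightarrow> nat \<Rightarrow> (nat \<Rightarrow> (nat \<Rightarrow>\<^sub>0 int) set) \<Rightarrow> (nat \<Rightarrow>\<^sub>0 int) set" where
  "cayley_set n k A = (\<Union>i<k. (\<lambda>a. a + frag_of (n + i)) ` A i)"

text \<open>The coefficients of \<open>\<Sum>i<k. \<lambda>\<^sub>i * f\<^sub>i\<close>.\<close>

definition cayley_poly ::
  "nat \<Rightarrow> nat \<Rightarrow> (nat \<Rightarrow> (nat \<Rightarrow>\<^sub>0 int) set) \<Rightarrow> (nat \<times> (nat \<Rightarrow>\<^sub>0 int) \<Rightarrow> complex) \<Rightarrow>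
   (nat \<Rightarrow>\<^sub>0 int) \<Rightarrow> complex" where
  "cayley_poly n k A c b =
     (\<Sum>i<k. \<Sum>a\<in>A i. if b = a + frag_of (n + i) then c (i, a) else 0)"

definition cayley_discriminant ::
  "nat \<Rightarrow> nat \<Rightarrow> (nat \<Rightarrow> (nat \<Rightarrow>\<^sub>0 int) set) \<Rightarrow> (nat \<times> (nat \<Rightarrow>\<^sub>0 int) \<Rightarrow> complex) set" where
  "cayley_discriminant n k A =
     {c \<in> coeff_space (system_index k A).
        cayley_poly n k A c \<in>
          Abstract_Topology.closure_of (zariski (cayley_set n k A))
            {g \<in> coeff_space (cayley_set n k A). \<exists>y \<in> torus (n + k).
               laurent (n + k) (cayley_set n k A) g y = 0 \<and>
               (\<forall>v. differential (n + k) (laurent (n + k) (cayley_set n k A) g) y v = 0)}}"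

end

theory Submission
	imports Defs "HOL-Complex_Analysis.Complex_Analysis" "HOL-Library.Function_Algebras"
begin

text \<open>The terms of a Cayley-singular system, evaluated at the singular point, form a relation: a vector w
with zero sum over every set of the tuple and zero total moment. Conversely, every relation and every
torus point with multipliers give a singular system (the Horn-Kapranov parametrization), so the Cayley
discriminant is the closure of the image of an entire map and is irreducible. Non-degenerate multiple
roots correspond to relations whose n moments satisfy a single linear dependence, with all coefficients
nonzero; by a Rado type argument these are generic if the tuple is simple, and none exist otherwise.
The codimension, read off from the growth of the number of independent polynomials, is the
dimension for generic w of the space of functions \<theta>, affine on each set of the tuple, for which
w \<theta> is again a relation. If this space exceeds the constants, differentiating along
the relations shows that all powers of \<theta> are affine, hence so are the indicators of its level sets;
these are the coordinates that make the tuple prelinear.\<close>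

section \<open>Linear algebra over finite index sets\<close>

text \<open>At \<zeta> = \<kappa> = 0 the differential of the parametrization sends a relation d and
  an affine function l to d - w * l. Its kernel consists of the l for which w * l is a relation,
  which is why these functions measure the codimension; constants always occur, by homogeneity, and
  account for codimension one. Torus points are written as exponentials so that the parameters form
  an affine space and any two image points lie on an entire curve. Codimension is a supremum over
  chains, so two estimates are needed. Each strict inclusion raises the growth exponent by one, and
  the number N of coefficients caps it. For the other direction explicit chains are given, whose
  members are proper by counting parameters: N - 2n for the relation and 2n for the affine form,
  less one for scaling. In the prelinear case one more is redundant: multiplying w by 1 + \<tau>
  \<theta> is undone by adding log(1 + \<tau> \<theta>) to the affine form, and this function is
  affine because \<theta> has finitely many values and affine level indicators.\<close>

lemma homogeneous_system_nontrivial: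
	fixes M :: "'k => 'u => 'a::field"
	assumes "finite K" "finite U" "card K < card U"
	shows "\<exists>y. (\<exists>u\<in>U. y u \<noteq> 0) \<and> (\<forall>k\<in>K. (\<Sum>u\<in>U. M k u * y u) = 0)" using assms
proof (induction K arbitrary: U M rule: finite_induct)
	case empty
	then have "U \<noteq> {}" by auto
	then show ?case by (intro exI[of _ "\<lambda>_. 1"]) auto
next
	case (insert k K)
	show ?case
	proof (cases "\<forall>u\<in>U. M k u = 0")
		case True
		have "card K < card U" using insert by simp
		from insert.IH[OF insert.prems(1) this, of M] obtain y where
			"\<exists>u\<in>U. y u \<noteq> 0" "\<forall>k\<in>K. (\<Sum>u\<in>U. M k u * y u) = 0" by blast
		with True show ?thesis by (intro exI[of _ y]) auto
	next
		case False
		then obtain u0 where u0: "u0 \<in> U" "M k u0 \<noteq> 0" by blast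
		define U' where "U' = U - {u0}"
		have U': "finite U'" "u0 \<notin> U'" "U = insert u0 U'" using insert.prems u0 by (auto simp: U'_def)
		have c: "card K < card U'" using insert.prems insert.hyps U' by simp
		from insert.IH[OF U'(1) c, of "\<lambda>l u. M l u - M l u0 * M k u / M k u0"] obtain y where
			y: "\<exists>u\<in>U'. y u \<noteq> 0" "\<forall>l\<in>K. (\<Sum>u\<in>U'. (M l u - M l u0 * M k u / M k u0) * y u) = 0" by blast
		define s where "s = - (\<Sum>u\<in>U'. M k u * y u) / M k u0"
		define z where "z = y(u0 := s)"
		have zs: "(\<Sum>u\<in>U. M l u * z u) = M l u0 * s + (\<Sum>u\<in>U'. M l u * y u)" for l
		proof -
			have "(\<Sum>u\<in>U'. M l u * z u) = (\<Sum>u\<in>U'. M l u * y u)"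
				by (rule sum.cong) (use U' in \<open>auto simp: z_def\<close>)
			then show ?thesis using U' by (simp add: z_def)
		qed
		have "(\<Sum>u\<in>U. M k u * z u) = 0" unfolding zs s_def using u0 by simp
		moreover have "(\<Sum>u\<in>U. M l u * z u) = 0" if "l \<in> K" for l
		proof -
			have "(\<Sum>u\<in>U'. (M l u - M l u0 * M k u / M k u0) * y u)
					= (\<Sum>u\<in>U'. M l u * y u) - (M l u0 / M k u0) * (\<Sum>u\<in>U'. M k u * y u)"
				by (simp add: sum_subtractf algebra_simps sum_distrib_left)
			also have "\<dots> = (\<Sum>u\<in>U. M l u * z u)" unfolding zs s_def by (simp add: field_simps)
			finally show ?thesis using y(2) that by simp
		qed
		moreover have "\<exists>u\<in>U. z u \<noteq> 0" using y(1) U' by (auto simp: z_def)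
		ultimately show ?thesis by blast
	qed
qed

text \<open>Elimination of one pivot \<open>p0\<close> of \<open>g k0\<close> per step: a functional
  killing the reduced vectors extends, by a suitable value at \<open>p0\<close>, to one killing the
  original vectors. Affinity of functions on the tuple, left inverses of matrices and the
  description of tangent vectors are all drawn from this duality.\<close>

lemma double_annihilator:
	fixes g :: "'k => 'p => 'a::field"
	assumes "finite K" "finite P"
		and "\<And>f. (\<And>k. k \<in> K ==> (\<Sum>p\<in>P. f p * g k p) = 0) ==> (\<Sum>p\<in>P. f p * d p) = 0"
	shows "\<exists>u. \<forall>p\<in>P. d p = (\<Sum>k\<in>K. u k * g k p)" using assms
proof (induction K arbitrary: P g d rule: finite_induct)
	case empty
	have "d p = 0" if "p \<in> P" for p
		using empty(2)[of "\<lambda>q. if q = p then 1 else 0"] that empty(1) by (simp add: if_distrib[of "\<lambda>x. x * _"] cong: if_cong)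
	then show ?case by simp
next
	case (insert k0 K)
	show ?case
	proof (cases "\<forall>p\<in>P. g k0 p = 0")
		case True
		have "(\<Sum>p\<in>P. f p * d p) = 0" if "\<And>k. k \<in> K ==> (\<Sum>p\<in>P. f p * g k p) = 0" for f
			by (rule insert.prems(2)) (use that True in auto)
		from insert.IH[OF insert.prems(1) this] obtain u where u: "\<forall>p\<in>P. d p = (\<Sum>k\<in>K. u k * g k p)" by blast
		show ?thesis by (rule exI[of _ u]) (use u True insert.hyps in auto)
	next
		case False
		then obtain p0 where p0: "p0 \<in> P" "g k0 p0 \<noteq> 0" by blast
		define P' where "P' = P - {p0}"
		have P': "finite P'" "p0 \<notin> P'" "P = insert p0 P'" using insert.prems(1) p0 by (auto simp: P'_def)
		define g' where "g' k p = g k p - g k p0 / g k0 p0 * g k0 p" for k p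
		define d' where "d' p = d p - d p0 / g k0 p0 * g k0 p" for p
		have "(\<Sum>p\<in>P'. f p * d' p) = 0" if f: "\<And>k. k \<in> K ==> (\<Sum>p\<in>P'. f p * g' k p) = 0" for f
		proof -
			define s where "s = - (\<Sum>p\<in>P'. f p * g k0 p) / g k0 p0"
			define F where "F = f(p0 := s)"
			have FP: "(\<Sum>p\<in>P. F p * h p) = s * h p0 + (\<Sum>p\<in>P'. f p * h p)" for h
			proof -
				have "(\<Sum>p\<in>P'. F p * h p) = (\<Sum>p\<in>P'. f p * h p)"
					by (rule sum.cong) (use P' in \<open>auto simp: F_def\<close>)
				then show ?thesis using P' by (simp add: F_def)
			qed
			have e: "(\<Sum>p\<in>P. F p * h p) = (\<Sum>p\<in>P'. f p * (h p - h p0 / g k0 p0 * g k0 p))" for h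
				unfolding FP s_def by (simp add: algebra_simps sum_subtractf sum_distrib_left sum_divide_distrib)
			have "(\<Sum>p\<in>P. F p * g k p) = 0" if "k \<in> insert k0 K" for k
			proof (cases "k = k0")
				case True
				then show ?thesis unfolding e using p0 by simp
			next
				case False
				then show ?thesis unfolding e using f[of k] that by (simp add: g'_def)
			qed
			then have "(\<Sum>p\<in>P. F p * d p) = 0" by (rule insert.prems(2))
			then show ?thesis unfolding e by (simp add: d'_def)
		qed
		from insert.IH[OF P'(1) this] obtain u where u: "\<forall>p\<in>P'. d' p = (\<Sum>k\<in>K. u k * g' k p)" by blast
		define c where "c = d p0 / g k0 p0 - (\<Sum>k\<in>K. u k * (g k p0 / g k0 p0))"
		define v where "v = u(k0 := c)"
		have vs: "(\<Sum>k\<in>insert k0 K. v k * g k p) = c * g k0 p + (\<Sum>k\<in>K. u k * g k p)" for p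
		proof -
			have "(\<Sum>k\<in>K. v k * g k p) = (\<Sum>k\<in>K. u k * g k p)"
				by (rule sum.cong) (use insert.hyps in \<open>auto simp: v_def\<close>)
			then show ?thesis using insert.hyps by (simp add: v_def)
		qed
		have "d p = (\<Sum>k\<in>insert k0 K. v k * g k p)" if "p \<in> P" for p
		proof (cases "p = p0")
			case True
			show ?thesis unfolding vs True c_def using p0
				by (simp add: algebra_simps sum_divide_distrib[symmetric])
		next
			case False
			then have "d' p = (\<Sum>k\<in>K. u k * g' k p)" using u that P' by blast
			then have "d p = d p0 / g k0 p0 * g k0 p + (\<Sum>k\<in>K. u k * g k p)
					 - (\<Sum>k\<in>K. u k * (g k p0 / g k0 p0)) * g k0 p"
				by (simp add: d'_def g'_def algebra_simps sum_subtractf sum_distrib_left)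
			then show ?thesis unfolding vs c_def by (simp add: algebra_simps)
		qed
		then show ?thesis by blast
	qed
qed

text \<open>The matrix \<open>G\<close> is a left inverse of the injective map with matrix
  \<open>M\<close>; its rows exist by duality, because a vector orthogonal to all rows of
  \<open>M\<close> is zero.\<close>

lemma dual_coefficients:
	fixes M :: "'k => 'u => 'a::field"
	assumes fin: "finite K" "finite U"
		and inj: "\<And>f u. (\<And>k. k \<in> K ==> (\<Sum>u\<in>U. f u * M k u) = 0) ==> u \<in> U ==> f u = 0"
	shows "\<exists>G. \<forall>u\<in>U. \<forall>u'\<in>U. (if u' = u then 1 else 0) = (\<Sum>k\<in>K. G u k * M k u')"
proof -
	have "\<forall>u\<in>U. \<exists>G. \<forall>u'\<in>U. (if u' = u then 1 else 0) = (\<Sum>k\<in>K. G k * M k u')"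
	proof (rule ballI, rule double_annihilator[OF fin])
		fix u f assume u: "u \<in> U" and "\<And>k. k \<in> K ==> (\<Sum>u\<in>U. f u * M k u) = 0"
		then have "f u = 0" by (rule inj[rotated])
		then show "(\<Sum>u'\<in>U. f u' * (if u' = u then 1 else 0)) = 0"
			using u fin by (simp add: if_distrib[of "\<lambda>x. _ * x"] cong: if_cong)
	qed
	from bchoice[OF this] show ?thesis .
qed

text \<open>Testing on a set \<open>J\<close> lets one notion serve both for vectors, with
  \<open>J\<close> the coordinates, and for functions restricted to a set of points, with
  \<open>J\<close> that set.\<close>

definition indep_family :: "'p set => 'k set => ('k => 'p => complex) => bool" where
	"indep_family J S v \<longleftrightarrow> (\<forall>u. (\<forall>j\<in>J. (\<Sum>i\<in>S. u i * v i j) = 0) --> (\<forall>i\<in>S. u i = 0))"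

lemma indep_familyI:
	assumes "\<And>u i. (\<And>j. j \<in> J ==> (\<Sum>i\<in>S. u i * v i j) = 0) ==> i \<in> S ==> u i = 0"
	shows "indep_family J S v" using assms unfolding indep_family_def by blast

lemma indep_familyD:
	assumes "indep_family J S v" "\<And>j. j \<in> J ==> (\<Sum>i\<in>S. u i * v i j) = 0" "i \<in> S"
	shows "u i = 0" using assms unfolding indep_family_def by blast

lemma indep_family_subset:
	assumes "indep_family J S v" "T \<subseteq> S" "finite S"
	shows "indep_family J T v"
proof (rule indep_familyI)
	fix u i assume u: "\<And>j. j \<in> J ==> (\<Sum>i\<in>T. u i * v i j) = 0" and i: "i \<in> T"
	have "(\<Sum>i\<in>S. (if i \<in> T then u i else 0) * v i j) = (\<Sum>i\<in>T. u i * v i j)" for j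
		using assms by (intro sum.mono_neutral_cong_right) auto
	then have "(if i \<in> T then u i else 0) = 0"
		by (intro indep_familyD[OF assms(1), where u = "\<lambda>i. if i \<in> T then u i else 0"])
			 (use u i assms(2) in auto)
	then show "u i = 0" using i by simp
qed

lemma indep_family_cong:
	assumes "\<And>i j. i \<in> S ==> j \<in> J ==> v i j = v' i j"
	shows "indep_family J S v = indep_family J S v'"
proof -
	have "(\<Sum>i\<in>S. u i * v i j) = (\<Sum>i\<in>S. u i * v' i j)" if "j \<in> J" for u j
		using assms that by (intro sum.cong) auto
	then show ?thesis unfolding indep_family_def by simp
qed

lemma indep_family_card_le:
	assumes "indep_family J S v" "finite S" "finite K"
		and "\<And>i j. i \<in> S ==> j \<in> J ==> v i j = (\<Sum>k\<in>K. m i k * b k j)"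
	shows "card S \<le> card K"
proof (rule ccontr)
	assume "\<not> card S \<le> card K"
	then obtain y where y: "\<exists>u\<in>S. y u \<noteq> 0" "\<forall>k\<in>K. (\<Sum>u\<in>S. m u k * y u) = 0"
		using homogeneous_system_nontrivial[OF assms(3,2), of "\<lambda>k u. m u k"] by auto
	have "(\<Sum>i\<in>S. y i * v i j) = 0" if "j \<in> J" for j
	proof -
		have "(\<Sum>i\<in>S. y i * v i j) = (\<Sum>i\<in>S. \<Sum>k\<in>K. m i k * y i * b k j)"
			using assms(4) that by (intro sum.cong refl) (simp add: sum_distrib_left ac_simps)
		also have "\<dots> = (\<Sum>k\<in>K. (\<Sum>i\<in>S. m i k * y i) * b k j)"
			by (subst sum.swap) (simp add: sum_distrib_right)
		also have "\<dots> = 0" using y(2) by simp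
		finally show ?thesis .
	qed
	with y(1) show False using assms(1) unfolding indep_family_def by blast
qed

section \<open>Dimension and Rado's theorem for vectors with finitely many coordinates\<close>

interpretation cfun: vector_space "\<lambda>(a::complex) (f::'i => complex). (\<lambda>i. a * f i)"
	by unfold_locales (auto simp: fun_eq_iff algebra_simps)

lemma sum_fun_apply: "(\<Sum>x\<in>S. (f x :: 'i => complex)) j = (\<Sum>x\<in>S. f x j)"
	by (induction S rule: infinite_finite_induct) auto

text \<open>The type of vectors is infinite-dimensional, and \<open>cfun.dim\<close> is the natural
  number 0 when a basis is infinite; dimension arguments therefore carry this bound on the
  support.\<close>

definition cvec_space :: "nat => (nat => complex) set" where
	"cvec_space n = {v. \<forall>j\<ge>n. v j = 0}"

lemma cvec_space_subspace: "cfun.subspace (cvec_space n)"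
	by (auto simp: cfun.subspace_def cvec_space_def)

lemma span_subset_cvec_space: "X \<subseteq> cvec_space n ==> cfun.span X \<subseteq> cvec_space n"
	by (rule cfun.span_minimal[OF _ cvec_space_subspace])

lemma cvec_space_finite_span:
	obtains E where "finite E" "card E \<le> n" "cvec_space n \<subseteq> cfun.span E"
proof -
	define e :: "nat => nat => complex" where "e i j = (if i = j then 1 else 0)" for i j
	have "v \<in> cfun.span (e ` {..<n})" if "v \<in> cvec_space n" for v
	proof -
		have "v = (\<Sum>i<n. (\<lambda>j. v i * e i j))"
		proof
			fix j
			show "v j = (\<Sum>i<n. (\<lambda>j. v i * e i j)) j" using that by (cases "j < n")
					(auto simp: sum_fun_apply e_def cvec_space_def if_distrib[of "\<lambda>x. _ * x"] cong: if_cong)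
		qed
		also have "\<dots> \<in> cfun.span (e ` {..<n})"
			by (intro cfun.span_sum cfun.span_scale cfun.span_base) auto
		finally show ?thesis .
	qed
	then show ?thesis by (intro that[of "e ` {..<n}"]) (use card_image_le[of "{..<n}" e] in auto)
qed

lemma finite_indep_cvec_space:
	assumes "cfun.independent B" "B \<subseteq> cvec_space n"
	shows "finite B" "card B \<le> n"
proof -
	obtain E where E: "finite E" "card E \<le> n" "cvec_space n \<subseteq> cfun.span E"
		by (rule cvec_space_finite_span)
	have "finite B \<and> card B \<le> card E"
		by (rule cfun.independent_span_bound[OF E(1) assms(1)]) (use assms(2) E(3) in auto)
	then show "finite B" "card B \<le> n" using E by auto
qed

lemma indep_card_le_dim:
	assumes "cfun.independent B" "B \<subseteq> cfun.span X" "X \<subseteq> cvec_space n"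
	shows "card B \<le> cfun.dim X"
proof -
	obtain C where C: "C \<subseteq> X" "cfun.independent C" "X \<subseteq> cfun.span C" "card C = cfun.dim X"
		by (rule cfun.basis_exists)
	have "finite C" using C assms(3) by (intro finite_indep_cvec_space(1)[of C n]) auto
	moreover have "B \<subseteq> cfun.span C"
		using assms(2) cfun.span_minimal[OF C(3) cfun.subspace_span] by auto
	ultimately show ?thesis using cfun.independent_span_bound[of C B] assms(1) C(4) by auto
qed

lemma cdim_mono:
	assumes "X \<subseteq> cfun.span Y" "Y \<subseteq> cvec_space n"
	shows "cfun.dim X \<le> cfun.dim Y"
proof -
	obtain C where C: "C \<subseteq> X" "cfun.independent C" "card C = cfun.dim X" by (rule cfun.basis_exists)
	then show ?thesis using indep_card_le_dim[of C Y n] assms by auto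
qed

lemma cdim_le: "X \<subseteq> cvec_space n ==> cfun.dim X \<le> n"
	by (metis cfun.basis_exists finite_indep_cvec_space(2) subset_trans)

lemma spanning_if_card_ge_dim:
	assumes "cfun.independent B" "B \<subseteq> cfun.span X" "X \<subseteq> cvec_space n" "cfun.dim X \<le> card B"
	shows "X \<subseteq> cfun.span B"
proof (rule ccontr)
	assume "\<not> X \<subseteq> cfun.span B"
	then obtain x where x: "x \<in> X" "x \<notin> cfun.span B" by blast
	have i: "cfun.independent (insert x B)" using x(2) assms(1) by (rule cfun.independent_insertI)
	have "insert x B \<subseteq> cfun.span X" using x assms(2) cfun.span_base by auto
	then have "card (insert x B) \<le> cfun.dim X" by (rule indep_card_le_dim[OF i _ assms(3)])
	moreover have "finite B" by (rule finite_indep_cvec_space(1)[OF assms(1)]) (use assms(2,3) span_subset_cvec_space in blast)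
	moreover have "x \<notin> B" using x cfun.span_base by auto
	ultimately show False using assms(4) by simp
qed

text \<open>A basis of \<open>W\<close> is extended to bases of the spans of \<open>X\<close> and of
  \<open>Y\<close>; together these span the union, and they share at least the basis of
  \<open>W\<close>. Any \<open>W\<close> inside both spans will do, so the intersection of the spans
  is never formed.\<close>

lemma cdim_submodular:
	assumes "X \<subseteq> cvec_space n" "Y \<subseteq> cvec_space n" "W \<subseteq> cfun.span X" "W \<subseteq> cfun.span Y"
	shows "cfun.dim (X \<union> Y) + cfun.dim W \<le> cfun.dim X + cfun.dim Y"
proof -
	obtain B where B: "B \<subseteq> W" "cfun.independent B" "card B = cfun.dim W" by (rule cfun.basis_exists)
	have ext: "\<exists>C. B \<subseteq> C \<and> finite C \<and> card C \<le> cfun.dim X \<and> X \<subseteq> cfun.span C"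
		if X: "X \<subseteq> cvec_space n" "W \<subseteq> cfun.span X" for X
	proof -
		have "B \<subseteq> cfun.span X" using B X by auto
		then obtain C where C: "B \<subseteq> C" "C \<subseteq> cfun.span X" "cfun.independent C" "cfun.span X \<subseteq> cfun.span C"
			using cfun.maximal_independent_subset_extend[OF _ B(2), of "cfun.span X"] by blast
		have "finite C" by (rule finite_indep_cvec_space(1)[OF C(3)]) (use C(2) X span_subset_cvec_space in blast)
		moreover have "card C \<le> cfun.dim X" by (rule indep_card_le_dim[OF C(3,2) X(1)])
		moreover have "X \<subseteq> cfun.span C" using C(4) cfun.span_superset by blast
		ultimately show ?thesis using C(1) by blast
	qed
	obtain C1 where C1: "B \<subseteq> C1" "finite C1" "card C1 \<le> cfun.dim X" "X \<subseteq> cfun.span C1"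
		using ext[OF assms(1,3)] by blast
	obtain C2 where C2: "B \<subseteq> C2" "finite C2" "card C2 \<le> cfun.dim Y" "Y \<subseteq> cfun.span C2"
		using ext[OF assms(2,4)] by blast
	have "X \<union> Y \<subseteq> cfun.span (C1 \<union> C2)"
		using C1(4) C2(4) cfun.span_mono[of C1 "C1 \<union> C2"] cfun.span_mono[of C2 "C1 \<union> C2"] by blast
	then have "cfun.dim (X \<union> Y) \<le> card (C1 \<union> C2)" using C1 C2 by (intro cfun.dim_le_card) auto
	moreover have "card (C1 \<union> C2) + card (C1 \<inter> C2) = card C1 + card C2"
		using C1 C2 card_Un_Int[of C1 C2] by simp
	moreover have "card B \<le> card (C1 \<inter> C2)" using C1 C2 by (intro card_mono) auto
	ultimately show ?thesis using B(3) C1(3) C2(3) by linarith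
qed

lemma indep_family_iff_independent:
	fixes v :: "'k => 'i => complex"
	assumes "finite S"
	shows "indep_family UNIV S v \<longleftrightarrow> inj_on v S \<and> cfun.independent (v ` S)"
proof
	assume v: "indep_family UNIV S v"
	have inj: "inj_on v S"
	proof (rule inj_onI, rule ccontr)
		fix i k assume ik: "i \<in> S" "k \<in> S" "v i = v k" "i \<noteq> k"
		define u :: "'k => complex" where "u l = (if l = i then 1 else if l = k then -1 else 0)" for l
		have "(\<Sum>l\<in>S. u l * v l j) = (\<Sum>l\<in>{i,k}. u l * v l j)" for j
			using ik assms by (intro sum.mono_neutral_right) (auto simp: u_def)
		also have "\<dots> j = 0" for j using ik by (simp add: u_def)
		finally have "u i = 0" using indep_familyD[OF v, where u = u, of i] ik by simp
		then show False by (simp add: u_def)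
	qed
	moreover have "cfun.independent (v ` S)"
	proof (rule cfun.independent_if_scalars_zero)
		fix f x assume f: "(\<Sum>x\<in>v ` S. (\<lambda>i. f x * x i)) = 0" and x: "x \<in> v ` S"
		obtain k where k: "k \<in> S" "x = v k" using x by blast
		have "(\<Sum>i\<in>S. f (v i) * v i j) = (\<Sum>x\<in>v ` S. (\<lambda>i. f x * x i)) j" for j
			by (simp add: sum_fun_apply sum.reindex[OF inj])
		then have "f (v k) = 0" using f indep_familyD[OF v, where u = "\<lambda>i. f (v i)", of k] k by simp
		then show "f x = 0" using k by simp
	qed (use assms in simp)
	ultimately show "inj_on v S \<and> cfun.independent (v ` S)" by blast
next
	assume r: "inj_on v S \<and> cfun.independent (v ` S)"
	show "indep_family UNIV S v"
	proof (rule indep_familyI)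
		fix u i assume u: "\<And>j. j \<in> UNIV ==> (\<Sum>i\<in>S. u i * v i j) = 0" and i: "i \<in> S"
		define g where "g = (\<lambda>x. u (inv_into S v x))"
		have "(\<Sum>x\<in>v ` S. (\<lambda>j. g x * x j)) = 0"
		proof
			fix j
			have "(\<Sum>x\<in>v ` S. (\<lambda>j. g x * x j)) j = (\<Sum>i\<in>S. g (v i) * v i j)"
				using r by (simp add: sum_fun_apply sum.reindex)
			also have "\<dots> = (\<Sum>i\<in>S. u i * v i j)" using r by (intro sum.cong refl) (simp add: g_def)
			finally show "(\<Sum>x\<in>v ` S. (\<lambda>j. g x * x j)) j = 0 j" using u by simp
		qed
		then have "g (v i) = 0"
			using r i assms unfolding cfun.independent_explicit_finite_subsets by blast
		then show "u i = 0" using r i by (simp add: g_def)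
	qed
qed

text \<open>Sets with at least two elements are shrunk. If deleting \<open>x\<close> and deleting
  \<open>y\<close> from \<open>D i0\<close> both break the rank condition, submodularity applied to
  the two deficient families contradicts the condition at their union with \<open>i0\<close> and at
  their intersection. For singletons the condition at \<open>I\<close> is independence.\<close>

theorem rado:
	fixes D :: "'k => (nat => complex) set"
	assumes "finite I" "\<And>i. i \<in> I ==> finite (D i) \<and> D i \<subseteq> cvec_space n"
		and "\<And>J. J \<subseteq> I ==> card J \<le> cfun.dim (\<Union>i\<in>J. D i)"
	shows "\<exists>d. (\<forall>i\<in>I. d i \<in> D i) \<and> indep_family UNIV I d" using assms(2,3)
proof (induction "\<Sum>i\<in>I. card (D i)" arbitrary: D rule: less_induct)
	case less
	let ?goal = "\<exists>d. (\<forall>i\<in>I. d i \<in> D i) \<and> indep_family UNIV I d"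
	show ?goal
	proof (cases "\<forall>i\<in>I. card (D i) \<le> 1")
		case True
		have ne: "D i \<noteq> {}" if "i \<in> I" for i
		proof
			assume "D i = {}"
			then have "1 \<le> cfun.dim ({} :: (nat => complex) set)" using less(3)[of "{i}"] that by simp
			then show False using cfun.dim_le_card'[of "{} :: (nat => complex) set"] by simp
		qed
		have "\<exists>x. D i = {x}" if "i \<in> I" for i
		proof -
			have "card (D i) = 1" using True ne[OF that] less(2)[OF that] that
				by (metis card_0_eq le_antisym less_one not_le)
			then show ?thesis by (simp add: card_1_singleton_iff)
		qed
		then obtain d where d: "\<And>i. i \<in> I ==> D i = {d i}" by metis
		have im: "(\<Union>i\<in>I. D i) = d ` I" using d by auto
		have c: "card I \<le> cfun.dim (d ` I)" using less(3)[of I] im by simp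
		have le: "cfun.dim (d ` I) \<le> card (d ` I)" using assms(1) by (intro cfun.dim_le_card') auto
		then have cc: "card (d ` I) = card I" using c card_image_le[OF assms(1), of d] by simp
		then have inj: "inj_on d I" using assms(1) by (simp add: eq_card_imp_inj_on)
		obtain B where B: "B \<subseteq> d ` I" "cfun.independent B" "card B = cfun.dim (d ` I)"
			by (rule cfun.basis_exists)
		have "B = d ` I" using B c cc assms(1) by (intro card_seteq) auto
		then have "indep_family UNIV I d" using B inj assms(1) by (simp add: indep_family_iff_independent)
		then show ?thesis using d by blast
	next
		case False
		then obtain i0 where i0: "i0 \<in> I" "\<not> card (D i0) \<le> 1" by blast
		then obtain x y where xy: "x \<in> D i0" "y \<in> D i0" "x \<noteq> y"
			using less(2)[OF i0(1)] by (metis card_le_Suc0_iff_eq One_nat_def)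
		define R where "R z = D(i0 := D i0 - {z})" for z
		have fin: "finite (R z i) \<and> R z i \<subseteq> cvec_space n" if "i \<in> I" for z i
			using less(2)[OF that] less(2)[OF i0(1)] by (auto simp: R_def)
		have smaller: "(\<Sum>i\<in>I. card (R z i)) < (\<Sum>i\<in>I. card (D i))" if "z \<in> D i0" for z
		proof (rule sum_strict_mono_ex1[OF assms(1)])
			show "\<forall>i\<in>I. card (R z i) \<le> card (D i)" using less(2) by (auto simp: R_def intro: card_mono)
			have "card (D i0 - {z}) < card (D i0)" using that less(2)[OF i0(1)] by (meson card_Diff1_less)
			then show "\<exists>i\<in>I. card (R z i) < card (D i)"
				using i0(1) by (intro bexI[of _ i0]) (simp_all add: R_def)
		qed
		have step: ?goal if z: "z \<in> D i0" and r: "\<And>J. J \<subseteq> I ==> card J \<le> cfun.dim (\<Union>i\<in>J. R z i)" for z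
		proof -
			obtain d where d: "\<forall>i\<in>I. d i \<in> R z i" "indep_family UNIV I d"
				using less(1)[OF smaller[OF z] fin r] by blast
			then show ?thesis by (intro exI[of _ d]) (auto simp: R_def split: if_splits)
		qed
		show ?thesis
		proof (rule ccontr)
			assume contra: "\<not> ?goal"
			\<comment> \<open>The condition can fail only at a family containing \<open>i0\<close>;
			  \<open>J\<close> lists its other members.\<close>
			have bad: "\<exists>J. J \<subseteq> I - {i0} \<and> cfun.dim ((D i0 - {z}) \<union> (\<Union>i\<in>J. D i)) \<le> card J" if "z \<in> D i0" for z
			proof -
				have "\<not> (\<forall>J. J \<subseteq> I --> card J \<le> cfun.dim (\<Union>i\<in>J. R z i))"
				proof
					assume r: "\<forall>J. J \<subseteq> I --> card J \<le> cfun.dim (\<Union>i\<in>J. R z i)"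
					have ?goal by (rule step[OF that]) (use r in simp)
					with contra show False ..
				qed
				then obtain J where J: "J \<subseteq> I" "\<not> card J \<le> cfun.dim (\<Union>i\<in>J. R z i)" by blast
				have "i0 \<in> J"
				proof (rule ccontr)
					assume "i0 \<notin> J"
					then have "R z i = D i" if "i \<in> J" for i using that by (auto simp: R_def)
					then have "(\<Union>i\<in>J. R z i) = (\<Union>i\<in>J. D i)" by (intro SUP_cong refl)
					then show False using J(2) less(3)[OF J(1)] by metis
				qed
				have "(\<Union>i\<in>J. R z i) = R z i0 \<union> (\<Union>i\<in>J - {i0}. R z i)" using \<open>i0 \<in> J\<close> by blast
				moreover have "R z i0 = D i0 - {z}" by (simp add: R_def)
				moreover have "(\<Union>i\<in>J - {i0}. R z i) = (\<Union>i\<in>J - {i0}. D i)" by (simp add: R_def)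
				ultimately have "(\<Union>i\<in>J. R z i) = (D i0 - {z}) \<union> (\<Union>i\<in>J - {i0}. D i)" by simp
				moreover have "card J = Suc (card (J - {i0}))"
					using \<open>i0 \<in> J\<close> card_Suc_Diff1[OF finite_subset[OF J(1) assms(1)]] by simp
				ultimately have "cfun.dim ((D i0 - {z}) \<union> (\<Union>i\<in>J - {i0}. D i)) \<le> card (J - {i0})"
					using J(2) by simp
				then show ?thesis using J(1) by blast
			qed
			obtain J1 where J1: "J1 \<subseteq> I - {i0}" "cfun.dim ((D i0 - {x}) \<union> (\<Union>i\<in>J1. D i)) \<le> card J1" using bad xy by blast
			obtain J2 where J2: "J2 \<subseteq> I - {i0}" "cfun.dim ((D i0 - {y}) \<union> (\<Union>i\<in>J2. D i)) \<le> card J2" using bad xy by blast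
			let ?X = "(D i0 - {x}) \<union> (\<Union>i\<in>J1. D i)" and ?Y = "(D i0 - {y}) \<union> (\<Union>i\<in>J2. D i)"
			let ?W = "\<Union>i\<in>J1 \<inter> J2. D i"
			have D0: "D i0 \<subseteq> cvec_space n" using less(2)[OF i0(1)] by simp
			have DJ: "(\<Union>i\<in>J. D i) \<subseteq> cvec_space n" if "J \<subseteq> I - {i0}" for J
				by (rule UN_least) (use less(2) that in blast)
			have sub: "?X \<subseteq> cvec_space n" "?Y \<subseteq> cvec_space n"
				using D0 DJ[of J1] DJ[of J2] J1(1) J2(1) by blast+
			have *: "cfun.dim (?X \<union> ?Y) + cfun.dim ?W \<le> cfun.dim ?X + cfun.dim ?Y"
				by (rule cdim_submodular[OF sub]; rule subset_trans[OF _ cfun.span_superset]; blast)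
			then have "cfun.dim (\<Union>i\<in>insert i0 (J1 \<union> J2). D i) + cfun.dim ?W \<le> cfun.dim ?X + cfun.dim ?Y"
			proof -
				\<comment> \<open>As \<open>x\<close> and \<open>y\<close> differ, the two punctured copies of
				  \<open>D i0\<close> together recover all of it.\<close>
				have "?X \<union> ?Y = (\<Union>i\<in>insert i0 (J1 \<union> J2). D i)" using xy by auto
				with * show ?thesis by simp
			qed
			moreover have "card (insert i0 (J1 \<union> J2)) \<le> cfun.dim (\<Union>i\<in>insert i0 (J1 \<union> J2). D i)"
			proof (rule less(3))
				show "insert i0 (J1 \<union> J2) \<subseteq> I" using i0(1) J1(1) J2(1) by auto
			qed
			moreover have "card (J1 \<inter> J2) \<le> cfun.dim ?W" using less(3) J1(1) by blast
			moreover have fJ: "finite J1" "finite J2" using J1(1) J2(1) assms(1) by (auto intro: finite_subset[of _ "I - {i0}"])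
			moreover have "card (J1 \<union> J2) + card (J1 \<inter> J2) = card J1 + card J2" using card_Un_Int[OF fJ] by simp
			moreover have "card (insert i0 (J1 \<union> J2)) = Suc (card (J1 \<union> J2))"
				using J1(1) J2(1) fJ by (intro card_insert_disjoint) auto
			ultimately show False using J1(2) J2(2) by linarith
		qed
	qed
qed

abbreviation coord :: "('a \<Rightarrow>\<^sub>0 'b::zero) => 'a => 'b" where
	"coord \<equiv> Poly_Mapping.lookup"

section \<open>Ranks of subgroups of lattices\<close>

definition cvec :: "(nat => int) => nat => complex" where
	"cvec x = (\<lambda>j. of_int (x j))"

lemma cvec_apply: "cvec x j = of_int (x j)" by (simp add: cvec_def)

text \<open>The members vanishing in the last coordinate have a basis by induction, and one more
  member with least positive last coordinate generates the rest by division with remainder. The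
  staircase shape makes the basis independent even over the complex numbers, so that ranks become
  complex dimensions.\<close>

lemma int_vectors_basis:
	fixes X :: "(nat => int) set"
	assumes "0 \<in> X" "\<And>x y. x \<in> X ==> y \<in> X ==> x - y \<in> X" "\<And>x j. x \<in> X ==> d \<le> j ==> x j = 0"
	shows "\<exists>(r::nat) b. (\<forall>i<r. b i \<in> X) \<and> (\<forall>x\<in>X. \<exists>z. \<forall>j. x j = (\<Sum>i<r. z i * b i j)) \<and>
					 indep_family UNIV {..<r} (\<lambda>i. cvec (b i))" using assms
proof (induction d arbitrary: X)
	case 0
	then show ?case by (intro exI[of _ "0::nat"] exI[of _ "\<lambda>_ _. 0"]) (simp add: indep_family_def)
next
	case (Suc d)
	have neg: "- x \<in> X" if "x \<in> X" for x using Suc(3)[OF Suc(2) that] by (simp only: diff_0)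
	have add: "x + y \<in> X" if "x \<in> X" "y \<in> X" for x y using Suc(3)[OF that(1) neg[OF that(2)]] by (simp only: diff_minus_eq_add)
	have mult_nat: "(\<lambda>j. int m * x j) \<in> X" if "x \<in> X" for x m
	proof (induction m)
		case 0
		then show ?case using Suc(2) by (simp add: zero_fun_def)
	next
		case (Suc m)
		have "(\<lambda>j. int (Suc m) * x j) = (\<lambda>j. int m * x j) + x" by (auto simp: algebra_simps)
		then show ?case using add[OF Suc that] by simp
	qed
	have mult: "(\<lambda>j. z * x j) \<in> X" if "x \<in> X" for x z
	proof (cases "z \<ge> 0")
		case True
		then show ?thesis using mult_nat[OF that, of "nat z"] by simp
	next
		case False
		then have "(\<lambda>j. z * x j) = - (\<lambda>j. int (nat (- z)) * x j)" by auto
		then show ?thesis using neg[OF mult_nat[OF that]] by metis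
	qed
	define X0 where "X0 = {x \<in> X. x d = 0}"
	have "x j = 0" if "x \<in> X0" "d \<le> j" for x j
		using that Suc(4)[of x j] by (cases "j = d") (auto simp: X0_def)
	then have "\<exists>(r::nat) b. (\<forall>i<r. b i \<in> X0) \<and> (\<forall>x\<in>X0. \<exists>z. \<forall>j. x j = (\<Sum>i<r. z i * b i j)) \<and>
					 indep_family UNIV {..<r} (\<lambda>i. cvec (b i))"
		using Suc(2,3) by (intro Suc(1)) (auto simp: X0_def)
	then obtain r :: nat and b where rb: "\<And>i. i < r ==> b i \<in> X0" "\<And>x. x \<in> X0 ==> \<exists>z. \<forall>j. x j = (\<Sum>i<r. z i * b i j)"
			"indep_family UNIV {..<r} (\<lambda>i. cvec (b i))" by blast
	show ?case
	proof (cases "X0 = X")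
		case True
		then show ?thesis using rb by blast
	next
		case False
		then obtain x where x: "x \<in> X" "x d \<noteq> 0" by (auto simp: X0_def)
		then have "\<exists>x. x \<in> X \<and> x d > 0" using neg[OF x(1)] by (metis fun_Compl_def neg_0_less_iff_less not_less_iff_gr_or_eq uminus_apply)
		then obtain g where g: "g \<in> X" "g d > 0" "\<And>y. y \<in> X ==> y d > 0 ==> nat (g d) \<le> nat (y d)"
			using ex_has_least_nat[of "\<lambda>x. x \<in> X \<and> x d > 0" _ "\<lambda>x. nat (x d)"] by blast
		define B where "B = b(r := g)"
		have Bs: "(\<Sum>i<r. f i (B i)) = (\<Sum>i<r. f i (b i))" for f :: "nat => (nat => int) => 'z::comm_monoid_add"
			by (rule sum.cong) (auto simp: B_def)
		have "\<exists>z. \<forall>j. x j = (\<Sum>i<Suc r. z i * B i j)" if "x \<in> X" for x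
		proof -
			\<comment> \<open>Remainder of \<open>x\<close> modulo \<open>g\<close>: its last coordinate is
			  nonnegative and below the minimal \<open>g d\<close>, hence zero.\<close>
			define y where "y = x - (\<lambda>j. (x d div g d) * g j)"
			have y: "y \<in> X" unfolding y_def by (intro Suc(3) mult that g)
			have "y d = x d mod g d" by (simp add: y_def minus_div_mult_eq_mod)
			then have "y d = 0"
				using g(3)[OF y] g(2) pos_mod_bound[OF g(2), of "x d"] pos_mod_sign[OF g(2), of "x d"] by linarith
			then have "y \<in> X0" using y by (simp add: X0_def)
			then obtain z where z: "\<And>j. y j = (\<Sum>i<r. z i * b i j)" using rb(2) by blast
			define w where "w = z(r := x d div g d)"
			have "x j = (\<Sum>i<Suc r. w i * B i j)" for j
			proof -
				have "(\<Sum>i<r. w i * B i j) = (\<Sum>i<r. z i * b i j)" by (rule sum.cong) (auto simp: w_def B_def)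
				then have "(\<Sum>i<Suc r. w i * B i j) = y j + (x d div g d) * g j" by (simp add: z w_def B_def)
				then show ?thesis by (simp add: y_def)
			qed
			then show ?thesis by blast
		qed
		moreover have "indep_family UNIV {..<Suc r} (\<lambda>i. cvec (B i))"
		proof (rule indep_familyI)
			fix u i assume u: "\<And>j. j \<in> UNIV ==> (\<Sum>i<Suc r. u i * cvec (B i) j) = 0" and i: "i \<in> {..<Suc r}"
			have e: "(\<Sum>i<r. u i * cvec (b i) j) + u r * of_int (g j) = 0" for j
				using u[of j] Bs[of "\<lambda>i x. u i * cvec x j"] by (simp add: B_def cvec_apply)
			have "(\<Sum>i<r. u i * cvec (b i) d) = 0"
				by (rule sum.neutral) (use rb(1) in \<open>auto simp: X0_def cvec_apply\<close>)
			with e[of d] g(2) have ur: "u r = 0" by simp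
			show "u i = 0"
			proof (cases "i = r")
				case False
				then have "i \<in> {..<r}" using i by auto
				then show ?thesis by (rule indep_familyD[OF rb(3), rotated]) (use e ur in simp)
			qed (use ur in simp)
		qed
		moreover have "\<forall>i<Suc r. B i \<in> X" using rb(1) g(1) by (auto simp: B_def X0_def less_Suc_eq)
		ultimately show ?thesis by blast
	qed
qed

lemma lookup_frag_combination:
	fixes r :: nat
	shows "coord (\<Sum>i<r. frag_cmul (z i) (frag_of i)) j = (if j < r then z j else 0)"
proof -
	have "coord (\<Sum>i<r. frag_cmul (z i) (frag_of i)) j = (\<Sum>i<r. z i * (if i = j then 1 else 0))"
		unfolding lookup_sum by (intro sum.cong refl) (simp add: lookup_single when_def)
	also have "\<dots> = (\<Sum>i<r. if i = j then z i else 0)" by (intro sum.cong) auto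
	also have "\<dots> = (if j < r then z j else 0)" by (subst sum.delta) auto
	finally show ?thesis .
qed

lemma int_lattice_iso_cancel: "int_lattice r \<cong> int_lattice s ==> r = s"
	using isomorphic_free_Abelian_groups[of "{..<r}" "{..<s}"] by (simp add: eqpoll_iff_card)

lemma lattice_dim_eqI:
	assumes "G\<lparr>carrier := H\<rparr> \<cong> int_lattice r" "group (G\<lparr>carrier := H\<rparr>)"
	shows "lattice_dim G H = r" unfolding lattice_dim_def
proof (rule the_equality)
	fix s assume s: "G\<lparr>carrier := H\<rparr> \<cong> int_lattice s"
	have "int_lattice s \<cong> int_lattice r" by (rule iso_trans[OF group.iso_sym[OF assms(2) s] assms(1)])
	then show "s = r" by (rule int_lattice_iso_cancel)
qed (rule assms)

text \<open>An integral basis of the image is also a complex basis of its span, so rank and complex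
  dimension agree. The abstract embedding \<rho> allows the same statement for the lattice itself
  and for its quotient by a saturated sublattice.\<close>

lemma lattice_dim_subgroup:
	fixes \<rho> :: "'a => nat => int"
	assumes "subgroup H G" "group G" and hom: "\<And>x y. x \<in> H ==> y \<in> H ==> \<rho> (x \<otimes>\<^bsub>G\<^esub> y) = \<rho> x + \<rho> y"
		and inj: "inj_on \<rho> H" and supp: "\<And>x j. x \<in> H ==> d \<le> j ==> \<rho> x j = 0"
	shows "G\<lparr>carrier := H\<rparr> \<cong> int_lattice (cfun.dim ((\<lambda>x. cvec (\<rho> x)) ` H))"
		and "lattice_dim G H = cfun.dim ((\<lambda>x. cvec (\<rho> x)) ` H)"
proof -
	interpret G: group G by fact
	interpret H: subgroup H G by fact
	interpret GH: group "G\<lparr>carrier := H\<rparr>" by (rule G.subgroup_imp_group) fact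
	have one: "\<rho> \<one>\<^bsub>G\<^esub> = 0" using hom[OF H.one_closed H.one_closed] by simp
	have inv: "\<rho> (inv\<^bsub>G\<^esub> x) = - \<rho> x" if "x \<in> H" for x
		using hom[OF that H.m_inv_closed[OF that]] that one by (simp add: eq_neg_iff_add_eq_0 add.commute)
	have cl: "x - y \<in> \<rho> ` H" if "x \<in> \<rho> ` H" "y \<in> \<rho> ` H" for x y
	proof -
		obtain a b where "a \<in> H" "b \<in> H" "x = \<rho> a" "y = \<rho> b" using \<open>x \<in> _\<close> \<open>y \<in> _\<close> by blast
		then have "x - y = \<rho> (a \<otimes>\<^bsub>G\<^esub> inv\<^bsub>G\<^esub> b)" by (simp add: hom inv)
		then show ?thesis using \<open>a \<in> H\<close> \<open>b \<in> H\<close> by simp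
	qed
	have z: "0 \<in> \<rho> ` H" using one by (metis H.one_closed image_eqI)
	have sp: "x j = 0" if "x \<in> \<rho> ` H" "d \<le> j" for x j using supp that by auto
	have "\<exists>(r::nat) b. (\<forall>i<r. b i \<in> \<rho> ` H) \<and> (\<forall>x\<in>\<rho> ` H. \<exists>z. \<forall>j. x j = (\<Sum>i<r. z i * b i j)) \<and>
					 indep_family UNIV {..<r} (\<lambda>i. cvec (b i))"
		by (rule int_vectors_basis[where d = d]) (fact z, rule cl, assumption+, rule sp, assumption+)
	then obtain r :: nat and b where rb: "\<forall>i<r. b i \<in> \<rho> ` H"
			"\<forall>x\<in>\<rho> ` H. \<exists>z. \<forall>j. x j = (\<Sum>i<r. z i * b i j)"
			"indep_family UNIV {..<r} (\<lambda>i. cvec (b i))" by (elim exE conjE)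
	note b = rb(1)[rule_format] rb(2)[rule_format] rb(3)
	define \<beta> where "\<beta> i = inv_into H \<rho> (b i)" for i
	have \<beta>: "\<beta> i \<in> H" "\<rho> (\<beta> i) = b i" if "i < r" for i
		using b(1)[OF that] by (auto simp: \<beta>_def inv_into_into f_inv_into_f)
	define comb where "comb c = (\<lambda>j. \<Sum>i<r. coord c i * b i j)" for c :: "nat \<Rightarrow>\<^sub>0 int"
	have comb_add: "comb (c + c') = comb c + comb c'" for c c'
		by (auto simp: comb_def lookup_add algebra_simps sum.distrib)
	have comb_mem: "comb c \<in> \<rho> ` H" for c
	proof -
		have sm: "(\<lambda>j. z * x j) \<in> \<rho> ` H" if "x \<in> \<rho> ` H" for x z
		proof -
			obtain a where a: "a \<in> H" "x = \<rho> a" using \<open>x \<in> _\<close> by blast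
			have nat: "\<rho> (a [^]\<^bsub>G\<^esub> m) = (\<lambda>j. int m * \<rho> a j) \<and> a [^]\<^bsub>G\<^esub> m \<in> H" for m :: nat
			proof (induction m)
				case 0
				then show ?case using one by (auto simp: fun_eq_iff)
			next
				case (Suc m)
				then show ?case using a hom by (auto simp: algebra_simps)
			qed
			show ?thesis
			proof (cases "z \<ge> 0")
				case True
				then show ?thesis using nat[of "nat z"] a by (metis image_eqI int_nat_eq)
			next
				case False
				then have "(\<lambda>j. z * x j) = - (\<lambda>j. int (nat (- z)) * \<rho> a j)" using a by auto
				also have "\<dots> = \<rho> (inv\<^bsub>G\<^esub> (a [^]\<^bsub>G\<^esub> nat (- z)))" using nat[of "nat (- z)"] inv by metis
				finally show ?thesis using nat[of "nat (- z)"] by auto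
			qed
		qed
		have "(\<lambda>j. \<Sum>i<m. coord c i * b i j) \<in> \<rho> ` H" if "m \<le> r" for m using that
		proof (induction m)
			case 0
			then show ?case using z by (simp add: zero_fun_def)
		next
			case (Suc m)
			obtain a1 where a1: "a1 \<in> H" "(\<lambda>j. \<Sum>i<m. coord c i * b i j) = \<rho> a1" using Suc by auto
			obtain a2 where a2: "a2 \<in> H" "(\<lambda>j. coord c m * b m j) = \<rho> a2" using sm[OF b(1), of m] Suc by auto
			have "(\<lambda>j. \<Sum>i<Suc m. coord c i * b i j) = \<rho> (a1 \<otimes>\<^bsub>G\<^esub> a2)"
				unfolding hom[OF a1(1) a2(1)] a1(2)[symmetric] a2(2)[symmetric] by auto
			then show ?case using a1 a2 by auto
		qed
		then show ?thesis by (simp add: comb_def)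
	qed
	define \<psi> where "\<psi> c = inv_into H \<rho> (comb c)" for c
	have \<psi>: "\<psi> c \<in> H" "\<rho> (\<psi> c) = comb c" for c
		using comb_mem[of c] by (auto simp: \<psi>_def inv_into_into f_inv_into_f)
	have "\<psi> \<in> iso (int_lattice r) (G\<lparr>carrier := H\<rparr>)"
	proof (rule isoI)
		show "\<psi> \<in> hom (int_lattice r) (G\<lparr>carrier := H\<rparr>)"
		proof (rule homI)
			fix c c' assume "c \<in> carrier (int_lattice r)" "c' \<in> carrier (int_lattice r)"
			have "\<rho> (\<psi> (c + c')) = \<rho> (\<psi> c \<otimes>\<^bsub>G\<^esub> \<psi> c')" by (simp add: \<psi> hom comb_add)
			then show "\<psi> (c \<otimes>\<^bsub>int_lattice r\<^esub> c') = \<psi> c \<otimes>\<^bsub>G\<lparr>carrier := H\<rparr>\<^esub> \<psi> c'"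
				using inj \<psi>(1) by (simp add: inj_on_eq_iff)
		qed (use \<psi> in simp)
		show "bij_betw \<psi> (carrier (int_lattice r)) (carrier (G\<lparr>carrier := H\<rparr>))"
		proof (rule bij_betw_imageI)
			show "inj_on \<psi> (carrier (int_lattice r))"
			proof (rule inj_onI)
				fix c c' assume c: "c \<in> carrier (int_lattice r)" "c' \<in> carrier (int_lattice r)" and e: "\<psi> c = \<psi> c'"
				have "comb c = comb c'" using e \<psi>(2) by metis
				then have "(\<Sum>i<r. of_int (coord c i - coord c' i) * cvec (b i) j) = 0" for j
				proof -
					have "(\<Sum>i<r. of_int (coord c i - coord c' i) * cvec (b i) j)
							= complex_of_int (comb c j - comb c' j)"
						by (simp add: comb_def left_diff_distrib sum_subtractf cvec_apply)
					then show ?thesis using \<open>comb c = comb c'\<close> by simp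
				qed
				then have "of_int (coord c i - coord c' i) = (0::complex)" if "i < r" for i
					using indep_familyD[OF b(3), of "\<lambda>i. of_int (coord c i - coord c' i)" i] that by simp
				then have "coord c i = coord c' i" if "i < r" for i
					using that by (metis eq_iff_diff_eq_0 of_int_eq_0_iff)
				moreover have "coord c i = coord c' i" if "\<not> i < r" for i
					using c that by (metis carrier_free_Abelian_group_iff in_keys_iff lessThan_iff subset_iff)
				ultimately show "c = c'" by (intro poly_mapping_eqI) blast
			qed
			show "\<psi> ` carrier (int_lattice r) = carrier (G\<lparr>carrier := H\<rparr>)"
			proof (intro equalityI subsetI)
				fix x assume "x \<in> carrier (G\<lparr>carrier := H\<rparr>)"
				then have x: "x \<in> H" by simp
				then obtain z where z: "\<And>j. \<rho> x j = (\<Sum>i<r. z i * b i j)" using b(2) by blast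
				define c where "c = (\<Sum>i<r. frag_cmul (z i) (frag_of i))"
				have lc: "coord c j = (if j < r then z j else 0)" for j
					unfolding c_def by (rule lookup_frag_combination)
				have "comb c = \<rho> x" by (auto simp: comb_def z lc)
				then have "\<psi> c = x" using x inj by (simp add: \<psi>_def)
				moreover have "c \<in> carrier (int_lattice r)"
					using lc by (auto simp: in_keys_iff split: if_splits)
				ultimately show "x \<in> \<psi> ` carrier (int_lattice r)" by blast
			qed (use \<psi> in auto)
		qed
	qed
	then have "int_lattice r \<cong> G\<lparr>carrier := H\<rparr>" by (rule is_isoI)
	then have iso: "G\<lparr>carrier := H\<rparr> \<cong> int_lattice r" by (rule group.iso_sym[rotated]) simp
	have "cfun.dim ((\<lambda>x. cvec (\<rho> x)) ` H) = r"
	proof -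
		have ib: "inj_on (\<lambda>i. cvec (b i)) {..<r}" "cfun.independent ((\<lambda>i. cvec (b i)) ` {..<r})"
			using b(3) by (simp_all add: indep_family_iff_independent)
		show ?thesis
		proof (rule cfun.dim_unique[OF _ _ ib(2)])
			show "(\<lambda>i. cvec (b i)) ` {..<r} \<subseteq> (\<lambda>x. cvec (\<rho> x)) ` H" using b(1) by fastforce
			show "card ((\<lambda>i. cvec (b i)) ` {..<r}) = r" using ib(1) by (simp add: card_image)
			show "(\<lambda>x. cvec (\<rho> x)) ` H \<subseteq> cfun.span ((\<lambda>i. cvec (b i)) ` {..<r})"
			proof (rule image_subsetI)
				fix x assume "x \<in> H"
				then obtain z where z: "\<And>j. \<rho> x j = (\<Sum>i<r. z i * b i j)" using b(2) by blast
				have "cvec (\<rho> x) = (\<Sum>i<r. (\<lambda>j. of_int (z i) * cvec (b i) j))"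
					by (auto simp: sum_fun_apply z cvec_apply)
				also have "\<dots> \<in> cfun.span ((\<lambda>i. cvec (b i)) ` {..<r})"
					by (intro cfun.span_sum cfun.span_scale cfun.span_base) auto
				finally show "cvec (\<rho> x) \<in> cfun.span ((\<lambda>i. cvec (b i)) ` {..<r})" .
			qed
		qed
	qed
	with iso show "G\<lparr>carrier := H\<rparr> \<cong> int_lattice (cfun.dim ((\<lambda>x. cvec (\<rho> x)) ` H))" by simp
	then show "lattice_dim G H = cfun.dim ((\<lambda>x. cvec (\<rho> x)) ` H)"
		by (rule lattice_dim_eqI) (rule GH.is_group)
qed

lemma lattice_dim_generate:
	fixes \<rho> :: "'a => nat => int"
	assumes "group G" "X \<subseteq> carrier G"
		and hom: "\<And>x y. x \<in> carrier G ==> y \<in> carrier G ==> \<rho> (x \<otimes>\<^bsub>G\<^esub> y) = \<rho> x + \<rho> y"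
		and inj: "inj_on \<rho> (carrier G)" and supp: "\<And>x j. x \<in> carrier G ==> d \<le> j ==> \<rho> x j = 0"
	shows "cfun.span ((\<lambda>x. cvec (\<rho> x)) ` generate G X) = cfun.span ((\<lambda>x. cvec (\<rho> x)) ` X)"
		and "lattice_dim G (generate G X) = cfun.dim ((\<lambda>x. cvec (\<rho> x)) ` X)"
proof -
	interpret group G by fact
	have one: "\<rho> \<one>\<^bsub>G\<^esub> = 0" using hom[OF one_closed one_closed] by simp
	have inv: "\<rho> (inv\<^bsub>G\<^esub> x) = - \<rho> x" if "x \<in> carrier G" for x
		using hom[OF that inv_closed[OF that]] that one by (simp add: eq_neg_iff_add_eq_0 add.commute)
	have sub: "subgroup (generate G X) G" by (rule generate_is_subgroup) fact
	have sc: "generate G X \<subseteq> carrier G" by (rule generate_incl) fact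
	have "cvec (\<rho> x) \<in> cfun.span ((\<lambda>x. cvec (\<rho> x)) ` X)" if "x \<in> generate G X" for x using that
	proof (induction rule: generate.induct)
		case one
		have "cvec (\<rho> \<one>\<^bsub>G\<^esub>) = 0" by (simp add: \<open>\<rho> \<one>\<^bsub>G\<^esub> = 0\<close> cvec_def zero_fun_def)
		then show ?case by (simp only: cfun.span_zero)
	next
		case (incl h)
		then show ?case by (intro cfun.span_base) auto
	next
		case (inv h)
		have "cvec (\<rho> (inv\<^bsub>G\<^esub> h)) = - cvec (\<rho> h)" using \<open>\<And>x. x \<in> carrier G ==> \<rho> (inv\<^bsub>G\<^esub> x) = - \<rho> x\<close> inv assms(2) by (auto simp: fun_eq_iff cvec_apply)
		then show ?case using inv cfun.span_neg[OF cfun.span_base[of "cvec (\<rho> h)"]] by (simp only: image_eqI)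
	next
		case (eng h1 h2)
		have "cvec (\<rho> (h1 \<otimes>\<^bsub>G\<^esub> h2)) = cvec (\<rho> h1) + cvec (\<rho> h2)" using hom eng(1,2) sc by (auto simp: fun_eq_iff subset_iff cvec_apply)
		then show ?case using cfun.span_add[OF eng(3,4)] by (simp only:)
	qed
	then show e: "cfun.span ((\<lambda>x. cvec (\<rho> x)) ` generate G X) = cfun.span ((\<lambda>x. cvec (\<rho> x)) ` X)"
		by (intro equalityI cfun.span_minimal cfun.span_mono cfun.subspace_span) (auto intro: generate.incl)
	have "lattice_dim G (generate G X) = cfun.dim ((\<lambda>x. cvec (\<rho> x)) ` generate G X)"
		using sc by (intro lattice_dim_subgroup(2)[OF sub assms(1)]) (auto intro: hom supp inj_on_subset[OF inj])
	then show "lattice_dim G (generate G X) = cfun.dim ((\<lambda>x. cvec (\<rho> x)) ` X)"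
		using cfun.span_eq_dim[OF e] by simp
qed

abbreviation polys :: "(('j => complex) => complex) set" where
	"polys \<equiv> polynomial_functions"

section \<open>Polynomial functions and the Zariski topology\<close>

lemma polynomial_functions_uminus: "p \<in> polys ==> (\<lambda>c. - p c) \<in> polys"
	using polynomial_functions.mult[OF polynomial_functions.const[of "-1"]] by simp

lemma polynomial_functions_diff:
	"p \<in> polys ==> q \<in> polys ==> (\<lambda>c. p c - q c) \<in> polys"
	using polynomial_functions.add[OF _ polynomial_functions_uminus] by fastforce

lemma polynomial_functions_sum:
	"(\<And>i. i \<in> I ==> p i \<in> polys) ==> (\<lambda>c. \<Sum>i\<in>I. p i c) \<in> polys"
	by (induction I rule: infinite_finite_induct) (auto intro: polynomial_functions.intros)

lemma polynomial_functions_prod: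
	"(\<And>i. i \<in> I ==> p i \<in> polys) ==> (\<lambda>c. \<Prod>i\<in>I. p i c) \<in> polys"
	by (induction I rule: infinite_finite_induct) (auto intro: polynomial_functions.intros)

lemma polynomial_functions_power:
	"p \<in> polys ==> (\<lambda>c. p c ^ m) \<in> polys" by (induction m) (auto intro: polynomial_functions.intros)

lemma polynomial_functions_compose:
	assumes "p \<in> polys" "\<And>j. (\<lambda>c. f c j) \<in> polys"
	shows "(\<lambda>c. p (f c)) \<in> polys"
	using assms(1) by induction (auto intro: polynomial_functions.intros assms(2))

lemma polynomial_functions_holomorphic:
	assumes "p \<in> polys" "\<And>j. (\<lambda>t. \<gamma> t j) holomorphic_on S"
	shows "(\<lambda>t. p (\<gamma> t)) holomorphic_on S"
	using assms(1) by induction (auto intro!: holomorphic_intros assms(2))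

text \<open>An entire function nonzero at a point is nonzero near it, so the other factor vanishes
  on a neighbourhood and, by analytic continuation, everywhere.\<close>

lemma holomorphic_mult_zero:
	assumes "f holomorphic_on UNIV" "g holomorphic_on UNIV" "\<And>z. f z * g z = (0::complex)"
	shows "(\<forall>z. f z = 0) \<or> (\<forall>z. g z = 0)"
proof (rule ccontr)
	assume "\<not> ?thesis"
	then obtain a b where a: "f a \<noteq> 0" and b: "g b \<noteq> 0" by blast
	have "continuous_on UNIV f" using assms(1) by (rule holomorphic_on_imp_continuous_on)
	then have "open {z. f z \<noteq> 0}" by (simp add: open_Collect_neq continuous_on_const)
	then have "a islimpt {z. f z \<noteq> 0}" using a by (intro interior_limit_point) (simp add: interior_open)
	then have "g b = 0"
		by (rule analytic_continuation[OF assms(2) open_UNIV connected_UNIV subset_UNIV UNIV_I])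
			(use assms(3) in \<open>auto simp: mult_eq_0_iff\<close>)
	then show False using b by simp
qed

lemma in_zariski_closure_iff:
	assumes "X \<subseteq> coeff_space J"
	shows "c \<in> (zariski J) closure_of X \<longleftrightarrow>
		c \<in> coeff_space J \<and> (\<forall>p\<in>polynomial_functions. (\<forall>x\<in>X. p x = 0) --> p c = 0)"
proof
	assume c: "c \<in> (zariski J) closure_of X"
	have "c \<in> coeff_space J" using c closure_of_subset_topspace[of "zariski J" X] by auto
	moreover have "p c = 0" if p: "p \<in> polys" "\<forall>x\<in>X. p x = 0" for p
	proof -
		have "closedin (zariski J) {c \<in> coeff_space J. p c = 0}"
			unfolding closedin_zariski by (rule exI[of _ "{p}"]) (use p in auto)
		then have "(zariski J) closure_of X \<subseteq> {c \<in> coeff_space J. p c = 0}"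
			by (rule closure_of_minimal[rotated]) (use p assms in auto)
		then show ?thesis using c by auto
	qed
	ultimately show "c \<in> coeff_space J \<and> (\<forall>p\<in>polynomial_functions. (\<forall>x\<in>X. p x = 0) --> p c = 0)"
		by blast
next
	assume c: "c \<in> coeff_space J \<and> (\<forall>p\<in>polynomial_functions. (\<forall>x\<in>X. p x = 0) --> p c = 0)"
	have "closedin (zariski J) ((zariski J) closure_of X)" by simp
	then obtain F where F: "F \<subseteq> polys"
			"(zariski J) closure_of X = {c \<in> coeff_space J. \<forall>p\<in>F. p c = 0}"
		unfolding closedin_zariski by blast
	have "X \<subseteq> (zariski J) closure_of X" using assms by (simp add: closure_of_subset)
	then show "c \<in> (zariski J) closure_of X" unfolding F(2) using c F(1) by blast
qed

text \<open>The last hypothesis is primality of the vanishing ideal of \<open>X\<close>. If neither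
  of two closed sets covering the closure contains \<open>X\<close>, each has an equation that fails
  somewhere on \<open>X\<close>, although the product of the two vanishes on
  \<open>X\<close>.\<close>

lemma irreducible_closedin_closure:
	assumes "X \<subseteq> coeff_space J" "X \<noteq> {}" and "\<And>p q. p \<in> polys ==> q \<in> polys ==>
					 (\<And>x. x \<in> X ==> p x * q x = 0) ==> (\<forall>x\<in>X. p x = 0) \<or> (\<forall>x\<in>X. q x = 0)"
	shows "irreducible_closedin (zariski J) ((zariski J) closure_of X)"
	unfolding irreducible_closedin_def
proof (intro conjI allI impI)
	let ?Z = "(zariski J) closure_of X"
	show "closedin (zariski J) ?Z" by simp
	have sub: "X \<subseteq> ?Z" using assms(1) by (simp add: closure_of_subset)
	then show "?Z \<noteq> {}" using assms(2) by blast
	fix U V assume UV: "closedin (zariski J) U \<and> closedin (zariski J) V \<and> ?Z = U \<union> V"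
	then obtain F G where F: "F \<subseteq> polys" "U = {c \<in> coeff_space J. \<forall>p\<in>F. p c = 0}"
		and G: "G \<subseteq> polys" "V = {c \<in> coeff_space J. \<forall>p\<in>G. p c = 0}" unfolding closedin_zariski by blast
	show "?Z = U \<or> ?Z = V"
	proof (rule ccontr)
		assume ne: "\<not> ?thesis"
		have "\<not> X \<subseteq> U" using ne closure_of_minimal[of X U "zariski J"] UV by blast
		then obtain x p where xp: "x \<in> X" "p \<in> F" "p x \<noteq> 0" using F(2) assms(1) by blast
		have "\<not> X \<subseteq> V" using ne closure_of_minimal[of X V "zariski J"] UV by blast
		then obtain y q where yq: "y \<in> X" "q \<in> G" "q y \<noteq> 0" using G(2) assms(1) by blast
		have "p z * q z = 0" if "z \<in> X" for z
		proof -
			have "z \<in> U \<union> V" using that sub UV by blast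
			then show ?thesis using xp(2) yq(2) F(2) G(2) by auto
		qed
		then have "(\<forall>x\<in>X. p x = 0) \<or> (\<forall>x\<in>X. q x = 0)" using assms(3) xp(2) yq(2) F(1) G(1) by blast
		then show False using xp yq by blast
	qed
qed

lemma irreducible_closedinD:
	assumes "irreducible_closedin (zariski J) Y" "p \<in> polys" "q \<in> polys"
		and "\<And>y. y \<in> Y ==> p y * q y = 0"
	shows "(\<forall>y\<in>Y. p y = 0) \<or> (\<forall>y\<in>Y. q y = 0)"
proof -
	have cl: "closedin (zariski J) Y" using assms(1) by (simp add: irreducible_closedin_def)
	have sub: "Y \<subseteq> coeff_space J" using closedin_subset[OF cl] by simp
	have c: "closedin (zariski J) {y \<in> Y. r y = 0}" if r: "r \<in> polys" for r
	proof -
		have "closedin (zariski J) {c \<in> coeff_space J. r c = 0}"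
			unfolding closedin_zariski by (rule exI[of _ "{r}"]) (use r in auto)
		then have "closedin (zariski J) (Y \<inter> {c \<in> coeff_space J. r c = 0})" using cl by blast
		moreover have "Y \<inter> {c \<in> coeff_space J. r c = 0} = {y \<in> Y. r y = 0}" using sub by blast
		ultimately show ?thesis by simp
	qed
	have "Y = {y \<in> Y. p y = 0} \<union> {y \<in> Y. q y = 0}" using assms(4) by auto
	then have "Y = {y \<in> Y. p y = 0} \<or> Y = {y \<in> Y. q y = 0}"
		using assms(1) c[OF assms(2)] c[OF assms(3)] unfolding irreducible_closedin_def by blast
	then show ?thesis by blast
qed

section \<open>Growth of the number of independent polynomials on a closed set\<close>

definition monomial_fun :: "'j set => ('j => nat) => ('j => complex) => complex" where
	"monomial_fun J \<alpha> c = (\<Prod>j\<in>J. c j ^ \<alpha> j)"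

definition exponents :: "'j set => nat => ('j => nat) set" where
	"exponents J D = (\<Pi>\<^sub>E j\<in>J. {..D})"

text \<open>Degrees are bounded in each variable separately, so that the number of monomials is
  exactly a power of D + 1.\<close>

definition box_polys :: "'j set => nat => (('j => complex) => complex) set" where
	"box_polys J D = {p. \<exists>u. p = (\<lambda>c. \<Sum>\<alpha>\<in>exponents J D. u \<alpha> * monomial_fun J \<alpha> c)}"

lemma finite_exponents [simp]: "finite J ==> finite (exponents J D)"
	by (simp add: exponents_def finite_PiE)

lemma card_exponents: "finite J ==> card (exponents J D) = (D + 1) ^ card J"
	by (simp add: exponents_def card_PiE)

lemma monomial_fun_restrict: "monomial_fun J (restrict \<alpha> J) = monomial_fun J \<alpha>"
	by (auto simp: monomial_fun_def intro!: ext prod.cong)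

lemma monomial_fun_in_polynomial_functions: "monomial_fun J \<alpha> \<in> polys"
	unfolding monomial_fun_def[abs_def]
	by (intro polynomial_functions_prod polynomial_functions_power polynomial_functions.coord)

lemma box_polys_in_polynomial_functions: "p \<in> box_polys J D ==> p \<in> polys" unfolding box_polys_def
	by (auto intro!: polynomial_functions_sum polynomial_functions.mult polynomial_functions.const
			monomial_fun_in_polynomial_functions)

lemma box_polys_monomial:
	assumes "finite J" "\<And>j. j \<in> J ==> \<alpha> j \<le> D"
	shows "monomial_fun J \<alpha> \<in> box_polys J D"
proof -
	have r: "restrict \<alpha> J \<in> exponents J D" using assms(2) by (auto simp: exponents_def)
	have eq: "monomial_fun J \<alpha> c = (\<Sum>\<beta>\<in>exponents J D. (if \<beta> = restrict \<alpha> J then 1 else 0) * monomial_fun J \<beta> c)" for c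
	proof -
		have "(\<Sum>\<beta>\<in>exponents J D. (if \<beta> = restrict \<alpha> J then 1 else 0) * monomial_fun J \<beta> c)
				= (\<Sum>\<beta>\<in>exponents J D. if \<beta> = restrict \<alpha> J then monomial_fun J \<beta> c else 0)"
			by (intro sum.cong) auto
		also have "\<dots> = monomial_fun J (restrict \<alpha> J) c" using r assms(1) by simp
		finally show ?thesis by (simp add: monomial_fun_restrict)
	qed
	show ?thesis unfolding box_polys_def
		by (rule CollectI, rule exI[of _ "\<lambda>\<beta>. if \<beta> = restrict \<alpha> J then 1 else 0"], rule ext, rule eq)
qed

lemma box_polys_add:
	assumes "p \<in> box_polys J D" "q \<in> box_polys J D"
	shows "(\<lambda>c. p c + q c) \<in> box_polys J D"
proof -
	obtain u v where u: "p = (\<lambda>c. \<Sum>\<alpha>\<in>exponents J D. u \<alpha> * monomial_fun J \<alpha> c)"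
		and v: "q = (\<lambda>c. \<Sum>\<alpha>\<in>exponents J D. v \<alpha> * monomial_fun J \<alpha> c)"
		using assms unfolding box_polys_def by blast
	have "(\<lambda>c. p c + q c) = (\<lambda>c. \<Sum>\<alpha>\<in>exponents J D. (u \<alpha> + v \<alpha>) * monomial_fun J \<alpha> c)"
		unfolding u v by (auto simp: sum.distrib distrib_right)
	then show ?thesis unfolding box_polys_def by (auto intro!: exI[of _ "\<lambda>\<alpha>. u \<alpha> + v \<alpha>"])
qed

lemma box_polys_scale:
	assumes "p \<in> box_polys J D"
	shows "(\<lambda>c. z * p c) \<in> box_polys J D"
proof -
	obtain u where u: "p = (\<lambda>c. \<Sum>\<alpha>\<in>exponents J D. u \<alpha> * monomial_fun J \<alpha> c)"
		using assms unfolding box_polys_def by blast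
	have "(\<lambda>c. z * p c) = (\<lambda>c. \<Sum>\<alpha>\<in>exponents J D. (z * u \<alpha>) * monomial_fun J \<alpha> c)"
		unfolding u by (auto simp: sum_distrib_left ac_simps)
	then show ?thesis unfolding box_polys_def by (auto intro!: exI[of _ "\<lambda>\<alpha>. z * u \<alpha>"])
qed

lemma box_polys_zero: "(\<lambda>c. 0) \<in> box_polys J D"
	unfolding box_polys_def by (auto intro!: exI[of _ "\<lambda>_. 0"])

lemma box_polys_sum:
	"(\<And>i. i \<in> I ==> p i \<in> box_polys J D) ==> (\<lambda>c. \<Sum>i\<in>I. p i c) \<in> box_polys J D"
	by (induction I rule: infinite_finite_induct) (auto intro: box_polys_zero box_polys_add)

lemma box_polys_mult:
	assumes "finite J" "p \<in> box_polys J D" "q \<in> box_polys J E"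
	shows "(\<lambda>c. p c * q c) \<in> box_polys J (D + E)"
proof -
	obtain u v where u: "p = (\<lambda>c. \<Sum>\<alpha>\<in>exponents J D. u \<alpha> * monomial_fun J \<alpha> c)"
		and v: "q = (\<lambda>c. \<Sum>\<beta>\<in>exponents J E. v \<beta> * monomial_fun J \<beta> c)"
		using assms unfolding box_polys_def by blast
	have "(\<lambda>c. p c * q c) = (\<lambda>c. \<Sum>\<alpha>\<in>exponents J D. \<Sum>\<beta>\<in>exponents J E.
			(u \<alpha> * v \<beta>) * monomial_fun J (\<lambda>j. \<alpha> j + \<beta> j) c)" unfolding u v sum_product
		by (intro ext sum.cong refl) (simp add: monomial_fun_def power_add prod.distrib)
	also have "\<dots> \<in> box_polys J (D + E)"
		by (intro box_polys_sum box_polys_scale box_polys_monomial assms(1))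
			 (fastforce simp: exponents_def intro!: add_mono)
	finally show ?thesis .
qed

lemma box_polys_mono:
	assumes "finite J" "D \<le> E" "p \<in> box_polys J D"
	shows "p \<in> box_polys J E"
proof -
	obtain u where u: "p = (\<lambda>c. \<Sum>\<alpha>\<in>exponents J D. u \<alpha> * monomial_fun J \<alpha> c)"
		using assms unfolding box_polys_def by blast
	have "\<And>\<alpha> j. \<alpha> \<in> exponents J D ==> j \<in> J ==> \<alpha> j \<le> E"
		using assms(2) unfolding exponents_def by (meson PiE_mem atMost_iff order_trans)
	then show ?thesis unfolding u by (intro box_polys_sum box_polys_scale box_polys_monomial assms(1)) blast
qed

text \<open>Agreement is claimed only on \<open>coeff_space J\<close>: a polynomial function may
  involve coordinates outside \<open>J\<close>, which vanish there.\<close>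

lemma polynomial_function_box:
	assumes "finite J" "p \<in> polys"
	shows "\<exists>D. \<exists>q\<in>box_polys J D. \<forall>c\<in>coeff_space J. p c = q c" using assms(2)
proof induction
	case (const z)
	have "(\<lambda>c. z * monomial_fun J (\<lambda>_. 0) c) \<in> box_polys J 0"
		by (intro box_polys_scale box_polys_monomial assms) simp
	then show ?case by (intro exI[of _ 0] bexI[of _ "\<lambda>c. z * monomial_fun J (\<lambda>_. 0) c"]) (simp_all add: monomial_fun_def)
next
	case (coord j)
	show ?case
	proof (cases "j \<in> J")
		case True
		have m: "monomial_fun J (\<lambda>i. if i = j then 1 else 0) \<in> box_polys J 1"
			by (intro box_polys_monomial assms) simp
		have "monomial_fun J (\<lambda>i. if i = j then 1 else 0) c = c j" for c :: "'a => complex"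
		proof -
			have "monomial_fun J (\<lambda>i. if i = j then 1 else 0) c = (\<Prod>i\<in>J. if i = j then c i else 1)"
				unfolding monomial_fun_def by (intro prod.cong) auto
			then show ?thesis using True assms(1) by simp
		qed
		then show ?thesis using m by (intro exI[of _ 1] bexI[OF _ m]) simp
	next
		case False
		then show ?thesis by (intro exI[of _ 0] bexI[OF _ box_polys_zero]) (simp add: coeff_space_def)
	qed
next
	case (add p q)
	then obtain D p' E q' where "p' \<in> box_polys J D" "\<forall>c\<in>coeff_space J. p c = p' c"
		"q' \<in> box_polys J E" "\<forall>c\<in>coeff_space J. q c = q' c" by blast
	then show ?case by (intro exI[of _ "D + E"] bexI[of _ "\<lambda>c. p' c + q' c"] box_polys_add)
			 (auto intro: box_polys_mono[OF assms(1), of D] box_polys_mono[OF assms(1), of E])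
next
	case (mult p q)
	then obtain D p' E q' where "p' \<in> box_polys J D" "\<forall>c\<in>coeff_space J. p c = p' c"
		"q' \<in> box_polys J E" "\<forall>c\<in>coeff_space J. q c = q' c" by blast
	then show ?case
		by (intro exI[of _ "D + E"] bexI[of _ "\<lambda>c. p' c * q' c"] box_polys_mult assms(1)) auto
qed

text \<open>With the other coordinates fixed, a relation is a polynomial in the new coordinate that
  vanishes identically; the induction applies to each of its coefficients.\<close>

lemma monomials_independent:
	assumes "finite J"
	shows "indep_family (coeff_space J) (exponents J D) (monomial_fun J)" using assms
proof (induction J rule: finite_induct)
	case empty
	show ?case by (rule indep_familyI) (auto simp: exponents_def monomial_fun_def coeff_space_def)
next
	case (insert j J)
	show ?case
	proof (rule indep_familyI)
		fix u \<alpha> assume u: "\<And>c. c \<in> coeff_space (insert j J) ==>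
				(\<Sum>\<alpha>\<in>exponents (insert j J) D. u \<alpha> * monomial_fun (insert j J) \<alpha> c) = 0"
			and \<alpha>: "\<alpha> \<in> exponents (insert j J) D"
		have inj: "inj_on (\<lambda>(m, \<beta>). \<beta>(j := m)) ({..D} \<times> exponents J D)"
			unfolding exponents_def by (rule inj_combinator) (rule insert.hyps)
		have ex: "exponents (insert j J) D = (\<lambda>(m, \<beta>). \<beta>(j := m)) ` ({..D} \<times> exponents J D)"
			unfolding exponents_def by (rule PiE_insert_eq)
		have e: "(\<Sum>m\<le>D. (\<Sum>\<beta>\<in>exponents J D. u (\<beta>(j := m)) * monomial_fun J \<beta> c) * z ^ m) = 0"
			if c: "c \<in> coeff_space J" for c z
		proof -
			let ?c = "c(j := z)"
			have mf: "monomial_fun (insert j J) (\<beta>(j := m)) ?c = monomial_fun J \<beta> c * z ^ m" for \<beta> m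
			proof -
				have "(\<Prod>i\<in>J. ?c i ^ (\<beta>(j := m)) i) = (\<Prod>i\<in>J. c i ^ \<beta> i)"
					by (rule prod.cong) (use insert.hyps in auto)
				then show ?thesis using insert.hyps by (simp add: monomial_fun_def)
			qed
			have "?c \<in> coeff_space (insert j J)" using c by (auto simp: coeff_space_def)
			from u[OF this] have "(\<Sum>(m, \<beta>)\<in>{..D} \<times> exponents J D. u (\<beta>(j := m)) * (monomial_fun J \<beta> c * z ^ m)) = 0"
				unfolding ex sum.reindex[OF inj] by (simp add: case_prod_unfold mf)
			then show ?thesis
				by (simp add: sum.cartesian_product[symmetric] sum_distrib_left sum_distrib_right mult.assoc)
		qed
		obtain m \<beta> where m: "m \<le> D" and \<beta>: "\<beta> \<in> exponents J D" and ab: "\<alpha> = \<beta>(j := m)"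
			using \<alpha> unfolding ex by auto
		have "(\<Sum>\<beta>\<in>exponents J D. u (\<beta>(j := m)) * monomial_fun J \<beta> c) = 0" if "c \<in> coeff_space J" for c
			using zero_polynom_imp_zero_coeffs[of "\<lambda>m. \<Sum>\<beta>\<in>exponents J D. u (\<beta>(j := m)) * monomial_fun J \<beta> c" D m] e[OF that] m
			by blast
		from indep_familyD[OF insert.IH, of "\<lambda>\<beta>. u (\<beta>(j := m))", OF this \<beta>]
		show "u \<alpha> = 0" by (simp add: ab)
	qed
qed

text \<open>The value at \<open>D\<close> of the Hilbert function of \<open>Y\<close>, with degrees
  bounded per variable, is at least \<open>m\<close>; a bound rather than a value, because only
  lower bounds are propagated.\<close>

definition independent_count :: "'j set => ('j => complex) set => nat => nat => bool" where
	"independent_count J Y D m \<longleftrightarrow>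
		 (\<exists>g. (\<forall>i<m. g i \<in> box_polys J D) \<and> indep_family Y {..<m} g)"

lemma independent_count_le:
	assumes "finite J" "independent_count J Y D m"
	shows "m \<le> (D + 1) ^ card J"
proof -
	obtain g where g: "\<forall>i<m. g i \<in> box_polys J D" "indep_family Y {..<m} g"
		using assms(2) by (auto simp: independent_count_def)
	then have "\<forall>i\<in>{..<m}. \<exists>u. g i = (\<lambda>c. \<Sum>\<alpha>\<in>exponents J D. u \<alpha> * monomial_fun J \<alpha> c)"
		by (simp add: box_polys_def)
	then obtain u where u: "\<And>i. i < m ==> g i = (\<lambda>c. \<Sum>\<alpha>\<in>exponents J D. u i \<alpha> * monomial_fun J \<alpha> c)"
		by (metis lessThan_iff)
	have "card {..<m} \<le> card (exponents J D)"
		by (rule indep_family_card_le[OF g(2), of _ u "monomial_fun J"]) (use assms(1) u in auto)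
	then show ?thesis by (simp add: card_exponents[OF assms(1)])
qed

text \<open>Multiplication by an equation \<open>f\<close> of \<open>Y\<close>: the products
  \<open>g i * f\<close> vanish on \<open>Y\<close> while the \<open>h i\<close> are independent
  there, so a relation first loses the coefficients of the \<open>h i\<close>. Irreducibility of
  \<open>Y'\<close> then allows \<open>f\<close> to be cancelled.\<close>

lemma independent_count_step:
	assumes "finite J" "irreducible_closedin (zariski J) Y'" "Y \<subseteq> Y'"
		and f: "f \<in> box_polys J E" "\<And>y. y \<in> Y ==> f y = 0" "\<exists>y\<in>Y'. f y \<noteq> 0"
		and "independent_count J Y' D M" "independent_count J Y (D + E) m"
	shows "independent_count J Y' (D + E) (M + m)"
proof -
	obtain g where g: "\<And>i. i < M ==> g i \<in> box_polys J D" "indep_family Y' {..<M} g"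
		using assms(7) by (auto simp: independent_count_def)
	obtain h where h: "\<And>i. i < m ==> h i \<in> box_polys J (D + E)" "indep_family Y {..<m} h"
		using assms(8) by (auto simp: independent_count_def)
	define k where "k i = (if i < M then (\<lambda>c. g i c * f c) else h (i - M))" for i
	have k: "k i \<in> box_polys J (D + E)" if "i < M + m" for i
		using that by (auto simp: k_def intro: box_polys_mult[OF assms(1) g(1) f(1)] h(1))
	have sp: "(\<Sum>i<M + m. u i * k i c) = (\<Sum>i<M. u i * g i c) * f c + (\<Sum>i<m. u (M + i) * h i c)" for u c
	proof -
		have "(\<Sum>i<M + m. u i * k i c) = (\<Sum>i<M. u i * k i c) + (\<Sum>i<m. u (M + i) * k (M + i) c)"
			by (induction m) (auto simp: add.assoc)
		moreover have "(\<Sum>i<M. u i * k i c) = (\<Sum>i<M. u i * g i c) * f c"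
			by (simp add: sum_distrib_right k_def mult.assoc)
		ultimately show ?thesis by (simp add: k_def)
	qed
	have "indep_family Y' {..<M + m} k"
	proof (rule indep_familyI)
		fix u i assume u: "\<And>c. c \<in> Y' ==> (\<Sum>i<M + m. u i * k i c) = 0" and i: "i \<in> {..<M + m}"
		have hz: "u (M + i) = 0" if "i < m" for i
		proof (rule indep_familyD[OF h(2), of "\<lambda>i. u (M + i)" i])
			fix c assume "c \<in> Y"
			then show "(\<Sum>i<m. u (M + i) * h i c) = 0" using u[of c] assms(3) f(2)[of c] by (auto simp: sp)
		qed (use that in simp)
		have "(\<Sum>i<M. u i * g i c) * f c = 0" if "c \<in> Y'" for c
		proof -
			have "(\<Sum>i<m. u (M + i) * h i c) = 0" by (rule sum.neutral) (simp add: hz)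
			then show ?thesis using u[OF that] by (simp add: sp)
		qed
		moreover have "(\<lambda>c. \<Sum>i<M. u i * g i c) \<in> polys"
			using g(1) by (intro polynomial_functions_sum polynomial_functions.mult polynomial_functions.const)
				(auto intro: box_polys_in_polynomial_functions)
		ultimately have "(\<forall>c\<in>Y'. (\<Sum>i<M. u i * g i c) = 0) \<or> (\<forall>c\<in>Y'. f c = 0)"
			using irreducible_closedinD[OF assms(2) _ box_polys_in_polynomial_functions[OF f(1)]] by blast
		then have gz: "(\<Sum>i<M. u i * g i c) = 0" if "c \<in> Y'" for c using f(3) that by blast
		show "u i = 0"
		proof (cases "i < M")
			case True
			then show ?thesis using indep_familyD[OF g(2), of u i] gz by simp
		next
			case False
			then show ?thesis using hz[of "i - M"] i by simp
		qed
	qed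
	then show ?thesis using k unfolding independent_count_def by blast
qed

text \<open>Dimension at least \<open>d\<close>, read off from the Hilbert function. The stride
  \<open>e\<close> is left free because passing to a larger irreducible set multiplies it by a
  number depending on the degree of an equation.\<close>

definition growth_at_least :: "'j set => ('j => complex) set => nat => bool" where
	"growth_at_least J Y d \<longleftrightarrow>
		 (\<exists>c>0. \<exists>e\<ge>1. \<forall>k. \<exists>m. independent_count J Y (e * k) m \<and> c * real k ^ d \<le> real m)"

text \<open>Telescoping of (k + 1)^(d + 1) - k^(d + 1) \<le> (d + 1) (k + 1)^d.\<close>

lemma sum_powers_ge: "real k ^ Suc d \<le> real (Suc d) * (\<Sum>i=1..k. real i ^ d)"
proof (induction k)
	case (Suc k)
	have "real (Suc k) ^ Suc d - real k ^ Suc d = (\<Sum>p<Suc d. real (Suc k) ^ p * real k ^ (d - p))"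
		by (subst diff_power_eq_sum) simp
	also have "\<dots> \<le> (\<Sum>p<Suc d. real (Suc k) ^ d)"
	proof (rule sum_mono)
		fix p assume p: "p \<in> {..<Suc d}"
		have "real (Suc k) ^ p * real k ^ (d - p) \<le> real (Suc k) ^ p * real (Suc k) ^ (d - p)"
			by (intro mult_left_mono power_mono) auto
		also have "\<dots> = real (Suc k) ^ d" using p by (simp add: power_add[symmetric])
		finally show "real (Suc k) ^ p * real k ^ (d - p) \<le> real (Suc k) ^ d" .
	qed
	finally have "real (Suc k) ^ Suc d - real k ^ Suc d \<le> real (Suc d) * real (Suc k) ^ d" by simp
	moreover have "(\<Sum>i=1..Suc k. real i ^ d) = (\<Sum>i=1..k. real i ^ d) + real (Suc k) ^ d" by simp
	ultimately show ?case using Suc by (simp add: distrib_left del: power_Suc of_nat_Suc)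
qed simp

text \<open>Adding up the increments of \<open>independent_count_step\<close> over 1, ..., k turns
  growth of order k^d on \<open>Y\<close> into growth of order k^(d + 1) on
  \<open>Y'\<close>.\<close>

lemma growth_at_least_step:
	assumes "finite J" "irreducible_closedin (zariski J) Y" "irreducible_closedin (zariski J) Y'"
		and "Y \<subset> Y'" "growth_at_least J Y d"
	shows "growth_at_least J Y' (Suc d)"
proof -
	have cl: "closedin (zariski J) Y" "closedin (zariski J) Y'"
		using assms(2,3) by (simp_all add: irreducible_closedin_def)
	have sub: "Y' \<subseteq> coeff_space J" using closedin_subset[OF cl(2)] by simp
	obtain F where F: "F \<subseteq> polys" "Y = {c \<in> coeff_space J. \<forall>p\<in>F. p c = 0}"
		using cl(1) unfolding closedin_zariski by blast
	obtain y p where y: "y \<in> Y'" "p \<in> F" "p y \<noteq> 0" using assms(4) F(2) sub by blast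
	obtain E0 f where f: "f \<in> box_polys J E0" "\<And>c. c \<in> coeff_space J ==> p c = f c"
		using polynomial_function_box[OF assms(1), of p] F(1) y(2) by blast
	obtain c e where ce: "c > 0" "e \<ge> 1" "\<And>k. \<exists>m. independent_count J Y (e * k) m \<and> c * real k ^ d \<le> real m"
		using assms(5) unfolding growth_at_least_def by blast
	\<comment> \<open>A multiple of the stride \<open>e\<close>, so that counts on \<open>Y\<close> are
	  available at every multiple of \<open>E\<close>, and at least the degree \<open>E0\<close> of the
	  equation.\<close>
	define E where "E = e * (E0 + 1)"
	have "1 * (E0 + 1) \<le> E" unfolding E_def using ce(2) by (rule mult_le_mono1)
	then have E: "E \<ge> 1" "E0 \<le> E" by simp_all
	have fE: "f \<in> box_polys J E" by (rule box_polys_mono[OF assms(1) E(2) f(1)])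
	have fY: "f z = 0" if "z \<in> Y" for z using that f(2)[of z] F(2) y(2) by auto
	have fY': "\<exists>z\<in>Y'. f z \<noteq> 0" using y f(2)[of y] sub by (metis subsetD)
	have "\<exists>m. independent_count J Y (E * i) m \<and> c * real i ^ d \<le> real m" for i
	proof -
		obtain m where "independent_count J Y (e * ((E0 + 1) * i)) m" "c * real ((E0 + 1) * i) ^ d \<le> real m"
			using ce(3) by blast
		moreover have "c * real i ^ d \<le> c * real ((E0 + 1) * i) ^ d"
			using ce(1) by (intro mult_left_mono power_mono) (auto simp: algebra_simps)
		ultimately show ?thesis unfolding E_def mult.assoc by (intro exI[of _ m]) linarith
	qed
	then obtain \<mu> where \<mu>: "\<And>i. independent_count J Y (E * i) (\<mu> i)" "\<And>i. c * real i ^ d \<le> real (\<mu> i)"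
		by metis
	have "independent_count J Y' (E * k) (\<Sum>i=1..k. \<mu> i)" for k
	proof (induction k)
		case 0
		show ?case by (simp add: independent_count_def indep_family_def)
	next
		case (Suc k)
		have "independent_count J Y' (E * k + E) ((\<Sum>i=1..k. \<mu> i) + \<mu> (Suc k))"
			using \<mu>(1)[of "Suc k"] assms(4)
			by (intro independent_count_step[OF assms(1,3) _ fE fY fY' Suc]) (auto simp: algebra_simps)
		then show ?case by (simp add: algebra_simps)
	qed
	moreover have "c / real (Suc d) * real k ^ Suc d \<le> real (\<Sum>i=1..k. \<mu> i)" for k
	proof -
		have "c / real (Suc d) * real k ^ Suc d \<le> c / real (Suc d) * (real (Suc d) * (\<Sum>i=1..k. real i ^ d))"
			using ce(1) by (intro mult_left_mono sum_powers_ge) simp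
		also have "\<dots> = (\<Sum>i=1..k. c * real i ^ d)" by (simp add: sum_distrib_left del: of_nat_Suc)
		also have "\<dots> \<le> (\<Sum>i=1..k. real (\<mu> i))" by (intro sum_mono \<mu>(2))
		finally show ?thesis by simp
	qed
	ultimately show ?thesis unfolding growth_at_least_def
		using ce(1) E(1) by (intro exI[of _ "c / real (Suc d)"] conjI exI[of _ E] allI exI[of _ "\<Sum>i=1.._. \<mu> i"]) auto
qed

lemma growth_at_least_le:
	assumes "finite J" "growth_at_least J Y d"
	shows "d \<le> card J"
proof (rule ccontr)
	assume d: "\<not> d \<le> card J"
	let ?N = "card J"
	obtain c e where ce: "c > 0" "e \<ge> 1" "\<And>k. \<exists>m. independent_count J Y (e * k) m \<and> c * real k ^ d \<le> real m"
		using assms(2) unfolding growth_at_least_def by blast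
	have b: "c * real k \<le> real ((2 * e) ^ ?N)" if "k \<ge> 1" for k
	proof -
		obtain m where m: "independent_count J Y (e * k) m" "c * real k ^ d \<le> real m" using ce(3) by blast
		have "m \<le> (e * k + 1) ^ ?N" by (rule independent_count_le[OF assms(1) m(1)])
		also have "\<dots> \<le> (2 * e * k) ^ ?N"
		proof (rule power_mono)
			have "1 \<le> e * k" using that ce(2) by simp
			then show "e * k + 1 \<le> 2 * e * k" by simp
		qed simp
		finally have "real m \<le> real ((2 * e * k) ^ ?N)" by (simp only: of_nat_le_iff)
		then have "c * real k ^ d \<le> real ((2 * e) ^ ?N) * real k ^ ?N"
			using m(2) by (simp add: power_mult_distrib)
		moreover have "c * real k ^ Suc ?N \<le> c * real k ^ d"
			using ce(1) that d by (intro mult_left_mono power_increasing) auto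
		ultimately have "(c * real k) * real k ^ ?N \<le> real ((2 * e) ^ ?N) * real k ^ ?N" by (simp add: mult.assoc)
		then show ?thesis using that by (simp add: mult_le_cancel_right_pos)
	qed
	obtain k :: nat where k: "real ((2 * e) ^ ?N) / c < real k" using reals_Archimedean2 by blast
	then have "real k > 0" using ce by (meson divide_nonneg_pos of_nat_0_le_iff order_le_less_trans)
	then have "k \<ge> 1" by simp
	from b[OF this] k ce(1) show False by (simp add: pos_divide_less_eq mult.commute)
qed

text \<open>Along a chain the growth exponent rises by one per inclusion, and the number of all
  monomials bounds it by \<open>card J\<close>.\<close>

lemma codimension_le:
	assumes "finite J" "growth_at_least J Z d" "card J \<le> d + r"
	shows "codimension (zariski J) Z \<le> enat r" unfolding codimension_def
proof (rule SUP_least)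
	fix s assume "s \<in> {d. \<exists>C. C 0 = Z \<and> (\<forall>i\<le>d. irreducible_closedin (zariski J) (C i)) \<and> (\<forall>i<d. C i \<subset> C (Suc i))}"
	then obtain C where C: "C 0 = Z" "\<forall>i\<le>s. irreducible_closedin (zariski J) (C i)" "\<forall>i<s. C i \<subset> C (Suc i)"
		by blast
	have "growth_at_least J (C i) (d + i)" if "i \<le> s" for i using that
	proof (induction i)
		case 0
		then show ?case using assms(2) C(1) by simp
	next
		case (Suc i)
		then show ?case using growth_at_least_step[OF assms(1), of "C i" "C (Suc i)" "d + i"] C by simp
	qed
	then have "d + s \<le> card J" using growth_at_least_le[OF assms(1)] by blast
	then show "enat s \<le> enat r" using assms(3) by simp
qed


lemma codimension_ge:
	assumes "C 0 = Z" "\<And>i. i \<le> r ==> irreducible_closedin (zariski J) (C i)" "\<And>i. i < r ==> C i \<subset> C (Suc i)"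
	shows "enat r \<le> codimension (zariski J) Z"
	unfolding codimension_def by (rule SUP_upper, rule CollectI, rule exI[of _ C]) (simp add: assms)

lemma growth_at_least_closure:
	assumes "X \<subseteq> Y" "growth_at_least J X d"
	shows "growth_at_least J Y d"
proof -
	have "independent_count J Y D m" if "independent_count J X D m" for D m
	proof -
		obtain g where g: "\<forall>i<m. g i \<in> box_polys J D" "indep_family X {..<m} g"
			using \<open>independent_count J X D m\<close> unfolding independent_count_def by blast
		have "indep_family Y {..<m} g"
			by (rule indep_familyI, rule indep_familyD[OF g(2)]) (use assms(1) in auto)
		with g(1) show ?thesis unfolding independent_count_def by blast
	qed
	with assms(2) show ?thesis unfolding growth_at_least_def by fast
qed

lemma box_polys_one: "finite J ==> (\<lambda>_. 1) \<in> box_polys J D"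
	using box_polys_monomial[of J "\<lambda>_. 0" D] by (simp add: monomial_fun_def[abs_def])

lemma box_polys_power:
	assumes "finite J" "p \<in> box_polys J D"
	shows "(\<lambda>c. p c ^ m) \<in> box_polys J (m * D)"
proof (induction m)
	case (Suc m)
	show ?case using box_polys_mult[OF assms(1,2) Suc] by (simp add: add.commute)
qed (simp add: box_polys_one assms)

lemma box_polys_prod:
	assumes "finite J" "finite I" "\<And>i. i \<in> I ==> p i \<in> box_polys J (D i)"
	shows "(\<lambda>c. \<Prod>i\<in>I. p i c) \<in> box_polys J (\<Sum>i\<in>I. D i)" using assms(2,3)
proof (induction I rule: finite_induct)
	case (insert i I)
	have "(\<lambda>c. \<Prod>i\<in>I. p i c) \<in> box_polys J (\<Sum>i\<in>I. D i)" by (rule insert.IH) (simp add: insert.prems)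
	from box_polys_mult[OF assms(1) insert.prems[of i] this] show ?case using insert.hyps by simp
qed (simp add: box_polys_one assms)

text \<open>If \<open>X\<close> has curves through \<open>q\<close> with arbitrary velocity in the
  coordinates \<open>J0\<close>, the monomials in c j - q j are independent on \<open>X\<close>: a
  relation, divided along a curve by the lowest power of t, tends for t to 0 to its lowest
  homogeneous part evaluated at the velocity.\<close>

lemma growth_at_least_tangent:
	assumes "finite J" "J0 \<subseteq> J"
		and curve: "\<And>y. \<exists>\<gamma>. (\<forall>t. \<gamma> t \<in> X) \<and> (\<forall>j\<in>J0. \<gamma> 0 j = q j \<and> ((\<lambda>t. \<gamma> t j) has_field_derivative y j) (at 0))"
	shows "growth_at_least J X (card J0)"
proof -
	have fin0: "finite J0" using assms(1,2) finite_subset by blast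
	define h where "h \<alpha> c = (\<Prod>j\<in>J0. (c j - q j) ^ \<alpha> j)" for \<alpha> :: "'a => nat" and c :: "'a => complex"
	\<comment> \<open>\<open>Suc\<close> keeps the stride positive when \<open>J0\<close> is
	  empty.\<close>
	have h_box: "h \<alpha> \<in> box_polys J (Suc (card J0) * D)" if \<alpha>: "\<alpha> \<in> exponents J0 D" for \<alpha> D
	proof -
		have "(\<lambda>c. c j - q j) \<in> box_polys J 1" if "j \<in> J0" for j
		proof -
			have "j \<in> J" using that assms(2) by auto
			then have "monomial_fun J (\<lambda>i. if i = j then 1 else 0) = (\<lambda>c. c j)"
				using assms(1) by (simp add: fun_eq_iff monomial_fun_def if_distrib cong: if_cong)
			moreover have "monomial_fun J (\<lambda>i. if i = j then 1 else 0) \<in> box_polys J 1"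
				by (intro box_polys_monomial assms(1)) simp
			ultimately have c: "(\<lambda>c. c j) \<in> box_polys J 1" by (simp only:)
			have "(\<lambda>c. c j + - q j * 1) \<in> box_polys J 1"
				by (rule box_polys_add[OF c box_polys_scale[OF box_polys_one[OF assms(1)]]])
			then show ?thesis by simp
		qed
		then have "h \<alpha> \<in> box_polys J (\<Sum>j\<in>J0. \<alpha> j * 1)"
			unfolding h_def[abs_def] by (rule box_polys_prod[OF assms(1) fin0 box_polys_power[OF assms(1)]])
		moreover have "(\<Sum>j\<in>J0. \<alpha> j * 1) \<le> of_nat (card J0) * D"
			by (rule sum_bounded_above) (use PiE_mem[OF \<alpha>[unfolded exponents_def]] in simp)
		then have "(\<Sum>j\<in>J0. \<alpha> j * 1) \<le> Suc (card J0) * D" by simp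
		ultimately show ?thesis by (rule box_polys_mono[OF assms(1), rotated])
	qed
	have indep: "indep_family X (exponents J0 D) h" for D
	proof (rule indep_familyI, rule ccontr)
		fix u \<alpha>0 assume u: "\<And>c. c \<in> X ==> (\<Sum>\<alpha>\<in>exponents J0 D. u \<alpha> * h \<alpha> c) = 0"
			and \<alpha>0: "\<alpha>0 \<in> exponents J0 D" "u \<alpha>0 \<noteq> 0"
		let ?E = "exponents J0 D"
		define deg where "deg \<alpha> = (\<Sum>j\<in>J0. \<alpha> j)" for \<alpha> :: "'a => nat"
		have "\<exists>\<alpha>. (\<alpha> \<in> ?E \<and> u \<alpha> \<noteq> 0) \<and> (\<forall>\<beta>. \<beta> \<in> ?E \<and> u \<beta> \<noteq> 0 --> deg \<alpha> \<le> deg \<beta>)"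
			by (rule ex_has_least_nat[where k = \<alpha>0]) (use \<alpha>0 in simp)
		then obtain \<alpha>1 where \<alpha>1: "\<alpha>1 \<in> ?E" "u \<alpha>1 \<noteq> 0" and min: "\<And>\<alpha>. \<alpha> \<in> ?E ==> u \<alpha> \<noteq> 0 ==> deg \<alpha>1 \<le> deg \<alpha>"
			by (elim exE conjE) simp
		\<comment> \<open>The lowest homogeneous part of the relation.\<close>
		define w where "w \<alpha> = (if deg \<alpha> = deg \<alpha>1 then u \<alpha> else 0)" for \<alpha>
		have "(\<Sum>\<alpha>\<in>?E. w \<alpha> * monomial_fun J0 \<alpha> y) = 0" for y
		proof -
			obtain \<gamma> where g: "(\<forall>t. \<gamma> t \<in> X) \<and> (\<forall>j\<in>J0. \<gamma> 0 j = q j \<and> ((\<lambda>t. \<gamma> t j) has_field_derivative y j) (at 0))"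
				using curve[of y] by (elim exE)
			have \<gamma>: "\<gamma> t \<in> X" "j \<in> J0 ==> \<gamma> 0 j = q j"
					"j \<in> J0 ==> ((\<lambda>t. \<gamma> t j) has_field_derivative y j) (at 0)" for t j using g by auto
			\<comment> \<open>Difference quotients of the curve: along it, \<open>h \<alpha>\<close> is t to
			  the degree of \<alpha> times a product that has a limit.\<close>
			define s where "s t j = (\<gamma> t j - q j) / t" for t j
			have lim: "((\<lambda>t. s t j) \<longlongrightarrow> y j) (at 0)" if "j \<in> J0" for j
				using \<gamma>(3)[OF that] \<gamma>(2)[OF that] by (simp add: has_field_derivative_iff s_def)
			have lm: "((\<lambda>t. \<Sum>\<alpha>\<in>?E. u \<alpha> * (t ^ (deg \<alpha> - deg \<alpha>1) * (\<Prod>j\<in>J0. s t j ^ \<alpha> j))) \<longlongrightarrow>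
						 (\<Sum>\<alpha>\<in>?E. u \<alpha> * (0 ^ (deg \<alpha> - deg \<alpha>1) * (\<Prod>j\<in>J0. y j ^ \<alpha> j)))) (at 0)"
				by (intro tendsto_sum tendsto_mult tendsto_power tendsto_prod tendsto_const tendsto_ident_at lim)
			have vanish: "(\<Sum>\<alpha>\<in>?E. u \<alpha> * (t ^ (deg \<alpha> - deg \<alpha>1) * (\<Prod>j\<in>J0. s t j ^ \<alpha> j))) = 0" if "t \<noteq> 0" for t
			proof -
				have key: "u \<alpha> * h \<alpha> (\<gamma> t) = t ^ deg \<alpha>1 * (u \<alpha> * (t ^ (deg \<alpha> - deg \<alpha>1) * (\<Prod>j\<in>J0. s t j ^ \<alpha> j)))"
					if "\<alpha> \<in> ?E" for \<alpha>
				proof (cases "u \<alpha> = 0")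
					case False
					have "h \<alpha> (\<gamma> t) = (\<Prod>j\<in>J0. t ^ \<alpha> j * s t j ^ \<alpha> j)"
						unfolding h_def using \<open>t \<noteq> 0\<close> by (simp add: s_def power_divide)
					also have "\<dots> = t ^ deg \<alpha> * (\<Prod>j\<in>J0. s t j ^ \<alpha> j)"
						by (simp add: prod.distrib deg_def power_sum)
					also have "t ^ deg \<alpha> = t ^ deg \<alpha>1 * t ^ (deg \<alpha> - deg \<alpha>1)"
						using min[OF that False] by (simp add: power_add[symmetric])
					finally show ?thesis by simp
				qed simp
				have "t ^ deg \<alpha>1 * (\<Sum>\<alpha>\<in>?E. u \<alpha> * (t ^ (deg \<alpha> - deg \<alpha>1) * (\<Prod>j\<in>J0. s t j ^ \<alpha> j)))
						= (\<Sum>\<alpha>\<in>?E. u \<alpha> * h \<alpha> (\<gamma> t))"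
					unfolding sum_distrib_left by (intro sum.cong refl key[symmetric])
				then show ?thesis using u[OF \<gamma>(1)] that by simp
			qed
			from lm have "((\<lambda>t. 0) \<longlongrightarrow> (\<Sum>\<alpha>\<in>?E. u \<alpha> * (0 ^ (deg \<alpha> - deg \<alpha>1) * (\<Prod>j\<in>J0. y j ^ \<alpha> j)))) (at (0::complex))"
				by (rule Lim_transform_within[where d = 1]) (simp_all add: vanish)
			then have "(\<Sum>\<alpha>\<in>?E. u \<alpha> * (0 ^ (deg \<alpha> - deg \<alpha>1) * (\<Prod>j\<in>J0. y j ^ \<alpha> j))) = 0"
				by (simp add: tendsto_const_iff)
			moreover have "u \<alpha> * 0 ^ (deg \<alpha> - deg \<alpha>1) = w \<alpha>" if "\<alpha> \<in> ?E" for \<alpha>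
				using min[OF that] by (cases "u \<alpha> = 0") (auto simp: w_def)
			ultimately show ?thesis by (simp add: monomial_fun_def mult.assoc[symmetric])
		qed
		then have "w \<alpha>1 = 0" by (rule indep_familyD[OF monomials_independent[OF fin0] _ \<alpha>1(1)])
		then show False using \<alpha>1(2) by (simp add: w_def)
	qed
	have "independent_count J X (Suc (card J0) * D) ((D + 1) ^ card J0)" for D
	proof -
		obtain e where e: "bij_betw e {..<card (exponents J0 D)} (exponents J0 D)"
			using ex_bij_betw_nat_finite[of "exponents J0 D"] fin0 by (auto simp: atLeast0LessThan)
		have ce: "card (exponents J0 D) = (D + 1) ^ card J0" by (rule card_exponents[OF fin0])
		have "indep_family X {..<card (exponents J0 D)} (\<lambda>i. h (e i))"
		proof (rule indep_familyI)
			fix u i assume u: "\<And>c. c \<in> X ==> (\<Sum>i<card (exponents J0 D). u i * h (e i) c) = 0"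
				and i: "i \<in> {..<card (exponents J0 D)}"
			let ?f = "inv_into {..<card (exponents J0 D)} e"
			have uc: "(\<Sum>\<alpha>\<in>exponents J0 D. u (?f \<alpha>) * h \<alpha> c) = (\<Sum>i<card (exponents J0 D). u i * h (e i) c)" for c
			proof -
				have "(\<Sum>\<alpha>\<in>exponents J0 D. u (?f \<alpha>) * h \<alpha> c) = (\<Sum>i<card (exponents J0 D). u (?f (e i)) * h (e i) c)"
					by (rule sum.reindex_bij_betw[OF e, symmetric])
				also have "\<dots> = (\<Sum>i<card (exponents J0 D). u i * h (e i) c)"
					by (intro sum.cong refl) (simp add: inv_into_f_f[OF bij_betw_imp_inj_on[OF e]])
				finally show ?thesis .
			qed
			have ei: "e i \<in> exponents J0 D" using i bij_betwE[OF e] by auto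
			have "u (?f (e i)) = 0"
				by (rule indep_familyD[OF indep[of D], of "\<lambda>\<alpha>. u (?f \<alpha>)" "e i"]) (simp_all only: uc u ei)
			then show "u i = 0" using i by (simp add: inv_into_f_f[OF bij_betw_imp_inj_on[OF e]])
		qed
		moreover have "\<forall>i<card (exponents J0 D). h (e i) \<in> box_polys J (Suc (card J0) * D)"
			using h_box bij_betwE[OF e] by auto
		ultimately show ?thesis unfolding independent_count_def ce by (intro exI[of _ "\<lambda>i. h (e i)"] conjI)
	qed
	moreover have "1 * real D ^ card J0 \<le> real ((D + 1) ^ card J0)" for D by (simp add: power_mono)
	ultimately have "\<exists>m. independent_count J X (Suc (card J0) * k) m \<and> 1 * real k ^ card J0 \<le> real m" for k
		by (intro exI[of _ "(k + 1) ^ card J0"]) simp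
	then show ?thesis unfolding growth_at_least_def
		by (intro exI[of _ 1] conjI exI[of _ "Suc (card J0)"]) simp_all
qed

text \<open>When the monomials outnumber the functions \<open>b\<close> spanning their pullbacks
  along \<phi>, a polynomial relation results. The \<open>b\<close> may be transcendental, such as
  exponentials; only their number counts.\<close>

lemma polynomial_relation_by_counting:
	assumes "finite J" "\<rho> < card J"
		and count: "\<And>D. \<exists>(K :: 'k set) b. finite K \<and> card K \<le> C * (D + 1) ^ \<rho> \<and>
				(\<forall>\<alpha>\<in>exponents J D. \<exists>m. \<forall>s\<in>S. monomial_fun J \<alpha> (\<phi> s) = (\<Sum>k\<in>K. m k * b k s))"
	shows "\<exists>D. \<exists>p\<in>box_polys J D. (\<forall>s\<in>S. p (\<phi> s) = 0) \<and> (\<exists>c\<in>coeff_space J. p c \<noteq> 0)"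
proof -
	\<comment> \<open>For this D the number (D + 1)^(\<rho> + 1) already exceeds C (D +
	  1)^\<rho>.\<close>
	define D where "D = C"
	obtain K :: "'k set" and b where K: "finite K" "card K \<le> C * (D + 1) ^ \<rho>"
			"\<forall>\<alpha>\<in>exponents J D. \<exists>m. \<forall>s\<in>S. monomial_fun J \<alpha> (\<phi> s) = (\<Sum>k\<in>K. m k * b k s)"
		using count by blast
	then obtain m where m: "\<And>\<alpha> s. \<alpha> \<in> exponents J D ==> s \<in> S ==> monomial_fun J \<alpha> (\<phi> s) = (\<Sum>k\<in>K. m \<alpha> k * b k s)"
		by metis
	have "\<not> indep_family S (exponents J D) (\<lambda>\<alpha> s. monomial_fun J \<alpha> (\<phi> s))"
	proof
		assume "indep_family S (exponents J D) (\<lambda>\<alpha> s. monomial_fun J \<alpha> (\<phi> s))"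
		then have "card (exponents J D) \<le> card K"
			by (rule indep_family_card_le[where m = m and b = b]) (use assms(1) K(1) m in auto)
		also have "\<dots> \<le> C * (D + 1) ^ \<rho>" by (rule K(2))
		also have "\<dots> < (D + 1) * (D + 1) ^ \<rho>" by (rule mult_less_mono1) (simp_all add: D_def)
		also have "\<dots> = (D + 1) ^ Suc \<rho>" by simp
		also have "\<dots> \<le> (D + 1) ^ card J" using assms(2) by (intro power_increasing) auto
		finally show False using card_exponents[OF assms(1)] by simp
	qed
	then obtain u \<alpha> where u: "\<And>s. s \<in> S ==> (\<Sum>\<alpha>\<in>exponents J D. u \<alpha> * monomial_fun J \<alpha> (\<phi> s)) = 0"
			"\<alpha> \<in> exponents J D" "u \<alpha> \<noteq> 0" unfolding indep_family_def by blast
	define p where "p c = (\<Sum>\<alpha>\<in>exponents J D. u \<alpha> * monomial_fun J \<alpha> c)" for c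
	have "p \<in> box_polys J D" unfolding box_polys_def p_def[abs_def] by (rule CollectI) (rule exI[of _ u], rule refl)
	moreover have "\<exists>c\<in>coeff_space J. p c \<noteq> 0"
		using indep_familyD[OF monomials_independent[OF assms(1), of D], of u \<alpha>] u(2,3) unfolding p_def by blast
	ultimately show ?thesis using u(1) by (intro exI[of _ D] bexI[of _ p]) (auto simp: p_def)
qed

section \<open>Generic points\<close>

lemma polynomial_function_line:
	assumes "p \<in> polys"
	shows "\<exists>q. \<forall>t. p (\<lambda>j. a j + t * b j) = poly q t" using assms
proof induction
	case (const z)
	show ?case by (rule exI[of _ "[:z:]"]) simp
next
	case (coord j)
	show ?case by (rule exI[of _ "[:a j, b j:]"]) simp
next
	case (add p q)
	then obtain r s where "\<forall>t. p (\<lambda>j. a j + t * b j) = poly r t" "\<forall>t. q (\<lambda>j. a j + t * b j) = poly s t"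
		by blast
	then show ?case by (intro exI[of _ "r + s"]) simp
next
	case (mult p q)
	then obtain r s where "\<forall>t. p (\<lambda>j. a j + t * b j) = poly r t" "\<forall>t. q (\<lambda>j. a j + t * b j) = poly s t"
		by blast
	then show ?case by (intro exI[of _ "r * s"]) simp
qed

lemma finite_zeros_on_line:
	assumes "p \<in> polys" "p (\<lambda>j. a j + t0 * b j) \<noteq> 0"
	shows "finite {t. p (\<lambda>j. a j + t * b j) = 0}"
proof -
	obtain q where q: "\<And>t. p (\<lambda>j. a j + t * b j) = poly q t" using polynomial_function_line[OF assms(1)] by blast
	have "q \<noteq> 0" using assms(2) q by auto
	then show ?thesis using poly_roots_finite[of q] q by simp
qed

lemma eventually_nonzero_on_line:
	assumes "p \<in> polys" "p a \<noteq> 0"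
	shows "\<forall>\<^sub>F t in at 0. p (\<lambda>j. a j + t * b j) \<noteq> 0"
proof -
	have "finite {t. p (\<lambda>j. a j + t * b j) = 0}"
		by (rule finite_zeros_on_line[OF assms(1), where ?t0.0 = 0]) (use assms(2) in simp)
	then have "open (- ({t. p (\<lambda>j. a j + t * b j) = 0} - {0}))" by (intro open_Compl finite_imp_closed) simp
	then show ?thesis unfolding eventually_at_topological
		by (intro exI[of _ "- ({t. p (\<lambda>j. a j + t * b j) = 0} - {0})"]) auto
qed

definition affine_closed :: "('j => complex) set => bool" where
	"affine_closed W \<longleftrightarrow> (\<forall>a\<in>W. \<forall>b\<in>W. \<forall>t. (\<lambda>j. a j + t * (b j - a j)) \<in> W)"

text \<open>The line through a point good for all earlier polynomials and a point good for the new
  one meets each zero set at finitely many parameters.\<close>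

lemma generic_point:
	assumes "affine_closed W" "W \<noteq> {}" "finite I" and "\<And>i. i \<in> I ==> p i \<in> polys \<and> (\<exists>w\<in>W. p i w \<noteq> 0)"
	shows "\<exists>w\<in>W. \<forall>i\<in>I. p i w \<noteq> 0" using assms(3,4)
proof (induction I rule: finite_induct)
	case empty
	then show ?case using assms(2) by auto
next
	case (insert i I)
	have "\<exists>w\<in>W. \<forall>i\<in>I. p i w \<noteq> 0" by (rule insert.IH) (use insert.prems in simp)
	then obtain a where a: "a \<in> W" "\<And>l. l \<in> I ==> p l a \<noteq> 0" by blast
	obtain b where b: "b \<in> W" "p i b \<noteq> 0" using insert.prems by blast
	let ?l = "\<lambda>t j. a j + t * (b j - a j)"
	have fin: "finite {t. p l (?l t) = 0}" if "l \<in> insert i I" for l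
	proof -
		have pl: "p l \<in> polys" using insert.prems that by simp
		show ?thesis
		proof (cases "l = i")
			case True
			have "?l 1 = b" by auto
			then show ?thesis using finite_zeros_on_line[OF pl, of a 1 "\<lambda>j. b j - a j"] b True by simp
		next
			case False
			have "?l 0 = a" by auto
			then show ?thesis using finite_zeros_on_line[OF pl, of a 0 "\<lambda>j. b j - a j"] a(2) that False by simp
		qed
	qed
	have "finite (\<Union>l\<in>insert i I. {t. p l (?l t) = 0})" using fin insert.hyps by blast
	then obtain t where "t \<notin> (\<Union>l\<in>insert i I. {t. p l (?l t) = 0})"
		using ex_new_if_finite[OF infinite_UNIV_char_0] by blast
	moreover have "?l t \<in> W" using assms(1) a(1) b(1) by (simp add: affine_closed_def)
	ultimately show ?case by (intro bexI[of _ "?l t"]) auto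
qed

text \<open>Division-free elimination: with a pivot \<open>y c i j0\<close> the reduced vectors
  \<open>z\<close> are again polynomial in \<open>c\<close>, and the product of all pivots is the
  required polynomial.\<close>

lemma indep_family_open:
	assumes "finite S" "\<And>i j. (\<lambda>c. y c i j) \<in> polys" "indep_family J S (y c0)"
	shows "\<exists>p\<in>polynomial_functions. p c0 \<noteq> 0 \<and> (\<forall>c. p c \<noteq> 0 --> indep_family J S (y c))" using assms
proof (induction S arbitrary: y rule: finite_induct)
	case empty
	show ?case by (intro bexI[of _ "\<lambda>_. 1"] polynomial_functions.const) (simp add: indep_family_def)
next
	case (insert i S)
	have "\<exists>j\<in>J. y c0 i j \<noteq> 0"
	proof (rule ccontr)
		assume n: "\<not> ?thesis"
		have "(\<Sum>l\<in>insert i S. (if l = i then 1 else 0) * y c0 l j) = y c0 i j" for j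
			using insert.hyps by (simp add: if_distrib[of "\<lambda>x. x * _"] sum.delta cong: if_cong)
		then have "(if i = i then 1 else 0) = (0::complex)"
			by (intro indep_familyD[OF insert.prems(2), where u = "\<lambda>l. if l = i then 1 else 0"]) (use n in auto)
		then show False by simp
	qed
	then obtain j0 where j0: "j0 \<in> J" "y c0 i j0 \<noteq> 0" by blast
	define z where "z c l j = y c i j0 * y c l j - y c l j0 * y c i j" for c l j
	have zs: "(\<Sum>l\<in>S. u l * z c l j) = y c i j0 * (\<Sum>l\<in>S. u l * y c l j) - (\<Sum>l\<in>S. u l * y c l j0) * y c i j" for u c j
		by (simp add: z_def sum_subtractf sum_distrib_left sum_distrib_right algebra_simps)
	have zp: "(\<lambda>c. z c l j) \<in> polys" for l j
		unfolding z_def by (intro polynomial_functions_diff polynomial_functions.mult insert.prems)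
	have zi: "indep_family J S (z c0)"
	proof (rule indep_familyI)
		fix u l assume u: "\<And>j. j \<in> J ==> (\<Sum>l\<in>S. u l * z c0 l j) = 0" and l: "l \<in> S"
		define w where "w = (\<lambda>l. if l = i then - (\<Sum>l\<in>S. u l * y c0 l j0) else y c0 i j0 * u l)"
		have "(\<Sum>l\<in>insert i S. w l * y c0 l j) = (\<Sum>l\<in>S. u l * z c0 l j)" for j
		proof -
			have "(\<Sum>l\<in>S. w l * y c0 l j) = (\<Sum>l\<in>S. y c0 i j0 * (u l * y c0 l j))"
				by (rule sum.cong) (use insert.hyps in \<open>auto simp: w_def\<close>)
			then show ?thesis using insert.hyps by (simp add: zs w_def sum_distrib_left)
		qed
		then have "w l = 0" using indep_familyD[OF insert.prems(2), of w l] u l by simp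
		then show "u l = 0" using j0(2) l insert.hyps by (auto simp: w_def split: if_splits)
	qed
	obtain p where p: "p \<in> polys" "p c0 \<noteq> 0" "\<And>c. p c \<noteq> 0 ==> indep_family J S (z c)"
		using insert.IH[OF zp zi] by blast
	show ?case
	proof (intro bexI[of _ "\<lambda>c. y c i j0 * p c"] conjI allI impI)
		show "(\<lambda>c. y c i j0 * p c) \<in> polys" by (intro polynomial_functions.mult insert.prems p)
		show "y c0 i j0 * p c0 \<noteq> 0" using j0 p by simp
		fix c assume c: "y c i j0 * p c \<noteq> 0"
		show "indep_family J (insert i S) (y c)"
		proof (rule indep_familyI)
			fix u l assume u: "\<And>j. j \<in> J ==> (\<Sum>l\<in>insert i S. u l * y c l j) = 0" and l: "l \<in> insert i S"
			have s: "(\<Sum>l\<in>S. u l * y c l j) = - u i * y c i j" if "j \<in> J" for j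
				using u[OF that] insert.hyps by (simp add: eq_neg_iff_add_eq_0 add.commute)
			have "(\<Sum>l\<in>S. u l * z c l j) = 0" if "j \<in> J" for j unfolding zs s[OF that] s[OF j0(1)] by simp
			then have us: "u l = 0" if "l \<in> S" for l using indep_familyD[OF p(3), of c u l] c that by simp
			then have "u i * y c i j0 = 0" using s[OF j0(1)] by simp
			then have "u i = 0" using c by simp
			then show "u l = 0" using l us by auto
		qed
	qed
qed

section \<open>The linear data of a tuple of finite sets\<close>

abbreviation lvec :: "(nat \<Rightarrow>\<^sub>0 int) => nat => complex" where
	"lvec a \<equiv> cvec (coord a)"

type_synonym term_index = "nat \<times> (nat \<Rightarrow>\<^sub>0 int)"

text \<open>One \<open>n\<close> serves as rank of the lattice and as number of sets: zero defect
  together with the spanning condition forces the two to agree.\<close>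

locale finite_tuple =
	fixes n :: nat and A :: "nat => (nat \<Rightarrow>\<^sub>0 int) set"
	assumes finite_A: "i < n ==> finite (A i)" and A_nonempty: "i < n ==> A i \<noteq> {}"
		and A_carrier: "i < n ==> A i \<subseteq> carrier (int_lattice n)"
		and span_A: "tuple_span (int_lattice n) A {..<n} = carrier (int_lattice n)"
begin

abbreviation P :: "(term_index) set" where
	"P \<equiv> system_index n A"

abbreviation dot :: "(nat => complex) => (nat => complex) => complex" where
	"dot h x \<equiv> \<Sum>j<n. h j * x j"

abbreviation covec :: "(nat => complex) => (nat \<Rightarrow>\<^sub>0 int) => complex" where
	"covec h a \<equiv> dot h (lvec a)"

text \<open>Restrictions of linear functions to the Cayley set: a linear part \<xi> common to all
  sets of the tuple, and one additive constant per set.\<close>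

definition linear_on_P :: "(term_index => complex) => bool" where
	"linear_on_P f \<longleftrightarrow> (\<exists>\<xi> \<eta>. \<forall>i<n. \<forall>a\<in>A i. f (i, a) = \<eta> i + covec \<xi> a)"

definition moment :: "(term_index => complex) => nat => nat => complex" where
	"moment w i j = (\<Sum>a\<in>A i. w (i, a) * lvec a j)"

text \<open>Linear relations among the vectors (a, e_i) of the Cayley set, that is, the annihilator
  of the functions in \<open>linear_on_P\<close>. The terms of a singular Cayley polynomial,
  evaluated at its singular point, form such a vector.\<close>

definition relations :: "(term_index => complex) set" where
	"relations = {w \<in> coeff_space P. (\<forall>i<n. (\<Sum>a\<in>A i. w (i, a)) = 0) \<and> (\<forall>j<n. (\<Sum>i<n. moment w i j) = 0)}"

text \<open>The vanishing of the total moment is a dependence with all coefficients 1; up to scaling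
  it is to be the only one. This is what a non-degenerate multiple root gives once its multipliers
  are normalized to 1.\<close>

definition proper_relations :: "(term_index => complex) set" where
	"proper_relations = {w \<in> relations. \<forall>\<mu>. (\<forall>j<n. (\<Sum>i<n. \<mu> i * moment w i j) = 0) --> (\<forall>i<n. \<mu> i = \<mu> 0)}"

lemma finite_P [simp]: "finite P"
	unfolding system_index_def by (rule finite_SigmaI) (simp_all add: finite_A)

lemma mem_P_iff: "(i, a) \<in> P \<longleftrightarrow> i < n \<and> a \<in> A i" by (simp add: system_index_def)

lemma sum_P: "(\<Sum>p\<in>P. f p) = (\<Sum>i<n. \<Sum>a\<in>A i. f (i, a))"
	unfolding system_index_def by (subst sum.Sigma) (auto simp: finite_A)

lemma lookup_A: "i < n ==> a \<in> A i ==> n \<le> j ==> coord a j = 0"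
	using A_carrier[of i] by (force simp: in_keys_iff)

lemma linear_pairing:
	"(\<Sum>i<n. \<Sum>a\<in>A i. w (i, a) * (\<eta> i + covec \<xi> a))
		 = (\<Sum>i<n. \<eta> i * (\<Sum>a\<in>A i. w (i, a))) + (\<Sum>j<n. \<xi> j * (\<Sum>i<n. moment w i j))"
proof -
	have "(\<Sum>i<n. \<Sum>a\<in>A i. w (i, a) * (\<eta> i + covec \<xi> a))
		 = (\<Sum>i<n. \<eta> i * (\<Sum>a\<in>A i. w (i, a))) + (\<Sum>i<n. \<Sum>a\<in>A i. \<Sum>j<n. \<xi> j * (w (i, a) * lvec a j))"
		by (simp add: distrib_left sum.distrib sum_distrib_left ac_simps)
	also have "(\<Sum>i<n. \<Sum>a\<in>A i. \<Sum>j<n. \<xi> j * (w (i, a) * lvec a j)) = (\<Sum>i<n. \<Sum>j<n. \<xi> j * moment w i j)"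
		by (intro sum.cong refl, subst sum.swap) (simp add: moment_def sum_distrib_left)
	also have "\<dots> = (\<Sum>j<n. \<xi> j * (\<Sum>i<n. moment w i j))"
		by (subst sum.swap) (simp add: sum_distrib_left)
	finally show ?thesis .
qed

lemma relations_pairing:
	assumes "w \<in> relations" "linear_on_P f"
	shows "(\<Sum>p\<in>P. w p * f p) = 0"
proof -
	obtain \<xi> \<eta> where f: "\<And>i a. i < n ==> a \<in> A i ==> f (i, a) = \<eta> i + covec \<xi> a"
		using assms(2) unfolding linear_on_P_def by blast
	have "(\<Sum>p\<in>P. w p * f p) = (\<Sum>i<n. \<Sum>a\<in>A i. w (i, a) * (\<eta> i + covec \<xi> a))"
		unfolding sum_P by (intro sum.cong refl) (simp add: f)
	then show ?thesis using assms(1) by (simp add: linear_pairing relations_def)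
qed

lemma relationsI:
	assumes "w \<in> coeff_space P" "\<And>f. linear_on_P f ==> (\<Sum>p\<in>P. w p * f p) = 0"
	shows "w \<in> relations"
proof -
	have lp: "(\<Sum>i<n. \<eta> i * (\<Sum>a\<in>A i. w (i, a))) + (\<Sum>j<n. \<xi> j * (\<Sum>i<n. moment w i j)) = 0" for \<xi> \<eta>
	proof -
		have "linear_on_P (\<lambda>(i, a). \<eta> i + covec \<xi> a)" by (auto simp: linear_on_P_def)
		from assms(2)[OF this] show ?thesis by (simp add: sum_P linear_pairing)
	qed
	have "(\<Sum>a\<in>A i. w (i, a)) = 0" if "i < n" for i
		using lp[of "\<lambda>l. if l = i then 1 else 0" "\<lambda>_. 0"] that by (simp add: if_distrib[of "\<lambda>x. x * _"] cong: if_cong)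
	moreover have "(\<Sum>i<n. moment w i j) = 0" if "j < n" for j
		using lp[of "\<lambda>_. 0" "\<lambda>l. if l = j then 1 else 0"] that by (simp add: if_distrib[of "\<lambda>x. x * _"] cong: if_cong)
	ultimately show ?thesis using assms(1) by (simp add: relations_def)
qed

text \<open>Affine functions and relations are mutual annihilators, by duality applied to the block
  indicators and the coordinate functions. Affinity of squares and powers of null functions is later
  proved through this criterion.\<close>

lemma linear_on_P_if_orthogonal:
	assumes "\<And>w. w \<in> relations ==> (\<Sum>p\<in>P. w p * f p) = 0"
	shows "linear_on_P f"
proof -
	define g :: "nat + nat => term_index => complex" where
		"g k p = (case k of Inl i => (if fst p = i then 1 else 0) | Inr j => lvec (snd p) j)" for k p
	let ?K = "{..<n} <+> {..<n}"
	have sumK: "(\<Sum>k\<in>?K. h k) = (\<Sum>i<n. h (Inl i)) + (\<Sum>j<n. h (Inr j))" for h :: "nat + nat => complex"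
		by (subst sum.Plus) auto
	have "\<exists>u. \<forall>p\<in>P. f p = (\<Sum>k\<in>?K. u k * g k p)"
	proof (rule double_annihilator)
		fix w assume w: "\<And>k. k \<in> ?K ==> (\<Sum>p\<in>P. w p * g k p) = 0"
		define w' where "w' = (\<lambda>p. if p \<in> P then w p else 0)"
		have w'g: "(\<Sum>p\<in>P. w' p * h p) = (\<Sum>p\<in>P. w p * h p)" for h by (rule sum.cong) (auto simp: w'_def)
		have "w' \<in> relations"
		proof (rule relationsI)
			show "w' \<in> coeff_space P" by (auto simp: w'_def coeff_space_def)
			fix h assume "linear_on_P h"
			then obtain \<xi> \<eta> where h: "\<And>i a. i < n ==> a \<in> A i ==> h (i, a) = \<eta> i + covec \<xi> a"
				unfolding linear_on_P_def by blast
			have hp: "h p = (\<Sum>i<n. \<eta> i * g (Inl i) p) + (\<Sum>j<n. \<xi> j * g (Inr j) p)" if "p \<in> P" for p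
				using that by (cases p) (auto simp: mem_P_iff h g_def if_distrib[of "\<lambda>x. _ * x"] cong: if_cong)
			have "(\<Sum>p\<in>P. w p * h p) = (\<Sum>p\<in>P. (\<Sum>i<n. \<eta> i * (w p * g (Inl i) p)) + (\<Sum>j<n. \<xi> j * (w p * g (Inr j) p)))"
				by (intro sum.cong refl) (simp add: hp distrib_left sum_distrib_left ac_simps)
			also have "\<dots> = (\<Sum>i<n. \<eta> i * (\<Sum>p\<in>P. w p * g (Inl i) p)) + (\<Sum>j<n. \<xi> j * (\<Sum>p\<in>P. w p * g (Inr j) p))"
				unfolding sum.distrib by (subst (1 2) sum.swap) (simp add: sum_distrib_left)
			also have "\<dots> = 0" using w by (simp add: InlI InrI)
			finally show "(\<Sum>p\<in>P. w' p * h p) = 0" by (simp add: w'g)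
		qed
		from assms[OF this] show "(\<Sum>p\<in>P. w p * f p) = 0" by (simp add: w'g)
	qed auto
	then obtain u where u: "\<And>p. p \<in> P ==> f p = (\<Sum>k\<in>?K. u k * g k p)" by blast
	have "f (i, a) = u (Inl i) + (\<Sum>j<n. u (Inr j) * lvec a j)" if "i < n" "a \<in> A i" for i a
		using u[of "(i, a)"] that unfolding sumK
		by (simp add: mem_P_iff g_def if_distrib[of "\<lambda>x. _ * x"] cong: if_cong)
	then show ?thesis unfolding linear_on_P_def
		by (intro exI[of _ "\<lambda>j. u (Inr j)"] exI[of _ "\<lambda>i. u (Inl i)"]) simp
qed

text \<open>The differences generate the lattice, so \<xi> vanishes on it and in particular on the
  unit vectors.\<close>

lemma functional_zero_on_differences:
	assumes "\<And>i a a'. i < n ==> a \<in> A i ==> a' \<in> A i ==> covec \<xi> a = covec \<xi> a'" and "j < n"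
	shows "\<xi> j = 0"
proof -
	define \<phi> where "\<phi> a = covec \<xi> a" for a
	have add: "\<phi> (a + b) = \<phi> a + \<phi> b" and diff: "\<phi> (a - b) = \<phi> a - \<phi> b" and neg: "\<phi> (- a) = - \<phi> a" for a b
		by (simp_all add: \<phi>_def cvec_apply lookup_add lookup_minus algebra_simps sum.distrib sum_subtractf sum_negf)
	interpret G: comm_group "int_lattice n" by (rule abelian_free_Abelian_group)
	have gen: "(\<Union>i\<in>{..<n}. {a \<otimes>\<^bsub>int_lattice n\<^esub> inv\<^bsub>int_lattice n\<^esub> a' | a a'. a \<in> A i \<and> a' \<in> A i}) = (\<Union>i\<in>{..<n}. {a - a' | a a'. a \<in> A i \<and> a' \<in> A i})"
	proof (rule SUP_cong[OF refl])
		fix i assume "i \<in> {..<n}"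
		then have "a \<otimes>\<^bsub>int_lattice n\<^esub> inv\<^bsub>int_lattice n\<^esub> a' = a - a'" if "a' \<in> A i" for a a'
			using A_carrier[of i] that by (simp add: subset_iff)
		then show "{a \<otimes>\<^bsub>int_lattice n\<^esub> inv\<^bsub>int_lattice n\<^esub> a' | a a'. a \<in> A i \<and> a' \<in> A i} = {a - a' | a a'. a \<in> A i \<and> a' \<in> A i}"
			by (intro Collect_cong) (metis (no_types, lifting))
	qed
	have dc: "a - a' \<in> carrier (int_lattice n) \<and> \<phi> (a - a') = 0" if "i < n" "a \<in> A i" "a' \<in> A i" for i a a'
	proof -
		have "Poly_Mapping.keys a \<subseteq> {..<n}" "Poly_Mapping.keys a' \<subseteq> {..<n}"
			using subsetD[OF A_carrier[OF that(1)]] that(2,3) by (simp_all only: carrier_free_Abelian_group_iff[symmetric])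
		then have "Poly_Mapping.keys (a - a') \<subseteq> {..<n}" using keys_diff[of a a'] by blast
		moreover have "\<phi> (a - a') = 0" using assms(1)[OF that] unfolding diff by (simp add: \<phi>_def)
		ultimately show ?thesis by simp
	qed
	have "\<phi> x = 0 \<and> x \<in> carrier (int_lattice n)"
		if "x \<in> generate (int_lattice n) (\<Union>i\<in>{..<n}. {a - a' | a a'. a \<in> A i \<and> a' \<in> A i})" for x
		using that
	proof (induction rule: generate.induct)
		case one
		then show ?case by (simp add: \<phi>_def cvec_apply)
	next
		case (incl h)
		then show ?case using dc by auto
	next
		case (inv h)
		then have h: "h \<in> carrier (int_lattice n) \<and> \<phi> h = 0" using dc by auto
		then have "inv\<^bsub>int_lattice n\<^esub> h = - h" by simp
		moreover have "\<phi> (- h) = 0" using h neg[of h] by simp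
		ultimately show ?case using h G.inv_closed[of h] by simp
	next
		case (eng h1 h2)
		then show ?case using add[of h1 h2] G.m_closed[of h1 h2] by (simp del: carrier_free_Abelian_group_iff)
	qed
	moreover have "frag_of j \<in> carrier (int_lattice n)" using assms(2) by simp
	ultimately have "\<phi> (frag_of j) = 0" using span_A unfolding tuple_span_def gen by blast
	moreover have "\<phi> (frag_of j) = \<xi> j"
		using assms(2) by (simp add: \<phi>_def cvec_apply lookup_single when_def if_distrib[of "\<lambda>x. _ * x"] if_distrib[of of_int] cong: if_cong)
	ultimately show ?thesis by simp
qed

text \<open>The n block indicators and the n coordinate functions are thus independent on
  \<open>P\<close>, so a relation satisfies 2n independent conditions, and linear parts and
  constants are unique.\<close>

lemma linear_zero:
	assumes "\<And>i a. i < n ==> a \<in> A i ==> \<eta> i + covec \<xi> a = 0"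
	shows "j < n ==> \<xi> j = 0" "i < n ==> \<eta> i = 0"
proof -
	have xi: "\<xi> j = 0" if "j < n" for j
	proof (rule functional_zero_on_differences[OF _ that])
		fix i a a' assume "i < n" "a \<in> A i" "a' \<in> A i"
		then show "covec \<xi> a = covec \<xi> a'" using assms[of i a] assms[of i a'] by (metis add_left_cancel)
	qed
	then show "j < n ==> \<xi> j = 0" .
	assume i: "i < n"
	then obtain a where "a \<in> A i" using A_nonempty by blast
	then show "\<eta> i = 0" using assms[OF i, of a] xi by simp
qed

lemma linear_on_P_add: "linear_on_P f ==> linear_on_P g ==> linear_on_P (\<lambda>p. f p + g p)"
	by (rule linear_on_P_if_orthogonal) (simp add: distrib_left sum.distrib relations_pairing)

lemma linear_on_P_scale: "linear_on_P f ==> linear_on_P (\<lambda>p. z * f p)"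
	by (rule linear_on_P_if_orthogonal)
		(simp add: mult.left_commute[of _ z] sum_distrib_left[symmetric] relations_pairing)

lemma linear_on_P_const: "linear_on_P (\<lambda>p. z)"
	unfolding linear_on_P_def by (intro exI[of _ "\<lambda>_. 0"] exI[of _ "\<lambda>_. z"]) simp

lemma linear_on_P_sum: "(\<And>i. i \<in> I ==> linear_on_P (f i)) ==> linear_on_P (\<lambda>p. \<Sum>i\<in>I. f i p)"
	by (induction I rule: infinite_finite_induct) (auto intro: linear_on_P_add linear_on_P_const)

lemma linear_on_P_cong: "(\<And>p. p \<in> P ==> f p = g p) ==> linear_on_P f = linear_on_P g"
	unfolding linear_on_P_def by (simp add: mem_P_iff)

lemma relations_affine: "affine_closed relations" unfolding affine_closed_def
proof (intro ballI allI)
	fix a b t assume ab: "a \<in> relations" "b \<in> relations"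
	show "(\<lambda>j. a j + t * (b j - a j)) \<in> relations"
	proof (rule relationsI)
		show "(\<lambda>j. a j + t * (b j - a j)) \<in> coeff_space P" using ab by (auto simp: relations_def coeff_space_def)
		fix f assume f: "linear_on_P f"
		have "(\<Sum>p\<in>P. (a p + t * (b p - a p)) * f p) = (1 - t) * (\<Sum>p\<in>P. a p * f p) + t * (\<Sum>p\<in>P. b p * f p)"
			by (simp add: algebra_simps sum.distrib sum_subtractf sum_distrib_left)
		then show "(\<Sum>p\<in>P. (a p + t * (b p - a p)) * f p) = 0"
			using relations_pairing[OF ab(1) f] relations_pairing[OF ab(2) f] by simp
	qed
qed

lemma relations_add_scale:
	assumes "a \<in> relations" "b \<in> relations"
	shows "(\<lambda>j. a j + t * b j) \<in> relations"
proof (rule relationsI)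
	show "(\<lambda>j. a j + t * b j) \<in> coeff_space P" using assms by (auto simp: relations_def coeff_space_def)
	fix f assume f: "linear_on_P f"
	have "(\<Sum>p\<in>P. (a p + t * b p) * f p) = (\<Sum>p\<in>P. a p * f p) + t * (\<Sum>p\<in>P. b p * f p)"
		by (simp add: algebra_simps sum.distrib sum_distrib_left)
	then show "(\<Sum>p\<in>P. (a p + t * b p) * f p) = 0"
		using relations_pairing[OF assms(1) f] relations_pairing[OF assms(2) f] by simp
qed

lemma relations_zero: "(\<lambda>_. 0) \<in> relations" by (simp add: relations_def coeff_space_def moment_def)

lemma moment_polynomial: "(\<lambda>w. moment w i j) \<in> polys" unfolding moment_def
	by (intro polynomial_functions_sum polynomial_functions.mult polynomial_functions.coord polynomial_functions.const)

end

text \<open>On the line v + t x, with \<open>v\<close> outside the earlier subspaces and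
  \<open>x\<close> outside the new one, each of the finitely many subspaces excludes at most one
  parameter.\<close>

lemma avoid_proper_subspaces:
	fixes V :: "(nat => complex) set"
	assumes "cfun.subspace V" "finite \<U>" "\<And>U. U \<in> \<U> ==> cfun.subspace U \<and> \<not> V \<subseteq> U"
	shows "\<exists>v\<in>V. \<forall>U\<in>\<U>. v \<notin> U" using assms(2,3)
proof (induction \<U> rule: finite_induct)
	case empty
	then show ?case using cfun.subspace_0[OF assms(1)] by auto
next
	case (insert U \<U>)
	have "\<exists>v\<in>V. \<forall>U\<in>\<U>. v \<notin> U" by (rule insert.IH) (use insert.prems in simp)
	then obtain v where v: "v \<in> V" "\<And>W. W \<in> \<U> ==> v \<notin> W" by auto
	show ?case
	proof (cases "v \<in> U")
		case False
		then show ?thesis using v by auto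
	next
		case True
		obtain x where x: "x \<in> V" "x \<notin> U" using insert.prems[of U] by auto
		define l where "l t = v + (\<lambda>i. t * x i)" for t
		have lV: "l t \<in> V" for t
			unfolding l_def by (intro cfun.subspace_add[OF assms(1)] cfun.subspace_scale[OF assms(1)] v x)
		have diff: "l s - l t = (\<lambda>i. (s - t) * x i)" for s t by (auto simp: l_def algebra_simps)
		have fin: "finite {t. l t \<in> W}" if W: "W \<in> \<U>" for W
		proof -
			have sW: "cfun.subspace W" using insert.prems[of W] W by simp
			have "s = t" if "l s \<in> W" "l t \<in> W" for s t
			proof (rule ccontr)
				assume "s \<noteq> t"
				have "(\<lambda>i. (s - t) * x i) \<in> W" using cfun.subspace_diff[OF sW that] by (simp only: diff)
				from cfun.subspace_scale[OF sW this, of "1 / (s - t)"] have "x \<in> W" using \<open>s \<noteq> t\<close> by simp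
				from cfun.subspace_scale[OF sW this, of s] have "(\<lambda>i. s * x i) \<in> W" .
				from cfun.subspace_diff[OF sW that(1) this] have "v \<in> W" by (simp add: l_def fun_diff_def)
				then show False using v(2)[OF W] by simp
			qed
			then show ?thesis
			proof (cases "{t. l t \<in> W} = {}")
				case False
				then obtain s where "l s \<in> W" by auto
				then have "{t. l t \<in> W} \<subseteq> {s}" using \<open>\<And>s t. l s \<in> W ==> l t \<in> W ==> s = t\<close> by auto
				then show ?thesis by (rule finite_subset) simp
			qed simp
		qed
		have "finite ((\<Union>W\<in>\<U>. {t. l t \<in> W}) \<union> {0})" using insert.hyps fin by simp
		from ex_new_if_finite[OF infinite_UNIV_char_0 this]
		obtain t where t: "t \<notin> (\<Union>W\<in>\<U>. {t. l t \<in> W}) \<union> {0}" by (elim exE)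
		have "l t \<notin> U"
		proof
			assume "l t \<in> U"
			have sU: "cfun.subspace U" using insert.prems[of U] by simp
			have "(\<lambda>i. t * x i) \<in> U" using cfun.subspace_diff[OF sU \<open>l t \<in> U\<close> True] by (simp add: l_def fun_diff_def)
			from cfun.subspace_scale[OF sU this, of "1 / t"] have "x \<in> U" using t by simp
			then show False using x by simp
		qed
		then show ?thesis using lV[of t] t by (intro bexI[of _ "l t"]) auto
	qed
qed

lemma Collect_pairs_eq_image: "{f a a' | a a'. a \<in> S \<and> a' \<in> T} = (\<lambda>(a, a'). f a a') ` (S \<times> T)"
	by auto

section \<open>Differences, moments and the covector of a relation\<close>

context finite_tuple
begin

definition diffs :: "nat set => (nat => complex) set" where
	"diffs I = (\<Union>i\<in>I. (\<lambda>(a, a') j. lvec a j - lvec a' j) ` (A i \<times> A i))"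

lemma diffs_Un: "diffs (I \<union> J) = diffs I \<union> diffs J" by (auto simp: diffs_def)

lemma diffs_mono: "I \<subseteq> J ==> diffs I \<subseteq> diffs J" by (auto simp: diffs_def)

lemma finite_diffs: "i < n ==> finite (diffs {i})" by (simp add: diffs_def finite_A)

lemma diffs_cvec_space: "I \<subseteq> {..<n} ==> diffs I \<subseteq> cvec_space n"
	by (auto simp: diffs_def cvec_space_def cvec_apply lookup_A)

lemma lattice_dim_tuple_span:
	assumes "I \<subseteq> {..<n}"
	shows "lattice_dim (int_lattice n) (tuple_span (int_lattice n) A I) = cfun.dim (diffs I)"
proof -
	let ?X = "\<Union>i\<in>I. {a \<otimes>\<^bsub>int_lattice n\<^esub> inv\<^bsub>int_lattice n\<^esub> a' | a a'. a \<in> A i \<and> a' \<in> A i}"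
	interpret G: comm_group "int_lattice n" by (rule abelian_free_Abelian_group)
	have ac: "a \<in> carrier (int_lattice n)" if "i \<in> I" "a \<in> A i" for i a
		using subsetD[OF A_carrier[of i]] assms that by auto
	have X: "?X \<subseteq> carrier (int_lattice n)"
	proof (rule UN_least, rule subsetI)
		fix i x assume i: "i \<in> I" and "x \<in> {a \<otimes>\<^bsub>int_lattice n\<^esub> inv\<^bsub>int_lattice n\<^esub> a' | a a'. a \<in> A i \<and> a' \<in> A i}"
		then obtain a a' where "a \<in> A i" "a' \<in> A i" and x: "x = a \<otimes>\<^bsub>int_lattice n\<^esub> inv\<^bsub>int_lattice n\<^esub> a'" by (elim CollectE exE conjE)
		then show "x \<in> carrier (int_lattice n)" unfolding x using ac[OF i] by (intro G.m_closed G.inv_closed)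
	qed
	have "lattice_dim (int_lattice n) (generate (int_lattice n) ?X) = cfun.dim ((\<lambda>x. lvec x) ` ?X)"
	proof (rule lattice_dim_generate(2)[OF G.is_group X])
		show "inj_on coord (carrier (int_lattice n))" by (rule inj_onI) (simp only: lookup_inject)
		show "coord x j = 0" if "x \<in> carrier (int_lattice n)" "n \<le> j" for x j
			using that by (force simp: in_keys_iff)
	qed (auto simp: lookup_add)
	moreover have "(\<lambda>x. lvec x) ` ?X = diffs I"
	proof -
		have e: "lvec (a \<otimes>\<^bsub>int_lattice n\<^esub> inv\<^bsub>int_lattice n\<^esub> a') = (\<lambda>j. lvec a j - lvec a' j)"
			if "i \<in> I" "a \<in> A i" "a' \<in> A i" for i a a'
			using ac[OF that(1,3)] by (auto simp: cvec_apply lookup_minus)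
		have "?X = (\<Union>i\<in>I. (\<lambda>(a, a'). a \<otimes>\<^bsub>int_lattice n\<^esub> inv\<^bsub>int_lattice n\<^esub> a') ` (A i \<times> A i))"
			by (simp only: Collect_pairs_eq_image)
		then have "(\<lambda>x. lvec x) ` ?X = (\<Union>i\<in>I. (\<lambda>(a, a'). lvec (a \<otimes>\<^bsub>int_lattice n\<^esub> inv\<^bsub>int_lattice n\<^esub> a')) ` (A i \<times> A i))"
			by (simp only: image_UN image_image case_prod_unfold)
		also have "\<dots> = diffs I" unfolding diffs_def by (intro SUP_cong refl image_cong) (use e in auto)
		finally show ?thesis .
	qed
	ultimately show ?thesis by (simp add: tuple_span_def)
qed

lemma dim_diffs_all: "cfun.dim (diffs {..<n}) = n"
proof -
	interpret G: comm_group "int_lattice n" by (rule abelian_free_Abelian_group)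
	have e: "(int_lattice n)\<lparr>carrier := carrier (int_lattice n)\<rparr> = int_lattice n" by simp
	have "lattice_dim (int_lattice n) (carrier (int_lattice n)) = n"
		by (rule lattice_dim_eqI) (simp_all only: e iso_refl G.is_group)
	then show ?thesis using lattice_dim_tuple_span[of "{..<n}"] span_A by simp
qed

lemma moment_in_span:
	assumes "i < n" "(\<Sum>a\<in>A i. w (i, a)) = 0"
	shows "moment w i \<in> cfun.span (diffs {i})"
proof -
	obtain a0 where a0: "a0 \<in> A i" using A_nonempty assms(1) by blast
	have "moment w i = (\<Sum>a\<in>A i. (\<lambda>j. w (i, a) * (lvec a j - lvec a0 j)))"
	proof
		fix j
		have "(\<Sum>a\<in>A i. w (i, a) * (lvec a j - lvec a0 j)) = moment w i j - (\<Sum>a\<in>A i. w (i, a)) * lvec a0 j"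
			by (simp add: moment_def right_diff_distrib sum_subtractf sum_distrib_right)
		then show "moment w i j = (\<Sum>a\<in>A i. (\<lambda>j. w (i, a) * (lvec a j - lvec a0 j))) j"
			using assms(2) by (simp add: sum_fun_apply)
	qed
	also have "\<dots> \<in> cfun.span (diffs {i})"
		by (intro cfun.span_sum cfun.span_scale cfun.span_base) (use a0 in \<open>auto simp: diffs_def\<close>)
	finally show ?thesis .
qed

text \<open>Together with \<open>moment_in_span\<close>: moments of zero-sum coefficients on A i
  fill the whole span of its differences, so prescribed vectors of that span can be realized as
  moments.\<close>

lemma span_diffs_eq:
	assumes "i < n" "x \<in> cfun.span (diffs {i})"
	shows "\<exists>\<beta>. (\<Sum>a\<in>A i. \<beta> a) = 0 \<and> (\<forall>j. x j = (\<Sum>a\<in>A i. \<beta> a * lvec a j))" using assms(2)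
proof (induction rule: cfun.span_induct_alt)
	case base
	show ?case by (rule exI[of _ "\<lambda>_. 0"]) simp
next
	case (step c x y)
	obtain a a' where a: "a \<in> A i" "a' \<in> A i" "x = (\<lambda>j. lvec a j - lvec a' j)"
		using step(1) by (auto simp: diffs_def)
	obtain \<beta> where \<beta>: "(\<Sum>a\<in>A i. \<beta> a) = 0" "\<And>j. y j = (\<Sum>a\<in>A i. \<beta> a * lvec a j)" using step(2) by auto
	define \<delta> :: "(nat \<Rightarrow>\<^sub>0 int) => (nat \<Rightarrow>\<^sub>0 int) => complex" where "\<delta> b d = (if d = b then 1 else 0)" for b d
	have \<delta>: "(\<Sum>d\<in>A i. \<delta> b d * f d) = f b" if "b \<in> A i" for b and f
		using that finite_A[OF assms(1)] by (simp add: \<delta>_def if_distrib[of "\<lambda>x. x * _"] cong: if_cong)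
	have s1: "(\<Sum>d\<in>A i. \<delta> b d) = 1" if "b \<in> A i" for b using \<delta>[OF that, of "\<lambda>_. 1"] by simp
	show ?case
	proof (rule exI[of _ "\<lambda>d. c * (\<delta> a d - \<delta> a' d) + \<beta> d"], intro conjI allI)
		show "(\<Sum>d\<in>A i. c * (\<delta> a d - \<delta> a' d) + \<beta> d) = 0"
			by (simp add: sum.distrib sum_distrib_left[symmetric] sum_subtractf s1 a \<beta>)
		fix j
		have "(\<Sum>d\<in>A i. (c * (\<delta> a d - \<delta> a' d) + \<beta> d) * lvec d j)
				= c * ((\<Sum>d\<in>A i. \<delta> a d * lvec d j) - (\<Sum>d\<in>A i. \<delta> a' d * lvec d j)) + (\<Sum>d\<in>A i. \<beta> d * lvec d j)"
			by (simp add: algebra_simps sum.distrib sum_subtractf sum_distrib_left)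
		also have "\<dots> = c * (lvec a j - lvec a' j) + y j" by (simp only: \<delta>[OF a(1)] \<delta>[OF a(2)] \<beta>(2))
		finally show "((\<lambda>i. c * x i) + y) j = (\<Sum>d\<in>A i. (c * (\<delta> a d - \<delta> a' d) + \<beta> d) * lvec d j)"
			by (simp add: a(3))
	qed
qed

lemma moment_cvec_space: "i < n ==> moment w i \<in> cvec_space n"
	by (simp add: moment_def cvec_space_def cvec_apply lookup_A)

text \<open>Extended by zero outside \<open>B\<close>, a dependence must have constant coefficients,
  and the constant is zero because an index is missing from \<open>B\<close>.\<close>

lemma proper_relations_indep:
	assumes "w \<in> proper_relations" "B \<subset> {..<n}"
	shows "indep_family UNIV B (moment w)"
proof (rule indep_familyI)
	fix u i assume u: "\<And>j. j \<in> UNIV ==> (\<Sum>i\<in>B. u i * moment w i j) = 0" and i: "i \<in> B"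
	define \<mu> where "\<mu> i = (if i \<in> B then u i else 0)" for i
	have "(\<Sum>i<n. \<mu> i * moment w i j) = (\<Sum>i\<in>B. u i * moment w i j)" for j
		using assms(2) by (intro sum.mono_neutral_cong_right) (auto simp: \<mu>_def)
	then have c: "\<mu> i = \<mu> 0" if "i < n" for i using assms(1) u that by (simp add: proper_relations_def)
	obtain l where "l < n" "l \<notin> B" using assms(2) by auto
	then have "\<mu> 0 = 0" using c[of l] by (simp add: \<mu>_def)
	then have "\<mu> i = 0" using c[of i] i assms(2) by auto
	then show "u i = 0" using i by (simp add: \<mu>_def)
qed

text \<open>Subtracting \<open>\<mu> 0\<close> times the total moment, which is zero, leaves a
  dependence among the moments of index at least 1.\<close>

lemma proper_relationsI:
	assumes "w \<in> relations" "indep_family UNIV {1..<n} (moment w)"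
	shows "w \<in> proper_relations" unfolding proper_relations_def
proof (intro CollectI conjI assms(1) allI impI)
	fix \<mu> i assume \<mu>: "\<forall>j<n. (\<Sum>i<n. \<mu> i * moment w i j) = 0" and i: "i < n"
	have "(\<Sum>i\<in>{1..<n}. (\<mu> i - \<mu> 0) * moment w i j) = 0" for j
	proof (cases "j < n")
		case True
		have "{..<n} = insert 0 {1..<n}" using i by auto
		then have "(\<Sum>i\<in>{1..<n}. (\<mu> i - \<mu> 0) * moment w i j) = (\<Sum>i<n. (\<mu> i - \<mu> 0) * moment w i j)" by simp
		also have "\<dots> = (\<Sum>i<n. \<mu> i * moment w i j) - \<mu> 0 * (\<Sum>i<n. moment w i j)"
			by (simp add: left_diff_distrib sum_subtractf sum_distrib_left)
		also have "\<dots> = 0" using \<mu> True assms(1) by (simp add: relations_def)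
		finally show ?thesis .
	next
		case False
		have "moment w i j = 0" if "i < n" for i using moment_cvec_space[OF that, of w] False by (simp add: cvec_space_def)
		then show ?thesis by (intro sum.neutral) auto
	qed
	then have "\<mu> i - \<mu> 0 = 0" if "i \<in> {1..<n}" using indep_familyD[OF assms(2), of "\<lambda>i. \<mu> i - \<mu> 0" i] that by simp
	then show "\<mu> i = \<mu> 0" using i by (cases "i = 0") auto
qed

text \<open>n - 1 equations in n unknowns; the equation of index 0 is minus the sum of the others.
  For a proper relation \<open>h\<close> is the normal of the hyperplane spanned by the moments,
  called its covector.\<close>

lemma covector_exists:
	assumes "w \<in> relations" "0 < n"
	shows "\<exists>h. (\<exists>j<n. h j \<noteq> 0) \<and> (\<forall>i<n. dot h (moment w i) = 0)"
proof -
	obtain h where h: "\<exists>j\<in>{..<n}. h j \<noteq> 0" "\<forall>i\<in>{1..<n}. (\<Sum>j\<in>{..<n}. moment w i j * h j) = 0"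
		using homogeneous_system_nontrivial[of "{1..<n}" "{..<n}" "moment w"] assms(2) by auto
	have hz: "dot h (moment w i) = 0" if "i \<in> {1..<n}" for i
		using h(2) that by (simp add: mult.commute)
	have "(\<Sum>i<n. \<Sum>j<n. h j * moment w i j) = (\<Sum>j<n. h j * (\<Sum>i<n. moment w i j))"
		by (subst sum.swap) (simp add: sum_distrib_left)
	also have "\<dots> = 0" using assms(1) by (simp add: relations_def)
	finally have t: "(\<Sum>i<n. \<Sum>j<n. h j * moment w i j) = 0" .
	have "{..<n} = insert 0 {1..<n}" using assms(2) by auto
	then have "(\<Sum>i<n. \<Sum>j<n. h j * moment w i j) = (\<Sum>j<n. h j * moment w 0 j) + (\<Sum>i\<in>{1..<n}. \<Sum>j<n. h j * moment w i j)" by simp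
	then have "(\<Sum>j<n. h j * moment w 0 j) = 0" using t hz by simp
	then have "dot h (moment w i) = 0" if "i < n" for i using hz[of i] that by (cases "i = 0") auto
	then show ?thesis using h(1) by (intro exI[of _ h]) auto
qed

text \<open>The n - 1 independent moments span the hyperplane \<open>h\<close> = 0: a further
  independent vector in it, together with the unit vector at \<open>j0\<close>, would make n + 1
  independent vectors.\<close>

lemma kernel_of_covector:
	assumes "w \<in> proper_relations" "0 < n" "j0 < n" "h j0 \<noteq> 0" "\<And>i. i < n ==> dot h (moment w i) = 0"
		and b: "b \<in> cvec_space n" "dot h b = 0"
	shows "\<exists>\<mu>. \<forall>j. b j = (\<Sum>i\<in>{1..<n}. \<mu> i * moment w i j)"
proof -
	have "{1..<n} \<noteq> {..<n}" using assms(2) by (metis atLeastLessThan_iff lessThan_iff not_one_le_zero)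
	then have "{1..<n} \<subset> {..<n}" by (simp add: psubset_eq subset_iff)
	from proper_relations_indep[OF assms(1) this] have ind: "inj_on (moment w) {1..<n}" "cfun.independent (moment w ` {1..<n})"
		by (simp_all add: indep_family_iff_independent)
	let ?B = "moment w ` {1..<n}"
	define H where "H = {x \<in> cvec_space n. dot h x = 0}"
	have "cfun.subspace H"
	proof (rule cfun.subspaceI)
		show "0 \<in> H" using cfun.subspace_0[OF cvec_space_subspace, of n] by (simp add: H_def)
		show "x + y \<in> H" if "x \<in> H" "y \<in> H" for x y
			using that cfun.subspace_add[OF cvec_space_subspace, of x n y] by (simp add: H_def distrib_left sum.distrib)
		show "(\<lambda>i. c * x i) \<in> H" if "x \<in> H" for c x
		proof -
			have "(\<Sum>j<n. h j * (c * x j)) = c * dot h x" by (simp add: sum_distrib_left ac_simps)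
			then show ?thesis using that cfun.subspace_scale[OF cvec_space_subspace, of x n c] by (simp add: H_def)
		qed
	qed
	moreover have BH: "?B \<subseteq> H" using assms(5) moment_cvec_space by (auto simp: H_def)
	moreover have "b \<in> H" using b by (simp add: H_def)
	ultimately have sH: "cfun.span (insert b ?B) \<subseteq> H" by (intro cfun.span_minimal) auto
	define e where "e = (\<lambda>j. if j = j0 then 1 else 0 :: complex)"
	have ec: "e \<in> cvec_space n" using assms(3) by (auto simp: e_def cvec_space_def)
	have "dot h e = h j0" using assms(3) by (simp add: e_def if_distrib[of "\<lambda>x. _ * x"] cong: if_cong)
	then have eH: "e \<notin> H" using assms(4) by (simp add: H_def)
	have "b \<in> cfun.span ?B"
	proof (rule ccontr)
		assume nb: "b \<notin> cfun.span ?B"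
		have i1: "cfun.independent (insert b ?B)" by (rule cfun.independent_insertI[OF nb ind(2)])
		have ne: "e \<notin> cfun.span (insert b ?B)" using eH sH by blast
		have i2: "cfun.independent (insert e (insert b ?B))" by (rule cfun.independent_insertI[OF ne i1])
		have "card (insert e (insert b ?B)) \<le> n"
			by (rule finite_indep_cvec_space(2)[OF i2]) (use ec BH b in \<open>auto simp: H_def\<close>)
		moreover have "b \<notin> ?B" by (rule contra_subsetD[OF cfun.span_superset nb])
		moreover have "e \<notin> insert b ?B" by (rule contra_subsetD[OF cfun.span_superset ne])
		moreover have "card ?B = n - 1" using ind(1) by (simp add: card_image)
		ultimately show False using assms(2) by simp
	qed
	then show ?thesis
	proof (induction rule: cfun.span_induct_alt)
		case base
		show ?case by (rule exI[of _ "\<lambda>_. 0"]) simp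
	next
		case (step c x y)
		obtain l where l: "l \<in> {1..<n}" "x = moment w l" using step(1) by auto
		obtain \<mu> where \<mu>: "\<And>j. y j = (\<Sum>i\<in>{1..<n}. \<mu> i * moment w i j)" using step(2) by auto
		have "((\<lambda>i. c * x i) + y) j = (\<Sum>i\<in>{1..<n}. ((if i = l then c else 0) + \<mu> i) * moment w i j)" for j
		proof -
			have "(\<Sum>i\<in>{1..<n}. (if i = l then c else 0) * moment w i j) = c * moment w l j"
				using l(1) by (simp add: if_distrib[of "\<lambda>x. x * _"] cong: if_cong)
			then show ?thesis by (simp add: l(2) \<mu> distrib_right sum.distrib)
		qed
		then show ?case by (intro exI[of _ "\<lambda>i. (if i = l then c else 0) + \<mu> i"] allI)
	qed
qed

lemma covector_unique:
	assumes "w \<in> proper_relations" "0 < n" "j0 < n" "h j0 \<noteq> 0" "\<And>i. i < n ==> dot h (moment w i) = 0"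
		and \<xi>: "\<And>i. i < n ==> dot \<xi> (moment w i) = 0"
	shows "\<forall>j<n. \<xi> j = (\<xi> j0 / h j0) * h j"
proof (intro allI impI)
	fix j assume j: "j < n"
	\<comment> \<open>Such vectors lie in the kernel of \<open>h\<close>; evaluating \<xi> on them
	  yields proportionality.\<close>
	define b where "b = (\<lambda>l. h j0 * (if l = j then 1 else 0) - h j * (if l = j0 then 1 else 0))"
	have sb: "(\<Sum>l<n. f l * b l) = h j0 * f j - h j * f j0" for f
	proof -
		have "(\<Sum>l<n. f l * b l) = h j0 * (\<Sum>l<n. f l * (if l = j then 1 else 0)) - h j * (\<Sum>l<n. f l * (if l = j0 then 1 else 0))"
			by (simp add: b_def right_diff_distrib sum_subtractf sum_distrib_left ac_simps)
		then show ?thesis using j assms(3) by (simp add: if_distrib[of "\<lambda>x. _ * x"] cong: if_cong)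
	qed
	have "b \<in> cvec_space n" using j assms(3) by (auto simp: b_def cvec_space_def)
	moreover have "(\<Sum>l<n. h l * b l) = 0" by (simp add: sb)
	ultimately obtain \<mu> where \<mu>: "\<And>l. b l = (\<Sum>i\<in>{1..<n}. \<mu> i * moment w i l)"
		using kernel_of_covector[OF assms(1-5)] by blast
	have "(\<Sum>l<n. \<xi> l * b l) = (\<Sum>i\<in>{1..<n}. \<mu> i * (\<Sum>l<n. \<xi> l * moment w i l))"
		unfolding \<mu> sum_distrib_left by (subst sum.swap) (simp add: ac_simps)
	also have "\<dots> = 0" using \<xi> by simp
	finally have "h j0 * \<xi> j = h j * \<xi> j0" by (simp add: sb)
	then show "\<xi> j = (\<xi> j0 / h j0) * h j" using assms(4) by (simp add: field_simps)
qed

end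

section \<open>Independent tuples of zero defect\<close>

locale BK_finite_tuple = finite_tuple +
	assumes BK_A: "BK_tuple (int_lattice n) A {..<n}"
begin

lemma card_le_dim_diffs:
	assumes "I \<subseteq> {..<n}"
	shows "card I \<le> cfun.dim (diffs I)" using BK_A assms lattice_dim_tuple_span[OF assms]
	unfolding BK_tuple_def independent_tuple_def by (auto simp: defect_def)

lemma BK_tuple_iff:
	assumes "I \<subseteq> {..<n}"
	shows "BK_tuple (int_lattice n) A I \<longleftrightarrow> cfun.dim (diffs I) = card I"
proof -
	have "independent_tuple (int_lattice n) A I"
		using BK_A assms unfolding BK_tuple_def independent_tuple_def by (meson subset_trans)
	then show ?thesis using lattice_dim_tuple_span[OF assms] by (simp add: BK_tuple_def defect_def)
qed

text \<open>The moments over \<open>B\<close> are independent and their number is the dimension of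
  the space they lie in.\<close>

lemma BK_moments_span:
	assumes "w \<in> proper_relations" "B \<subset> {..<n}" "cfun.dim (diffs B) = card B"
	shows "diffs B \<subseteq> cfun.span (moment w ` B)"
proof -
	have fB: "finite B" using assms(2) finite_subset by blast
	have ind: "inj_on (moment w) B" "cfun.independent (moment w ` B)"
		using proper_relations_indep[OF assms(1,2)] fB by (simp_all add: indep_family_iff_independent)
	have "moment w ` B \<subseteq> cfun.span (diffs B)"
	proof (rule image_subsetI)
		fix i assume i: "i \<in> B"
		then have "i < n" using assms(2) by auto
		then have "moment w i \<in> cfun.span (diffs {i})"
			by (rule moment_in_span) (use assms(1) \<open>i < n\<close> in \<open>simp add: proper_relations_def relations_def\<close>)
		moreover have "cfun.span (diffs {i}) \<subseteq> cfun.span (diffs B)" using i by (intro cfun.span_mono diffs_mono) simp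
		ultimately show "moment w i \<in> cfun.span (diffs B)" by (rule subsetD[rotated])
	qed
	then show ?thesis by (intro spanning_if_card_ge_dim[OF ind(2) _ diffs_cvec_space])
			 (use assms(2,3) ind(1) in \<open>auto simp: card_image\<close>)
qed

text \<open>If proper BK-subtuples cover the tuple, every difference lies in the span of the
  moments, of dimension at most n - 1 since the moments sum to zero; but the differences span
  dimension n.\<close>

lemma not_simple_imp_no_proper_relations:
	assumes "\<not> simple_BK_tuple (int_lattice n) A {..<n}" "0 < n"
	shows "proper_relations = {}"
proof (rule ccontr)
	assume "proper_relations \<noteq> {}"
	then obtain w where w: "w \<in> proper_relations" by auto
	obtain \<F> where \<F>: "\<F> \<subseteq> {C. C \<subset> {..<n} \<and> BK_tuple (int_lattice n) A C}" "\<Union>\<F> = {..<n}"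
		using assms(1) BK_A unfolding simple_BK_tuple_def by auto
	have "diffs {..<n} \<subseteq> cfun.span (moment w ` {..<n})"
	proof
		fix x assume "x \<in> diffs {..<n}"
		then obtain i where i: "i < n" "x \<in> diffs {i}" unfolding diffs_def by (simp only: UN_iff lessThan_iff singleton_iff) blast
		then obtain C where C: "C \<in> \<F>" "i \<in> C" using \<F>(2) by (metis UnionE lessThan_iff)
		have C': "C \<subset> {..<n}" "BK_tuple (int_lattice n) A C" using C(1) \<F>(1) by auto
		have "diffs {i} \<subseteq> diffs C" using C(2) by (intro diffs_mono) simp
		also have "\<dots> \<subseteq> cfun.span (moment w ` C)"
			using BK_moments_span[OF w C'(1)] C' BK_tuple_iff[of C] by (simp add: psubset_imp_subset)
		also have "\<dots> \<subseteq> cfun.span (moment w ` {..<n})" using C'(1) by (intro cfun.span_mono image_mono) auto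
		finally show "x \<in> cfun.span (moment w ` {..<n})" using i(2) by (rule subsetD)
	qed
	also have "\<dots> \<subseteq> cfun.span (moment w ` {1..<n})"
	proof (rule cfun.span_minimal[OF image_subsetI cfun.subspace_span])
		fix i assume i: "i \<in> {..<n}"
		show "moment w i \<in> cfun.span (moment w ` {1..<n})"
		proof (cases "i = 0")
			case False
			then show ?thesis using i by (intro cfun.span_base imageI) simp
		next
			case True
			have "moment w 0 = - (\<Sum>i\<in>{1..<n}. moment w i)"
			proof
				fix j
				have "(\<Sum>i<n. moment w i j) = 0"
				proof (cases "j < n")
					case True
					then show ?thesis using w by (simp add: proper_relations_def relations_def)
				next
					case False
					have "moment w i j = 0" if "i < n" for i using moment_cvec_space[OF that, of w] False by (simp add: cvec_space_def)
					then show ?thesis by (intro sum.neutral) auto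
				qed
				moreover have "{..<n} = insert 0 {1..<n}" using assms(2) by auto
				ultimately have "moment w 0 j + (\<Sum>i\<in>{1..<n}. moment w i j) = 0" by simp
				then show "moment w 0 j = (- (\<Sum>i\<in>{1..<n}. moment w i)) j"
					by (simp add: sum_fun_apply eq_neg_iff_add_eq_0)
			qed
			also have "\<dots> \<in> cfun.span (moment w ` {1..<n})"
				by (intro cfun.span_neg cfun.span_sum cfun.span_base imageI)
			finally show ?thesis using True by simp
		qed
	qed
	finally have "cfun.dim (diffs {..<n}) \<le> card (moment w ` {1..<n})" by (intro cfun.dim_le_card) auto
	also have "\<dots> \<le> n - 1" using card_image_le[of "{1..<n}" "moment w"] by simp
	finally show False using dim_diffs_all assms(2) by simp
qed

end

section \<open>Simple tuples and the relations they admit\<close>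

locale simple_finite_tuple = BK_finite_tuple +
	assumes simple_A: "simple_BK_tuple (int_lattice n) A {..<n}"
begin

text \<open>Simplicity says that this union is a proper subtuple. By submodularity it is itself BK,
  hence the largest proper BK-subtuple.\<close>

definition K :: "nat set" where
	"K = \<Union>{C. C \<subset> {..<n} \<and> BK_tuple (int_lattice n) A C}"

abbreviation spanK where "spanK \<equiv> cfun.span (diffs K)"

lemma n_pos: "0 < n"
proof (rule ccontr)
	assume "\<not> 0 < n"
	then have "\<Union>{} = {..<n} \<and> {} \<subseteq> {C. C \<subset> {..<n} \<and> BK_tuple (int_lattice n) A C}" by auto
	then show False using simple_A unfolding simple_BK_tuple_def by metis
qed

lemma K_psubset: "K \<subset> {..<n}"
proof -
	have "K \<subseteq> {..<n}" unfolding K_def by (rule Union_least) auto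
	moreover have "K \<noteq> {..<n}" using simple_A unfolding simple_BK_tuple_def K_def by (metis subset_refl)
	ultimately show ?thesis by simp
qed

text \<open>Independence bounds the intersection from below, so submodularity bounds the union from
  above; the reverse bound for the union is independence again.\<close>

lemma BK_Un:
	assumes "B \<subseteq> {..<n}" "C \<subseteq> {..<n}" "cfun.dim (diffs B) = card B" "cfun.dim (diffs C) = card C"
	shows "cfun.dim (diffs (B \<union> C)) = card (B \<union> C)"
proof -
	have "cfun.dim (diffs B \<union> diffs C) + cfun.dim (diffs (B \<inter> C)) \<le> cfun.dim (diffs B) + cfun.dim (diffs C)"
		by (rule cdim_submodular[OF diffs_cvec_space[OF assms(1)] diffs_cvec_space[OF assms(2)]])
			 (rule subset_trans[OF diffs_mono cfun.span_superset], simp)+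
	moreover have "card (B \<inter> C) \<le> cfun.dim (diffs (B \<inter> C))" using assms by (intro card_le_dim_diffs) auto
	moreover have "card B + card C = card (B \<union> C) + card (B \<inter> C)"
		using assms finite_subset by (intro card_Un_Int) blast+
	moreover have "card (B \<union> C) \<le> cfun.dim (diffs (B \<union> C))" using assms by (intro card_le_dim_diffs) auto
	ultimately show ?thesis using assms(3,4) by (simp add: diffs_Un)
qed

lemma dim_diffs_empty: "cfun.dim (diffs {}) = 0"
	using cfun.dim_le_card'[of "diffs {}"] by (simp add: diffs_def)

lemma K_BK: "cfun.dim (diffs K) = card K"
proof -
	let ?F = "{C. C \<subset> {..<n} \<and> BK_tuple (int_lattice n) A C}"
	have "finite ?F" by (rule finite_subset[of _ "Pow {..<n}"]) auto
	moreover have "cfun.dim (diffs (\<Union>\<F>)) = card (\<Union>\<F>)" if "finite \<F>" "\<F> \<subseteq> ?F" for \<F> using that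
	proof (induction \<F> rule: finite_induct)
		case empty
		then show ?case by (simp add: dim_diffs_empty)
	next
		case (insert C \<F>)
		have C: "C \<subseteq> {..<n}" "BK_tuple (int_lattice n) A C" using insert.prems by auto
		have "\<Union>\<F> \<subseteq> {..<n}" using insert.prems by (intro Union_least) auto
		moreover have "cfun.dim (diffs C) = card C" using C BK_tuple_iff by simp
		ultimately show ?case using BK_Un[OF C(1)] insert by simp
	qed
	ultimately show ?thesis unfolding K_def by blast
qed

lemma BK_subset_K:
	assumes "C \<subset> {..<n}" "cfun.dim (diffs C) = card C"
	shows "C \<subseteq> K"
	using assms BK_tuple_iff[of C] unfolding K_def by (intro Union_upper) (simp add: psubset_imp_subset)

lemma card_less_dim_diffs:
	assumes "I \<subset> {..<n}" "\<not> I \<subseteq> K"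
	shows "card I < cfun.dim (diffs I)"
	using BK_subset_K[OF assms(1)] assms(2) card_le_dim_diffs[of I] assms(1) by (metis le_neq_implies_less psubset_imp_subset)

lemma largest_proper_BK_eq: "largest_proper_BK (int_lattice n) A {..<n} = K"
	unfolding largest_proper_BK_def
proof (rule Greatest_equality)
	show "K \<subset> {..<n} \<and> BK_tuple (int_lattice n) A K"
		using K_psubset K_BK BK_tuple_iff[of K] by (simp add: psubset_imp_subset)
	show "C \<le> K" if "C \<subset> {..<n} \<and> BK_tuple (int_lattice n) A C" for C
		using that unfolding K_def by (intro Union_upper) simp
qed

text \<open>Relations with the condition on the total moment dropped. On this affine space the
  moments of different blocks vary independently; the condition is restored afterwards by rescaling
  blocks.\<close>

definition zero_sums :: "(term_index => complex) set" where
	"zero_sums = {w \<in> coeff_space P. \<forall>i<n. (\<Sum>a\<in>A i. w (i, a)) = 0}"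

lemma zero_sums_affine: "affine_closed zero_sums" unfolding affine_closed_def zero_sums_def
	by (auto simp: coeff_space_def sum.distrib sum_distrib_left[symmetric] sum_subtractf)

text \<open>Quotienting by a generic vector b of the span of A i0 leaves n vectors in a space of
	dimension n - 1, any n - 1 of which can be made independent; the coefficients of their unique
	relation are then all nonzero.\<close>

lemma proper_relation_avoiding:
	assumes i0: "i0 < n" "i0 \<notin> K"
	shows "\<exists>b\<in>cfun.span (diffs {i0}). \<exists>w\<in>relations. indep_family UNIV {..<n} (\<lambda>i. if i = 0 then b else moment w i)"
proof -
	\<comment> \<open>All subtuple spans that miss some difference of A i0. A vector of the span of A
	  i0 avoiding them lies in a subtuple span only if all of A i0 does.\<close>
	let ?\<U> = "(\<lambda>I. cfun.span (diffs I)) ` {I. I \<subseteq> {..<n} \<and> \<not> diffs {i0} \<subseteq> cfun.span (diffs I)}"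
	have "\<exists>b\<in>cfun.span (diffs {i0}). \<forall>U\<in>?\<U>. b \<notin> U"
	proof (rule avoid_proper_subspaces[OF cfun.subspace_span])
		show "finite ?\<U>" by (rule finite_imageI, rule finite_subset[of _ "Pow {..<n}"]) auto
		fix U assume "U \<in> ?\<U>"
		then obtain I where I: "U = cfun.span (diffs I)" "\<not> diffs {i0} \<subseteq> cfun.span (diffs I)" by auto
		then show "cfun.subspace U \<and> \<not> cfun.span (diffs {i0}) \<subseteq> U"
			using cfun.subspace_span[of "diffs I"] cfun.span_superset[of "diffs {i0}"] by (auto dest: subset_trans)
	qed
	then obtain b where b: "b \<in> cfun.span (diffs {i0})" and
		b_avoid: "\<And>I. I \<subseteq> {..<n} ==> b \<in> cfun.span (diffs I) ==> diffs {i0} \<subseteq> cfun.span (diffs I)" by auto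
	have bc: "b \<in> cvec_space n" using b span_subset_cvec_space[OF diffs_cvec_space[of "{i0}"]] i0 by auto
	define y where "y w i = (if i = n then b else moment w i)" for w i
	have y_poly: "(\<lambda>w. y w i j) \<in> polys" for i j
		by (cases "i = n") (simp_all add: y_def moment_polynomial polynomial_functions.const)
	have "\<exists>p\<in>polynomial_functions. (\<exists>w\<in>zero_sums. p w \<noteq> 0) \<and> (\<forall>w. p w \<noteq> 0 --> indep_family UNIV (insert n {..<n} - {l}) (y w))"
		if l: "l < n" for l
	proof -
		define D where "D i = (if i = n then {b} else diffs {i})" for i
		let ?S = "insert n {..<n} - {l}"
		\<comment> \<open>The rank condition is critical when \<open>b\<close> lies in the span of J'.
		  Then so do the differences of A i0. If i0 is in J', this subtuple is not inside \<open>K\<close>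
		  and has positive defect; otherwise adding i0 leaves the dimension unchanged, and independence of
		  the enlarged tuple supplies the missing one.\<close>
		have "\<exists>d. (\<forall>i\<in>?S. d i \<in> D i) \<and> indep_family UNIV ?S d"
		proof (rule rado)
			show "finite (D i) \<and> D i \<subseteq> cvec_space n" if "i \<in> ?S" for i
				using that bc finite_diffs[of i] diffs_cvec_space[of "{i}"] by (auto simp: D_def)
			fix J assume J: "J \<subseteq> ?S"
			define J' where "J' = J - {n}"
			have J': "J' \<subset> {..<n}" using J l by (auto simp: J'_def)
			have UJ': "(\<Union>i\<in>J'. D i) = diffs J'" by (auto simp: J'_def D_def diffs_def split: if_splits)
			show "card J \<le> cfun.dim (\<Union>i\<in>J. D i)"
			proof (cases "n \<in> J")
				case False
				then show ?thesis using UJ' card_le_dim_diffs[of J'] J' by (simp add: J'_def psubset_imp_subset)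
			next
				case True
				have fJ': "finite J'" using J' finite_subset by blast
				have cJ: "card J = Suc (card J')"
				proof -
					have "J = insert n J'" using True by (auto simp: J'_def)
					moreover have "n \<notin> J'" by (simp add: J'_def)
					ultimately show ?thesis using fJ' card_insert_disjoint[of J' n] by simp
				qed
				have "(\<Union>i\<in>J. D i) = D n \<union> (\<Union>i\<in>J'. D i)" using True by (auto simp: J'_def)
				then have UJ: "(\<Union>i\<in>J. D i) = insert b (diffs J')" unfolding UJ' by (simp add: D_def)
				have dJ': "diffs J' \<subseteq> cvec_space n" using J' by (intro diffs_cvec_space) auto
				have icv: "insert b (diffs J') \<subseteq> cvec_space n" using bc dJ' by simp
				have mono: "cfun.dim (diffs J') \<le> cfun.dim (insert b (diffs J'))"
					by (rule cdim_mono[OF _ icv]) (rule subset_trans[OF subset_insertI cfun.span_superset])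
				have "card J' + 1 \<le> cfun.dim (insert b (diffs J'))"
				proof (cases "b \<in> cfun.span (diffs J')")
					case False
					obtain B where B: "B \<subseteq> diffs J'" "cfun.independent B" "diffs J' \<subseteq> cfun.span B" "card B = cfun.dim (diffs J')"
						by (rule cfun.basis_exists)
					have nb: "b \<notin> cfun.span B" using False cfun.span_mono[OF B(1)] by auto
					have i: "cfun.independent (insert b B)" by (rule cfun.independent_insertI[OF nb B(2)])
					have "card (insert b B) \<le> cfun.dim (insert b (diffs J'))"
					proof (rule indep_card_le_dim[OF i _ icv])
						show "insert b B \<subseteq> cfun.span (insert b (diffs J'))"
							by (rule subset_trans[OF insert_mono[OF B(1)] cfun.span_superset])
					qed
					moreover have "finite B" by (rule finite_indep_cvec_space(1)[OF B(2)]) (use B(1) dJ' in auto)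
					moreover have "b \<notin> B" by (rule contra_subsetD[OF cfun.span_superset nb])
					ultimately show ?thesis using B(4) card_le_dim_diffs[OF psubset_imp_subset[OF J']] by simp
				next
					case True
					then have i0J: "diffs {i0} \<subseteq> cfun.span (diffs J')" using b_avoid[of J'] J' by auto
					have "card J' + 1 \<le> cfun.dim (diffs J')"
					proof (cases "i0 \<in> J'")
						case True
						then have "\<not> J' \<subseteq> K" using i0(2) by auto
						then show ?thesis using card_less_dim_diffs[OF J'] by simp
					next
						case False
						have "diffs (insert i0 J') \<subseteq> cfun.span (diffs J')"
							using i0J cfun.span_superset[of "diffs J'"] diffs_Un[of "{i0}" J'] by simp
						then have "cfun.dim (diffs (insert i0 J')) \<le> cfun.dim (diffs J')" by (rule cdim_mono[OF _ dJ'])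
						moreover have "card (insert i0 J') \<le> cfun.dim (diffs (insert i0 J'))"
							using i0(1) J' by (intro card_le_dim_diffs) auto
						ultimately show ?thesis using False fJ' by simp
					qed
					then show ?thesis using mono by simp
				qed
				then show ?thesis using UJ cJ by simp
			qed
		qed simp
		then obtain d where d0: "\<forall>i\<in>?S. d i \<in> D i" "indep_family UNIV ?S d" by (elim exE conjE)
		note d = d0(1)[rule_format] d0(2)
		have "\<forall>i. \<exists>\<beta>. i < n --> i \<noteq> l --> (\<Sum>a\<in>A i. \<beta> a) = 0 \<and> (\<forall>j. d i j = (\<Sum>a\<in>A i. \<beta> a * lvec a j))"
		proof
			fix i
			show "\<exists>\<beta>. i < n --> i \<noteq> l --> (\<Sum>a\<in>A i. \<beta> a) = 0 \<and> (\<forall>j. d i j = (\<Sum>a\<in>A i. \<beta> a * lvec a j))"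
			proof (cases "i < n \<and> i \<noteq> l")
				case True
				then have "d i \<in> cfun.span (diffs {i})" using d(1)[of i] by (intro cfun.span_base) (simp add: D_def)
				then show ?thesis using span_diffs_eq[of i "d i"] True by simp
			qed auto
		qed
		from choice[OF this]
		obtain \<beta> where \<beta>0: "\<forall>i. i < n --> i \<noteq> l --> (\<Sum>a\<in>A i. \<beta> i a) = 0 \<and> (\<forall>j. d i j = (\<Sum>a\<in>A i. \<beta> i a * lvec a j))"
			by (elim exE)
		note \<beta> = \<beta>0[rule_format]
		define w where "w p = (if p \<in> P \<and> fst p \<noteq> l then \<beta> (fst p) (snd p) else 0)" for p
		have wsum: "(\<Sum>a\<in>A i. w (i, a) * f a) = (if i = l then 0 else (\<Sum>a\<in>A i. \<beta> i a * f a))" if "i < n" for i f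
		proof (cases "i = l")
			case False
			then show ?thesis using that by (auto simp: w_def mem_P_iff intro!: sum.cong)
		qed (simp add: w_def)
		have wz: "w \<in> zero_sums"
		proof -
			have "(\<Sum>a\<in>A i. w (i, a)) = 0" if "i < n" for i using wsum[OF that, of "\<lambda>_. 1"] \<beta>[OF that] by simp
			then show ?thesis by (auto simp: zero_sums_def coeff_space_def w_def)
		qed
		have "y w i j = d i j" if "i \<in> ?S" for i j
			using d(1)[OF that] wsum[of i "\<lambda>a. lvec a j"] \<beta>[of i] that by (auto simp: y_def D_def moment_def)
		then have "indep_family UNIV ?S (y w)" using d(2) indep_family_cong[of ?S UNIV "y w" d] by simp
		then have "\<exists>p\<in>polynomial_functions. p w \<noteq> 0 \<and> (\<forall>w. p w \<noteq> 0 --> indep_family UNIV ?S (y w))"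
			by (rule indep_family_open[rotated 2]) (simp_all add: y_poly)
		then obtain p where "p \<in> polys" "p w \<noteq> 0" "\<forall>w. p w \<noteq> 0 --> indep_family UNIV ?S (y w)"
			by (elim bexE conjE)
		with wz show ?thesis by (intro bexI[of _ p] conjI bexI[of _ w])
	qed
	then have "\<forall>l. \<exists>p. l < n --> p \<in> polys \<and> (\<exists>w\<in>zero_sums. p w \<noteq> 0) \<and> (\<forall>w. p w \<noteq> 0 --> indep_family UNIV (insert n {..<n} - {l}) (y w))"
		unfolding Bex_def by (metis (no_types, lifting))
	from choice[OF this]
	obtain p where p0: "\<forall>l. l < n --> p l \<in> polys \<and> (\<exists>w\<in>zero_sums. p l w \<noteq> 0) \<and> (\<forall>w. p l w \<noteq> 0 --> indep_family UNIV (insert n {..<n} - {l}) (y w))"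
		by (elim exE)
	note p = p0[rule_format]
	have "(\<lambda>_. 0) \<in> zero_sums" by (simp add: zero_sums_def coeff_space_def)
	then have ne: "zero_sums \<noteq> {}" by auto
	have "\<exists>w\<in>zero_sums. \<forall>l\<in>{..<n}. p l w \<noteq> 0"
		by (rule generic_point[OF zero_sums_affine ne]) (simp_all add: p0)
	then obtain w1 where w1: "w1 \<in> zero_sums" "\<And>l. l < n ==> p l w1 \<noteq> 0" by auto
	have ind: "indep_family UNIV (insert n {..<n} - {l}) (y w1)" if "l < n" for l
		using p0 w1(2)[OF that] that by simp
	\<comment> \<open>n + 1 vectors in dimension n. A zero coefficient \<open>\<mu> l\<close> with l <
	  n would leave a dependence among the remaining vectors, which are independent by the choice of
	  \<open>w1\<close>.\<close>
	obtain \<mu> where \<mu>: "\<exists>i\<in>insert n {..<n}. \<mu> i \<noteq> 0" "\<And>j. j < n ==> (\<Sum>i\<in>insert n {..<n}. y w1 i j * \<mu> i) = 0"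
		using homogeneous_system_nontrivial[of "{..<n}" "insert n {..<n}" "\<lambda>j i. y w1 i j"] by auto
	have ycv: "y w1 i \<in> cvec_space n" if "i \<le> n" for i
		using that bc moment_cvec_space[of i w1] by (auto simp: y_def)
	have \<mu>': "(\<Sum>i<n. \<mu> i * moment w1 i j) + \<mu> n * b j = 0" for j
	proof (cases "j < n")
		case True
		have "(\<Sum>i<n. y w1 i j * \<mu> i) = (\<Sum>i<n. \<mu> i * moment w1 i j)" by (intro sum.cong refl) (auto simp: y_def)
		then show ?thesis using \<mu>(2)[OF True] by (simp add: y_def mult.commute add.commute)
	next
		case False
		have "moment w1 i j = 0" if "i < n" for i using moment_cvec_space[OF that, of w1] False by (simp add: cvec_space_def)
		then have "(\<Sum>i<n. \<mu> i * moment w1 i j) = 0" by (intro sum.neutral) auto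
		then show ?thesis using bc False by (simp add: cvec_space_def)
	qed
	have \<mu>nz: "\<mu> l \<noteq> 0" if l: "l < n" for l
	proof
		assume z: "\<mu> l = 0"
		have "(\<Sum>i\<in>insert n {..<n} - {l}. \<mu> i * y w1 i j) = 0" for j
		proof -
			have "(\<Sum>i\<in>insert n {..<n} - {l}. \<mu> i * y w1 i j) = (\<Sum>i\<in>insert n {..<n}. \<mu> i * y w1 i j)"
				by (rule sum.mono_neutral_left) (use z in auto)
			also have "\<dots> = \<mu> n * b j + (\<Sum>i<n. \<mu> i * moment w1 i j)" by (simp add: y_def)
			finally show ?thesis using \<mu>'[of j] by (simp add: add.commute)
		qed
		then have "\<mu> i = 0" if "i \<in> insert n {..<n} - {l}" for i
			using indep_familyD[OF ind[OF l], of \<mu> i] that by simp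
		then show False using \<mu>(1) z by auto
	qed
	obtain \<beta> where \<beta>: "(\<Sum>a\<in>A i0. \<beta> a) = 0" "\<And>j. b j = (\<Sum>a\<in>A i0. \<beta> a * lvec a j)"
		using span_diffs_eq[OF i0(1) b] by auto
	\<comment> \<open>Scaling block i by \<open>\<mu> i\<close> and putting the multiple of
	  \<open>b\<close> into block i0 makes the moments sum to zero.\<close>
	define w where "w p = (if p \<in> P then \<mu> (fst p) * w1 p + (if fst p = i0 then \<mu> n * \<beta> (snd p) else 0) else 0)" for p
	have ws: "(\<Sum>a\<in>A i. w (i, a) * f a) = \<mu> i * (\<Sum>a\<in>A i. w1 (i, a) * f a) + (if i = i0 then \<mu> n * (\<Sum>a\<in>A i. \<beta> a * f a) else 0)"
		if "i < n" for i f
	proof -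
		have "(\<Sum>a\<in>A i. w (i, a) * f a) = (\<Sum>a\<in>A i. \<mu> i * (w1 (i, a) * f a) + (if i = i0 then \<mu> n * (\<beta> a * f a) else 0))"
			using that by (intro sum.cong refl) (auto simp: w_def mem_P_iff algebra_simps)
		then show ?thesis by (cases "i = i0") (simp_all add: sum.distrib sum_distrib_left)
	qed
	have m: "moment w i j = \<mu> i * moment w1 i j + (if i = i0 then \<mu> n * b j else 0)" if "i < n" for i j
		using ws[OF that, of "\<lambda>a. lvec a j"] by (auto simp: moment_def \<beta>(2))
	have wrel: "w \<in> relations" unfolding relations_def
	proof (intro CollectI conjI allI impI)
		show "w \<in> coeff_space P" by (auto simp: coeff_space_def w_def)
		fix i assume i: "i < n"
		show "(\<Sum>a\<in>A i. w (i, a)) = 0"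
			using ws[OF i, of "\<lambda>_. 1"] w1(1) i \<beta>(1) by (auto simp: zero_sums_def)
	next
		fix j assume "j < n"
		have "(\<Sum>i<n. moment w i j) = (\<Sum>i<n. \<mu> i * moment w1 i j) + (\<Sum>i<n. if i = i0 then \<mu> n * b j else 0)"
			by (simp add: m sum.distrib)
		then show "(\<Sum>i<n. moment w i j) = 0" using \<mu>'[of j] i0(1) by simp
	qed
	have "indep_family UNIV {..<n} (\<lambda>i. if i = 0 then b else moment w i)"
	proof (rule indep_familyI)
		fix u i assume u: "\<And>j. j \<in> UNIV ==> (\<Sum>i<n. u i * (if i = 0 then b else moment w i) j) = 0" and i: "i \<in> {..<n}"
		\<comment> \<open>Total coefficient of \<open>b\<close>, including the contribution of block i0
		  unless i0 is the block replaced by \<open>b\<close>.\<close>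
		define s where "s = u 0 + (if i0 = 0 then 0 else u i0 * \<mu> n)"
		define v where "v i = (if i = n then s else u i * \<mu> i)" for i
		have n0: "{..<n} = insert 0 {1..<n}" using n_pos by auto
		have S0: "insert n {..<n} - {0} = insert n {1..<n}" using n_pos by auto
		have "(\<Sum>i\<in>insert n {..<n} - {0}. v i * y w1 i j) = 0" for j
		proof -
			have "0 = u 0 * b j + (\<Sum>i\<in>{1..<n}. u i * moment w i j)" using u[of j] unfolding n0 by simp
			also have "(\<Sum>i\<in>{1..<n}. u i * moment w i j) = (\<Sum>i\<in>{1..<n}. u i * \<mu> i * moment w1 i j + (if i = i0 then u i * \<mu> n * b j else 0))"
				by (intro sum.cong refl) (simp add: m algebra_simps)
			also have "\<dots> = (\<Sum>i\<in>{1..<n}. u i * \<mu> i * moment w1 i j) + (\<Sum>i\<in>{1..<n}. if i = i0 then u i * \<mu> n * b j else 0)"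
				by (simp add: sum.distrib)
			also have "(\<Sum>i\<in>{1..<n}. if i = i0 then u i * \<mu> n * b j else 0) = (if i0 = 0 then 0 else u i0 * \<mu> n * b j)"
				using i0(1) by (subst sum.delta) auto
			also have "(\<Sum>i\<in>{1..<n}. u i * \<mu> i * moment w1 i j) = (\<Sum>i\<in>{1..<n}. v i * y w1 i j)"
				by (intro sum.cong refl) (auto simp: v_def y_def)
			finally have "0 = u 0 * b j + ((\<Sum>i\<in>{1..<n}. v i * y w1 i j) + (if i0 = 0 then 0 else u i0 * \<mu> n * b j))" .
			then show ?thesis unfolding S0 by (cases "i0 = 0") (simp_all add: v_def y_def s_def algebra_simps)
		qed
		then have vz: "v i = 0" if "i \<in> insert n {..<n} - {0}" for i
			using indep_familyD[OF ind[OF n_pos], of v i] that by simp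
		have uz: "u i = 0" if "i \<in> {1..<n}" for i using vz[of i] \<mu>nz[of i] that by (auto simp: v_def)
		have "s = 0" using vz[of n] n_pos by (simp add: v_def)
		then have "u 0 = 0" using uz[of i0] i0(1) by (auto simp: s_def split: if_splits)
		then show "u i = 0" using uz[of i] i by (cases "i = 0") auto
	qed
	with b wrel show ?thesis by (intro bexI[of _ b] bexI[of _ w])
qed

end

text \<open>The values of \<open>y\<close> are mere choices, without continuity. For small t the
  equation itself bounds them, as in a Neumann series; hence they tend to \<open>y0\<close>, and the
  difference quotient, a fixed linear image of them, converges.\<close>

lemma linear_perturbation_derivative:
	fixes y :: "complex => 'u => complex"
	assumes "finite U" and ev: "\<forall>\<^sub>F t in at 0. \<forall>u\<in>U. y t u = y0 u + t * (\<Sum>u'\<in>U. c u u' * y t u')"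
		and "u \<in> U"
	shows "((\<lambda>t. (y t u - y0 u) / t) \<longlongrightarrow> (\<Sum>u'\<in>U. c u u' * y0 u')) (at 0)"
proof -
	define C where "C = (\<Sum>u\<in>U. \<Sum>u'\<in>U. norm (c u u'))"
	define S where "S t = (\<Sum>u\<in>U. norm (y t u))" for t
	define S0 where "S0 = (\<Sum>u\<in>U. norm (y0 u))"
	have C0: "0 \<le> C" unfolding C_def by (intro sum_nonneg) simp
	have le_S: "norm (y t u) \<le> S t" if "u \<in> U" for t u
		unfolding S_def using that assms(1) by (intro member_le_sum) auto
	have bd1: "(\<Sum>u'\<in>U. norm (c u u' * y t u')) \<le> (\<Sum>u'\<in>U. norm (c u u')) * S t" if "u \<in> U" for t u
		unfolding sum_distrib_right norm_mult by (intro sum_mono mult_left_mono le_S) auto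
	have rowC: "(\<Sum>u'\<in>U. norm (c u u')) \<le> C" if "u \<in> U" for u unfolding C_def using that assms(1)
		by (intro member_le_sum[of u U "\<lambda>u. \<Sum>u'\<in>U. norm (c u u')"]) (auto intro: sum_nonneg)
	\<comment> \<open>Once norm t times \<open>C\<close> is below 1/2, the occurrence of
	  \<open>S t\<close> on the right can be absorbed, which gives the factor 2.\<close>
	have bd: "\<forall>\<^sub>F t in at 0. S t \<le> 2 * S0"
	proof -
		have "((\<lambda>t::complex. norm t * C) \<longlongrightarrow> norm (0::complex) * C) (at 0)" by (intro tendsto_intros)
		then have "\<forall>\<^sub>F t in at (0::complex). norm t * C < 1/2" by (rule order_tendstoD(2)) simp
		with ev show ?thesis
		proof eventually_elim
			case (elim t)
			have "S t \<le> (\<Sum>u\<in>U. norm (y0 u) + norm t * ((\<Sum>u'\<in>U. norm (c u u')) * S t))" unfolding S_def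
			proof (rule sum_mono)
				fix u assume u: "u \<in> U"
				have "norm (y t u) \<le> norm (y0 u) + norm (t * (\<Sum>u'\<in>U. c u u' * y t u'))"
					using elim(1) u norm_triangle_ineq by metis
				also have "norm (t * (\<Sum>u'\<in>U. c u u' * y t u')) \<le> norm t * (\<Sum>u'\<in>U. norm (c u u' * y t u'))"
					unfolding norm_mult[of t] by (intro mult_left_mono sum_norm_le) auto
				also have "\<dots> \<le> norm t * ((\<Sum>u'\<in>U. norm (c u u')) * S t)" by (intro mult_left_mono bd1 u) simp
				finally show "norm (y t u) \<le> norm (y0 u) + norm t * ((\<Sum>u'\<in>U. norm (c u u')) * (\<Sum>u\<in>U. norm (y t u)))"
					by (simp add: S_def)
			qed
			also have "\<dots> = S0 + (norm t * C) * S t"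
				by (simp add: sum.distrib S0_def C_def sum_distrib_left[symmetric] sum_distrib_right[symmetric] mult.assoc)
			also have "\<dots> \<le> S0 + (1/2) * S t"
			proof -
				have "0 \<le> S t" unfolding S_def by (intro sum_nonneg) simp
				then have "(norm t * C) * S t \<le> (1/2) * S t" using elim(2) by (intro mult_right_mono) auto
				then show ?thesis by simp
			qed
			finally show ?case by simp
		qed
	qed
	have conv: "((\<lambda>t. y t v) \<longlongrightarrow> y0 v) (at 0)" if v: "v \<in> U" for v
	proof -
		have "((\<lambda>t. y t v - y0 v) \<longlongrightarrow> 0) (at 0)"
		proof (rule Lim_null_comparison)
			show "\<forall>\<^sub>F t in at 0. norm (y t v - y0 v) \<le> norm t * (C * (2 * S0))" using ev bd
			proof eventually_elim
				case (elim t)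
				have "y t v - y0 v = t * (\<Sum>u'\<in>U. c v u' * y t u')" using elim(1) v by (metis add_diff_cancel_left')
				then have "norm (y t v - y0 v) = norm t * norm (\<Sum>u'\<in>U. c v u' * y t u')" by (simp add: norm_mult)
				also have "\<dots> \<le> norm t * (C * (2 * S0))"
				proof (rule mult_left_mono)
					have "norm (\<Sum>u'\<in>U. c v u' * y t u') \<le> (\<Sum>u'\<in>U. norm (c v u' * y t u'))" by (rule norm_sum)
					also have "\<dots> \<le> (\<Sum>u'\<in>U. norm (c v u')) * S t" by (rule bd1[OF v])
					also have "\<dots> \<le> C * (2 * S0)"
						by (rule mult_mono[OF rowC[OF v] elim(2) C0]) (simp add: S_def sum_nonneg)
					finally show "norm (\<Sum>u'\<in>U. c v u' * y t u') \<le> C * (2 * S0)" .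
				qed simp
				finally show ?case .
			qed
			have "((\<lambda>t::complex. norm t * (C * (2 * S0))) \<longlongrightarrow> norm (0::complex) * (C * (2 * S0))) (at 0)"
				by (intro tendsto_intros)
			then show "((\<lambda>t::complex. norm t * (C * (2 * S0))) \<longlongrightarrow> 0) (at 0)" by simp
		qed
		then show ?thesis by (simp add: LIM_zero_iff)
	qed
	have "((\<lambda>t. \<Sum>u'\<in>U. c u u' * y t u') \<longlongrightarrow> (\<Sum>u'\<in>U. c u u' * y0 u')) (at 0)"
		by (intro tendsto_sum tendsto_mult tendsto_const conv)
	moreover have "\<forall>\<^sub>F t in at 0. (y t u - y0 u) / t = (\<Sum>u'\<in>U. c u u' * y t u')"
		using ev eventually_neq_at_within[of 0]
	proof eventually_elim
		case (elim t)
		then have "y t u - y0 u = t * (\<Sum>u'\<in>U. c u u' * y t u')" using assms(3) by (metis add_diff_cancel_left')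
		then show ?case using elim(2) by simp
	qed
	ultimately show ?thesis by (simp cong: tendsto_cong)
qed

lemma polynomial_interpolation:
	fixes F :: "complex => complex"
	assumes "finite S"
	shows "\<exists>q. \<forall>x\<in>S. poly q x = F x" using assms
proof (induction S rule: finite_induct)
	case empty
	show ?case by simp
next
	case (insert x S)
	then obtain q where q: "\<forall>x\<in>S. poly q x = F x" by auto
	define r where "r = (\<Prod>s\<in>S. [:- s, 1:])"
	have r: "poly r z = (\<Prod>s\<in>S. z - s)" for z by (simp add: r_def poly_prod)
	have "poly r x \<noteq> 0" using insert.hyps by (auto simp: r)
	moreover have "poly r z = 0" if "z \<in> S" for z using that insert.hyps(1) by (auto simp: r)
	ultimately show ?case using q
		by (intro exI[of _ "q + smult ((F x - poly q x) / poly r x) r"]) auto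
qed

section \<open>Vectors transversal to the moment hyperplane\<close>

context finite_tuple
begin

text \<open>For a relation the moment of index 0 is minus the sum of the others, so its slot is free
  for \<open>b\<close>: the condition says that the relation is proper and that \<open>b\<close>
  lies outside the hyperplane spanned by its moments.\<close>

definition transversal :: "(nat => complex) => (term_index => complex) => bool" where
	"transversal b w \<longleftrightarrow> indep_family UNIV {..<n} (\<lambda>i. if i = 0 then b else moment w i)"

lemma transversal_open:
	assumes "transversal b w0"
	shows "\<exists>p\<in>polynomial_functions. p w0 \<noteq> 0 \<and> (\<forall>w. p w \<noteq> 0 --> transversal b w)"
	unfolding transversal_def
proof (rule indep_family_open)
	show "(\<lambda>c. (if i = 0 then b else moment c i) j) \<in> polys" for i j
		by (cases "i = 0") (simp_all add: moment_polynomial polynomial_functions.const)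
qed (use assms in \<open>simp_all add: transversal_def\<close>)

lemma transversal_indep: "transversal b w ==> indep_family UNIV {1..<n} (moment w)"
proof -
	assume "transversal b w"
	then have "indep_family UNIV {1..<n} (\<lambda>i. if i = 0 then b else moment w i)"
		unfolding transversal_def by (rule indep_family_subset) auto
	then show ?thesis by (subst indep_family_cong[where v' = "\<lambda>i. if i = 0 then b else moment w i"]) auto
qed

lemma transversal_proper: "w \<in> relations ==> transversal b w ==> w \<in> proper_relations"
	by (rule proper_relationsI[OF _ transversal_indep])

lemma transversalI:
	assumes "0 < n" "indep_family UNIV {1..<n} (moment w)"
		"\<And>i. i \<in> {1..<n} ==> dot h (moment w i) = 0" "dot h b \<noteq> 0"
	shows "transversal b w" unfolding transversal_def
proof (rule indep_familyI)
	have n0: "{..<n} = insert 0 {1..<n}" using assms(1) by auto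
	fix u i assume u: "\<And>j. j \<in> UNIV ==> (\<Sum>i<n. u i * (if i = 0 then b else moment w i) j) = 0" and i: "i \<in> {..<n}"
	have e: "u 0 * b j + (\<Sum>i\<in>{1..<n}. u i * moment w i j) = 0" for j
		using u[of j] unfolding n0 by simp
	have "(\<Sum>j<n. h j * (u 0 * b j + (\<Sum>i\<in>{1..<n}. u i * moment w i j)))
			= u 0 * dot h b + (\<Sum>j<n. \<Sum>i\<in>{1..<n}. u i * (h j * moment w i j))"
		by (simp add: distrib_left sum.distrib sum_distrib_left ac_simps)
	also have "(\<Sum>j<n. \<Sum>i\<in>{1..<n}. u i * (h j * moment w i j)) = (\<Sum>i\<in>{1..<n}. u i * dot h (moment w i))"
		by (subst sum.swap) (simp add: sum_distrib_left)
	also have "\<dots> = 0" using assms(3) by simp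
	finally have "u 0 * dot h b = 0" by (simp only: e) simp
	then have u0: "u 0 = 0" using assms(4) by simp
	have "u i = 0" if "i \<in> {1..<n}" for i using indep_familyD[OF assms(2), of u i] e u0 that by simp
	then show "u i = 0" using u0 i by (cases "i = 0") auto
qed

text \<open>A vector killed by the covector is a combination of the moments of index at least
  1.\<close>

lemma transversal_covector:
	assumes "0 < n" "w \<in> relations" "transversal b w" "b \<in> cvec_space n"
		"j0 < n" "h j0 \<noteq> 0" "\<And>i. i < n ==> dot h (moment w i) = 0"
	shows "dot h b \<noteq> 0"
proof
	assume "dot h b = 0"
	then obtain \<mu> where \<mu>: "\<And>j. b j = (\<Sum>i\<in>{1..<n}. \<mu> i * moment w i j)"
		using kernel_of_covector[OF transversal_proper[OF assms(2,3)] assms(1,5,6,7,4)] by auto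
	have n0: "{..<n} = insert 0 {1..<n}" using assms(1) by auto
	have "(\<Sum>i<n. (if i = 0 then - 1 else \<mu> i) * (if i = 0 then b else moment w i) j) = 0" for j
	proof -
		have "(\<Sum>i\<in>{1..<n}. (if i = 0 then - 1 else \<mu> i) * (if i = 0 then b else moment w i) j) = (\<Sum>i\<in>{1..<n}. \<mu> i * moment w i j)"
			by (rule sum.cong) auto
		then show ?thesis unfolding n0 using \<mu>[of j] by simp
	qed
	then have "(if (0::nat) = 0 then - 1 else \<mu> 0) = (0::complex)"
		by (rule indep_familyD[OF assms(3)[unfolded transversal_def], where u = "\<lambda>i. if i = 0 then - 1 else \<mu> i"])
			(use assms(1) in simp)
	then show False by simp
qed

text \<open>Each condition is open and nonempty on the affine space of relations, so finitely many
  hold at once.\<close>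

lemma transversal_generic:
	assumes "finite B" "\<And>b. b \<in> B ==> \<exists>w\<in>relations. transversal b w"
	shows "\<exists>w\<in>relations. \<forall>b\<in>B. transversal b w"
proof -
	have "\<forall>b. \<exists>p. b \<in> B --> p \<in> polys \<and> (\<exists>w\<in>relations. p w \<noteq> 0) \<and> (\<forall>w. p w \<noteq> 0 --> transversal b w)"
	proof
		fix b
		show "\<exists>p. b \<in> B --> p \<in> polys \<and> (\<exists>w\<in>relations. p w \<noteq> 0) \<and> (\<forall>w. p w \<noteq> 0 --> transversal b w)"
		proof (cases "b \<in> B")
			case True
			then obtain w where w: "w \<in> relations" "transversal b w" using assms(2) by auto
			obtain p where "p \<in> polys" "p w \<noteq> 0" "\<forall>w. p w \<noteq> 0 --> transversal b w"
				using transversal_open[OF w(2)] by (elim bexE conjE)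
			then show ?thesis using w(1) by (intro exI[of _ p]) auto
		qed simp
	qed
	from choice[OF this]
	obtain p where p: "\<forall>b. b \<in> B --> p b \<in> polys \<and> (\<exists>w\<in>relations. p b w \<noteq> 0) \<and> (\<forall>w. p b w \<noteq> 0 --> transversal b w)"
		by (elim exE)
	have ne: "relations \<noteq> {}" using relations_zero by auto
	have "\<exists>w\<in>relations. \<forall>b\<in>B. p b w \<noteq> 0"
		by (rule generic_point[OF relations_affine ne assms(1)]) (simp add: p)
	then obtain w where "w \<in> relations" "\<forall>b\<in>B. p b w \<noteq> 0" by (elim bexE)
	then show ?thesis using p by (intro bexI[of _ w]) simp_all
qed

lemma functional_span_zero:
	assumes "\<And>x. x \<in> S ==> dot h x = 0" "x \<in> cfun.span S"
	shows "dot h x = 0" using assms(2)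
proof (induction rule: cfun.span_induct_alt)
	case (step c x y)
	have "(\<Sum>j<n. h j * ((\<lambda>i. c * x i) + y) j) = c * dot h x + dot h y"
		by (simp add: distrib_left sum.distrib sum_distrib_left ac_simps)
	then show ?case using step assms(1) by simp
qed simp

section \<open>Null functions of a relation\<close>

lemma pairing_moment:
	"(\<Sum>a\<in>A i. w (i, a) * covec h a) = dot h (moment w i)"
	unfolding moment_def sum_distrib_left by (subst sum.swap) (simp add: ac_simps)

text \<open>The radical of the symmetric form given by the sum of w p * f p * g p on affine
  functions. For a relation \<open>w\<close> these are the directions in which the parametrization
  of the discriminant degenerates at \<open>w\<close>.\<close>

definition null_functions :: "(term_index => complex) => (term_index => complex) set" where
	"null_functions w = {f. linear_on_P f \<and> (\<forall>g. linear_on_P g --> (\<Sum>p\<in>P. w p * f p * g p) = 0)}"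

definition nonconstant :: "(term_index => complex) => bool" where
	"nonconstant f \<longleftrightarrow> (\<exists>p\<in>P. \<exists>q\<in>P. f p \<noteq> f q)"

lemma null_functions_add_scale:
	assumes "f \<in> null_functions w" "g \<in> null_functions w"
	shows "(\<lambda>p. \<alpha> * f p + \<beta> * g p) \<in> null_functions w"
proof -
	have "(\<Sum>p\<in>P. w p * (\<alpha> * f p + \<beta> * g p) * k p) = \<alpha> * (\<Sum>p\<in>P. w p * f p * k p) + \<beta> * (\<Sum>p\<in>P. w p * g p * k p)" for k
		by (simp add: algebra_simps sum.distrib sum_distrib_left)
	then show ?thesis using assms by (auto simp: null_functions_def intro!: linear_on_P_add linear_on_P_scale)
qed

lemma null_functions_const:
	assumes "w \<in> relations"
	shows "(\<lambda>p. z) \<in> null_functions w"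
proof -
	have "(\<Sum>p\<in>P. w p * z * g p) = z * (\<Sum>p\<in>P. w p * g p)" for g
		by (simp add: sum_distrib_left ac_simps)
	then show ?thesis using relations_pairing[OF assms] by (simp add: null_functions_def linear_on_P_const)
qed

lemma null_functions_covector:
	assumes "w \<in> relations" "f \<in> null_functions w"
		and rep: "\<And>i a. i < n ==> a \<in> A i ==> f (i, a) = \<eta> i + covec \<xi> a" and i: "i < n"
	shows "dot \<xi> (moment w i) = 0"
proof -
	define g :: "term_index => complex" where "g p = (if fst p = i then 1 else 0)" for p
	have "linear_on_P g" unfolding linear_on_P_def
		by (intro exI[of _ "\<lambda>_. 0"] exI[of _ "\<lambda>l. if l = i then 1 else 0"]) (simp add: g_def)
	then have "0 = (\<Sum>p\<in>P. w p * f p * g p)" using assms(2) by (simp add: null_functions_def)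
	also have "\<dots> = (\<Sum>l<n. \<Sum>a\<in>A l. w (l, a) * f (l, a) * (if l = i then 1 else 0))"
		by (simp add: sum_P g_def)
	also have "\<dots> = (\<Sum>l<n. if l = i then (\<Sum>a\<in>A l. w (l, a) * f (l, a)) else 0)"
		by (intro sum.cong refl) auto
	also have "\<dots> = (\<Sum>a\<in>A i. w (i, a) * f (i, a))" using i by simp
	also have "\<dots> = (\<Sum>a\<in>A i. w (i, a) * \<eta> i + w (i, a) * covec \<xi> a)"
		using i by (intro sum.cong refl) (simp add: rep distrib_left)
	also have "\<dots> = (\<Sum>a\<in>A i. w (i, a)) * \<eta> i + (\<Sum>a\<in>A i. w (i, a) * covec \<xi> a)"
		by (simp add: sum.distrib sum_distrib_right)
	also have "\<dots> = dot \<xi> (moment w i)" using assms(1) i by (simp add: relations_def pairing_moment)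
	finally show ?thesis by simp
qed

text \<open>Pairing with the coordinate functions turns the block constants into coefficients of a
  dependence among the moments, and for a proper relation these are all equal.\<close>

lemma null_functions_const_if_no_covector:
	assumes "w \<in> proper_relations" "f \<in> null_functions w"
		and rep: "\<And>i a. i < n ==> a \<in> A i ==> f (i, a) = \<eta> i" and "i < n"
	shows "\<eta> i = \<eta> 0"
proof -
	have "(\<Sum>i<n. \<eta> i * moment w i j) = 0" if "j < n" for j
	proof -
		define g :: "term_index => complex" where "g p = lvec (snd p) j" for p
		have "linear_on_P g" unfolding linear_on_P_def
			by (intro exI[of _ "\<lambda>l. if l = j then 1 else 0"] exI[of _ "\<lambda>_. 0"])
				 (use that in \<open>simp add: g_def if_distrib[of "\<lambda>x. x * _"] cong: if_cong\<close>)
		then have "0 = (\<Sum>p\<in>P. w p * f p * g p)" using assms(2) by (simp add: null_functions_def)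
		also have "\<dots> = (\<Sum>i<n. \<eta> i * moment w i j)"
			unfolding sum_P moment_def sum_distrib_left by (intro sum.cong refl) (simp add: rep g_def)
		finally show ?thesis by simp
	qed
	then show ?thesis using assms(1,4) by (simp add: proper_relations_def)
qed

lemma nonconstant_covector:
	assumes "w \<in> proper_relations" "f \<in> null_functions w" "nonconstant f"
		and rep: "\<And>i a. i < n ==> a \<in> A i ==> f (i, a) = \<eta> i + covec \<xi> a"
	shows "\<exists>j<n. \<xi> j \<noteq> 0"
proof (rule ccontr)
	assume "\<not> ?thesis"
	then have fe: "f (i, a) = \<eta> i" if "i < n" "a \<in> A i" for i a using rep[OF that] by simp
	have e: "\<eta> i = \<eta> 0" if "i < n" for i
		by (rule null_functions_const_if_no_covector[OF assms(1,2) fe that])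
	have fc: "f p = \<eta> 0" if "p \<in> P" for p
	proof -
		obtain i a where p: "p = (i, a)" by (cases p)
		then have "i < n" "a \<in> A i" using that by (simp_all add: mem_P_iff)
		then show ?thesis using fe e[of i] by (simp add: p)
	qed
	obtain p q where "p \<in> P" "q \<in> P" "f p \<noteq> f q" using assms(3) unfolding nonconstant_def by (elim bexE)
	then show False using fc by simp
qed

text \<open>Linear parts are multiples of the covector, unique up to scaling; subtracting a multiple
  of \<theta> leaves block constants, and these are equal.\<close>

lemma null_functions_dim_le_2:
	assumes "0 < n" "w \<in> proper_relations" "\<theta> \<in> null_functions w" "nonconstant \<theta>" "f \<in> null_functions w"
	shows "\<exists>\<alpha> \<beta>. \<forall>p\<in>P. f p = \<alpha> * \<theta> p + \<beta>"
proof -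
	have wr: "w \<in> relations" using assms(2) by (simp add: proper_relations_def)
	obtain \<xi> \<eta> where \<theta>: "\<And>i a. i < n ==> a \<in> A i ==> \<theta> (i, a) = \<eta> i + covec \<xi> a"
		using assms(3) by (auto simp: null_functions_def linear_on_P_def)
	obtain \<xi>' \<eta>' where f: "\<And>i a. i < n ==> a \<in> A i ==> f (i, a) = \<eta>' i + covec \<xi>' a"
		using assms(5) by (auto simp: null_functions_def linear_on_P_def)
	obtain j0 where j0: "j0 < n" "\<xi> j0 \<noteq> 0" using nonconstant_covector[OF assms(2-4) \<theta>] by auto
	define c where "c = \<xi>' j0 / \<xi> j0"
	have c: "\<xi>' j = c * \<xi> j" if "j < n" for j
		using covector_unique[OF assms(2,1) j0 null_functions_covector[OF wr assms(3) \<theta>] null_functions_covector[OF wr assms(5) f]] that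
		by (simp add: c_def)
	have nf: "(\<lambda>p. 1 * f p + (- c) * \<theta> p) \<in> null_functions w"
		by (rule null_functions_add_scale[OF assms(5,3)])
	have ce: "1 * f (i, a) + (- c) * \<theta> (i, a) = \<eta>' i - c * \<eta> i" if "i < n" "a \<in> A i" for i a
	proof -
		have "covec \<xi>' a = c * covec \<xi> a"
			unfolding sum_distrib_left by (intro sum.cong refl) (simp add: c)
		then show ?thesis by (simp add: f[OF that] \<theta>[OF that] algebra_simps)
	qed
	have e: "\<eta>' i - c * \<eta> i = \<eta>' 0 - c * \<eta> 0" if "i < n" for i
		by (rule null_functions_const_if_no_covector[OF assms(2) nf ce that])
	have "f p = c * \<theta> p + (\<eta>' 0 - c * \<eta> 0)" if "p \<in> P" for p
	proof -
		obtain i a where p: "p = (i, a)" by (cases p)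
		then have ia: "i < n" "a \<in> A i" using that by (simp_all add: mem_P_iff)
		have "1 * f (i, a) + (- c) * \<theta> (i, a) = \<eta>' 0 - c * \<eta> 0" using ce[OF ia] e[OF ia(1)] by simp
		then show ?thesis by (simp add: p algebra_simps)
	qed
	then show ?thesis by blast
qed

end

lemma tail_psubset:
	assumes "0 < n"
	shows "{1..<n} \<subset> {..<n::nat}"
proof (rule psubsetI)
	have "0 \<in> {..<n}" "0 \<notin> {1..<n}" using assms by simp_all
	then show "{1..<n} \<noteq> {..<n}" by metis
qed auto

section \<open>Transversality to vectors outside the span of K\<close>

context simple_finite_tuple
begin

text \<open>By genericity one relation serves all blocks outside \<open>K\<close>; it is proper
  because there is at least one such block.\<close>

lemma transversal_vectors_exist:
	"\<exists>b. \<exists>w\<in>relations. (\<forall>i. i < n --> i \<notin> K --> b i \<in> cfun.span (diffs {i}) \<and> transversal (b i) w) \<and> w \<in> proper_relations"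
proof -
	have "\<forall>i. \<exists>b. i < n \<and> i \<notin> K --> b \<in> cfun.span (diffs {i}) \<and> (\<exists>w\<in>relations. transversal b w)"
	proof
		fix i
		show "\<exists>b. i < n \<and> i \<notin> K --> b \<in> cfun.span (diffs {i}) \<and> (\<exists>w\<in>relations. transversal b w)"
		proof (cases "i < n \<and> i \<notin> K")
			case True
			then have "\<exists>b\<in>cfun.span (diffs {i}). \<exists>w\<in>relations. transversal b w"
				using proper_relation_avoiding[of i] unfolding transversal_def by simp
			then obtain b where "b \<in> cfun.span (diffs {i})" "\<exists>w\<in>relations. transversal b w" by (rule bexE)
			then show ?thesis by (intro exI[of _ b]) simp
		next
			case False
			then show ?thesis by (simp only: simp_thms)
		qed
	qed
	from choice[OF this] obtain b where b: "\<forall>i. i < n \<and> i \<notin> K --> b i \<in> cfun.span (diffs {i}) \<and> (\<exists>w\<in>relations. transversal (b i) w)"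
		by (elim exE)
	have "\<exists>w\<in>relations. \<forall>x\<in>b ` ({..<n} - K). transversal x w"
		by (rule transversal_generic) (use b in auto)
	then obtain w where w: "w \<in> relations" "\<forall>x\<in>b ` ({..<n} - K). transversal x w" by (elim bexE)
	obtain i where "i < n" "i \<notin> K" using K_psubset by auto
	then have "transversal (b i) w" using w(2) by simp
	then have "w \<in> proper_relations" by (rule transversal_proper[OF w(1)])
	then show ?thesis using w b by (intro exI[of _ b] bexI[of _ w]) auto
qed

text \<open>Moving w inside the relations moves its covector in all directions annihilating the
	span of K; to first order this is the solvability of a linear system dual to the existence
	of \<psi> below.\<close>

lemma transversal_exists:
	assumes b: "b \<in> cvec_space n" "b \<notin> spanK"
	shows "\<exists>w\<in>relations. transversal b w"
proof (rule ccontr)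
	assume contra: "\<not> ?thesis"
	obtain c w where cw0: "w \<in> relations" "w \<in> proper_relations"
		"\<forall>i. i < n --> i \<notin> K --> c i \<in> cfun.span (diffs {i}) \<and> transversal (c i) w"
		using transversal_vectors_exist by (elim exE bexE conjE)
	note cw = cw0(1,2) cw0(3)[rule_format]
	obtain h where h0: "(\<exists>j<n. h j \<noteq> 0) \<and> (\<forall>i<n. dot h (moment w i) = 0)"
		using covector_exists[OF cw(1) n_pos] by (elim exE)
	note h = conjunct1[OF h0] conjunct2[OF h0]
	obtain j0 where j0: "j0 < n" "h j0 \<noteq> 0" using h(1) by auto
	have hm: "dot h (moment w i) = 0" if "i < n" for i using h(2) that by simp
	have n0: "{..<n} = insert 0 {1..<n}" using n_pos by auto
	have ind: "indep_family UNIV {1..<n} (moment w)"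
		by (rule proper_relations_indep[OF cw(2) tail_psubset[OF n_pos]])
	have tI: "transversal x w" if "dot h x \<noteq> 0" for x
		by (rule transversalI[OF n_pos ind _ that]) (simp add: hm)
	have hb: "dot h b = 0" using tI[of b] contra cw(1) by auto
	have "\<exists>\<mu>. \<forall>j. b j = (\<Sum>i\<in>{1..<n}. \<mu> i * moment w i j)"
		by (rule kernel_of_covector[OF cw(2) n_pos j0 _ b(1) hb]) (rule hm)
	then obtain \<mu>0 where \<mu>0: "\<forall>j. b j = (\<Sum>i\<in>{1..<n}. \<mu>0 i * moment w i j)" by (elim exE)
	define \<mu> where "\<mu> = \<mu>0(0 := 0)"
	have bm: "b j = (\<Sum>i\<in>{1..<n}. \<mu> i * moment w i j)" for j
	proof -
		have "(\<Sum>i\<in>{1..<n}. \<mu> i * moment w i j) = (\<Sum>i\<in>{1..<n}. \<mu>0 i * moment w i j)"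
			by (rule sum.cong) (auto simp: \<mu>_def)
		then show ?thesis using \<mu>0 by simp
	qed
	have m_add: "moment (\<lambda>p. w p + t * d p) i j = moment w i j + t * moment d i j" for t d i j
		by (simp add: moment_def distrib_right sum.distrib sum_distrib_left mult.assoc)
	\<comment> \<open>A nonzero value would make \<open>x\<close>, the combination of the moments of
	  \<open>d\<close> with coefficients \<mu>, transversal to w + t d for some t \<noteq> 0. Now
	  \<open>b\<close> is the same combination of the moments of w + t d, minus t x, so it would be
	  transversal as well.\<close>
	have dual: "(\<Sum>i\<in>{1..<n}. \<mu> i * dot h (moment d i)) = 0" if d: "d \<in> relations" for d
	proof (rule ccontr)
		assume nz: "(\<Sum>i\<in>{1..<n}. \<mu> i * dot h (moment d i)) \<noteq> 0"
		define x where "x j = (\<Sum>i\<in>{1..<n}. \<mu> i * moment d i j)" for j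
		have hx: "dot h x = (\<Sum>i\<in>{1..<n}. \<mu> i * dot h (moment d i))"
			unfolding x_def sum_distrib_left by (subst sum.swap) (simp add: ac_simps)
		have "transversal x w" by (rule tI, rule notI, rule notE[OF nz]) (simp only: hx[symmetric])
		from transversal_open[OF this]
		obtain p where p: "p \<in> polys" "p w \<noteq> 0" "\<forall>w. p w \<noteq> 0 --> transversal x w" by (elim bexE conjE)
		have "\<forall>\<^sub>F t in at 0. p (\<lambda>q. w q + t * d q) \<noteq> 0" by (rule eventually_nonzero_on_line[of p w d, OF p(1,2)])
		then have "\<forall>\<^sub>F t in at 0. t \<noteq> 0 \<and> p (\<lambda>q. w q + t * d q) \<noteq> 0"
			using eventually_neq_at_within[of "0::complex" 0 UNIV] by (rule eventually_conj[rotated])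
		then have "\<exists>t. t \<noteq> 0 \<and> p (\<lambda>q. w q + t * d q) \<noteq> 0" by (rule eventually_happens'[rotated]) simp
		then obtain t where t: "t \<noteq> 0" "p (\<lambda>q. w q + t * d q) \<noteq> 0" by (elim exE conjE)
		let ?w = "\<lambda>q. w q + t * d q"
		have tx: "transversal x ?w" using p(3) t(2) by simp
		have wr: "?w \<in> relations" by (rule relations_add_scale[OF cw(1) d])
		have "transversal b ?w" unfolding transversal_def
		proof (rule indep_familyI)
			fix u i assume u: "\<And>j. j \<in> UNIV ==> (\<Sum>i<n. u i * (if i = 0 then b else moment ?w i) j) = 0" and i: "i \<in> {..<n}"
			define v where "v i = (if i = 0 then - t * u 0 else u i + u 0 * \<mu> i)" for i
			have "(\<Sum>i<n. v i * (if i = 0 then x else moment ?w i) j) = 0" for j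
			proof -
				have b': "b j = (\<Sum>i\<in>{1..<n}. \<mu> i * moment ?w i j) - t * x j"
					by (simp add: bm m_add x_def distrib_left sum.distrib sum_distrib_left ac_simps)
				have "(\<Sum>i<n. v i * (if i = 0 then x else moment ?w i) j)
					= - t * u 0 * x j + (\<Sum>i\<in>{1..<n}. v i * moment ?w i j)" unfolding n0 by (simp add: v_def)
				also have "(\<Sum>i\<in>{1..<n}. v i * moment ?w i j) = (\<Sum>i\<in>{1..<n}. u i * moment ?w i j + u 0 * (\<mu> i * moment ?w i j))"
					by (intro sum.cong refl) (simp add: v_def algebra_simps)
				also have "\<dots> = (\<Sum>i\<in>{1..<n}. u i * moment ?w i j) + u 0 * (\<Sum>i\<in>{1..<n}. \<mu> i * moment ?w i j)"
					by (simp add: sum.distrib sum_distrib_left)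
				also have "- t * u 0 * x j + \<dots> = u 0 * b j + (\<Sum>i\<in>{1..<n}. u i * moment ?w i j)"
					unfolding b' by (simp add: algebra_simps)
				also have "\<dots> = (\<Sum>i<n. u i * (if i = 0 then b else moment ?w i) j)" unfolding n0 by simp
				finally show ?thesis using u[of j] by simp
			qed
			then have vz: "v i = 0" if "i < n" for i
				using indep_familyD[OF tx[unfolded transversal_def], of v i] that by simp
			have "u 0 = 0" using vz[of 0] n_pos t(1) by (simp add: v_def)
			then show "u i = 0" using vz[of i] i by (cases "i = 0") (auto simp: v_def)
		qed
		then show False using contra wr by auto
	qed
	\<comment> \<open>By \<open>dual\<close> this function is orthogonal to every relation and hence
	  affine: scaling \<open>h\<close> blockwise by \<mu> yields, up to block constants, one linear
	  form \<psi>. It kills the moments of \<open>w\<close>, so it is a multiple of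
	  \<open>h\<close>.\<close>
	define g where "g p = \<mu> (fst p) * covec h (snd p)" for p
	have "linear_on_P g"
	proof (rule linear_on_P_if_orthogonal)
		fix d assume d: "d \<in> relations"
		have "(\<Sum>p\<in>P. d p * g p) = (\<Sum>i<n. \<mu> i * dot h (moment d i))"
			unfolding sum_P pairing_moment[symmetric] sum_distrib_left[of "\<mu> _"]
			by (intro sum.cong refl) (simp add: g_def)
		also have "\<dots> = (\<Sum>i\<in>{1..<n}. \<mu> i * dot h (moment d i))" unfolding n0 by (simp add: \<mu>_def)
		finally show "(\<Sum>p\<in>P. d p * g p) = 0" using dual[OF d] by simp
	qed
	then obtain \<psi> \<eta> where g0: "\<forall>i<n. \<forall>a\<in>A i. g (i, a) = \<eta> i + covec \<psi> a"
		unfolding linear_on_P_def by (elim exE)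
	have g: "\<mu> i * covec h a = \<eta> i + covec \<psi> a" if "i < n" "a \<in> A i" for i a
		using g0 that by (simp add: g_def)
	have zs: "(\<Sum>a\<in>A i. w (i, a)) = 0" if "i < n" for i using cw(1) that by (simp add: relations_def)
	have "dot \<psi> (moment w i) = 0" if i: "i < n" for i
	proof -
		have "dot \<psi> (moment w i) = (\<Sum>a\<in>A i. w (i, a) * (\<mu> i * covec h a - \<eta> i))"
			unfolding pairing_moment[symmetric] by (intro sum.cong refl) (simp add: g[OF i])
		also have "\<dots> = \<mu> i * (\<Sum>a\<in>A i. w (i, a) * covec h a) - (\<Sum>a\<in>A i. w (i, a)) * \<eta> i"
			by (simp add: right_diff_distrib sum_subtractf sum_distrib_left sum_distrib_right ac_simps)
		also have "\<dots> = 0" by (simp add: pairing_moment hm[OF i] zs[OF i])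
		finally show ?thesis .
	qed
	then have "\<forall>j<n. \<psi> j = (\<psi> j0 / h j0) * h j" by (intro covector_unique[OF cw(2) n_pos j0 hm])
	then have \<psi>: "\<psi> j = (\<psi> j0 / h j0) * h j" if "j < n" for j using that by simp
	define s where "s = \<psi> j0 / h j0"
	\<comment> \<open>If \<open>\<mu> i\<close> differs from \<open>s\<close>, then \<open>h\<close> is
	  constant on A i and kills \<open>c i\<close>, against the transversality of
	  \<open>c i\<close>.\<close>
	have \<mu>s: "\<mu> i = s" if i: "i < n" "i \<notin> K" for i
	proof (rule ccontr)
		assume ne: "\<mu> i \<noteq> s"
		have e: "(\<mu> i - s) * covec h a = \<eta> i" if a: "a \<in> A i" for a
		proof -
			have "covec \<psi> a = s * covec h a"
				unfolding sum_distrib_left by (intro sum.cong refl) (use \<psi> in \<open>simp add: s_def\<close>)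
			then show ?thesis using g[OF i(1) a] by (simp add: algebra_simps)
		qed
		have "dot h x = 0" if "x \<in> diffs {i}" for x
		proof -
			obtain a a' where a: "a \<in> A i" "a' \<in> A i" and x: "x = (\<lambda>j. lvec a j - lvec a' j)"
				using \<open>x \<in> diffs {i}\<close> by (auto simp: diffs_def)
			have "(\<mu> i - s) * covec h a = (\<mu> i - s) * covec h a'" using e[OF a(1)] e[OF a(2)] by simp
			then show ?thesis using ne by (simp add: x right_diff_distrib sum_subtractf)
		qed
		moreover have ci: "c i \<in> cfun.span (diffs {i})" using cw(3)[OF i] by (rule conjunct1)
		ultimately have "(\<Sum>j<n. h j * c i j) = 0" by (rule functional_span_zero)
		moreover have "c i \<in> cvec_space n"
			using cw(3)[OF i] span_subset_cvec_space[OF diffs_cvec_space[of "{i}"]] i(1) by auto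
		moreover have "(\<Sum>j<n. h j * c i j) \<noteq> 0" if "c i \<in> cvec_space n"
			by (rule transversal_covector[OF n_pos cw(1) _ that j0 hm]) (use cw(3)[OF i] in simp)
		ultimately show False by simp
	qed
	\<comment> \<open>Subtracting \<open>s\<close> times the total moment, which is zero, leaves only
	  the blocks in \<open>K\<close>.\<close>
	have "b = (\<Sum>i\<in>K. (\<lambda>j. (\<mu> i - s) * moment w i j))"
	proof
		fix j
		have mz: "(\<Sum>i<n. moment w i j) = 0"
		proof (cases "j < n")
			case False
			have "moment w i j = 0" if "i < n" for i using moment_cvec_space[OF that, of w] False by (simp add: cvec_space_def)
			then show ?thesis by (intro sum.neutral) auto
		qed (use cw(1) in \<open>simp add: relations_def\<close>)
		have "b j = (\<Sum>i<n. \<mu> i * moment w i j)" unfolding bm n0 by (simp add: \<mu>_def)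
		also have "\<dots> = (\<Sum>i<n. (\<mu> i - s) * moment w i j)"
			using mz by (simp add: left_diff_distrib sum_subtractf sum_distrib_left[symmetric])
		also have "\<dots> = (\<Sum>i\<in>K. (\<mu> i - s) * moment w i j)"
			by (rule sum.mono_neutral_right) (use K_psubset \<mu>s in auto)
		finally show "b j = (\<Sum>i\<in>K. (\<lambda>j. (\<mu> i - s) * moment w i j)) j" by (simp add: sum_fun_apply)
	qed
	also have "\<dots> \<in> spanK"
	proof (intro cfun.span_sum cfun.span_scale)
		fix i assume i: "i \<in> K"
		then have "i < n" using K_psubset by auto
		then have "moment w i \<in> cfun.span (diffs {i})" by (rule moment_in_span) (rule zs[OF \<open>i < n\<close>])
		moreover have "cfun.span (diffs {i}) \<subseteq> spanK" using i by (intro cfun.span_mono diffs_mono) simp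
		ultimately show "moment w i \<in> spanK" by (rule subsetD[rotated])
	qed
	finally show False using b(2) by simp
qed

end

section \<open>Perturbing a relation together with its null function\<close>

context finite_tuple
begin

text \<open>All proper relations are included so that the property is available along perturbations
  of a given one; for simple tuples it turns out to be equivalent to prelinearity.\<close>

definition degenerate :: bool where
	"degenerate \<longleftrightarrow> (\<forall>w\<in>proper_relations. \<exists>\<theta>\<in>null_functions w. nonconstant \<theta>)"

definition basis_fun :: "nat + nat => term_index => complex" where
	"basis_fun k p = (case k of Inl i => (if fst p = i then 1 else 0) | Inr j => lvec (snd p) j)"

abbreviation index_sum :: "(nat + nat) set" where
	"index_sum \<equiv> {..<n} <+> {..<n}"

lemma sum_index_sum: "(\<Sum>k\<in>index_sum. h k) = (\<Sum>i<n. h (Inl i)) + (\<Sum>j<n. h (Inr j))"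
	for h :: "nat + nat => complex" by (subst sum.Plus) auto

lemma basis_fun_combination:
	assumes "i < n"
	shows "(\<Sum>k\<in>index_sum. y k * basis_fun k (i, a)) = y (Inl i) + (\<Sum>j<n. y (Inr j) * lvec a j)"
	using assms unfolding sum_index_sum
	by (simp add: basis_fun_def if_distrib[of "\<lambda>x. _ * x"] cong: if_cong)

lemma basis_fun_linear: "linear_on_P (\<lambda>p. \<Sum>k\<in>index_sum. y k * basis_fun k p)"
	unfolding linear_on_P_def
	by (intro exI[of _ "\<lambda>j. y (Inr j)"] exI[of _ "\<lambda>i. y (Inl i)"]) (simp add: basis_fun_combination)

lemma linear_on_P_basis:
	assumes "linear_on_P f"
	shows "\<exists>y. \<forall>p\<in>P. f p = (\<Sum>k\<in>index_sum. y k * basis_fun k p)"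
proof -
	obtain \<xi> \<eta> where f: "\<And>i a. i < n ==> a \<in> A i ==> f (i, a) = \<eta> i + covec \<xi> a"
		using assms by (auto simp: linear_on_P_def)
	show ?thesis by (rule exI[of _ "\<lambda>k. case k of Inl i => \<eta> i | Inr j => \<xi> j"])
			 (auto simp: basis_fun_combination f mem_P_iff)
qed

lemma linear_on_P_basis_single: "k \<in> index_sum ==> linear_on_P (basis_fun k)"
proof -
	assume k: "k \<in> index_sum"
	have "(\<Sum>l\<in>index_sum. (if l = k then 1 else 0) * basis_fun l p) = basis_fun k p" for p
		using k by (simp add: if_distrib[of "\<lambda>x. x * _"] cong: if_cong)
	then show ?thesis using basis_fun_linear[of "\<lambda>l. if l = k then 1 else 0"] by simp
qed

text \<open>Null functions of w + t d solve a linear system depending linearly on t. Fixing the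
  constant of block 0 and one nonzero coordinate of the covector makes the solution at t = 0 unique,
  so the system has a left inverse there, and arbitrarily chosen normalized solutions for t \<noteq>
  0 are differentiable at 0.\<close>

lemma null_functions_curve:
	assumes n: "0 < n" and deg: degenerate
		and w: "w \<in> proper_relations" and \<theta>: "\<theta> \<in> null_functions w" "nonconstant \<theta>" and d: "d \<in> relations"
	shows "\<exists>\<Theta> \<theta>'. linear_on_P \<theta>' \<and> (\<forall>p\<in>P. \<Theta> 0 p = \<theta> p \<and> ((\<lambda>t. \<Theta> t p) has_field_derivative \<theta>' p) (at 0)) \<and>
		(\<forall>\<^sub>F t in at 0. (\<lambda>p. w p + t * d p) \<in> proper_relations \<and> \<Theta> t \<in> null_functions (\<lambda>p. w p + t * d p) \<and> nonconstant (\<Theta> t))"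
proof -
	let ?U = index_sum and ?f = "\<lambda>y p. \<Sum>k\<in>index_sum. y k * basis_fun k p"
	let ?w = "\<lambda>t p. w p + t * d p"
	have wr: "w \<in> relations" using w by (simp add: proper_relations_def)
	have wtr: "?w t \<in> relations" for t by (rule relations_add_scale[OF wr d])
	have "linear_on_P \<theta>" using \<theta>(1) by (simp add: null_functions_def)
	from linear_on_P_basis[OF this] obtain y0 where y0: "\<forall>p\<in>P. \<theta> p = ?f y0 p" by (elim exE)
	have rep0: "\<theta> (i, a) = y0 (Inl i) + (\<Sum>j<n. y0 (Inr j) * lvec a j)" if "i < n" "a \<in> A i" for i a
		using y0 that by (simp add: mem_P_iff basis_fun_combination)
	obtain j0 where j0: "j0 < n" "y0 (Inr j0) \<noteq> 0" using nonconstant_covector[OF w \<theta> rep0] by auto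
	\<comment> \<open>Transversality to this unit vector is open, and it keeps the coordinate
	  \<open>j0\<close> of the covector nonzero for nearby relations, so that the normalization remains
	  possible.\<close>
	define e where "e j = (if j = j0 then 1 else 0 :: complex)" for j
	have ec: "e \<in> cvec_space n" using j0(1) by (auto simp: e_def cvec_space_def)
	have es: "dot f e = f j0" for f using j0(1) by (simp add: e_def if_distrib[of "\<lambda>x. _ * x"] cong: if_cong)
	have "transversal e w"
	proof (rule transversalI[OF n, where h = "\<lambda>j. y0 (Inr j)"])
		show "indep_family UNIV {1..<n} (moment w)" by (rule proper_relations_indep[OF w tail_psubset[OF n]])
		show "(\<Sum>j<n. y0 (Inr j) * moment w i j) = 0" if "i \<in> {1..<n}" for i
			by (rule null_functions_covector[OF wr \<theta>(1) rep0]) (use that in simp_all)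
		show "(\<Sum>j<n. y0 (Inr j) * e j) \<noteq> 0" by (simp add: es j0)
	qed
	from transversal_open[OF this]
	obtain p where p: "p \<in> polys" "p w \<noteq> 0" "\<forall>w. p w \<noteq> 0 --> transversal e w" by (elim bexE conjE)
	have evp: "\<forall>\<^sub>F t in at 0. p (?w t) \<noteq> 0" by (rule eventually_nonzero_on_line[of p w d, OF p(1,2)])
	define good where "good t y \<longleftrightarrow> ?f y \<in> null_functions (?w t) \<and> y (Inl 0) = y0 (Inl 0) \<and> y (Inr j0) = y0 (Inr j0)" for t y
	have ex: "\<exists>y. good t y" if pt: "p (?w t) \<noteq> 0" for t
	proof -
		have tr: "transversal e (?w t)" using p(3) pt by simp
		have pr: "?w t \<in> proper_relations" by (rule transversal_proper[OF wtr tr])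
		obtain \<phi> where \<phi>: "\<phi> \<in> null_functions (?w t)" "nonconstant \<phi>" using deg pr unfolding degenerate_def by (elim ballE bexE) auto
		have "linear_on_P \<phi>" using \<phi>(1) by (simp add: null_functions_def)
		from linear_on_P_basis[OF this] obtain z where z: "\<forall>p\<in>P. \<phi> p = ?f z p" by (elim exE)
		have rep: "\<phi> (i, a) = z (Inl i) + (\<Sum>j<n. z (Inr j) * lvec a j)" if "i < n" "a \<in> A i" for i a
			using z that by (simp add: mem_P_iff basis_fun_combination)
		obtain l where l: "l < n" "z (Inr l) \<noteq> 0" using nonconstant_covector[OF pr \<phi> rep] by auto
		have "(\<Sum>j<n. z (Inr j) * e j) \<noteq> 0"
			by (rule transversal_covector[OF n wtr tr ec l null_functions_covector[OF wtr \<phi>(1) rep]])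
		then have zj: "z (Inr j0) \<noteq> 0" by (simp add: es)
		\<comment> \<open>Scaling adjusts the coordinate of the covector; adding a constant, which is
		  always a null function, adjusts block 0.\<close>
		define \<alpha> where "\<alpha> = y0 (Inr j0) / z (Inr j0)"
		define \<beta> where "\<beta> = y0 (Inl 0) - \<alpha> * z (Inl 0)"
		define y where "y k = (case k of Inl i => \<alpha> * z (Inl i) + \<beta> | Inr j => \<alpha> * z (Inr j))" for k
		have fy: "?f y q = \<alpha> * \<phi> q + \<beta> * 1" if "q \<in> P" for q
		proof -
			obtain i a where q0: "q = (i, a)" by (cases q)
			then have q: "q = (i, a)" "i < n" "a \<in> A i" using that by (simp_all add: mem_P_iff)
			show ?thesis unfolding q(1) basis_fun_combination[OF q(2)] rep[OF q(2,3)]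
				by (simp add: y_def distrib_left sum_distrib_left mult.assoc)
		qed
		have "(\<lambda>q. \<alpha> * \<phi> q + \<beta> * 1) \<in> null_functions (?w t)"
			by (rule null_functions_add_scale[OF \<phi>(1) null_functions_const[OF wtr]])
		moreover have "(\<Sum>q\<in>P. ?w t q * ?f y q * g q) = (\<Sum>q\<in>P. ?w t q * (\<alpha> * \<phi> q + \<beta> * 1) * g q)" for g
			by (intro sum.cong refl) (simp only: fy)
		ultimately have "?f y \<in> null_functions (?w t)" unfolding null_functions_def by (simp add: basis_fun_linear)
		moreover have "y (Inl 0) = y0 (Inl 0)" "y (Inr j0) = y0 (Inr j0)" using zj by (simp_all add: y_def \<beta>_def \<alpha>_def)
		ultimately show ?thesis unfolding good_def by (intro exI[of _ y]) simp
	qed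
	define Y where "Y t = (if t = 0 then y0 else (SOME y. good t y))" for t
	have Y: "good t (Y t)" if "p (?w t) \<noteq> 0" "t \<noteq> 0" for t
		using someI_ex[OF ex[OF that(1)]] that(2) by (simp add: Y_def)
	have \<theta>0: "?f y0 \<in> null_functions w"
	proof -
		have "(\<Sum>q\<in>P. w q * ?f y0 q * g q) = (\<Sum>q\<in>P. w q * \<theta> q * g q)" for g
			by (intro sum.cong refl) (use y0 in simp)
		then show ?thesis using \<theta>(1) unfolding null_functions_def by (simp add: basis_fun_linear)
	qed
	\<comment> \<open>Rows \<open>Inl v\<close> are the null conditions at \<open>w\<close> tested on
	  the generators; the two rows \<open>Inr\<close> read off the normalized coefficients.\<close>
	define M :: "((nat + nat) + bool) => nat + nat => complex" where
		"M k u = (case k of Inl v => (\<Sum>q\<in>P. w q * basis_fun u q * basis_fun v q)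
			| Inr c => (if c then (if u = Inl 0 then 1 else 0) else (if u = Inr j0 then 1 else 0)))" for k u
	let ?K = "?U <+> (UNIV :: bool set)"
	have bilin: "(\<Sum>u\<in>?U. y u * (\<Sum>q\<in>P. z q * basis_fun u q * basis_fun v q)) = (\<Sum>q\<in>P. z q * ?f y q * basis_fun v q)" for y z v
		unfolding sum_distrib_left sum_distrib_right by (subst sum.swap) (simp add: ac_simps)
	have inl0: "Inl 0 \<in> ?U" and inrj: "Inr j0 \<in> ?U" using n j0(1) by (auto simp: InlI InrI)
	\<comment> \<open>A solution is a null function \<alpha> \<theta> + \<beta>; the two normalized
	  coefficients being zero force \<alpha> = 0 and then \<beta> = 0.\<close>
	have inj: "y u = 0" if y: "\<And>k. k \<in> ?K ==> (\<Sum>u\<in>?U. y u * M k u) = 0" and u: "u \<in> ?U" for y u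
	proof -
		have "(\<Sum>u\<in>?U. y u * M (Inr b) u) = 0" for b by (rule y) (simp add: InrI)
		from this[of True] this[of False] have y00: "y (Inl 0) = 0" "y (Inr j0) = 0"
			using inl0 inrj by (simp_all add: M_def if_distrib[of "\<lambda>x. _ * x"] cong: if_cong)
		have fy: "?f y \<in> null_functions w" unfolding null_functions_def
		proof (intro CollectI conjI basis_fun_linear allI impI)
			fix g assume "linear_on_P g"
			from linear_on_P_basis[OF this] obtain z where z: "\<forall>p\<in>P. g p = ?f z p" by (elim exE)
			have "(\<Sum>q\<in>P. w q * ?f y q * g q) = (\<Sum>q\<in>P. \<Sum>v\<in>?U. z v * (w q * ?f y q * basis_fun v q))"
			proof (rule sum.cong[OF refl])
				fix q assume "q \<in> P"
				then have "g q = ?f z q" using z by simp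
				moreover have "x * ?f z q = (\<Sum>v\<in>?U. z v * (x * basis_fun v q))" for x
					unfolding sum_distrib_left by (simp add: ac_simps)
				ultimately show "w q * ?f y q * g q = (\<Sum>v\<in>?U. z v * (w q * ?f y q * basis_fun v q))" by simp
			qed
			also have "\<dots> = (\<Sum>v\<in>?U. z v * (\<Sum>q\<in>P. w q * ?f y q * basis_fun v q))"
				unfolding sum_distrib_left[of "z _"] by (rule sum.swap)
			also have "\<dots> = 0"
			proof (rule sum.neutral, rule ballI)
				fix v assume v: "v \<in> ?U"
				have "(\<Sum>u\<in>?U. y u * M (Inl v) u) = 0" using v by (intro y) (simp add: InlI)
				then show "z v * (\<Sum>q\<in>P. w q * ?f y q * basis_fun v q) = 0" by (simp add: M_def bilin)
			qed
			finally show "(\<Sum>q\<in>P. w q * ?f y q * g q) = 0" .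
		qed
		obtain \<alpha> \<beta> where ab: "\<forall>p\<in>P. ?f y p = \<alpha> * \<theta> p + \<beta>" using null_functions_dim_le_2[OF n w \<theta> fy] by (elim exE)
		have z: "(y (Inl i) - \<alpha> * y0 (Inl i) - \<beta>) + (\<Sum>j<n. (y (Inr j) - \<alpha> * y0 (Inr j)) * lvec a j) = 0" if "i < n" "a \<in> A i" for i a
		proof -
			have "?f y (i, a) = \<alpha> * \<theta> (i, a) + \<beta>" using ab that by (simp add: mem_P_iff)
			then show ?thesis unfolding basis_fun_combination[OF that(1)] rep0[OF that]
				by (simp add: left_diff_distrib sum_subtractf sum_distrib_left algebra_simps)
		qed
		have yr: "y (Inr j) - \<alpha> * y0 (Inr j) = 0" if "j < n" for j by (rule linear_zero(1)[OF z that])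
		have yl: "y (Inl i) - \<alpha> * y0 (Inl i) - \<beta> = 0" if "i < n" for i by (rule linear_zero(2)[OF z that])
		have "\<alpha> = 0" using yr[OF j0(1)] y00 j0(2) by simp
		moreover from this have "\<beta> = 0" using yl[OF n] y00 by simp
		ultimately show ?thesis using u yr yl by (auto simp: Plus_def)
	qed
	have "\<exists>G. \<forall>u\<in>?U. \<forall>u'\<in>?U. (if u' = u then 1 else 0) = (\<Sum>k\<in>?K. G u k * M k u')"
		by (rule dual_coefficients, simp, simp) (rule inj)
	then obtain G where G: "\<forall>u\<in>?U. \<forall>u'\<in>?U. (if u' = u then 1 else 0) = (\<Sum>k\<in>?K. G u k * M k u')" by (rule exE)
	have left_inv: "y u = (\<Sum>k\<in>?K. G u k * (\<Sum>u'\<in>?U. y u' * M k u'))" if u: "u \<in> ?U" for y u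
	proof -
		have "y u = (\<Sum>u'\<in>?U. y u' * (if u' = u then 1 else 0))" using u by (simp add: if_distrib[of "\<lambda>x. _ * x"] cong: if_cong)
		also have "\<dots> = (\<Sum>u'\<in>?U. y u' * (\<Sum>k\<in>?K. G u k * M k u'))" using G u by (intro sum.cong refl) simp
		also have "\<dots> = (\<Sum>k\<in>?K. G u k * (\<Sum>u'\<in>?U. y u' * M k u'))"
			unfolding sum_distrib_left by (subst sum.swap) (simp add: ac_simps)
		finally show ?thesis .
	qed
	\<comment> \<open>The part of the system coming from \<open>d\<close> is moved to the right-hand
	  side; applying the left inverse brings it into the form required by the perturbation
	  lemma.\<close>
	define c where "c u u' = - (\<Sum>v\<in>?U. G u (Inl v) * (\<Sum>q\<in>P. d q * basis_fun u' q * basis_fun v q))" for u u'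
	have step: "Y t u = y0 u + t * (\<Sum>u'\<in>?U. c u u' * Y t u')" if pt: "p (?w t) \<noteq> 0" and t: "t \<noteq> 0" and u: "u \<in> ?U" for t u
	proof -
		have gd: "good t (Y t)" by (rule Y[OF pt t])
		have Ml: "(\<Sum>u'\<in>?U. (Y t u' - y0 u') * M (Inl v) u') = - t * (\<Sum>u'\<in>?U. Y t u' * (\<Sum>q\<in>P. d q * basis_fun u' q * basis_fun v q))" if v: "v \<in> ?U" for v
		proof -
			have "0 = (\<Sum>q\<in>P. ?w t q * ?f (Y t) q * basis_fun v q)"
				using gd linear_on_P_basis_single[OF v] by (simp add: good_def null_functions_def)
			also have "\<dots> = (\<Sum>q\<in>P. w q * ?f (Y t) q * basis_fun v q) + t * (\<Sum>q\<in>P. d q * ?f (Y t) q * basis_fun v q)"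
				by (simp only: distrib_right sum.distrib sum_distrib_left[of t] mult.assoc)
			finally have "(\<Sum>q\<in>P. w q * ?f (Y t) q * basis_fun v q) = - t * (\<Sum>q\<in>P. d q * ?f (Y t) q * basis_fun v q)"
				by (simp add: eq_neg_iff_add_eq_0 del: mult_minus_left)
			moreover have "(\<Sum>q\<in>P. w q * ?f y0 q * basis_fun v q) = 0"
				using \<theta>0 linear_on_P_basis_single[OF v] by (simp add: null_functions_def)
			ultimately show ?thesis
				by (simp only: left_diff_distrib sum_subtractf M_def sum.case bilin diff_zero)
		qed
		have Mr: "(\<Sum>u'\<in>?U. (Y t u' - y0 u') * M (Inr b) u') = 0" for b
			using gd inl0 inrj by (cases b) (simp_all add: good_def M_def if_distrib[of "\<lambda>x. _ * x"] cong: if_cong)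
		have "Y t u - y0 u = (\<Sum>k\<in>?K. G u k * (\<Sum>u'\<in>?U. (Y t u' - y0 u') * M k u'))"
			using left_inv[OF u, of "\<lambda>u'. Y t u' - y0 u'"] .
		also have "\<dots> = (\<Sum>v\<in>?U. G u (Inl v) * (\<Sum>u'\<in>?U. (Y t u' - y0 u') * M (Inl v) u'))"
			by (subst sum.Plus) (simp_all add: Mr)
		also have "\<dots> = (\<Sum>v\<in>?U. G u (Inl v) * (- t * (\<Sum>u'\<in>?U. Y t u' * (\<Sum>q\<in>P. d q * basis_fun u' q * basis_fun v q))))"
			by (intro sum.cong refl) (simp only: Ml)
		also have "\<dots> = t * (\<Sum>u'\<in>?U. c u u' * Y t u')"
		proof -
			have "(\<Sum>u'\<in>?U. c u u' * Y t u') = (\<Sum>u'\<in>?U. \<Sum>v\<in>?U. - (G u (Inl v) * (Y t u' * (\<Sum>q\<in>P. d q * basis_fun u' q * basis_fun v q))))"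
				by (simp only: c_def sum_negf[symmetric] sum_distrib_right mult_minus_left) (simp only: ac_simps)
			also have "\<dots> = (\<Sum>v\<in>?U. - (G u (Inl v) * (\<Sum>u'\<in>?U. Y t u' * (\<Sum>q\<in>P. d q * basis_fun u' q * basis_fun v q))))"
				by (subst sum.swap) (simp only: sum_negf sum_distrib_left)
			finally have "(\<Sum>u'\<in>?U. c u u' * Y t u') = \<dots>" .
			then show ?thesis by (simp only: sum_distrib_left[of t]) (intro sum.cong refl, simp)
		qed
		finally show ?thesis by (simp add: algebra_simps)
	qed
	define y' where "y' u = (\<Sum>u'\<in>?U. c u u' * y0 u')" for u
	have lim: "((\<lambda>t. (Y t u - y0 u) / t) \<longlongrightarrow> y' u) (at 0)" if "u \<in> ?U" for u unfolding y'_def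
	proof (rule linear_perturbation_derivative[OF _ _ that])
		show "\<forall>\<^sub>F t in at 0. \<forall>u\<in>?U. Y t u = y0 u + t * (\<Sum>u'\<in>?U. c u u' * Y t u')"
			using evp eventually_neq_at_within[of "0::complex" 0 UNIV]
		proof eventually_elim
			case (elim t)
			show ?case by (rule ballI) (rule step[OF elim])
		qed
	qed simp
	have derY: "((\<lambda>t. Y t u) has_field_derivative y' u) (at 0)" if "u \<in> ?U" for u
		using lim[OF that] by (simp add: has_field_derivative_iff Y_def)
	define \<Theta> where "\<Theta> t = ?f (Y t)" for t
	have "((\<lambda>t. \<Theta> t q) has_field_derivative ?f y' q) (at 0)" for q
		unfolding \<Theta>_def by (intro DERIV_sum DERIV_cmult_right derY)
	moreover have "\<Theta> 0 q = \<theta> q" if "q \<in> P" for q using y0 that by (simp add: \<Theta>_def Y_def)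
	moreover have "\<forall>\<^sub>F t in at 0. ?w t \<in> proper_relations \<and> \<Theta> t \<in> null_functions (?w t) \<and> nonconstant (\<Theta> t)"
		using evp eventually_neq_at_within[of "0::complex" 0 UNIV]
	proof eventually_elim
		case (elim t)
		have gd: "good t (Y t)" by (rule Y[OF elim])
		have tr: "transversal e (?w t)" using p(3) elim(1) by simp
		have pr: "?w t \<in> proper_relations" by (rule transversal_proper[OF wtr tr])
		have nf: "\<Theta> t \<in> null_functions (?w t)" using gd by (simp add: good_def \<Theta>_def)
		have "nonconstant (\<Theta> t)"
		proof (rule ccontr)
			assume "\<not> nonconstant (\<Theta> t)"
			have c: "\<Theta> t q = \<Theta> t q'" if "q \<in> P" "q' \<in> P" for q q'
				by (rule ccontr, rule notE[OF \<open>\<not> nonconstant (\<Theta> t)\<close>]) (unfold nonconstant_def, intro bexI, assumption, rule that(2), rule that(1))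
			have "Y t (Inr j0) = 0"
			proof (rule functional_zero_on_differences[OF _ j0(1)])
				fix i a a' assume ia: "i < n" "a \<in> A i" "a' \<in> A i"
				have "\<Theta> t (i, a) = \<Theta> t (i, a')" using ia by (intro c) (simp_all add: mem_P_iff)
				then show "(\<Sum>j<n. Y t (Inr j) * lvec a j) = (\<Sum>j<n. Y t (Inr j) * lvec a' j)"
					by (simp add: \<Theta>_def basis_fun_combination[OF ia(1)])
			qed
			then show False using gd j0(2) by (simp add: good_def)
		qed
		with pr nf show ?case by simp
	qed
	ultimately show ?thesis
		by (intro exI[of _ \<Theta>] exI[of _ "?f y'"] conjI basis_fun_linear ballI) simp_all
qed

end

lemma derivative_zero_if_eventually_zero:
	fixes F :: "complex => complex"
	assumes "F 0 = 0" "\<forall>\<^sub>F t in at 0. F t = 0" "(F has_field_derivative D) (at 0)"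
	shows "D = 0"
proof -
	have l: "((\<lambda>t. (F t - F 0) / (t - 0)) \<longlongrightarrow> D) (at 0)" using assms(3) by (simp add: has_field_derivative_iff)
	have "\<forall>\<^sub>F t in at 0. (F t - F 0) / (t - 0) = 0" using assms(2) by eventually_elim (simp add: assms(1))
	then have "((\<lambda>t. (F t - F 0) / (t - 0)) \<longlongrightarrow> 0) (at 0)" by (rule tendsto_eventually)
	then show ?thesis using l tendsto_unique[OF trivial_limit_at] by auto
qed

context finite_tuple
begin

lemma linear_on_P_null: "f \<in> null_functions w ==> linear_on_P f" by (simp add: null_functions_def)

lemma null_functionE:
	assumes w: "w \<in> proper_relations" and \<theta>: "\<theta> \<in> null_functions w" "nonconstant \<theta>"
	obtains \<xi> \<eta> j where "\<And>i a. i < n ==> a \<in> A i ==> \<theta> (i, a) = \<eta> i + covec \<xi> a"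
		"j < n" "\<xi> j \<noteq> 0" "\<And>i. i < n ==> dot \<xi> (moment w i) = 0"
proof -
	have wr: "w \<in> relations" using w by (simp add: proper_relations_def)
	obtain \<xi> \<eta> where rep: "\<And>i a. i < n ==> a \<in> A i ==> \<theta> (i, a) = \<eta> i + covec \<xi> a"
		using linear_on_P_null[OF \<theta>(1)] by (auto simp: linear_on_P_def)
	have cov: "dot \<xi> (moment w i) = 0" if i: "i < n" for i
		by (rule null_functions_covector[OF wr \<theta>(1) _ i]) (rule rep)
	have "\<exists>j<n. \<xi> j \<noteq> 0" by (rule nonconstant_covector[OF w \<theta>]) (rule rep)
	then obtain j where "j < n" "\<xi> j \<noteq> 0" by (elim exE conjE)
	then show thesis using that[of \<eta> \<xi> j, OF rep _ _ cov] by simp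
qed

lemma null_functions_curve_first_order:
	assumes "\<theta> \<in> null_functions w" "linear_on_P f"
		and \<Theta>: "\<And>p. p \<in> P ==> \<Theta> 0 p = \<theta> p" "\<And>p. p \<in> P ==> ((\<lambda>t. \<Theta> t p) has_field_derivative \<theta>' p) (at 0)"
		and ev: "\<forall>\<^sub>F t in at 0. \<Theta> t \<in> null_functions (\<lambda>p. w p + t * d p)"
	shows "(\<Sum>p\<in>P. (d p * \<theta> p + w p * \<theta>' p) * f p) = 0"
proof (rule derivative_zero_if_eventually_zero[where F = "\<lambda>t. \<Sum>p\<in>P. (w p + t * d p) * \<Theta> t p * f p"])
	have "(\<Sum>p\<in>P. w p * \<Theta> 0 p * f p) = (\<Sum>p\<in>P. w p * \<theta> p * f p)" by (intro sum.cong refl) (simp add: \<Theta>)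
	then show "(\<Sum>p\<in>P. (w p + 0 * d p) * \<Theta> 0 p * f p) = 0" using assms(1,2) by (simp add: null_functions_def)
	show "\<forall>\<^sub>F t in at 0. (\<Sum>p\<in>P. (w p + t * d p) * \<Theta> t p * f p) = 0"
		using ev by eventually_elim (use assms(2) in \<open>simp add: null_functions_def\<close>)
	show "((\<lambda>t. \<Sum>p\<in>P. (w p + t * d p) * \<Theta> t p * f p) has_field_derivative (\<Sum>p\<in>P. (d p * \<theta> p + w p * \<theta>' p) * f p)) (at 0)"
	proof (rule DERIV_sum)
		fix p assume p: "p \<in> P"
		have "((\<lambda>t. w p + t * d p) has_field_derivative d p) (at 0)"
			by (auto intro!: derivative_eq_intros)
		from DERIV_mult[OF this \<Theta>(2)[OF p]]
		have "((\<lambda>t. (w p + t * d p) * \<Theta> t p) has_field_derivative (d p * \<theta> p + w p * \<theta>' p)) (at 0)"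
			by (simp add: \<Theta>(1)[OF p] mult.commute)
		then show "((\<lambda>t. (w p + t * d p) * \<Theta> t p * f p) has_field_derivative (d p * \<theta> p + w p * \<theta>' p) * f p) (at 0)"
			by (rule DERIV_cmult_right)
	qed
qed

text \<open>The null condition tested on \<theta> itself is differentiated along the direction
  \<open>d\<close>: the term with \<theta>' pairs the null function \<theta> with an affine function
  and vanishes, which leaves the pairing of \<open>d\<close> with the square.\<close>

lemma degenerate_square:
	assumes n: "0 < n" and deg: degenerate
		and w: "w \<in> proper_relations" and \<theta>: "\<theta> \<in> null_functions w" "nonconstant \<theta>"
	shows "linear_on_P (\<lambda>p. \<theta> p ^ 2)"
proof (rule linear_on_P_if_orthogonal)
	fix d assume d: "d \<in> relations"
	obtain \<Theta> \<theta>' where lin: "linear_on_P \<theta>'"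
		and c: "\<forall>p\<in>P. \<Theta> 0 p = \<theta> p \<and> ((\<lambda>t. \<Theta> t p) has_field_derivative \<theta>' p) (at 0)"
		and ev: "\<forall>\<^sub>F t in at 0. (\<lambda>p. w p + t * d p) \<in> proper_relations \<and> \<Theta> t \<in> null_functions (\<lambda>p. w p + t * d p) \<and> nonconstant (\<Theta> t)"
		using null_functions_curve[OF n deg w \<theta> d] by (elim exE conjE)
	have ev1: "\<forall>\<^sub>F t in at 0. \<Theta> t \<in> null_functions (\<lambda>p. w p + t * d p)" using ev by eventually_elim simp
	have "(\<Sum>p\<in>P. (d p * \<theta> p + w p * \<theta>' p) * \<theta> p) = 0"
		by (rule null_functions_curve_first_order[OF \<theta>(1) linear_on_P_null[OF \<theta>(1)] _ _ ev1]) (use c in simp_all)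
	moreover have "(\<Sum>p\<in>P. (d p * \<theta> p + w p * \<theta>' p) * \<theta> p) = (\<Sum>p\<in>P. d p * \<theta> p ^ 2) + (\<Sum>p\<in>P. w p * \<theta> p * \<theta>' p)"
		by (simp add: algebra_simps sum.distrib power2_eq_square)
	moreover have "(\<Sum>p\<in>P. w p * \<theta> p * \<theta>' p) = 0" using \<theta>(1) lin by (simp add: null_functions_def)
	ultimately show "(\<Sum>p\<in>P. d p * \<theta> p ^ 2) = 0" by simp
qed

text \<open>Along the curve with initial direction w \<theta>, the derivative of the null function is
	- \<theta>^2 up to null functions, so differentiating the linearity of \<theta>^k yields that of \<theta>^(k+1).\<close>

lemma degenerate_powers:
	assumes n: "0 < n" and deg: degenerate
	shows "w \<in> proper_relations ==> \<theta> \<in> null_functions w ==> nonconstant \<theta> ==> linear_on_P (\<lambda>p. \<theta> p ^ k)"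
proof (induction k arbitrary: w \<theta> rule: less_induct)
	case (less k)
	note w = less.prems(1) and \<theta> = less.prems(2,3)
	have wr: "w \<in> relations" using w by (simp add: proper_relations_def)
	show ?case
	proof (cases "k \<le> 2")
		case True
		then consider "k = 0" | "k = 1" | "k = 2" by linarith
		then show ?thesis
		proof cases
			case 1
			then show ?thesis by (simp add: linear_on_P_const)
		next
			case 2
			then show ?thesis using linear_on_P_null[OF \<theta>(1)] by simp
		next
			case 3
			then show ?thesis using degenerate_square[OF n deg w \<theta>] by simp
		qed
	next
		case False
		define m where "m = k - 2"
		have k: "k = Suc (Suc m)" "1 \<le> m" using False by (auto simp: m_def)
		define d where "d p = w p * \<theta> p" for p
		have "d \<in> relations"
		proof (rule relationsI)
			show "d \<in> coeff_space P" using wr by (auto simp: d_def relations_def coeff_space_def)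
			show "(\<Sum>p\<in>P. d p * f p) = 0" if "linear_on_P f" for f
				using \<theta>(1) that by (simp add: d_def null_functions_def)
		qed
		from null_functions_curve[OF n deg w \<theta> this]
		obtain \<Theta> \<theta>' where lin: "linear_on_P \<theta>'"
			and c: "\<forall>p\<in>P. \<Theta> 0 p = \<theta> p \<and> ((\<lambda>t. \<Theta> t p) has_field_derivative \<theta>' p) (at 0)"
			and ev: "\<forall>\<^sub>F t in at 0. (\<lambda>p. w p + t * d p) \<in> proper_relations \<and> \<Theta> t \<in> null_functions (\<lambda>p. w p + t * d p) \<and> nonconstant (\<Theta> t)"
			by (elim exE conjE)
		have ev1: "\<forall>\<^sub>F t in at 0. \<Theta> t \<in> null_functions (\<lambda>p. w p + t * d p)" using ev by eventually_elim simp
		have fo: "(\<Sum>p\<in>P. (d p * \<theta> p + w p * \<theta>' p) * f p) = 0" if "linear_on_P f" for f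
			by (rule null_functions_curve_first_order[OF \<theta>(1) that _ _ ev1]) (use c in simp_all)
		\<comment> \<open>For the direction w \<theta> the first-order condition says that this function,
		  affine by the case of squares, is null. Hence \<theta>' is - \<theta>^2 plus a combination of
		  \<theta> and 1.\<close>
		have "(\<lambda>p. \<theta> p ^ 2 + \<theta>' p) \<in> null_functions w" unfolding null_functions_def
		proof (intro CollectI conjI allI impI)
			show "linear_on_P (\<lambda>p. \<theta> p ^ 2 + \<theta>' p)"
				by (rule linear_on_P_add[OF degenerate_square[OF n deg w \<theta>] lin])
			fix f assume "linear_on_P f"
			from fo[OF this] show "(\<Sum>p\<in>P. w p * (\<theta> p ^ 2 + \<theta>' p) * f p) = 0"
				by (simp add: d_def algebra_simps power2_eq_square)
		qed
		from null_functions_dim_le_2[OF n w \<theta> this]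
		obtain \<alpha> \<beta> where ab: "\<forall>p\<in>P. \<theta> p ^ 2 + \<theta>' p = \<alpha> * \<theta> p + \<beta>" by (elim exE)
		have \<theta>': "\<theta>' p = \<alpha> * \<theta> p + \<beta> - \<theta> p ^ 2" if "p \<in> P" for p
			using ab that by (simp add: eq_diff_eq add.commute)
		show ?thesis
		proof (rule linear_on_P_if_orthogonal)
			fix e assume e: "e \<in> relations"
			\<comment> \<open>The pairing of \<open>e\<close> with the power m + 1 of the moving null
			  function is zero for all small t, the induction hypothesis covering the perturbed relations
			  too; its derivative contains the power m + 2 = k.\<close>
			have "(\<Sum>p\<in>P. e p * (of_nat (Suc m) * (\<theta>' p * \<theta> p ^ m))) = 0"
			proof (rule derivative_zero_if_eventually_zero[where F = "\<lambda>t. \<Sum>p\<in>P. e p * \<Theta> t p ^ Suc m"])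
				have "linear_on_P (\<lambda>p. \<theta> p ^ Suc m)" by (rule less.IH[OF _ w \<theta>]) (simp add: k)
				moreover have "(\<Sum>p\<in>P. e p * \<Theta> 0 p ^ Suc m) = (\<Sum>p\<in>P. e p * \<theta> p ^ Suc m)"
					by (intro sum.cong refl) (use c in simp)
				ultimately show "(\<Sum>p\<in>P. e p * \<Theta> 0 p ^ Suc m) = 0" using relations_pairing[OF e] by simp
				show "\<forall>\<^sub>F t in at 0. (\<Sum>p\<in>P. e p * \<Theta> t p ^ Suc m) = 0" using ev
				proof eventually_elim
					case (elim t)
					have "linear_on_P (\<lambda>p. \<Theta> t p ^ Suc m)"
						by (rule less.IH[of "Suc m" "\<lambda>p. w p + t * d p"]) (use elim in \<open>simp_all add: k\<close>)
					then show ?case by (rule relations_pairing[OF e])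
				qed
				show "((\<lambda>t. \<Sum>p\<in>P. e p * \<Theta> t p ^ Suc m) has_field_derivative (\<Sum>p\<in>P. e p * (of_nat (Suc m) * (\<theta>' p * \<theta> p ^ m)))) (at 0)"
				proof (rule DERIV_sum)
					fix p assume p: "p \<in> P"
					have "((\<lambda>t. \<Theta> t p ^ Suc m) has_field_derivative of_nat (Suc m) * (\<theta>' p * \<theta> p ^ m)) (at 0)"
						using DERIV_power[of "\<lambda>t. \<Theta> t p" "\<theta>' p" 0 UNIV "Suc m"] c p by simp
					then show "((\<lambda>t. e p * \<Theta> t p ^ Suc m) has_field_derivative e p * (of_nat (Suc m) * (\<theta>' p * \<theta> p ^ m))) (at 0)"
						by (rule DERIV_cmult)
				qed
			qed
			moreover have "(\<Sum>p\<in>P. e p * (of_nat (Suc m) * (\<theta>' p * \<theta> p ^ m)))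
					= of_nat (Suc m) * (\<alpha> * (\<Sum>p\<in>P. e p * \<theta> p ^ Suc m) + \<beta> * (\<Sum>p\<in>P. e p * \<theta> p ^ m) - (\<Sum>p\<in>P. e p * \<theta> p ^ k))"
			proof -
				have "e p * (of_nat (Suc m) * (\<theta>' p * \<theta> p ^ m))
					= of_nat (Suc m) * (\<alpha> * (e p * \<theta> p ^ Suc m) + \<beta> * (e p * \<theta> p ^ m) - e p * \<theta> p ^ k)" if "p \<in> P" for p
					unfolding \<theta>'[OF that] k(1) by (simp add: algebra_simps power2_eq_square del: of_nat_Suc)
				then show ?thesis
					by (simp add: sum_distrib_left sum.distrib sum_subtractf right_diff_distrib distrib_left del: of_nat_Suc power_Suc)
			qed
			moreover have "(\<Sum>p\<in>P. e p * \<theta> p ^ Suc m) = 0"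
				by (rule relations_pairing[OF e], rule less.IH[OF _ w \<theta>]) (simp add: k)
			moreover have "(\<Sum>p\<in>P. e p * \<theta> p ^ m) = 0"
				by (rule relations_pairing[OF e], rule less.IH[OF _ w \<theta>]) (simp add: k)
			ultimately show "(\<Sum>p\<in>P. e p * \<theta> p ^ k) = 0" by (simp del: of_nat_Suc)
		qed
	qed
qed

text \<open>On finitely many values every function is a polynomial, so it suffices that all powers
  are affine. This is applied to indicators of level sets.\<close>

lemma degenerate_compose:
	assumes n: "0 < n" and deg: degenerate
		and w: "w \<in> proper_relations" and \<theta>: "\<theta> \<in> null_functions w" "nonconstant \<theta>"
	shows "linear_on_P (\<lambda>p. F (\<theta> p))"
proof -
	obtain q where q: "\<forall>x\<in>\<theta> ` P. poly q x = F x" using polynomial_interpolation[of "\<theta> ` P" F] by auto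
	have "linear_on_P (\<lambda>p. \<Sum>i\<le>degree q. coeff q i * \<theta> p ^ i)"
		by (intro linear_on_P_sum linear_on_P_scale degenerate_powers[OF n deg w \<theta>])
	moreover have "(\<Sum>i\<le>degree q. coeff q i * \<theta> p ^ i) = F (\<theta> p)" if "p \<in> P" for p
		using q that by (simp add: poly_altdef[symmetric])
	ultimately show ?thesis by (subst linear_on_P_cong[of _ "\<lambda>p. \<Sum>i\<le>degree q. coeff q i * \<theta> p ^ i"]) simp_all
qed

text \<open>Both sides are linear parts of \<theta>, on the right written as the sum over r of r
  times the indicator of the level r; linear parts are unique.\<close>

lemma indicator_combination:
	assumes rep: "\<And>i a. i < n ==> a \<in> A i ==> \<theta> (i, a) = \<eta> i + covec \<xi> a"
		and ind: "\<And>r i a. i < n ==> a \<in> A i ==> (\<Sum>j<n. Z r j * lvec a j) + \<kappa> r i = (if \<theta> (i, a) = r then 1 else 0)"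
		and j: "j < n"
	shows "\<xi> j = (\<Sum>r\<in>\<theta> ` P. r * Z r j)"
proof -
	let ?c = "\<lambda>h a. \<Sum>j<n. h j * lvec a j" and ?z = "\<lambda>j. \<Sum>r\<in>\<theta> ` P. r * Z r j"
	have "((\<Sum>r\<in>\<theta> ` P. r * \<kappa> r i) - \<eta> i) + (\<Sum>j<n. (?z j - \<xi> j) * lvec a j) = 0" if ia: "i < n" "a \<in> A i" for i a
	proof -
		have p: "(i, a) \<in> P" using ia by (simp add: mem_P_iff)
		have "(\<Sum>r\<in>\<theta> ` P. r * (?c (Z r) a + \<kappa> r i)) = (\<Sum>r\<in>\<theta> ` P. if \<theta> (i, a) = r then r else 0)"
			by (rule sum.cong[OF refl]) (simp add: ind[OF ia])
		also have "\<dots> = \<theta> (i, a)" using p by simp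
		finally have e: "(\<Sum>r\<in>\<theta> ` P. r * ?c (Z r) a) + (\<Sum>r\<in>\<theta> ` P. r * \<kappa> r i) = \<eta> i + ?c \<xi> a"
			unfolding rep[OF ia] by (simp only: distrib_left sum.distrib)
		have s: "(\<Sum>r\<in>\<theta> ` P. r * ?c (Z r) a) = ?c ?z a"
			unfolding sum_distrib_left sum_distrib_right by (subst sum.swap) (simp only: mult.assoc)
		have "x - y + (s - t) = (s + x) - (y + t)" for x y s t :: complex by simp
		then show ?thesis using e unfolding s by (simp only: left_diff_distrib sum_subtractf diff_self)
	qed
	then have "?z j - \<xi> j = 0" by (rule linear_zero(1)[OF _ j])
	then show ?thesis by simp
qed

end

section \<open>The Horn-Kapranov parametrization\<close>

lemma box_polys_cong:
	assumes "p \<in> box_polys J D" "\<And>j. j \<in> J ==> c j = c' j"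
	shows "p c = p c'"
proof -
	obtain u where u: "p = (\<lambda>c. \<Sum>\<alpha>\<in>exponents J D. u \<alpha> * monomial_fun J \<alpha> c)"
		using assms(1) unfolding box_polys_def by (elim CollectE exE)
	have "monomial_fun J \<alpha> c = monomial_fun J \<alpha> c'" for \<alpha>
		unfolding monomial_fun_def by (intro prod.cong refl) (simp add: assms(2))
	then show ?thesis by (simp add: u)
qed

text \<open>On an entire curve in \<open>X\<close> through two given points, polynomials with
  product zero become entire functions with product zero, so one of them vanishes at both
  points.\<close>

lemma irreducible_closedin_curves:
	assumes "X \<subseteq> coeff_space J" "X \<noteq> {}" and curve: "\<And>x y. x \<in> X ==> y \<in> X ==>
			\<exists>\<gamma>. (\<forall>t. \<gamma> t \<in> X) \<and> \<gamma> 0 = x \<and> \<gamma> 1 = y \<and> (\<forall>j. (\<lambda>t. \<gamma> t j) holomorphic_on UNIV)"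
	shows "irreducible_closedin (zariski J) ((zariski J) closure_of X)"
proof (rule irreducible_closedin_closure[OF assms(1,2)])
	fix p q :: "('a => complex) => complex"
	assume pq: "p \<in> polys" "q \<in> polys" and z: "\<And>x. x \<in> X ==> p x * q x = 0"
	show "(\<forall>x\<in>X. p x = 0) \<or> (\<forall>x\<in>X. q x = 0)"
	proof (rule ccontr)
		assume "\<not> ?thesis"
		then obtain x y where xy: "x \<in> X" "p x \<noteq> 0" "y \<in> X" "q y \<noteq> 0" by auto
		obtain \<gamma> where \<gamma>: "\<forall>t. \<gamma> t \<in> X" "\<gamma> 0 = x" "\<gamma> 1 = y" "\<forall>j. (\<lambda>t. \<gamma> t j) holomorphic_on UNIV"
			using curve[OF xy(1,3)] by (elim exE conjE)
		have "(\<lambda>t. p (\<gamma> t)) holomorphic_on UNIV" "(\<lambda>t. q (\<gamma> t)) holomorphic_on UNIV"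
			by (rule polynomial_functions_holomorphic[OF pq(1)] polynomial_functions_holomorphic[OF pq(2)], use \<gamma>(4) in simp)+
		then have "(\<forall>t. p (\<gamma> t) = 0) \<or> (\<forall>t. q (\<gamma> t) = 0)"
			by (rule holomorphic_mult_zero) (use z \<gamma>(1) in simp)
		then show False using xy \<gamma>(2,3) by metis
	qed
qed

lemma coeff_space_irreducible: "irreducible_closedin (zariski J) (coeff_space J)"
proof -
	have "irreducible_closedin (zariski J) ((zariski J) closure_of (coeff_space J))"
	proof (rule irreducible_closedin_curves[OF subset_refl])
		show "coeff_space J \<noteq> {}" by (auto simp: coeff_space_def)
		fix x y :: "'a => complex" assume xy: "x \<in> coeff_space J" "y \<in> coeff_space J"
		show "\<exists>\<gamma>. (\<forall>t. \<gamma> t \<in> coeff_space J) \<and> \<gamma> 0 = x \<and> \<gamma> 1 = y \<and> (\<forall>j. (\<lambda>t. \<gamma> t j) holomorphic_on UNIV)"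
			by (rule exI[of _ "\<lambda>t j. x j + t * (y j - x j)"])
				 (use xy in \<open>auto simp: coeff_space_def intro!: holomorphic_intros\<close>)
	qed
	then show ?thesis using closure_of_topspace[of "zariski J"] by simp
qed

context finite_tuple
begin

text \<open>At the torus point exp \<zeta> with multipliers exp \<kappa>, the term of index p is its
  coefficient times the exponential of this value.\<close>

definition affine_form :: "(nat => complex) => (nat => complex) => term_index => complex" where
	"affine_form \<zeta> \<kappa> p = \<kappa> (fst p) + covec \<zeta> (snd p)"

text \<open>A system singular at the torus point exp \<zeta> with multipliers exp \<kappa> is recovered from the relation w
	formed by the values of its terms there.\<close>

definition horn :: "(term_index => complex) => (nat => complex) => (nat => complex) =>
		term_index => complex" where
	"horn w \<zeta> \<kappa> = (\<lambda>p. w p * exp (- affine_form \<zeta> \<kappa> p))"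

text \<open>These are identified below with the systems whose Cayley polynomial is singular, and
  \<open>mix_points\<close>, for n > 0, with those having a non-degenerate multiple root.\<close>

definition cay_points :: "(term_index => complex) set" where
	"cay_points = {horn w \<zeta> \<kappa> | w \<zeta> \<kappa>. w \<in> relations}"

definition mix_points :: "(term_index => complex) set" where
	"mix_points = {horn w \<zeta> \<kappa> | w \<zeta> \<kappa>. w \<in> proper_relations}"

lemma relations_coeff_space: "w \<in> relations ==> w \<in> coeff_space P" by (simp add: relations_def)

lemma horn_coeff_space: "w \<in> relations ==> horn w \<zeta> \<kappa> \<in> coeff_space P"
	using relations_coeff_space[of w] by (simp add: horn_def coeff_space_def)

lemma cay_points_coeff_space: "cay_points \<subseteq> coeff_space P"
	unfolding cay_points_def using horn_coeff_space by (intro subsetI) (elim CollectE exE conjE, simp)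

lemma cay_pointsI: "w \<in> relations ==> horn w \<zeta> \<kappa> \<in> cay_points"
	unfolding cay_points_def by (rule CollectI) (intro exI conjI, rule refl)

lemma mix_subset_cay: "mix_points \<subseteq> cay_points"
	unfolding mix_points_def cay_points_def proper_relations_def by auto

lemma affine_form_add: "affine_form (\<lambda>j. \<zeta> j + \<zeta>' j) (\<lambda>i. \<kappa> i + \<kappa>' i) p = affine_form \<zeta> \<kappa> p + affine_form \<zeta>' \<kappa>' p"
	by (simp add: affine_form_def distrib_right sum.distrib)

lemma affine_form_scale: "affine_form (\<lambda>j. t * \<zeta> j) (\<lambda>i. t * \<kappa> i) p = t * affine_form \<zeta> \<kappa> p"
	by (simp add: affine_form_def distrib_left sum_distrib_left mult.assoc)

lemma linear_on_P_obtain_affine_form: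
	assumes "linear_on_P f"
	shows "\<exists>\<zeta> \<kappa>. \<forall>p\<in>P. f p = affine_form \<zeta> \<kappa> p"
proof -
	obtain \<zeta> \<kappa> where f: "\<forall>i<n. \<forall>a\<in>A i. f (i, a) = \<kappa> i + covec \<zeta> a"
		using assms unfolding linear_on_P_def by (elim exE)
	have "f p = affine_form \<zeta> \<kappa> p" if "p \<in> P" for p
	proof -
		obtain i a where p: "p = (i, a)" by (cases p)
		then show ?thesis using f that by (simp add: affine_form_def mem_P_iff)
	qed
	then show ?thesis by (intro exI[of _ \<zeta>] exI[of _ \<kappa>]) simp
qed

lemma horn_polynomial:
	assumes "f \<in> polys"
	shows "(\<lambda>w. f (horn w \<zeta> \<kappa>)) \<in> polys" by (rule polynomial_functions_compose[OF assms])
		(simp add: horn_def polynomial_functions.mult polynomial_functions.coord polynomial_functions.const)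

lemma proper_relations_open:
	assumes "w0 \<in> proper_relations" "0 < n"
	shows "\<exists>p\<in>polynomial_functions. p w0 \<noteq> 0 \<and> (\<forall>w\<in>relations. p w \<noteq> 0 --> w \<in> proper_relations)"
proof -
	have "indep_family UNIV {1..<n} (moment w0)"
		by (rule proper_relations_indep[OF assms(1) tail_psubset[OF assms(2)]])
	then have "\<exists>p\<in>polynomial_functions. p w0 \<noteq> 0 \<and> (\<forall>w. p w \<noteq> 0 --> indep_family UNIV {1..<n} (moment w))"
		by (rule indep_family_open[rotated 2]) (simp_all add: moment_polynomial)
	then obtain p where p: "p \<in> polys" "p w0 \<noteq> 0" "\<forall>w. p w \<noteq> 0 --> indep_family UNIV {1..<n} (moment w)"
		by (elim bexE conjE)
	show ?thesis by (rule bexI[OF _ p(1)]) (use p(2,3) proper_relationsI in simp)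
qed

text \<open>The relations form an affine space, on which two polynomials that are not identically
  zero are simultaneously nonzero somewhere.\<close>

lemma vanish_on_relations:
	assumes "D \<in> polys" "w0 \<in> relations" "D w0 \<noteq> 0"
		and f: "f \<in> polys" "\<And>w. w \<in> relations ==> D w \<noteq> 0 ==> f w = 0" and "w \<in> relations"
	shows "f w = 0"
proof (rule ccontr)
	assume nz: "f w \<noteq> 0"
	have ne: "relations \<noteq> {}" using assms(2) by auto
	have "\<exists>w\<in>relations. \<forall>b\<in>(UNIV :: bool set). (if b then D else f) w \<noteq> 0"
	proof (rule generic_point[OF relations_affine ne])
		show "(if b then D else f) \<in> polys \<and> (\<exists>w\<in>relations. (if b then D else f) w \<noteq> 0)" for b
			using assms(1-3) f(1) assms(6) nz by (cases b) auto
	qed simp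
	then obtain v where v: "v \<in> relations" "\<forall>b. (if b then D else f) v \<noteq> 0" by (elim bexE) simp
	have "D v \<noteq> 0" "f v \<noteq> 0" using v(2)[rule_format, of True] v(2)[rule_format, of False] by simp_all
	then show False using f(2)[OF v(1)] by simp
qed

text \<open>For fixed \<zeta> and \<kappa> the parametrization is linear in \<open>w\<close>, and
  proper relations form a nonempty open part of all relations; a polynomial vanishing on the image
  of that part vanishes on the whole image.\<close>

lemma closure_mix_eq_closure_cay:
	assumes "proper_relations \<noteq> {}" "0 < n"
	shows "(zariski P) closure_of mix_points = (zariski P) closure_of cay_points"
proof
	show "(zariski P) closure_of mix_points \<subseteq> (zariski P) closure_of cay_points"
		by (rule closure_of_mono[OF mix_subset_cay])
	obtain w0 where w0: "w0 \<in> proper_relations" using assms(1) by auto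
	obtain D where D: "D \<in> polys" "D w0 \<noteq> 0" "\<forall>w\<in>relations. D w \<noteq> 0 --> w \<in> proper_relations"
		using proper_relations_open[OF w0 assms(2)] by (elim bexE conjE)
	have mixI: "horn w \<zeta> \<kappa> \<in> mix_points" if "w \<in> proper_relations" for w \<zeta> \<kappa>
		unfolding mix_points_def using that by (intro CollectI exI conjI) (rule refl)
	have "c \<in> (zariski P) closure_of mix_points" if c: "c \<in> cay_points" for c
		unfolding in_zariski_closure_iff[OF subset_trans[OF mix_subset_cay cay_points_coeff_space]]
	proof (intro conjI ballI impI)
		show "c \<in> coeff_space P" using c cay_points_coeff_space by (rule subsetD[rotated])
		fix p assume p: "p \<in> polys" "\<forall>x\<in>mix_points. p x = 0"
		obtain w \<zeta> \<kappa> where w: "w \<in> relations" "c = horn w \<zeta> \<kappa>" using c unfolding cay_points_def by (elim CollectE exE conjE)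
		have w0r: "w0 \<in> relations" using w0 by (simp add: proper_relations_def)
		have "p (horn w \<zeta> \<kappa>) = 0"
			by (rule vanish_on_relations[OF D(1) w0r D(2) horn_polynomial[OF p(1)] _ w(1)]) (use D(3) p(2) mixI in simp)
		then show "p c = 0" by (simp add: w(2))
	qed
	then show "(zariski P) closure_of cay_points \<subseteq> (zariski P) closure_of mix_points"
		by (intro closure_of_minimal) auto
qed

text \<open>Linear interpolation of \<open>w\<close>, \<zeta>, \<kappa> and \<open>t\<close> joins
  two points by an entire curve. With \<open>v\<close> a coordinate vector this is the middle member
  of the chain for codimension two; with \<open>v\<close> = 0 it is the parametrized set
  itself.\<close>

lemma irreducible_translates:
	"irreducible_closedin (zariski P) ((zariski P) closure_of {(\<lambda>p. x p + t * v p) | x t. x \<in> cay_points})"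
	if v: "v \<in> coeff_space P"
proof (rule irreducible_closedin_curves)
	let ?X = "{(\<lambda>p. x p + t * v p) | x t. x \<in> cay_points}"
	show "?X \<subseteq> coeff_space P" using v cay_points_coeff_space by (auto simp: coeff_space_def)
	have "horn (\<lambda>_. 0) (\<lambda>_. 0) (\<lambda>_. 0) \<in> cay_points" by (rule cay_pointsI[OF relations_zero])
	then show "?X \<noteq> {}" by auto
	fix x y assume "x \<in> ?X" "y \<in> ?X"
	then obtain w1 \<zeta>1 \<kappa>1 t1 w2 \<zeta>2 \<kappa>2 t2 where
		x: "w1 \<in> relations" "x = (\<lambda>p. horn w1 \<zeta>1 \<kappa>1 p + t1 * v p)" and
		y: "w2 \<in> relations" "y = (\<lambda>p. horn w2 \<zeta>2 \<kappa>2 p + t2 * v p)"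
		unfolding cay_points_def by (elim CollectE exE conjE) simp
	define \<gamma> where "\<gamma> s = (\<lambda>p. horn (\<lambda>p. w1 p + s * (w2 p - w1 p)) (\<lambda>j. \<zeta>1 j + s * (\<zeta>2 j - \<zeta>1 j)) (\<lambda>i. \<kappa>1 i + s * (\<kappa>2 i - \<kappa>1 i)) p
			+ (t1 + s * (t2 - t1)) * v p)" for s
	show "\<exists>\<gamma>. (\<forall>t. \<gamma> t \<in> ?X) \<and> \<gamma> 0 = x \<and> \<gamma> 1 = y \<and> (\<forall>j. (\<lambda>t. \<gamma> t j) holomorphic_on UNIV)"
	proof (intro exI[of _ \<gamma>] conjI allI)
		fix s
		have "(\<lambda>p. w1 p + s * (w2 p - w1 p)) \<in> relations"
			using relations_affine x(1) y(1) unfolding affine_closed_def by simp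
		then show "\<gamma> s \<in> ?X" unfolding \<gamma>_def by (intro CollectI exI conjI) (rule refl, rule cay_pointsI)
	next
		show "\<gamma> 0 = x" by (simp add: \<gamma>_def x(2))
		show "\<gamma> 1 = y" by (simp add: \<gamma>_def y(2))
		show "(\<lambda>t. \<gamma> t j) holomorphic_on UNIV" for j
			unfolding \<gamma>_def horn_def affine_form_def by (intro holomorphic_intros)
	qed
qed

lemma irreducible_cay: "irreducible_closedin (zariski P) ((zariski P) closure_of cay_points)"
proof -
	have "{(\<lambda>p. x p + t * (\<lambda>_. 0) p) | x t. x \<in> cay_points} = cay_points" by auto
	then show ?thesis using irreducible_translates[of "\<lambda>_. 0"] by (simp add: coeff_space_def)
qed

text \<open>The functional pairing affine functions with - z is represented by the symmetric form of
  \<open>w\<close>, because it kills the radical, the null functions. Adding w times the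
  representing affine function turns \<open>z\<close> into a relation.\<close>

lemma tangent_space:
	assumes "w \<in> relations" and orth: "\<And>f. f \<in> null_functions w ==> (\<Sum>p\<in>P. z p * f p) = 0"
	shows "\<exists>d\<in>relations. \<exists>\<zeta> \<kappa>. \<forall>p\<in>P. z p = d p - w p * affine_form \<zeta> \<kappa> p"
proof -
	let ?U = index_sum and ?f = "\<lambda>y p. \<Sum>k\<in>index_sum. y k * basis_fun k p"
	have bilin: "(\<Sum>u\<in>?U. y u * (\<Sum>q\<in>P. w q * basis_fun u q * basis_fun v q)) = (\<Sum>q\<in>P. w q * ?f y q * basis_fun v q)" for y v
		unfolding sum_distrib_left sum_distrib_right by (subst sum.swap) (simp add: ac_simps)
	have sym_w: "(\<Sum>q\<in>P. w q * basis_fun u q * basis_fun v q) = (\<Sum>q\<in>P. w q * basis_fun v q * basis_fun u q)" for u v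
		by (rule sum.cong[OF refl]) (simp add: ac_simps)
	have orth_basis: "(\<Sum>q\<in>P. g q * f q) = 0"
		if f: "linear_on_P f" and g: "\<And>v. v \<in> ?U ==> (\<Sum>q\<in>P. g q * basis_fun v q) = 0" for f g
	proof -
		obtain c where c: "\<forall>p\<in>P. f p = ?f c p" using linear_on_P_basis[OF f] by (elim exE)
		have "(\<Sum>q\<in>P. g q * f q) = (\<Sum>q\<in>P. \<Sum>v\<in>?U. c v * (g q * basis_fun v q))"
			using c by (intro sum.cong refl) (simp add: sum_distrib_left mult.left_commute)
		also have "\<dots> = (\<Sum>v\<in>?U. c v * (\<Sum>q\<in>P. g q * basis_fun v q))"
			unfolding sum_distrib_left[of "c _"] by (rule sum.swap)
		also have "\<dots> = 0" using g by simp
		finally show ?thesis .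
	qed
	have "\<exists>y. \<forall>v\<in>?U. - (\<Sum>q\<in>P. z q * basis_fun v q) = (\<Sum>u\<in>?U. y u * (\<Sum>q\<in>P. w q * basis_fun u q * basis_fun v q))"
	proof (rule double_annihilator)
		fix c assume c: "\<And>u. u \<in> ?U ==> (\<Sum>v\<in>?U. c v * (\<Sum>q\<in>P. w q * basis_fun u q * basis_fun v q)) = 0"
		have "?f c \<in> null_functions w" unfolding null_functions_def
		proof (intro CollectI conjI basis_fun_linear allI impI)
			fix g assume g: "linear_on_P g"
			show "(\<Sum>p\<in>P. w p * ?f c p * g p) = 0"
			proof (rule orth_basis[OF g])
				fix u assume u: "u \<in> ?U"
				have "(\<Sum>v\<in>?U. c v * (\<Sum>q\<in>P. w q * basis_fun u q * basis_fun v q)) = (\<Sum>v\<in>?U. c v * (\<Sum>q\<in>P. w q * basis_fun v q * basis_fun u q))"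
					by (rule sum.cong[OF refl]) (subst sym_w, rule refl)
				then show "(\<Sum>p\<in>P. w p * ?f c p * basis_fun u p) = 0" using c[OF u] bilin[of c u] by simp
			qed
		qed
		from orth[OF this] have "(\<Sum>p\<in>P. z p * ?f c p) = 0" .
		moreover have "(\<Sum>p\<in>P. z p * ?f c p) = (\<Sum>v\<in>?U. c v * (\<Sum>q\<in>P. z q * basis_fun v q))"
			unfolding sum_distrib_left by (subst sum.swap) (simp add: ac_simps)
		ultimately show "(\<Sum>v\<in>?U. c v * - (\<Sum>q\<in>P. z q * basis_fun v q)) = 0"
			by (simp only: mult_minus_right sum_negf) simp
	qed auto
	then obtain y where y: "\<forall>v\<in>?U. - (\<Sum>q\<in>P. z q * basis_fun v q) = (\<Sum>q\<in>P. w q * ?f y q * basis_fun v q)"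
		unfolding bilin by (elim exE)
	obtain \<zeta> \<kappa> where zk: "\<forall>p\<in>P. ?f y p = affine_form \<zeta> \<kappa> p"
		using linear_on_P_obtain_affine_form[OF basis_fun_linear[of y]] by (elim exE)
	define d where "d p = (if p \<in> P then z p + w p * affine_form \<zeta> \<kappa> p else 0)" for p
	have "d \<in> relations"
	proof (rule relationsI)
		show "d \<in> coeff_space P" by (simp add: coeff_space_def d_def)
		fix f assume f: "linear_on_P f"
		show "(\<Sum>p\<in>P. d p * f p) = 0"
		proof (rule orth_basis[OF f])
			fix v assume v: "v \<in> ?U"
			have "(\<Sum>q\<in>P. d q * basis_fun v q) = (\<Sum>q\<in>P. z q * basis_fun v q + w q * ?f y q * basis_fun v q)"
				by (intro sum.cong refl) (use zk in \<open>simp add: d_def distrib_right\<close>)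
			then show "(\<Sum>q\<in>P. d q * basis_fun v q) = 0" unfolding sum.distrib y[rule_format, OF v, symmetric] by (simp only: right_minus)
		qed
	qed
	then show ?thesis by (intro bexI[of _ d] exI[of _ \<zeta>] exI[of _ \<kappa>] ballI) (simp_all add: d_def)
qed

text \<open>The curve with parameters w + t d, t \<zeta>, t \<kappa> starts at \<open>w\<close> with
  velocity d - w * l, where l is the affine form of \<zeta> and \<kappa>. By the last hypothesis the
  coordinates in \<open>J0\<close> of such velocities are arbitrary.\<close>

lemma growth_cay:
	assumes "w \<in> relations" "J0 \<subseteq> P"
		and ext: "\<And>y. \<exists>z. (\<forall>p\<in>J0. z p = y p) \<and> (\<forall>f\<in>null_functions w. (\<Sum>p\<in>P. z p * f p) = 0)"
	shows "growth_at_least P cay_points (card J0)"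
proof (rule growth_at_least_tangent[OF finite_P assms(2), where q = w])
	fix y
	obtain z where z: "\<forall>p\<in>J0. z p = y p" "\<forall>f\<in>null_functions w. (\<Sum>p\<in>P. z p * f p) = 0" using ext[of y] by (elim exE conjE)
	have "\<exists>d\<in>relations. \<exists>\<zeta> \<kappa>. \<forall>p\<in>P. z p = d p - w p * affine_form \<zeta> \<kappa> p"
		by (rule tangent_space[OF assms(1)]) (use z(2) in simp)
	then obtain d \<zeta> \<kappa> where d: "d \<in> relations" "\<forall>p\<in>P. z p = d p - w p * affine_form \<zeta> \<kappa> p" by (elim bexE exE)
	define \<gamma> where "\<gamma> t = horn (\<lambda>p. w p + t * d p) (\<lambda>j. t * \<zeta> j) (\<lambda>i. t * \<kappa> i)" for t
	show "\<exists>\<gamma>. (\<forall>t. \<gamma> t \<in> cay_points) \<and> (\<forall>j\<in>J0. \<gamma> 0 j = w j \<and> ((\<lambda>t. \<gamma> t j) has_field_derivative y j) (at 0))"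
	proof (intro exI[of _ \<gamma>] conjI allI ballI)
		show "\<gamma> t \<in> cay_points" for t
			unfolding \<gamma>_def by (rule cay_pointsI[OF relations_add_scale[OF assms(1) d(1)]])
		fix p assume p: "p \<in> J0"
		show "\<gamma> 0 p = w p" by (simp add: \<gamma>_def horn_def affine_form_def)
		have yp: "y p = d p - w p * affine_form \<zeta> \<kappa> p" using z(1)[rule_format, OF p] d(2)[rule_format, OF subsetD[OF assms(2) p]] by (metis (no_types))
		have "((\<lambda>t. (w p + t * d p) * exp (- (t * affine_form \<zeta> \<kappa> p))) has_field_derivative d p - w p * affine_form \<zeta> \<kappa> p) (at 0)"
			by (auto intro!: derivative_eq_intros)
		then show "((\<lambda>t. \<gamma> t p) has_field_derivative y p) (at 0)"
			by (simp add: \<gamma>_def horn_def affine_form_scale yp)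
	qed
qed

end

section \<open>Upper bounds for the dimension by counting parameters\<close>

context finite_tuple
begin

lemma affine_form_zero_unique:
	assumes "\<And>p. p \<in> P ==> (\<Sum>k\<in>index_sum. y k * basis_fun k p) = 0" "k \<in> index_sum"
	shows "y k = 0"
proof -
	have z: "y (Inl i) + (\<Sum>j<n. y (Inr j) * lvec a j) = 0" if "i < n" "a \<in> A i" for i a
		using assms(1)[of "(i, a)"] that by (simp add: mem_P_iff basis_fun_combination)
	have "y (Inr j) = 0" if "j < n" for j by (rule linear_zero(1)[OF z that])
	moreover have "y (Inl i) = 0" if "i < n" for i by (rule linear_zero(2)[OF z that])
	ultimately show ?thesis using assms(2) by (auto simp: Plus_def)
qed

text \<open>The 2n generators of the affine functions are independent on \<open>P\<close>, so at
  least 2n positions \<open>Q\<close> have independent rows; a dual basis on \<open>Q\<close>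
  expresses the entries of a relation there through the remaining ones.\<close>

lemma relations_parametrized:
	"\<exists>P'\<subseteq>P. card P' + 2 * n \<le> card P \<and> (\<exists>m. \<forall>w\<in>relations. \<forall>p\<in>P. w p = (\<Sum>q\<in>P'. m p q * w q))"
proof -
	let ?U = index_sum
	define r where "r p = (\<lambda>k. if k \<in> ?U then basis_fun k p else 0)" for p
	obtain B where B: "B \<subseteq> r ` P" "cfun.independent B" "r ` P \<subseteq> cfun.span B"
		by (rule cfun.basis_exists)
	have finB: "finite B" using B(1) by (rule finite_subset) simp
	define Q where "Q = inv_into P r ` B"
	have QP: "Q \<subseteq> P" unfolding Q_def by (rule image_subsetI) (rule inv_into_into[OF subsetD[OF B(1)]])
	have rinv: "r (inv_into P r b) = b" if "b \<in> B" for b using B(1) that by (intro f_inv_into_f) auto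
	have rQ: "r ` Q = B" unfolding Q_def image_image using rinv by simp
	have "inj_on (\<lambda>b. r (inv_into P r b)) B" by (rule inj_onI) (simp add: rinv)
	then have injQ: "inj_on r Q" unfolding Q_def by (rule inj_on_imageI[unfolded comp_def])
	have finQ: "finite Q" using QP by (rule finite_subset) simp
	have cQ: "card Q = card B" using card_image[OF injQ] rQ by simp
	have indQ: "indep_family UNIV Q r" using finQ injQ rQ B(2) by (simp add: indep_family_iff_independent)
	have cU: "card ?U = 2 * n" by (simp add: card_Plus)
	have big: "2 * n \<le> card B"
	proof (rule ccontr)
		assume "\<not> 2 * n \<le> card B"
		then have lt: "card B < card ?U" using cU by simp
		obtain y where y: "\<exists>k\<in>?U. y k \<noteq> 0" "\<forall>b\<in>B. (\<Sum>k\<in>?U. b k * y k) = 0"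
			using homogeneous_system_nontrivial[OF finB _ lt, of "\<lambda>b k. b k"] by (simp, elim exE conjE)
		have "(\<Sum>k\<in>?U. y k * x k) = 0" if "x \<in> cfun.span B" for x using that
		proof (induction rule: cfun.span_induct_alt)
			case (step c x z)
			have "(\<Sum>k\<in>?U. y k * ((\<lambda>i. c * x i) + z) k) = c * (\<Sum>k\<in>?U. x k * y k) + (\<Sum>k\<in>?U. y k * z k)"
				by (simp add: distrib_left sum.distrib sum_distrib_left ac_simps)
			then show ?case using step y(2) by simp
		qed simp
		then have "(\<Sum>k\<in>?U. y k * r p k) = 0" if "p \<in> P" for p using B(3) that by (simp add: image_subset_iff)
		then have "(\<Sum>k\<in>?U. y k * basis_fun k p) = 0" if "p \<in> P" for p
			using that by (simp add: r_def cong: sum.cong)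
		then have "y k = 0" if "k \<in> ?U" for k using that by (rule affine_form_zero_unique)
		then show False using y(1) by auto
	qed
	have "\<exists>c. \<forall>q0\<in>Q. \<forall>q\<in>Q. (if q = q0 then 1 else 0) = (\<Sum>k\<in>?U. c q0 k * basis_fun k q)"
	proof (rule dual_coefficients[OF _ finQ])
		fix f q assume f: "\<And>k. k \<in> ?U ==> (\<Sum>q\<in>Q. f q * basis_fun k q) = 0" and q: "q \<in> Q"
		have "(\<Sum>q\<in>Q. f q * r q k) = 0" for k by (cases "k \<in> ?U") (simp_all add: r_def f)
		then show "f q = 0" using indep_familyD[OF indQ, of f q] q by simp
	qed simp
	then obtain c where c: "\<forall>q0\<in>Q. \<forall>q\<in>Q. (if q = q0 then 1 else 0) = (\<Sum>k\<in>?U. c q0 k * basis_fun k q)" by (rule exE)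
	define P' where "P' = P - Q"
	define m where "m p q = (if p \<in> Q then - (\<Sum>k\<in>?U. c p k * basis_fun k q) else (if p = q then 1 else 0))" for p q
	have "w p = (\<Sum>q\<in>P'. m p q * w q)" if w: "w \<in> relations" and p: "p \<in> P" for w p
	proof (cases "p \<in> Q")
		case False
		then have "p \<in> P'" using p by (simp add: P'_def)
		then show ?thesis using False by (simp add: m_def P'_def if_distrib[of "\<lambda>x. x * _"] cong: if_cong)
	next
		case True
		let ?g = "\<lambda>q. \<Sum>k\<in>?U. c p k * basis_fun k q"
		have "0 = (\<Sum>q\<in>P. w q * ?g q)" using relations_pairing[OF w basis_fun_linear[of "c p"]] by simp
		also have "\<dots> = (\<Sum>q\<in>Q. w q * ?g q) + (\<Sum>q\<in>P'. w q * ?g q)"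
			unfolding P'_def using sum.subset_diff[OF QP finite_P] by (simp add: add.commute)
		also have "(\<Sum>q\<in>Q. w q * ?g q) = (\<Sum>q\<in>Q. w q * (if q = p then 1 else 0))"
			using c[THEN bspec, OF True] by (intro sum.cong refl) simp
		also have "\<dots> = w p" using True finQ by (simp add: if_distrib[of "\<lambda>x. _ * x"] cong: if_cong)
		finally have "w p = - (\<Sum>q\<in>P'. w q * ?g q)" by (simp add: eq_neg_iff_add_eq_0)
		also have "\<dots> = (\<Sum>q\<in>P'. m p q * w q)"
		proof -
			have "- (w q * ?g q) = m p q * w q" for q using True by (simp add: m_def)
			then show ?thesis by (simp only: sum_negf[symmetric])
		qed
		finally show ?thesis .
	qed
	moreover have "card P' + 2 * n \<le> card P"
	proof -
		have "card P' + card Q = card P" unfolding P'_def using card_Diff_subset[OF finQ QP] card_mono[OF finite_P QP] by simp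
		then show ?thesis using big cQ by simp
	qed
	moreover have "P' \<subseteq> P" by (simp add: P'_def)
	ultimately show ?thesis by (intro exI[of _ P'] conjI exI[of _ m] ballI)
qed

text \<open>Normalized parameters: scaling \<open>w\<close> absorbs \<open>\<kappa> 0\<close>, and
  \<open>J1\<close> lists redundant coordinates of \<zeta>, none for the hypersurface bound and one
  in the degenerate case.\<close>

definition slice :: "nat set => ((term_index => complex) \<times> (nat => complex) \<times> (nat => complex)) set" where
	"slice J1 = {(w, \<zeta>, \<kappa>). w \<in> relations \<and> \<kappa> 0 = 0 \<and> (\<forall>j\<in>J1. \<zeta> j = 0)}"

text \<open>On the slice a monomial in the coefficients becomes a polynomial in the free entries of
  \<open>w\<close> times one character in the remaining coordinates of \<zeta> and \<kappa>, with
  degrees and exponents of order D. Such products lie in a space of dimension O((D + 1)^\<rho>), and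
  \<rho> \<le> card P - 1 - card J1 < card J.\<close>

lemma slice_polynomial_relation:
	assumes n: "0 < n" and J: "J \<subseteq> P" and J1: "J1 \<subseteq> {..<n}" and less: "card P < Suc (card J + card J1)"
	shows "\<exists>D. \<exists>f\<in>box_polys J D. (\<forall>w \<zeta> \<kappa>. (w, \<zeta>, \<kappa>) \<in> slice J1 --> f (horn w \<zeta> \<kappa>) = 0) \<and> (\<exists>c\<in>coeff_space J. f c \<noteq> 0)"
proof -
	obtain P' m where P': "P' \<subseteq> P" "card P' + 2 * n \<le> card P" "\<forall>w\<in>relations. \<forall>p\<in>P. w p = (\<Sum>q\<in>P'. m p q * w q)"
		using relations_parametrized by (elim exE conjE)
	have finJ: "finite J" and finP': "finite P'" and finJ1: "finite J1"
		using J P'(1) J1 by (auto intro: finite_subset)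
	let ?I = "({1..<n} <+> ({..<n} - J1))"
	have finI: "finite ?I" by simp
	have cI: "card ?I = (n - 1) + (n - card J1)"
		using J1 finJ1 by (simp add: card_Plus card_Diff_subset)
	have cJ1: "card J1 \<le> n" using card_mono[OF _ J1] by simp
	define \<rho> where "\<rho> = card P' + card ?I"
	have \<rho>: "\<rho> < card J" using P'(2) less n cI cJ1 by (simp add: \<rho>_def)
	\<comment> \<open>Bounds the coordinates of all lattice points involved; the summand 1 makes it
	  bound the block indicators too.\<close>
	define Amax where "Amax = (\<Sum>p\<in>P. \<Sum>j<n. nat \<bar>coord (snd p) j\<bar>) + 1"
	have Amax: "nat \<bar>coord (snd p) j\<bar> \<le> Amax" if "p \<in> P" "j < n" for p j
	proof -
		have "nat \<bar>coord (snd p) j\<bar> \<le> (\<Sum>j<n. nat \<bar>coord (snd p) j\<bar>)"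
			using that(2) by (intro member_le_sum) auto
		also have "\<dots> \<le> (\<Sum>p\<in>P. \<Sum>j<n. nat \<bar>coord (snd p) j\<bar>)"
			using that(1) by (intro member_le_sum[where f = "\<lambda>p. \<Sum>j<n. nat \<bar>coord (snd p) j\<bar>"]) auto
		finally show ?thesis by (simp add: Amax_def)
	qed
	define N where "N = card J"
	\<comment> \<open>With \<open>N\<close> coefficients of exponent at most D each, a character
	  exponent takes at most 2 N Amax D + 1 \<le> M (D + 1) values.\<close>
	define M where "M = 2 * N * Amax + 1"
	define mu :: "nat + nat => term_index => int" where
		"mu k p = (case k of Inl i => (if fst p = i then 1 else 0) | Inr j => coord (snd p) j)" for k p
	have mu_basis: "of_int (mu k p) = basis_fun k p" for k p
		by (simp add: mu_def basis_fun_def cvec_apply split: sum.splits)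
	have mu_bound: "\<bar>mu k p\<bar> \<le> int Amax" if "k \<in> ?I" "p \<in> P" for k p
	proof (cases k)
		case (Inl i)
		have "1 \<le> Amax" by (simp add: Amax_def)
		then show ?thesis unfolding Inl by (simp add: mu_def)
	next
		case (Inr j)
		then have "j < n" using that(1) by auto
		from Amax[OF that(2) this] show ?thesis unfolding Inr mu_def by (simp add: nat_le_iff)
	qed
	define coords where "coords s k = (case s of (w, \<zeta>, \<kappa>) => (case k of Inl i => \<kappa> i | Inr j => \<zeta> j))"
		for s :: "(term_index => complex) \<times> (nat => complex) \<times> (nat => complex)" and k :: "nat + nat"
	have form: "affine_form \<zeta> \<kappa> p = (\<Sum>k\<in>?I. coords (w, \<zeta>, \<kappa>) k * of_int (mu k p))"
		if s: "(w, \<zeta>, \<kappa>) \<in> slice J1" and p: "p \<in> P" for w \<zeta> \<kappa> p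
	proof -
		obtain i a where ia: "p = (i, a)" by (cases p)
		have i: "i < n" using p by (simp add: ia mem_P_iff)
		have "affine_form \<zeta> \<kappa> p = (\<Sum>k\<in>index_sum. coords (w, \<zeta>, \<kappa>) k * basis_fun k p)"
			unfolding ia basis_fun_combination[OF i] by (simp add: affine_form_def coords_def)
		also have "\<dots> = (\<Sum>k\<in>?I. coords (w, \<zeta>, \<kappa>) k * basis_fun k p)"
		proof (rule sum.mono_neutral_right)
			show "?I \<subseteq> index_sum" by auto
			show "\<forall>k\<in>index_sum - ?I. coords (w, \<zeta>, \<kappa>) k * basis_fun k p = 0"
			proof
				fix k assume k: "k \<in> index_sum - ?I"
				show "coords (w, \<zeta>, \<kappa>) k * basis_fun k p = 0"
				proof (cases k)
					case (Inl l)
					then have "l = 0" using k by (cases "l = 0") auto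
					then show ?thesis using s Inl by (simp add: coords_def slice_def)
				next
					case (Inr l)
					then have "l \<in> J1" using k by auto
					then show ?thesis using s Inr by (simp add: coords_def slice_def)
				qed
			qed
		qed simp
		finally show ?thesis by (simp add: mu_basis)
	qed
	define bfun where "bfun k s = monomial_fun P' (fst k) (fst s) * exp (- (\<Sum>l\<in>?I. coords s l * of_int (snd k l)))"
		for k :: "(term_index => nat) \<times> (nat + nat => int)" and s
	let ?h = "\<lambda>(w, \<zeta>, \<kappa>). horn w \<zeta> \<kappa>"
	define C where "C = (N + 1) ^ card P' * M ^ card ?I"
	have key: "\<exists>(K :: ((term_index => nat) \<times> (nat + nat => int)) set) b. finite K \<and> card K \<le> C * (D + 1) ^ \<rho> \<and>
				(\<forall>\<alpha>\<in>exponents J D. \<exists>c. \<forall>s\<in>slice J1. monomial_fun J \<alpha> (?h s) = (\<Sum>k\<in>K. c k * b k s))" for D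
	proof -
		let ?B = "N * Amax * D"
		let ?E = "\<Pi>\<^sub>E l\<in>?I. {- int ?B..int ?B}"
		let ?K = "exponents P' (N * D) \<times> ?E"
		have finK: "finite ?K" using finP' finI by (intro finite_cartesian_product finite_exponents finite_PiE) auto
		have cardK: "card ?K \<le> C * (D + 1) ^ \<rho>"
		proof -
			have "card ?K = (N * D + 1) ^ card P' * (2 * ?B + 1) ^ card ?I"
			proof -
				have "card ?E = (2 * ?B + 1) ^ card ?I"
				proof -
					have "card {- int b..int b} = 2 * b + 1" for b :: nat by simp
					then show ?thesis by (simp only: card_PiE[OF finI] prod_constant)
				qed
				then show ?thesis using finP' by (simp only: card_cartesian_product card_exponents)
			qed
			also have "\<dots> \<le> ((N + 1) * (D + 1)) ^ card P' * (M * (D + 1)) ^ card ?I"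
			proof -
				have 1: "N * D + 1 \<le> (N + 1) * (D + 1)" by (simp add: algebra_simps)
				have 2: "2 * ?B + 1 \<le> M * (D + 1)" by (simp add: M_def algebra_simps)
				show ?thesis by (rule mult_le_mono[OF power_mono[OF 1] power_mono[OF 2]]) (rule le0)+
			qed
			also have "\<dots> = C * (D + 1) ^ \<rho>"
			proof -
				have "(x * z) ^ i * (y * z) ^ j = (x ^ i * y ^ j) * z ^ (i + j)" for x y z i j :: nat
					by (simp add: power_mult_distrib power_add)
				then show ?thesis by (simp only: C_def \<rho>_def)
			qed
			finally show ?thesis .
		qed
		have mon: "\<exists>c. \<forall>s\<in>slice J1. monomial_fun J \<alpha> (?h s) = (\<Sum>k\<in>?K. c k * bfun k s)"
			if \<alpha>: "\<alpha> \<in> exponents J D" for \<alpha>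
		proof -
			have \<alpha>D: "\<alpha> p \<le> D" if "p \<in> J" for p using \<alpha> that unfolding exponents_def by (auto dest: PiE_mem)
			define pw where "pw = (\<lambda>w. \<Prod>p\<in>J. (\<Sum>q\<in>P'. m p q * w q) ^ \<alpha> p)"
			have lin: "(\<lambda>w. \<Sum>q\<in>P'. m p q * w q) \<in> box_polys P' 1" for p
			proof (intro box_polys_sum box_polys_scale)
				fix q assume q: "q \<in> P'"
				have "monomial_fun P' (\<lambda>i. if i = q then 1 else 0) \<in> box_polys P' 1" by (intro box_polys_monomial finP') simp
				moreover have "monomial_fun P' (\<lambda>i. if i = q then 1 else 0) w = w q" for w :: "_ => complex"
				proof -
					have "monomial_fun P' (\<lambda>i. if i = q then 1 else 0) w = (\<Prod>i\<in>P'. if i = q then w i else 1)"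
						unfolding monomial_fun_def by (intro prod.cong) auto
					then show ?thesis using q finP' by simp
				qed
				ultimately show "(\<lambda>w. w q) \<in> box_polys P' 1" by (simp only: ext[of "monomial_fun P' (\<lambda>i. if i = q then 1 else 0)" "\<lambda>w. w q"])
			qed
			have "pw \<in> box_polys P' (\<Sum>p\<in>J. \<alpha> p * 1)"
				unfolding pw_def by (intro box_polys_prod finP' finJ box_polys_power lin)
			moreover have "(\<Sum>p\<in>J. \<alpha> p * 1) \<le> N * D"
				using sum_bounded_above[of J \<alpha> D] \<alpha>D by (simp add: N_def)
			ultimately have "pw \<in> box_polys P' (N * D)" using box_polys_mono[OF finP'] by simp
			then obtain u where u: "pw = (\<lambda>w. \<Sum>\<gamma>\<in>exponents P' (N * D). u \<gamma> * monomial_fun P' \<gamma> w)"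
				unfolding box_polys_def by (elim CollectE exE)
			\<comment> \<open>The exponent of the character: the sum of the Cayley exponents with
			  multiplicities \<alpha>. It is common to all terms of the polynomial factor.\<close>
			define \<beta> where "\<beta> = restrict (\<lambda>l. \<Sum>p\<in>J. int (\<alpha> p) * mu l p) ?I"
			have \<beta>: "\<beta> \<in> ?E"
			proof (rule PiE_I)
				fix l assume l: "l \<in> ?I"
				have "\<bar>\<Sum>p\<in>J. int (\<alpha> p) * mu l p\<bar> \<le> (\<Sum>p\<in>J. \<bar>int (\<alpha> p) * mu l p\<bar>)" by (rule sum_abs)
				also have "\<dots> \<le> (\<Sum>p\<in>J. int D * int Amax)"
				proof (rule sum_mono)
					fix p assume p: "p \<in> J"
					show "\<bar>int (\<alpha> p) * mu l p\<bar> \<le> int D * int Amax"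
						unfolding abs_mult using \<alpha>D[OF p] mu_bound[OF l subsetD[OF J p]] by (intro mult_mono) auto
				qed
				also have "\<dots> = int ?B" by (simp add: N_def)
				finally have "\<bar>\<Sum>p\<in>J. int (\<alpha> p) * mu l p\<bar> \<le> int ?B" .
				then show "\<beta> l \<in> {- int ?B..int ?B}" using l by (simp only: \<beta>_def restrict_apply if_True atLeastAtMost_iff abs_le_iff) simp
			qed (simp add: \<beta>_def)
			define c where "c k = (if snd k = \<beta> then u (fst k) else 0)" for k
			have "monomial_fun J \<alpha> (horn w \<zeta> \<kappa>) = (\<Sum>k\<in>?K. c k * bfun k (w, \<zeta>, \<kappa>))" if s: "(w, \<zeta>, \<kappa>) \<in> slice J1" for w \<zeta> \<kappa>
			proof -
				have wr: "w \<in> relations" using s by (simp add: slice_def)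
				have "monomial_fun J \<alpha> (horn w \<zeta> \<kappa>) = (\<Prod>p\<in>J. w p ^ \<alpha> p) * (\<Prod>p\<in>J. exp (- affine_form \<zeta> \<kappa> p) ^ \<alpha> p)"
					by (simp add: monomial_fun_def horn_def power_mult_distrib prod.distrib)
				also have "(\<Prod>p\<in>J. w p ^ \<alpha> p) = pw w" unfolding pw_def
				proof (rule prod.cong[OF refl])
					fix p assume "p \<in> J"
					then have "w p = (\<Sum>q\<in>P'. m p q * w q)" using P'(3) wr J by auto
					then show "w p ^ \<alpha> p = (\<Sum>q\<in>P'. m p q * w q) ^ \<alpha> p" by simp
				qed
				also have "(\<Prod>p\<in>J. exp (- affine_form \<zeta> \<kappa> p) ^ \<alpha> p) = exp (- (\<Sum>l\<in>?I. coords (w, \<zeta>, \<kappa>) l * of_int (\<beta> l)))"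
				proof -
					have "(\<Prod>p\<in>J. exp (- affine_form \<zeta> \<kappa> p) ^ \<alpha> p) = exp (\<Sum>p\<in>J. of_nat (\<alpha> p) * (- affine_form \<zeta> \<kappa> p))"
						by (simp add: exp_sum[OF finJ] exp_of_nat_mult[symmetric] del: mult_minus_right)
					also have "(\<Sum>p\<in>J. of_nat (\<alpha> p) * (- affine_form \<zeta> \<kappa> p))
							= - (\<Sum>p\<in>J. \<Sum>l\<in>?I. coords (w, \<zeta>, \<kappa>) l * (of_nat (\<alpha> p) * of_int (mu l p)))"
					proof -
						have "of_nat (\<alpha> p) * (- affine_form \<zeta> \<kappa> p) = - (\<Sum>l\<in>?I. coords (w, \<zeta>, \<kappa>) l * (of_nat (\<alpha> p) * of_int (mu l p)))" if "p \<in> J" for p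
							unfolding form[OF s subsetD[OF J that]] by (simp add: sum_distrib_left mult.left_commute)
						then show ?thesis by (simp add: sum_negf)
					qed
					also have "(\<Sum>p\<in>J. \<Sum>l\<in>?I. coords (w, \<zeta>, \<kappa>) l * (of_nat (\<alpha> p) * of_int (mu l p)))
							= (\<Sum>l\<in>?I. coords (w, \<zeta>, \<kappa>) l * of_int (\<beta> l))"
						by (subst sum.swap) (intro sum.cong refl, simp add: \<beta>_def sum_distrib_left)
					finally show ?thesis .
				qed
				also have "pw w * exp (- (\<Sum>l\<in>?I. coords (w, \<zeta>, \<kappa>) l * of_int (\<beta> l))) = (\<Sum>\<gamma>\<in>exponents P' (N * D). u \<gamma> * bfun (\<gamma>, \<beta>) (w, \<zeta>, \<kappa>))"
					unfolding u by (simp add: sum_distrib_right bfun_def mult.assoc)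
				also have "\<dots> = (\<Sum>\<gamma>\<in>exponents P' (N * D). \<Sum>b\<in>?E. c (\<gamma>, b) * bfun (\<gamma>, b) (w, \<zeta>, \<kappa>))"
				proof (rule sum.cong[OF refl])
					fix \<gamma>
					have "(\<Sum>b\<in>?E. c (\<gamma>, b) * bfun (\<gamma>, b) (w, \<zeta>, \<kappa>))
							= (\<Sum>b\<in>?E. if b = \<beta> then u \<gamma> * bfun (\<gamma>, b) (w, \<zeta>, \<kappa>) else 0)"
						by (intro sum.cong refl) (simp add: c_def)
					also have "\<dots> = u \<gamma> * bfun (\<gamma>, \<beta>) (w, \<zeta>, \<kappa>)"
						by (simp only: sum.delta[OF finite_PiE[OF finI finite_atLeastAtMost_int]] \<beta> if_True)
					finally show "u \<gamma> * bfun (\<gamma>, \<beta>) (w, \<zeta>, \<kappa>) = (\<Sum>b\<in>?E. c (\<gamma>, b) * bfun (\<gamma>, b) (w, \<zeta>, \<kappa>))" ..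
				qed
				also have "\<dots> = (\<Sum>k\<in>?K. c k * bfun k (w, \<zeta>, \<kappa>))"
					by (simp only: sum.cartesian_product case_prod_unfold prod.collapse)
				finally show ?thesis .
			qed
			then show ?thesis by (intro exI[of _ c] ballI) (simp only: split_paired_all case_prod_conv)
		qed
		have mon_all: "\<forall>\<alpha>\<in>exponents J D. \<exists>c. \<forall>s\<in>slice J1. monomial_fun J \<alpha> (?h s) = (\<Sum>k\<in>?K. c k * bfun k s)"
			by (rule ballI) (rule mon)
		show ?thesis
			by (rule exI[of _ ?K], rule exI[of _ bfun], rule conjI[OF finK conjI[OF cardK mon_all]])
	qed
	have "\<exists>D. \<exists>f\<in>box_polys J D. (\<forall>s\<in>slice J1. f (?h s) = 0) \<and> (\<exists>c\<in>coeff_space J. f c \<noteq> 0)"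
		by (rule polynomial_relation_by_counting[OF finJ \<rho> key])
	then show ?thesis
	proof (rule exE, elim bexE)
		fix D f
		assume f: "f \<in> box_polys J D"
			and f0: "(\<forall>s\<in>slice J1. f (?h s) = 0) \<and> (\<exists>c\<in>coeff_space J. f c \<noteq> 0)"
		have "\<forall>w \<zeta> \<kappa>. (w, \<zeta>, \<kappa>) \<in> slice J1 --> f (horn w \<zeta> \<kappa>) = 0"
		proof (intro allI impI)
			fix w \<zeta> \<kappa> assume s: "(w, \<zeta>, \<kappa>) \<in> slice J1"
			show "f (horn w \<zeta> \<kappa>) = 0" using bspec[OF conjunct1[OF f0] s] by (simp only: case_prod_conv)
		qed
		from conjI[OF this conjunct2[OF f0]]
		have "\<exists>f\<in>box_polys J D. (\<forall>w \<zeta> \<kappa>. (w, \<zeta>, \<kappa>) \<in> slice J1 --> f (horn w \<zeta> \<kappa>) = 0) \<and> (\<exists>c\<in>coeff_space J. f c \<noteq> 0)"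
			by (rule bexI[where x = f, OF _ f])
		then show ?thesis by (rule exI[where x = D])
	qed
qed

end

text \<open>Since \<psi> has nonzero derivative, the points - \<psi> \<tau> are nonzero for small
  \<tau> and accumulate at 0, where the identity theorem applies.\<close>

lemma frequent_zeros_imp_zero:
	fixes G \<psi> :: "complex => complex"
	assumes G: "G holomorphic_on UNIV" and \<psi>: "\<psi> 0 = 0" "(\<psi> has_field_derivative d) (at 0)" "d \<noteq> 0"
		and zero: "\<forall>\<^sub>F \<tau> in at 0. G (- \<psi> \<tau>) = 0"
	shows "G z = 0"
proof -
	have "((\<lambda>\<tau>. (\<psi> \<tau> - \<psi> 0) / (\<tau> - 0)) \<longlongrightarrow> d) (at 0)" using \<psi>(2) by (simp add: has_field_derivative_iff)
	then have "\<forall>\<^sub>F \<tau> in at 0. (\<psi> \<tau> - \<psi> 0) / (\<tau> - 0) \<noteq> 0" using \<psi>(3) by (rule tendsto_imp_eventually_ne)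
	then have ne: "\<forall>\<^sub>F \<tau> in at 0. - \<psi> \<tau> \<noteq> 0" by eventually_elim (simp add: \<psi>(1))
	have "isCont \<psi> 0" using \<psi>(2) by (rule DERIV_isCont)
	then have "(\<psi> \<longlongrightarrow> 0) (at 0)" using \<psi>(1) by (simp add: isCont_def)
	then have t: "((\<lambda>\<tau>. - \<psi> \<tau>) \<longlongrightarrow> 0) (at 0)" using tendsto_minus[of \<psi> 0] by simp
	have lim: "filterlim (\<lambda>\<tau>. - \<psi> \<tau>) (at 0) (at 0)" using t ne by (simp add: filterlim_at)
	have "0 islimpt {z. G z = 0}" unfolding islimpt_iff_eventually
	proof
		assume "\<forall>\<^sub>F y in at 0. y \<notin> {z. G z = 0}"
		then have "\<forall>\<^sub>F \<tau> in at 0. - \<psi> \<tau> \<notin> {z. G z = 0}" using lim by (rule eventually_compose_filterlim)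
		with zero have "\<forall>\<^sub>F \<tau> in at (0::complex). False" by eventually_elim simp
		then show False by simp
	qed
	then show ?thesis
		by (rule analytic_continuation[OF G open_UNIV connected_UNIV subset_UNIV UNIV_I]) simp_all
qed

section \<open>Codimension of the closure of the parametrized set\<close>

context finite_tuple
begin

lemma relations_scale: "w \<in> relations ==> (\<lambda>p. t * w p) \<in> relations"
	using relations_add_scale[OF relations_zero, of w t] by simp

text \<open>Multiplying \<open>w\<close> by exp(- \<kappa> 0) and subtracting
  \<open>\<kappa> 0\<close> from \<kappa> does not change the system.\<close>

lemma slice_vanish:
	assumes f: "\<forall>w \<zeta> \<kappa>. (w, \<zeta>, \<kappa>) \<in> slice J1 --> f (horn w \<zeta> \<kappa>) = 0"
		and "w \<in> relations" "\<forall>j\<in>J1. \<zeta> j = 0"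
	shows "f (horn w \<zeta> \<kappa>) = 0"
proof -
	have "(\<lambda>p. exp (- \<kappa> 0) * w p, \<zeta>, \<lambda>i. \<kappa> i - \<kappa> 0) \<in> slice J1"
		using assms(2,3) relations_scale by (simp add: slice_def)
	moreover have "horn w \<zeta> \<kappa> = horn (\<lambda>p. exp (- \<kappa> 0) * w p) \<zeta> (\<lambda>i. \<kappa> i - \<kappa> 0)"
	proof
		fix p
		have "exp (- \<kappa> 0) * exp (- affine_form \<zeta> (\<lambda>i. \<kappa> i - \<kappa> 0) p) = exp (- affine_form \<zeta> \<kappa> p)"
			by (simp add: exp_add[symmetric] affine_form_def)
		then show "horn w \<zeta> \<kappa> p = horn (\<lambda>p. exp (- \<kappa> 0) * w p) \<zeta> (\<lambda>i. \<kappa> i - \<kappa> 0) p"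
			unfolding horn_def by (metis (no_types) mult.assoc mult.commute)
	qed
	ultimately show ?thesis using f by simp
qed

lemma P_nonempty: "0 < n ==> \<exists>p. p \<in> P"
	using A_nonempty[of 0] by (auto simp: mem_P_iff system_index_def)

text \<open>Parameter count with \<open>J1\<close> empty: one parameter fewer than coefficients,
  hence an equation.\<close>

lemma closure_cay_psubset:
	assumes "0 < n"
	shows "(zariski P) closure_of cay_points \<subset> coeff_space P"
proof -
	have "\<exists>D. \<exists>f\<in>box_polys P D. (\<forall>w \<zeta> \<kappa>. (w, \<zeta>, \<kappa>) \<in> slice {} --> f (horn w \<zeta> \<kappa>) = 0) \<and> (\<exists>c\<in>coeff_space P. f c \<noteq> 0)"
		by (rule slice_polynomial_relation[OF assms subset_refl]) simp_all
	then obtain D f c where f: "f \<in> box_polys P D" "\<forall>w \<zeta> \<kappa>. (w, \<zeta>, \<kappa>) \<in> slice {} --> f (horn w \<zeta> \<kappa>) = 0"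
		and c: "c \<in> coeff_space P" "f c \<noteq> 0" by (elim exE bexE conjE)
	have "f x = 0" if "x \<in> cay_points" for x
		using that slice_vanish[OF f(2)] unfolding cay_points_def by (elim CollectE exE conjE) simp
	then have "c \<notin> (zariski P) closure_of cay_points"
		unfolding in_zariski_closure_iff[OF cay_points_coeff_space]
		using c box_polys_in_polynomial_functions[OF f(1)] by metis
	moreover have "(zariski P) closure_of cay_points \<subseteq> coeff_space P"
		using closure_of_subset_topspace[of "zariski P" cay_points] by simp
	ultimately show ?thesis using c(1) by (intro psubsetI) auto
qed

text \<open>If a proper relation has only constant null functions, velocities there need only have
  sum zero; all coordinates but one are free, and the growth exponent is at least card P -
  1.\<close>

lemma hypersurface_closure_cay:
	assumes n: "0 < n" and deg: "\<not> degenerate"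
	shows "hypersurface (zariski P) ((zariski P) closure_of cay_points)"
proof -
	let ?Z = "(zariski P) closure_of cay_points"
	obtain w where w: "w \<in> proper_relations" "\<forall>\<theta>\<in>null_functions w. \<not> nonconstant \<theta>"
		using deg unfolding degenerate_def by (auto simp: Bex_def)
	have wr: "w \<in> relations" using w(1) by (simp add: proper_relations_def)
	obtain p0 where p0: "p0 \<in> P" using P_nonempty[OF n] by (elim exE)
	have "growth_at_least P cay_points (card (P - {p0}))"
	proof (rule growth_cay[OF wr])
		fix y :: "term_index => complex"
		define z where "z p = (if p = p0 then - (\<Sum>p\<in>P - {p0}. y p) else y p)" for p
		have "(\<Sum>p\<in>P. z p) = z p0 + (\<Sum>p\<in>P - {p0}. z p)" by (rule sum.remove[OF finite_P p0])
		also have "(\<Sum>p\<in>P - {p0}. z p) = (\<Sum>p\<in>P - {p0}. y p)" by (rule sum.cong) (auto simp: z_def)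
		also have "z p0 + (\<Sum>p\<in>P - {p0}. y p) = 0" by (simp add: z_def)
		finally have z0: "(\<Sum>p\<in>P. z p) = 0" .
		have "(\<Sum>p\<in>P. z p * f p) = 0" if f: "f \<in> null_functions w" for f
		proof -
			have "f p = f p0" if "p \<in> P" for p using w(2)[rule_format, OF f] that p0 unfolding nonconstant_def by metis
			then have "(\<Sum>p\<in>P. z p * f p) = (\<Sum>p\<in>P. z p * f p0)" by (intro sum.cong refl) simp
			also have "\<dots> = (\<Sum>p\<in>P. z p) * f p0" by (simp only: sum_distrib_right)
			finally show ?thesis by (simp add: z0)
		qed
		then show "\<exists>z. (\<forall>p\<in>P - {p0}. z p = y p) \<and> (\<forall>f\<in>null_functions w. (\<Sum>p\<in>P. z p * f p) = 0)"
			by (intro exI[of _ z] conjI ballI) (simp_all add: z_def)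
	qed auto
	moreover have sub: "cay_points \<subseteq> ?Z" by (rule closure_of_subset) (simp add: cay_points_coeff_space)
	ultimately have g: "growth_at_least P ?Z (card (P - {p0}))" by (rule growth_at_least_closure[rotated])
	have "codimension (zariski P) ?Z \<le> enat 1"
		by (rule codimension_le[OF finite_P g]) (use p0 in simp)
	moreover have "enat 1 \<le> codimension (zariski P) ?Z"
		by (rule codimension_ge[where C = "\<lambda>i. if i = 0 then ?Z else coeff_space P"])
			(simp_all add: irreducible_cay coeff_space_irreducible closure_cay_psubset[OF n])
	ultimately show ?thesis by (simp add: hypersurface_def irreducible_cay one_enat_def)
qed

text \<open>For a null function \<theta> of \<open>w\<close>, the relation w (1 + \<tau> \<theta>)
  with log(1 + \<tau> \<theta>) added to the affine form gives the same system. This shift moves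
  \<open>\<zeta> j0\<close> with nonzero speed, so \<open>f\<close>, as a function of
  \<open>\<zeta> j0\<close>, has zeros accumulating at 0 and vanishes identically.\<close>

lemma degenerate_slice_vanish:
	assumes n: "0 < n" and deg: degenerate and j0: "j0 < n"
		and w0: "w0 \<in> relations" "transversal (\<lambda>j. if j = j0 then 1 else 0) w0"
		and f: "f \<in> polys" "\<forall>w \<zeta> \<kappa>. (w, \<zeta>, \<kappa>) \<in> slice {j0} --> f (horn w \<zeta> \<kappa>) = 0" and x: "x \<in> cay_points"
	shows "f x = 0"
proof -
	let ?e = "\<lambda>j. if j = j0 then 1 else 0 :: complex"
	obtain D where D: "D \<in> polys" "D w0 \<noteq> 0" "\<forall>w. D w \<noteq> 0 --> transversal ?e w"
		using transversal_open[OF w0(2)] by (elim bexE conjE)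
	have main: "f (horn w \<zeta> \<kappa>) = 0" if wr: "w \<in> relations" and tw: "transversal ?e w" for w \<zeta> \<kappa>
	proof -
		have w: "w \<in> proper_relations" by (rule transversal_proper[OF wr tw])
		obtain \<theta> where \<theta>: "\<theta> \<in> null_functions w" "nonconstant \<theta>" using deg w unfolding degenerate_def by (auto simp: Bex_def)
		obtain \<xi> \<eta> j1 where rep: "\<And>i a. i < n ==> a \<in> A i ==> \<theta> (i, a) = \<eta> i + covec \<xi> a"
			and j1: "j1 < n" "\<xi> j1 \<noteq> 0" and cov: "\<And>i. i < n ==> dot \<xi> (moment w i) = 0"
			by (rule null_functionE[OF w \<theta>]) (rule that)
		have ecv: "?e \<in> cvec_space n" using j0 by (simp add: cvec_space_def)
		have "dot \<xi> ?e \<noteq> 0"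
			by (rule transversal_covector[where h = \<xi> and b = ?e and w = w, OF n wr tw ecv j1 cov])
		then have xi: "\<xi> j0 \<noteq> 0" using j0 by (simp add: if_distrib[of "\<lambda>x. _ * x"] cong: if_cong)
		let ?R = "\<theta> ` P"
		\<comment> \<open>Affine forms of the level indicators; \<open>Zc c\<close> and
		  \<open>Kc c\<close> then represent the function sending p to c (\<theta> p).\<close>
		have "\<forall>r. \<exists>zk. \<forall>p\<in>P. (if \<theta> p = r then 1 else 0) = affine_form (fst zk) (snd zk) p"
		proof
			fix r
			obtain Z K where "\<forall>p\<in>P. (if \<theta> p = r then 1 else 0) = affine_form Z K p"
				using linear_on_P_obtain_affine_form[OF degenerate_compose[OF n deg w \<theta>, of "\<lambda>x. if x = r then 1 else 0"]] by (elim exE)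
			then show "\<exists>zk. \<forall>p\<in>P. (if \<theta> p = r then 1 else 0) = affine_form (fst zk) (snd zk) p"
				by (intro exI[of _ "(Z, K)"]) simp
		qed
		from choice[OF this] obtain zk where zk: "\<forall>r. \<forall>p\<in>P. (if \<theta> p = r then 1 else 0) = affine_form (fst (zk r)) (snd (zk r)) p"
			by (elim exE)
		define Zc where "Zc c = (\<lambda>j. \<Sum>r\<in>?R. c r * fst (zk r) j)" for c
		define Kc where "Kc c = (\<lambda>i. \<Sum>r\<in>?R. c r * snd (zk r) i)" for c
		have lin: "affine_form (Zc c) (Kc c) p = c (\<theta> p)" if p: "p \<in> P" for c p
		proof -
			have "affine_form (Zc c) (Kc c) p = (\<Sum>r\<in>?R. c r * affine_form (fst (zk r)) (snd (zk r)) p)"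
			proof -
				have "(\<Sum>j<n. (\<Sum>r\<in>?R. c r * fst (zk r) j) * lvec (snd p) j) = (\<Sum>r\<in>?R. c r * (\<Sum>j<n. fst (zk r) j * lvec (snd p) j))"
					unfolding sum_distrib_left sum_distrib_right by (subst sum.swap) (simp add: mult.assoc)
				then show ?thesis by (simp add: affine_form_def Zc_def Kc_def distrib_left sum.distrib)
			qed
			also have "\<dots> = (\<Sum>r\<in>?R. c r * (if \<theta> p = r then 1 else 0))"
				by (rule sum.cong[OF refl]) (simp only: zk[rule_format, OF p])
			also have "\<dots> = c (\<theta> p)" using p by (simp add: if_distrib[of "\<lambda>x. _ * x"] cong: if_cong)
			finally show ?thesis .
		qed
		have Zid: "Zc (\<lambda>r. r) j0 = \<xi> j0" unfolding Zc_def
		proof (rule indicator_combination[OF rep _ j0, symmetric, where \<kappa> = "\<lambda>r. snd (zk r)"])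
			fix r i a assume ia: "i < n" "a \<in> A i"
			then have "(i, a) \<in> P" by (simp add: mem_P_iff)
			from zk[rule_format, OF this, of r]
			show "(\<Sum>j<n. fst (zk r) j * lvec a j) + snd (zk r) i = (if \<theta> (i, a) = r then 1 else 0)"
				by (simp only: affine_form_def fst_conv snd_conv add.commute)
		qed
		\<comment> \<open>The component \<open>j0\<close> of the linear part of log(1 + \<tau> \<theta>);
		  its derivative at 0 is that component for \<theta> itself, namely
		  \<open>\<xi> j0\<close>.\<close>
		define \<psi> where "\<psi> \<tau> = Zc (\<lambda>r. Ln (1 + \<tau> * r)) j0" for \<tau>
		have psi0: "\<psi> 0 = 0" by (simp add: \<psi>_def Zc_def)
		have psid: "(\<psi> has_field_derivative \<xi> j0) (at 0)"
		proof -
			have "((\<lambda>\<tau>. Ln (1 + \<tau> * r) * fst (zk r) j0) has_field_derivative r * fst (zk r) j0) (at 0)" for r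
				by (auto intro!: derivative_eq_intros)
			then have "((\<lambda>\<tau>. \<Sum>r\<in>?R. Ln (1 + \<tau> * r) * fst (zk r) j0) has_field_derivative (\<Sum>r\<in>?R. r * fst (zk r) j0)) (at 0)"
				by (intro DERIV_sum)
			then show ?thesis using Zid by (simp add: \<psi>_def[abs_def] Zc_def)
		qed
		define G where "G z = f (horn w (\<lambda>j. if j = j0 then z else \<zeta> j) \<kappa>)" for z
		have Ghol: "G holomorphic_on UNIV" unfolding G_def
		proof (rule polynomial_functions_holomorphic[OF f(1)])
			fix p :: "term_index"
			have "(\<lambda>z. \<Sum>j<n. (if j = j0 then z else \<zeta> j) * lvec (snd p) j) holomorphic_on UNIV"
			proof (intro holomorphic_intros)
				show "(\<lambda>z. if j = j0 then z else \<zeta> j) holomorphic_on UNIV" for j by (cases "j = j0") auto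
			qed
			moreover have "(\<lambda>z. c * exp (- (k + S z))) holomorphic_on UNIV" if "S holomorphic_on UNIV" for c k :: complex and S
				by (intro holomorphic_intros that)
			ultimately show "(\<lambda>z. horn w (\<lambda>j. if j = j0 then z else \<zeta> j) \<kappa> p) holomorphic_on UNIV"
				unfolding horn_def affine_form_def by simp
		qed
		\<comment> \<open>Away from the zeros of 1 + \<tau> r the exponential inverts
		  \<open>Ln\<close>.\<close>
		have nz: "\<forall>\<^sub>F \<tau> in at (0::complex). \<forall>r\<in>?R. 1 + \<tau> * r \<noteq> 0"
		proof (rule eventually_ball_finite)
			show "\<forall>r\<in>?R. \<forall>\<^sub>F \<tau> in at 0. 1 + \<tau> * r \<noteq> 0"
			proof
				fix r
				have "((\<lambda>\<tau>::complex. 1 + \<tau> * r) \<longlongrightarrow> 1 + 0 * r) (at 0)" by (intro tendsto_intros)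
				then show "\<forall>\<^sub>F \<tau> in at 0. 1 + \<tau> * r \<noteq> 0" by (rule tendsto_imp_eventually_ne) simp
			qed
		qed simp
		have "\<forall>\<^sub>F \<tau> in at 0. G (- \<psi> \<tau>) = 0" using nz
		proof eventually_elim
			fix \<tau> assume nz: "\<forall>r\<in>?R. 1 + \<tau> * r \<noteq> 0"
			define \<zeta>' where "\<zeta>' j = (if j = j0 then - \<psi> \<tau> else \<zeta> j)" for j
			define L where "L = (\<lambda>r. Ln (1 + \<tau> * r))"
			define w' where "w' p = w p * (1 + \<tau> * \<theta> p)" for p
			have "w' \<in> relations"
			proof (rule relationsI)
				show "w' \<in> coeff_space P" using relations_coeff_space[OF wr] by (simp add: w'_def coeff_space_def)
				fix g assume g: "linear_on_P g"
				have "(\<Sum>p\<in>P. w' p * g p) = (\<Sum>p\<in>P. w p * g p) + \<tau> * (\<Sum>p\<in>P. w p * \<theta> p * g p)"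
					by (simp add: w'_def algebra_simps sum.distrib sum_distrib_left)
				then show "(\<Sum>p\<in>P. w' p * g p) = 0"
					using relations_pairing[OF wr g] \<theta>(1) g by (simp add: null_functions_def)
			qed
			moreover have "\<forall>j\<in>{j0}. \<zeta>' j + Zc L j = 0" by (simp add: \<zeta>'_def \<psi>_def L_def)
			ultimately have "f (horn w' (\<lambda>j. \<zeta>' j + Zc L j) (\<lambda>i. \<kappa> i + Kc L i)) = 0"
				by (rule slice_vanish[OF f(2)])
			moreover have "horn w' (\<lambda>j. \<zeta>' j + Zc L j) (\<lambda>i. \<kappa> i + Kc L i) = horn w \<zeta>' \<kappa>"
			proof
				fix p
				show "horn w' (\<lambda>j. \<zeta>' j + Zc L j) (\<lambda>i. \<kappa> i + Kc L i) p = horn w \<zeta>' \<kappa> p"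
				proof (cases "p \<in> P")
					case True
					then have nzp: "1 + \<tau> * \<theta> p \<noteq> 0" using nz by simp
					have e: "y * exp (- (x + Ln y)) = exp (- x)" if "y \<noteq> 0" for x y
						using that by (simp add: exp_diff exp_minus field_simps)
					show ?thesis
						unfolding horn_def affine_form_add lin[OF True] L_def w'_def by (simp only: mult.assoc e[OF nzp])
				next
					case False
					have "\<forall>p. p \<notin> P --> w p = 0" using relations_coeff_space[OF wr] unfolding coeff_space_def by (rule CollectD)
					from this[rule_format, OF False] show ?thesis by (simp add: horn_def w'_def)
				qed
			qed
			ultimately show "G (- \<psi> \<tau>) = 0" by (simp add: G_def \<zeta>'_def[abs_def])
		qed
		then have "G (\<zeta> j0) = 0" by (rule frequent_zeros_imp_zero[OF Ghol psi0 psid xi])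
		moreover have "(\<lambda>j. if j = j0 then \<zeta> j0 else \<zeta> j) = \<zeta>" by auto
		ultimately show ?thesis by (simp add: G_def)
	qed
	obtain w \<zeta> \<kappa> where w: "w \<in> relations" "x = horn w \<zeta> \<kappa>" using x unfolding cay_points_def by (elim CollectE exE conjE)
	have "f (horn w \<zeta> \<kappa>) = 0"
		by (rule vanish_on_relations[OF D(1) w0(1) D(2) horn_polynomial[OF f(1)] _ w(1)]) (rule main, simp, use D(3) in simp)
	then show ?thesis by (simp add: w(2))
qed

text \<open>Otherwise a polynomial vanishing on the set would still vanish after its points are
  changed in one coordinate, then in another, and finally in all. From the zero system every point
  of the space is reached, although the closure is proper.\<close>

lemma ex_translate_not_in_closure:
	assumes "0 < n"
	shows "\<exists>q\<in>P. \<exists>x\<in>cay_points. \<exists>t. (\<lambda>p. x p + t * (if p = q then 1 else 0)) \<notin> (zariski P) closure_of cay_points"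
proof (rule ccontr)
	assume "\<not> ?thesis"
	then have cl: "(\<lambda>p. x p + t * (if p = q then 1 else 0)) \<in> (zariski P) closure_of cay_points"
		if "q \<in> P" "x \<in> cay_points" for q x t using that by blast
	have step: "f (\<lambda>p. x p + (if p \<in> Q then t p else 0)) = 0"
		if "finite Q" "Q \<subseteq> P" "f \<in> polys" "\<And>x. x \<in> cay_points ==> f x = 0" "x \<in> cay_points" for Q f x t
		using that
	proof (induction Q arbitrary: f x rule: finite_induct)
		case empty
		then show ?case by simp
	next
		case (insert q Q)
		define g where "g c = f (\<lambda>p. c p + (if p = q then t q else 0))" for c
		have "g (\<lambda>p. x p + (if p \<in> Q then t p else 0)) = 0"
		proof (rule insert.IH)
			show "Q \<subseteq> P" using insert.prems(1) by simp
			show "g \<in> polys" unfolding g_def by (rule polynomial_functions_compose[OF insert.prems(2)])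
					(intro polynomial_functions.add polynomial_functions.coord polynomial_functions.const)
			fix y assume y: "y \<in> cay_points"
			have "(\<lambda>p. y p + t q * (if p = q then 1 else 0)) \<in> (zariski P) closure_of cay_points"
				using insert.prems(1) y by (intro cl) auto
			moreover have "(\<lambda>p. y p + t q * (if p = q then 1 else 0)) = (\<lambda>p. y p + (if p = q then t q else 0))" by auto
			ultimately show "g y = 0"
				unfolding g_def in_zariski_closure_iff[OF cay_points_coeff_space] using insert.prems(2,3) by simp
		qed (rule insert.prems)
		moreover have "(\<lambda>p. x p + (if p \<in> Q then t p else 0) + (if p = q then t q else 0)) = (\<lambda>p. x p + (if p \<in> insert q Q then t p else 0))"
			using insert.hyps(2) by auto
		ultimately show ?case by (simp add: g_def)
	qed
	have "\<exists>c. c \<in> coeff_space P \<and> c \<notin> (zariski P) closure_of cay_points" using closure_cay_psubset[OF assms] by blast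
	then obtain c f where c: "c \<in> coeff_space P" and f: "f \<in> polys" "\<And>x. x \<in> cay_points ==> f x = 0" "f c \<noteq> 0"
		unfolding in_zariski_closure_iff[OF cay_points_coeff_space] by auto
	have z: "horn (\<lambda>_. 0) (\<lambda>_. 0) (\<lambda>_. 0) \<in> cay_points" by (rule cay_pointsI[OF relations_zero])
	have "f (\<lambda>p. horn (\<lambda>_. 0) (\<lambda>_. 0) (\<lambda>_. 0) p + (if p \<in> P then c p else 0)) = 0"
		by (rule step[OF finite_P subset_refl f(1) f(2) z])
	moreover have "(\<lambda>p. horn (\<lambda>_. 0) (\<lambda>_. 0) (\<lambda>_. 0) p + (if p \<in> P then c p else 0)) = c"
		using c by (auto simp: horn_def coeff_space_def)
	ultimately show False using f(3) by simp
qed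

text \<open>Upper bound: null functions are spanned by 1 and \<theta>, so velocities can be
  prescribed away from two positions where \<theta> differs. Lower bound: between the closure and
  the whole space lies the closure of the translates along one coordinate \<open>q\<close>, proper
  because the parameter count yields an equation in which \<open>q\<close> does not occur.\<close>

lemma codimension_two_closure_cay:
	assumes n: "0 < n" and deg: degenerate and ne: "proper_relations \<noteq> {}"
	shows "codimension (zariski P) ((zariski P) closure_of cay_points) = 2"
proof -
	let ?Z = "(zariski P) closure_of cay_points"
	obtain w where w: "w \<in> proper_relations" using ne by auto
	have wr: "w \<in> relations" using w by (simp add: proper_relations_def)
	obtain \<theta> where \<theta>: "\<theta> \<in> null_functions w" "nonconstant \<theta>" using deg w unfolding degenerate_def by (auto simp: Bex_def)
	obtain p0 p1 where p: "p0 \<in> P" "p1 \<in> P" "\<theta> p0 \<noteq> \<theta> p1" using \<theta>(2) by (auto simp: nonconstant_def)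
	have p01: "p0 \<noteq> p1" using p(3) by auto
	let ?J0 = "P - {p0, p1}"
	have "growth_at_least P cay_points (card ?J0)"
	proof (rule growth_cay[OF wr])
		fix y :: "term_index => complex"
		define s0 where "s0 = (\<Sum>p\<in>?J0. y p)"
		define s1 where "s1 = (\<Sum>p\<in>?J0. y p * \<theta> p)"
		\<comment> \<open>With this value at \<open>p1\<close> and - s0 - z1 at \<open>p0\<close>, the
		  pairings of z with 1 and with \<theta> both vanish.\<close>
		define z1 where "z1 = (\<theta> p0 * s0 - s1) / (\<theta> p1 - \<theta> p0)"
		define z where "z p = (if p = p1 then z1 else if p = p0 then - s0 - z1 else y p)" for p
		have split: "(\<Sum>p\<in>P. z p * g p) = z1 * g p1 + (- s0 - z1) * g p0 + (\<Sum>p\<in>?J0. y p * g p)" for g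
		proof -
			have "(\<Sum>p\<in>P. z p * g p) = (\<Sum>p\<in>{p0, p1}. z p * g p) + (\<Sum>p\<in>?J0. z p * g p)"
				using p by (subst sum.subset_diff[of "{p0, p1}" P]) (auto simp: add.commute)
			also have "(\<Sum>p\<in>{p0, p1}. z p * g p) = z1 * g p1 + (- s0 - z1) * g p0" using p01 by (simp add: z_def)
			also have "(\<Sum>p\<in>?J0. z p * g p) = (\<Sum>p\<in>?J0. y p * g p)" by (rule sum.cong) (auto simp: z_def)
			finally show ?thesis .
		qed
		have "(\<Sum>p\<in>P. z p) = 0" using split[of "\<lambda>_. 1"] by (simp add: s0_def)
		moreover have "(\<Sum>p\<in>P. z p * \<theta> p) = 0"
		proof -
			have "z1 * (\<theta> p1 - \<theta> p0) = \<theta> p0 * s0 - s1" using p(3) by (simp add: z1_def)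
			then show ?thesis unfolding split[of \<theta>] s1_def[symmetric] by (simp add: algebra_simps)
		qed
		moreover have "\<exists>\<alpha> \<beta>. \<forall>p\<in>P. f p = \<alpha> * \<theta> p + \<beta>" if "f \<in> null_functions w" for f
			by (rule null_functions_dim_le_2[OF n w \<theta> that])
		ultimately have zf: "(\<Sum>p\<in>P. z p * f p) = 0" if f: "f \<in> null_functions w" for f
		proof -
			obtain \<alpha> \<beta> where ab: "\<forall>p\<in>P. f p = \<alpha> * \<theta> p + \<beta>"
				using null_functions_dim_le_2[OF n w \<theta> f] by (elim exE)
			have "(\<Sum>p\<in>P. z p * f p) = (\<Sum>p\<in>P. \<alpha> * (z p * \<theta> p) + \<beta> * z p)"
				using ab by (intro sum.cong refl) (simp add: algebra_simps)
			also have "\<dots> = \<alpha> * (\<Sum>p\<in>P. z p * \<theta> p) + \<beta> * (\<Sum>p\<in>P. z p)"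
				by (simp add: sum.distrib sum_distrib_left)
			finally show ?thesis using \<open>(\<Sum>p\<in>P. z p) = 0\<close> \<open>(\<Sum>p\<in>P. z p * \<theta> p) = 0\<close> by simp
		qed
		have "\<forall>p\<in>?J0. z p = y p" by (simp add: z_def)
		then show "\<exists>z. (\<forall>p\<in>?J0. z p = y p) \<and> (\<forall>f\<in>null_functions w. (\<Sum>p\<in>P. z p * f p) = 0)"
			using zf by (intro exI[of _ z] conjI ballI) simp_all
	qed auto
	moreover have sub: "cay_points \<subseteq> ?Z" by (rule closure_of_subset) (simp add: cay_points_coeff_space)
	ultimately have g: "growth_at_least P ?Z (card ?J0)" by (rule growth_at_least_closure[rotated])
	have "card P = card ?J0 + 2"
		using card_Diff_subset[of "{p0, p1}" P] card_mono[OF finite_P, of "{p0, p1}"] p p01 by simp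
	then have le: "codimension (zariski P) ?Z \<le> enat 2" by (intro codimension_le[OF finite_P g]) simp
	obtain q x t where q: "q \<in> P" and x: "x \<in> cay_points" and out: "(\<lambda>p. x p + t * (if p = q then 1 else 0)) \<notin> ?Z"
		using ex_translate_not_in_closure[OF n] by (elim bexE exE)
	obtain \<xi> \<eta> j0 where j0: "j0 < n" "\<xi> j0 \<noteq> 0" and cov: "\<And>i. i < n ==> dot \<xi> (moment w i) = 0"
		by (rule null_functionE[OF w \<theta>]) (rule that)
	have tr: "transversal (\<lambda>j. if j = j0 then 1 else 0) w"
	proof (rule transversalI[OF n proper_relations_indep[OF w tail_psubset[OF n]]])
		show "dot \<xi> (moment w i) = 0" if "i \<in> {1..<n}" for i using that by (intro cov) simp
		show "(\<Sum>j<n. \<xi> j * (if j = j0 then 1 else 0)) \<noteq> 0"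
			using j0 by (simp add: if_distrib[of "\<lambda>x. _ * x"] cong: if_cong)
	qed
	let ?e = "\<lambda>p. if p = q then 1 else 0 :: complex"
	let ?X = "{(\<lambda>p. x p + t * ?e p) | x t. x \<in> cay_points}"
	let ?Y = "(zariski P) closure_of ?X"
	\<comment> \<open>Giving up the coordinate \<open>q\<close> is compensated by the redundancy of
	  \<open>\<zeta> j0\<close>.\<close>
	have "\<exists>D. \<exists>f\<in>box_polys (P - {q}) D. (\<forall>w \<zeta> \<kappa>. (w, \<zeta>, \<kappa>) \<in> slice {j0} --> f (horn w \<zeta> \<kappa>) = 0) \<and> (\<exists>c\<in>coeff_space (P - {q}). f c \<noteq> 0)"
		by (rule slice_polynomial_relation[OF n]) (use q j0 card_Suc_Diff1[OF finite_P q] in auto)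
	then obtain D f c where f: "f \<in> box_polys (P - {q}) D" "\<forall>w \<zeta> \<kappa>. (w, \<zeta>, \<kappa>) \<in> slice {j0} --> f (horn w \<zeta> \<kappa>) = 0"
		and c: "c \<in> coeff_space (P - {q})" "f c \<noteq> 0" by (elim exE bexE conjE)
	have fp: "f \<in> polys" by (rule box_polys_in_polynomial_functions[OF f(1)])
	have eP: "?e \<in> coeff_space P" using q by (simp add: coeff_space_def)
	have XP: "?X \<subseteq> coeff_space P" using eP cay_points_coeff_space by (auto simp: coeff_space_def)
	have cP: "c \<in> coeff_space P" using c(1) by (simp add: coeff_space_def)
	have fX: "f y = 0" if yX: "y \<in> ?X" for y
	proof -
		obtain x t where y: "y = (\<lambda>p. x p + t * ?e p)" and x: "x \<in> cay_points" using yX by (elim CollectE exE conjE)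
		have "f y = f x" by (rule box_polys_cong[OF f(1)]) (simp add: y)
		then show ?thesis using degenerate_slice_vanish[OF n deg j0(1) wr tr fp f(2) x] by simp
	qed
	have cY: "c \<notin> ?Y"
	proof
		assume "c \<in> ?Y"
		then have "\<forall>p\<in>polynomial_functions. (\<forall>x\<in>?X. p x = 0) --> p c = 0"
			unfolding in_zariski_closure_iff[OF XP] by (rule conjunct2)
		from this[THEN bspec, OF fp, THEN mp, OF ballI[OF fX]] show False using c(2) by (rule notE[rotated])
	qed
	have YP: "?Y \<subseteq> coeff_space P"
		using closure_of_subset_topspace[of "zariski P" ?X] unfolding topspace_zariski .
	have Y1: "?Y \<subset> coeff_space P"
	proof (rule psubsetI[OF YP])
		show "?Y \<noteq> coeff_space P" using cP cY by metis
	qed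
	have XY: "?X \<subseteq> ?Y" using XP by (intro closure_of_subset) (simp only: topspace_zariski)
	have "cay_points \<subseteq> ?X"
	proof
		fix x assume "x \<in> cay_points"
		then show "x \<in> ?X" by (intro CollectI exI[of _ x] exI[of _ 0] conjI) simp_all
	qed
	then have ZY: "?Z \<subseteq> ?Y" by (rule closure_of_mono)
	have out': "(\<lambda>p. x p + t * ?e p) \<in> ?Y" by (rule subsetD[OF XY], intro CollectI exI conjI, rule refl, rule x)
	have Y0: "?Z \<subset> ?Y"
	proof (rule psubsetI[OF ZY])
		show "?Z \<noteq> ?Y" using out out' by metis
	qed
	have "enat 2 \<le> codimension (zariski P) ?Z"
	proof (rule codimension_ge[where C = "\<lambda>i. if i = 0 then ?Z else if i = 1 then ?Y else coeff_space P"])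
		show "irreducible_closedin (zariski P) (if i = 0 then ?Z else if i = 1 then ?Y else coeff_space P)" for i :: nat
		proof (cases "i = 0")
			case True
			show ?thesis by (simp only: True if_True irreducible_cay refl)
		next
			case False
			then show ?thesis
				by (cases "i = 1") (simp_all only: if_True if_False irreducible_translates[OF eP] coeff_space_irreducible refl)
		qed
		fix i :: nat assume "i < 2"
		then consider "i = 0" | "i = 1" by linarith
		then show "(if i = 0 then ?Z else if i = 1 then ?Y else coeff_space P) \<subset> (if Suc i = 0 then ?Z else if Suc i = 1 then ?Y else coeff_space P)"
			by cases (simp_all only: Y0 Y1 if_True if_False refl One_nat_def nat.inject nat.distinct)
	qed (simp only: if_True refl)
	then show ?thesis using le by (simp add: numeral_eq_enat)
qed

end

section \<open>Prelinear tuples\<close>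

lemma int_lattice_carrier_iff: "a \<in> carrier (int_lattice n) \<longleftrightarrow> (\<forall>j\<ge>n. coord a j = 0)"
	unfolding carrier_free_Abelian_group_iff subset_iff in_keys_iff lessThan_iff by (metis not_le)

lemma int_lattice_additive:
	fixes N :: "(nat \<Rightarrow>\<^sub>0 int) => int"
	assumes add: "\<And>a b. a \<in> carrier (int_lattice n) ==> b \<in> carrier (int_lattice n) ==> N (a + b) = N a + N b"
		and a: "a \<in> carrier (int_lattice n)"
	shows "N a = (\<Sum>j<n. coord a j * N (frag_of j))"
proof -
	have N0: "N 0 = 0" using add[of 0 0] by simp
	have "Poly_Mapping.keys a \<subseteq> {..<n}" using a by simp
	then show ?thesis
	proof (rule free_Abelian_group_induct[where P = "\<lambda>a. N a = (\<Sum>j<n. coord a j * N (frag_of j))"])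
		show "N 0 = (\<Sum>j<n. coord 0 j * N (frag_of j))" by (simp add: N0)
	next
		fix x y :: "nat \<Rightarrow>\<^sub>0 int"
		assume xy: "Poly_Mapping.keys x \<subseteq> {..<n}" "Poly_Mapping.keys y \<subseteq> {..<n}"
			and N: "N x = (\<Sum>j<n. coord x j * N (frag_of j))" "N y = (\<Sum>j<n. coord y j * N (frag_of j))"
		have "Poly_Mapping.keys (x - y) \<subseteq> {..<n}" using xy keys_diff[of x y] by blast
		then have "N (x - y + y) = N (x - y) + N y" using xy(2) by (intro add) simp_all
		then have "N (x - y) = N x - N y" by simp
		then show "N (x - y) = (\<Sum>j<n. coord (x - y) j * N (frag_of j))"
			unfolding N by (simp add: lookup_minus left_diff_distrib sum_subtractf)
	next
		fix i assume i: "i \<in> {..<n}"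
		have "(\<Sum>j<n. coord (frag_of i) j * N (frag_of j)) = (\<Sum>j<n. if j = i then N (frag_of j) else 0)"
			by (intro sum.cong refl) (simp add: lookup_single when_def)
		then show "N (frag_of i) = (\<Sum>j<n. coord (frag_of i) j * N (frag_of j))" using i by simp
	qed
qed

section \<open>The quotient by the saturated span of K\<close>

context simple_finite_tuple
begin

abbreviation M where "M \<equiv> int_lattice n"

abbreviation diff_set where "diff_set i \<equiv> {a \<otimes>\<^bsub>M\<^esub> inv\<^bsub>M\<^esub> a' | a a'. a \<in> A i \<and> a' \<in> A i}"

abbreviation differences where "differences I \<equiv> \<Union>i\<in>I. diff_set i"

definition sat :: "(nat \<Rightarrow>\<^sub>0 int) set" where
	"sat = {a \<in> carrier M. lvec a \<in> spanK}"

definition proj :: "(nat \<Rightarrow>\<^sub>0 int) => (nat \<Rightarrow>\<^sub>0 int) set" where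
	"proj a = sat #>\<^bsub>M\<^esub> a"

abbreviation Q where "Q \<equiv> M Mod sat"

lemma lvec_add: "lvec (a + b) = lvec a + lvec b" by (simp add: fun_eq_iff cvec_apply lookup_add)

lemma lvec_uminus: "lvec (- a) = - lvec a" by (simp add: fun_eq_iff cvec_apply)

lemma lvec_diff: "lvec (a - b) = lvec a - lvec b" by (simp add: fun_eq_iff cvec_apply lookup_minus)

lemma lvec_zero: "lvec 0 = 0" by (simp add: fun_eq_iff cvec_apply)

lemma A_in_M: "i < n ==> a \<in> A i ==> a \<in> carrier M" using A_carrier by (rule subsetD)

lemma K_less: "i \<in> K ==> i < n" using psubset_imp_subset[OF K_psubset] by (auto simp: subset_iff)

lemma subgroup_sat: "subgroup sat M"
proof
	show "sat \<subseteq> carrier M" by (rule subsetI) (simp only: sat_def mem_Collect_eq)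
	show "\<one>\<^bsub>M\<^esub> \<in> sat" unfolding sat_def one_free_Abelian_group mem_Collect_eq lvec_zero
		by (rule conjI[OF _ cfun.span_zero]) simp
next
	fix x y assume xy: "x \<in> sat" "y \<in> sat"
	have "x + y \<in> carrier M" using xy by (simp only: sat_def mem_Collect_eq int_lattice_carrier_iff lookup_add) simp
	moreover have "lvec (x + y) \<in> spanK"
		unfolding lvec_add using xy by (intro cfun.span_add) (simp_all only: sat_def mem_Collect_eq)
	ultimately show "x \<otimes>\<^bsub>M\<^esub> y \<in> sat" by (simp only: sat_def mem_Collect_eq mult_free_Abelian_group)
next
	fix x assume x: "x \<in> sat"
	then have xM: "x \<in> carrier M" by (simp only: sat_def mem_Collect_eq)
	then have inv: "inv\<^bsub>M\<^esub> x = - x" by simp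
	have "inv\<^bsub>M\<^esub> x \<in> carrier M" by (rule group.inv_closed[OF group_free_Abelian_group xM])
	moreover have "lvec (- x) \<in> spanK"
		unfolding lvec_uminus using x by (intro cfun.span_neg) (simp only: sat_def mem_Collect_eq)
	ultimately show "inv\<^bsub>M\<^esub> x \<in> sat" unfolding inv by (simp only: sat_def mem_Collect_eq)
qed

lemma normal_sat: "normal sat M"
	by (rule comm_group.subgroup_imp_normal[OF abelian_free_Abelian_group subgroup_sat])

lemma lvec_diffs: "i \<in> I ==> a \<in> A i ==> a' \<in> A i ==> lvec (a - a') \<in> diffs I"
proof -
	assume i: "i \<in> I" "a \<in> A i" "a' \<in> A i"
	have "(\<lambda>j. lvec a j - lvec a' j) \<in> diffs I"
		unfolding diffs_def by (rule UN_I[OF i(1)], rule image_eqI[where x = "(a, a')"]) (simp_all add: i)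
	moreover have "lvec (a - a') = (\<lambda>j. lvec a j - lvec a' j)" by (rule ext) (simp add: cvec_apply lookup_minus)
	ultimately show "lvec (a - a') \<in> diffs I" by (simp only:)
qed

lemma lookup_inj_on: "inj_on coord S" by (rule inj_onI) (simp only: lookup_inject)

lemma lattice_dim_subgroup_M:
	assumes "subgroup H M"
	shows "lattice_dim M H = cfun.dim (lvec ` H)"
proof (rule lattice_dim_subgroup(2)[OF assms group_free_Abelian_group _ lookup_inj_on])
	show "coord (x \<otimes>\<^bsub>M\<^esub> y) = coord x + coord y" for x y by (rule ext) (simp add: lookup_add)
	show "coord x j = 0" if "x \<in> H" "n \<le> j" for x j
		using subgroup.mem_carrier[OF assms that(1)] that(2) unfolding int_lattice_carrier_iff by simp
qed

lemma lvec_cvec_space: "a \<in> carrier M ==> lvec a \<in> cvec_space n"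
	unfolding int_lattice_carrier_iff by (simp add: cvec_space_def cvec_apply)

lemma K_differences_subset: "differences K = (\<Union>i\<in>K. {a - a' | a a'. a \<in> A i \<and> a' \<in> A i})"
proof -
	have "a \<otimes>\<^bsub>M\<^esub> inv\<^bsub>M\<^esub> a' = a - a'" if "i \<in> K" "a \<in> A i" "a' \<in> A i" for i a a'
		using A_in_M[OF K_less[OF that(1)] that(3)] by simp
	then show ?thesis by (intro SUP_cong refl) (simp only: Collect_pairs_eq_image, intro image_cong refl, auto)
qed

lemma diffs_K_subset: "diffs K \<subseteq> lvec ` tuple_span M A K"
proof
	fix x assume "x \<in> diffs K"
	then obtain i a a' where i: "i \<in> K" "a \<in> A i" "a' \<in> A i" and x: "x = (\<lambda>j. lvec a j - lvec a' j)"
		unfolding diffs_def by auto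
	have "a - a' \<in> tuple_span M A K" unfolding tuple_span_def K_differences_subset
		by (rule generate.incl, rule UN_I[OF i(1)], intro CollectI exI conjI) (rule refl, rule i(2), rule i(3))
	moreover have "x = lvec (a - a')" unfolding x lvec_diff by (simp add: fun_eq_iff)
	ultimately show "x \<in> lvec ` tuple_span M A K" by (rule image_eqI[rotated])
qed

lemma tuple_span_K_sat: "tuple_span M A K \<subseteq> sat" unfolding tuple_span_def
proof (rule group.generate_subgroup_incl[OF group_free_Abelian_group _ subgroup_sat])
	show "differences K \<subseteq> sat" unfolding K_differences_subset
	proof (rule UN_least, rule subsetI)
		fix i x assume i: "i \<in> K" and "x \<in> {a - a' | a a'. a \<in> A i \<and> a' \<in> A i}"
		then obtain a a' where a: "a \<in> A i" "a' \<in> A i" and x: "x = a - a'" by (elim CollectE exE conjE)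
		have "a - a' \<in> carrier M" using A_in_M[OF K_less[OF i] a(1)] A_in_M[OF K_less[OF i] a(2)]
			by (simp only: int_lattice_carrier_iff lookup_minus) simp
		then show "x \<in> sat" unfolding x sat_def using cfun.span_base[OF lvec_diffs[OF i a]] by simp
	qed
qed

lemma diffs_K_cvec_space: "diffs K \<subseteq> cvec_space n"
	by (rule diffs_cvec_space[OF psubset_imp_subset[OF K_psubset]])

text \<open>A subgroup of the same rank containing the span of \<open>K\<close> has the same complex
  span, so it consists of lattice points of \<open>spanK\<close>.\<close>

lemma saturation_eq: "saturation M (tuple_span M A K) = sat" unfolding saturation_def
proof (rule Greatest_equality)
	have K: "K \<subseteq> {..<n}" by (rule psubset_imp_subset[OF K_psubset])
	have dK: "lattice_dim M (tuple_span M A K) = cfun.dim (diffs K)" by (rule lattice_dim_tuple_span[OF K])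
	have "cfun.dim (lvec ` sat) \<le> cfun.dim (diffs K)"
		by (rule cdim_mono[OF image_subsetI diffs_K_cvec_space]) (simp only: sat_def mem_Collect_eq)
	moreover have "cfun.dim (diffs K) \<le> cfun.dim (lvec ` sat)"
	proof (rule cdim_mono[where n = n])
		have "diffs K \<subseteq> lvec ` sat" by (rule subset_trans[OF diffs_K_subset image_mono[OF tuple_span_K_sat]])
		then show "diffs K \<subseteq> cfun.span (lvec ` sat)" using cfun.span_superset by (rule subset_trans)
		show "lvec ` sat \<subseteq> cvec_space n"
			by (rule image_subsetI, rule lvec_cvec_space) (simp only: sat_def mem_Collect_eq)
	qed
	ultimately show "subgroup sat M \<and> tuple_span M A K \<subseteq> sat \<and> lattice_dim M sat = lattice_dim M (tuple_span M A K)"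
		using lattice_dim_subgroup_M[OF subgroup_sat] by (simp add: subgroup_sat tuple_span_K_sat dK)
	fix L assume L: "subgroup L M \<and> tuple_span M A K \<subseteq> L \<and> lattice_dim M L = lattice_dim M (tuple_span M A K)"
	have LM: "x \<in> carrier M" if "x \<in> L" for x by (rule subgroup.mem_carrier[OF conjunct1[OF L] that])
	have Lc: "lvec ` L \<subseteq> cvec_space n" by (rule image_subsetI, rule lvec_cvec_space) (rule LM)
	have dim: "cfun.dim (lvec ` L) = cfun.dim (diffs K)" using L lattice_dim_subgroup_M[of L] dK by simp
	obtain B where B: "B \<subseteq> diffs K" "cfun.independent B" "card B = cfun.dim (diffs K)" by (rule cfun.basis_exists)
	have "lvec ` tuple_span M A K \<subseteq> lvec ` L" using L by (intro image_mono) simp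
	then have "B \<subseteq> lvec ` L" using subset_trans[OF B(1) diffs_K_subset] by (rule subset_trans[rotated])
	then have "B \<subseteq> cfun.span (lvec ` L)" using cfun.span_superset by (rule subset_trans)
	then have "lvec ` L \<subseteq> cfun.span B" by (rule spanning_if_card_ge_dim[OF B(2) _ Lc]) (simp add: dim B(3))
	then have "lvec ` L \<subseteq> spanK" using cfun.span_mono[OF B(1)] by (rule subset_trans)
	then have Ls: "lvec x \<in> spanK" if "x \<in> L" for x using that by (rule subsetD[OF _ imageI])
	show "L \<le> sat" by (rule subsetI) (simp only: sat_def mem_Collect_eq LM Ls)
qed

lemma group_Q: "group Q" by (rule normal.factorgroup_is_group[OF normal_sat])

lemma carrier_Q: "carrier Q = proj ` carrier M" by (simp only: carrier_FactGroup proj_def[abs_def])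

lemma proj_add: "a \<in> carrier M ==> b \<in> carrier M ==> proj a \<otimes>\<^bsub>Q\<^esub> proj b = proj (a + b)"
	using normal.rcos_sum[OF normal_sat, of a b] by (simp add: proj_def)

lemma proj_hom: "group_hom M Q proj"
	by (intro group_hom.intro group_free_Abelian_group group_Q group_hom_axioms.intro homI)
		(simp_all only: carrier_Q proj_add mult_free_Abelian_group, rule imageI)

lemma proj_eq_one_iff:
	assumes "a \<in> carrier M"
	shows "proj a = sat \<longleftrightarrow> a \<in> sat" unfolding proj_def
	by (rule iffI, erule group.coset_join1[OF group_free_Abelian_group _ assms subgroup_sat])
		(rule group.coset_join2[OF group_free_Abelian_group assms subgroup_sat])

lemma proj_eq_iff:
	assumes "a \<in> carrier M" "b \<in> carrier M"
	shows "proj a = proj b \<longleftrightarrow> a - b \<in> sat"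
proof -
	interpret group_hom M Q proj by (rule proj_hom)
	have ab: "a - b = a \<otimes>\<^bsub>M\<^esub> inv\<^bsub>M\<^esub> b" using assms by simp
	have c: "a - b \<in> carrier M" unfolding ab using assms by (intro G.m_closed G.inv_closed)
	have "proj (a - b) = proj a \<otimes>\<^bsub>Q\<^esub> inv\<^bsub>Q\<^esub> proj b" unfolding ab using assms by (simp only: hom_mult hom_inv G.inv_closed)
	then have "proj (a - b) = \<one>\<^bsub>Q\<^esub> \<longleftrightarrow> proj a = proj b"
		by (simp only: H.inv_solve_right'[OF H.one_closed hom_closed[OF assms(1)] hom_closed[OF assms(2)]] H.l_one[OF hom_closed[OF assms(2)]])
	then show ?thesis using proj_eq_one_iff[OF c] by simp
qed

lemma proj_differences:
	assumes "I \<subseteq> {..<n}"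
	shows "(\<Union>i\<in>I. {c \<otimes>\<^bsub>Q\<^esub> inv\<^bsub>Q\<^esub> c' | c c'. c \<in> proj ` A i \<and> c' \<in> proj ` A i})
		= proj ` differences I"
proof -
	interpret group_hom M Q proj by (rule proj_hom)
	have e: "proj a \<otimes>\<^bsub>Q\<^esub> inv\<^bsub>Q\<^esub> proj a' = proj (a \<otimes>\<^bsub>M\<^esub> inv\<^bsub>M\<^esub> a')" if "i \<in> I" "a \<in> A i" "a' \<in> A i" for i a a'
	proof -
		have "i < n" using assms that(1) by (auto simp: subset_iff)
		then have "a \<in> carrier M" "a' \<in> carrier M" using A_in_M[of i] that(2,3) by blast+
		then show ?thesis by (simp only: hom_mult hom_inv G.inv_closed)
	qed
	show ?thesis unfolding Collect_pairs_eq_image image_UN image_image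
	proof (rule SUP_cong[OF refl])
		fix i assume i: "i \<in> I"
		have "(\<lambda>(a, a'). a \<otimes>\<^bsub>Q\<^esub> inv\<^bsub>Q\<^esub> a') ` (proj ` A i \<times> proj ` A i)
			= (\<lambda>p. proj (fst p) \<otimes>\<^bsub>Q\<^esub> inv\<^bsub>Q\<^esub> proj (snd p)) ` (A i \<times> A i)"
		proof -
			have "proj ` A i \<times> proj ` A i = (\<lambda>p. (proj (fst p), proj (snd p))) ` (A i \<times> A i)" by force
			then show ?thesis by (simp only: image_image case_prod_conv)
		qed
		also have "\<dots> = (\<lambda>x. proj (case x of (a, a') => a \<otimes>\<^bsub>M\<^esub> inv\<^bsub>M\<^esub> a')) ` (A i \<times> A i)"
			by (rule image_cong[OF refl]) (simp only: case_prod_unfold mem_Times_iff e[OF i])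
		finally show "(\<lambda>(a, a'). a \<otimes>\<^bsub>Q\<^esub> inv\<^bsub>Q\<^esub> a') ` (proj ` A i \<times> proj ` A i)
			= (\<lambda>x. proj (case x of (a, a') => a \<otimes>\<^bsub>M\<^esub> inv\<^bsub>M\<^esub> a')) ` (A i \<times> A i)" .
	qed
qed

text \<open>Differences from \<open>K\<close> vanish in the quotient, so the remaining sets generate
  it; the isomorphism in the definition of linearity is then defined on all of
  \<open>Q\<close>.\<close>

lemma tuple_span_Q: "tuple_span Q (\<lambda>i. proj ` A i) ({..<n} - K) = carrier Q"
proof -
	interpret group_hom M Q proj by (rule proj_hom)
	have D: "differences I \<subseteq> carrier M" if I: "I \<subseteq> {..<n}" for I
	proof (rule UN_least, rule subsetI)
		fix i x assume i: "i \<in> I" and "x \<in> diff_set i"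
		then obtain a a' where a: "a \<in> A i" "a' \<in> A i" and x: "x = a \<otimes>\<^bsub>M\<^esub> inv\<^bsub>M\<^esub> a'" by (elim CollectE exE conjE)
		have "i < n" using i I by auto
		then show "x \<in> carrier M" unfolding x using A_in_M a by (intro G.m_closed G.inv_closed)
	qed
	let ?J = "{..<n} - K"
	have J: "?J \<subseteq> {..<n}" by auto
	have span: "tuple_span Q (\<lambda>i. proj ` A i) ?J = generate Q (proj ` differences ?J)"
		unfolding tuple_span_def proj_differences[OF J] ..
	have DJ: "proj ` differences ?J \<subseteq> carrier Q" unfolding carrier_Q by (rule image_mono[OF D[OF J]])
	have "carrier Q = proj ` generate M (differences {..<n})" using span_A by (simp only: tuple_span_def carrier_Q)
	also have "\<dots> = generate Q (proj ` differences {..<n})" by (rule generate_img[OF D[OF subset_refl], symmetric])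
	also have "\<dots> \<subseteq> generate Q (proj ` differences ?J)"
	proof (rule H.generate_subgroup_incl[OF _ H.generate_is_subgroup[OF DJ]])
		show "proj ` differences {..<n} \<subseteq> generate Q (proj ` differences ?J)"
		proof (rule image_subsetI)
			fix x assume "x \<in> differences {..<n}"
			then obtain i where i: "i \<in> {..<n}" and x: "x \<in> diff_set i" by (rule UN_E)
			show "proj x \<in> generate Q (proj ` differences ?J)"
			proof (cases "i \<in> K")
				case True
				then have "x \<in> differences K" using x by (rule UN_I)
				then have "x \<in> sat" using tuple_span_K_sat generate.incl[of x "differences K" M] unfolding tuple_span_def by blast
				then have "proj x = \<one>\<^bsub>Q\<^esub>" using proj_eq_one_iff[of x] subgroup.mem_carrier[OF subgroup_sat, of x] by simp
				then show ?thesis using generate.one[of Q] by (simp only:)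
			next
				case False
				then have "x \<in> differences ?J" using i x by (intro UN_I[of i]) auto
				then show ?thesis by (intro generate.incl imageI)
			qed
		qed
	qed
	finally show ?thesis using H.generate_incl[OF DJ] unfolding span by (intro equalityI)
qed

lemma prelinear_iff:
	"prelinear M A {..<n} \<longleftrightarrow> linear_BK_tuple Q (\<lambda>i. proj ` A i) ({..<n} - K)"
	using simple_A by (simp add: prelinear_def Let_def largest_proper_BK_eq saturation_eq proj_def[abs_def])

end

section \<open>Prelinear tuples are degenerate\<close>

context simple_finite_tuple
begin

lemma linear_on_P_covec: "linear_on_P (\<lambda>p. covec h (snd p))"
	unfolding linear_on_P_def by (intro exI[of _ h] exI[of _ "\<lambda>_. 0"]) simp

text \<open>The subtuple \<open>K\<close> being BK and proper, its moments form a basis of its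
  span.\<close>

lemma moment_span_K:
	assumes "w \<in> proper_relations" "y \<in> spanK"
	shows "\<exists>e. \<forall>j. y j = (\<Sum>i\<in>K. e i * moment w i j)"
proof -
	have finK: "finite K" using psubset_imp_subset[OF K_psubset] by (rule finite_subset) simp
	have inj: "inj_on (moment w) K"
		using proper_relations_indep[OF assms(1) K_psubset] finK by (simp add: indep_family_iff_independent)
	have "spanK \<subseteq> cfun.span (moment w ` K)"
		by (rule cfun.span_minimal[OF BK_moments_span[OF assms(1) K_psubset K_BK] cfun.subspace_span])
	then have "y \<in> cfun.span (moment w ` K)" using assms(2) by (rule subsetD)
	then obtain u where u: "y = (\<Sum>v\<in>moment w ` K. (\<lambda>i. u v * v i))"
		unfolding cfun.span_finite[OF finite_imageI[OF finK]] by (rule imageE)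
	have "y j = (\<Sum>i\<in>K. u (moment w i) * moment w i j)" for j
		unfolding u sum.reindex[OF inj] by (simp add: sum_fun_apply)
	then show ?thesis by (intro exI[of _ "\<lambda>i. u (moment w i)"] allI)
qed

lemma covector_vanishes_on_K:
	assumes "w \<in> proper_relations" "x \<in> spanK" "\<And>i. i < n ==> dot h (moment w i) = 0"
	shows "dot h x = 0"
proof -
	obtain e where e: "\<forall>j. x j = (\<Sum>i\<in>K. e i * moment w i j)" using moment_span_K[OF assms(1,2)] by (elim exE)
	have "dot h x = (\<Sum>i\<in>K. e i * dot h (moment w i))"
		unfolding e[rule_format] sum_distrib_left by (subst sum.swap) (simp add: ac_simps)
	also have "\<dots> = 0" by (rule sum.neutral) (simp add: assms(3) K_less)
	finally show ?thesis .
qed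

text \<open>On a set outside \<open>K\<close> the translated simplex coordinates take values 0 and
  1, at most one of them 1. The covector \<open>h\<close> vanishes on the span of \<open>K\<close>,
  so it is a combination of these coordinates, and multiplication by \<open>h\<close> plus a block
  constant acts on coordinate q as a scalar. Hence w times that function, over the blocks outside
  \<open>K\<close>, has total moment in the span of \<open>K\<close>; constants on the blocks of
  \<open>K\<close> cancel it.\<close>

lemma linear_imp_degenerate:
	assumes lin: "linear_BK_tuple Q (\<lambda>i. proj ` A i) ({..<n} - K)"
	shows degenerate unfolding degenerate_def
proof
	fix w assume w: "w \<in> proper_relations"
	have wr: "w \<in> relations" using w by (simp add: proper_relations_def)
	let ?J = "{..<n} - K" and ?m = "card ({..<n} - K)"
	have Qe: "Q\<lparr>carrier := carrier Q\<rparr> = Q" by simp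
	obtain t \<phi> where t\<phi>: "(\<forall>i\<in>?J. t i \<in> carrier Q) \<and> \<phi> \<in> iso Q (int_lattice ?m) \<and>
		(\<forall>i\<in>?J. \<forall>c\<in>proj ` A i. c \<otimes>\<^bsub>Q\<^esub> t i \<in> carrier Q \<and> \<phi> (c \<otimes>\<^bsub>Q\<^esub> t i) \<in> insert 0 (frag_of ` {..<?m}))"
		using conjunct2[OF lin[unfolded linear_BK_tuple_def tuple_span_Q Qe]] by (elim exE)
	note t = conjunct1[OF t\<phi>] and iso = conjunct1[OF conjunct2[OF t\<phi>]]
	have img: "\<phi> (c \<otimes>\<^bsub>Q\<^esub> t i) \<in> insert 0 (frag_of ` {..<?m})" if "i \<in> ?J" "c \<in> proj ` A i" for i c
		by (rule conjunct2[OF conjunct2[OF conjunct2[OF t\<phi>], THEN bspec, OF that(1), THEN bspec, OF that(2)]])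
	have hom: "\<phi> (X \<otimes>\<^bsub>Q\<^esub> Y) = \<phi> X + \<phi> Y" if "X \<in> carrier Q" "Y \<in> carrier Q" for X Y
		using iso that hom_mult[of \<phi> Q "int_lattice ?m"] by (simp add: iso_def)
	have bij: "bij_betw \<phi> (carrier Q) (carrier (int_lattice ?m))" using iso by (simp only: iso_def mem_Collect_eq)
	have projQ: "proj a \<in> carrier Q" if "a \<in> carrier M" for a unfolding carrier_Q using that by (rule imageI)
	define N where "N q a = coord (\<phi> (proj a)) q" for q a
	have Nadd: "N q (a + b) = N q a + N q b" if "a \<in> carrier M" "b \<in> carrier M" for q a b
		unfolding N_def proj_add[OF that, symmetric] hom[OF projQ[OF that(1)] projQ[OF that(2)]] by (rule lookup_add)
	have N0: "N q 0 = 0" for q using Nadd[of 0 0] by simp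
	have Nlin: "N q a = (\<Sum>j<n. coord a j * N q (frag_of j))" if "a \<in> carrier M" for q a
		by (rule int_lattice_additive[OF Nadd that])
	have sat_if: "a \<in> sat" if a: "a \<in> carrier M" and z: "\<And>q. q < ?m ==> N q a = 0" for a
	proof -
		have "coord (\<phi> (proj a)) q = 0" for q
		proof (cases "q < ?m")
			case True
			then show ?thesis using z unfolding N_def by simp
		next
			case False
			moreover have "\<phi> (proj a) \<in> carrier (int_lattice ?m)" using bij projQ[OF a] by (rule bij_betwE[rule_format])
			ultimately show ?thesis unfolding int_lattice_carrier_iff by simp
		qed
		moreover have "coord (\<phi> (proj 0)) q = 0" for q using N0 by (simp add: N_def)
		ultimately have "\<phi> (proj a) = \<phi> (proj 0)" by (intro poly_mapping_eqI) simp
		then have "proj a = proj 0" using bij_betw_imp_inj_on[OF bij] projQ[OF a] projQ[of 0] by (simp add: inj_on_eq_iff)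
		then show ?thesis using proj_eq_iff[OF a, of 0] by simp
	qed
	have N_sat: "N q a = 0" if "a \<in> sat" for a q
	proof -
		have aM: "a \<in> carrier M" using that by (simp only: sat_def mem_Collect_eq)
		have "proj a = proj 0" using proj_eq_iff[OF aM, of 0] that by simp
		then show ?thesis using N0[of q] by (simp add: N_def)
	qed
	have "\<forall>q\<in>{..<?m}. \<exists>u. u \<in> carrier M \<and> \<phi> (proj u) = frag_of q"
	proof
		fix q assume "q \<in> {..<?m}"
		then have "frag_of q \<in> \<phi> ` proj ` carrier M"
			using bij_betw_imp_surj_on[OF bij] unfolding carrier_Q by simp
		then obtain u where "u \<in> carrier M" "\<phi> (proj u) = frag_of q" by (elim imageE) simp
		then show "\<exists>u. u \<in> carrier M \<and> \<phi> (proj u) = frag_of q" by (intro exI[of _ u] conjI)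
	qed
	\<comment> \<open>Lifts to \<open>M\<close> of the coordinate basis of the quotient.\<close>
	from bchoice[OF this] obtain u where u: "\<forall>q\<in>{..<?m}. u q \<in> carrier M \<and> \<phi> (proj (u q)) = frag_of q" by (elim exE)
	have Nu: "N q (u q') = (if q = q' then 1 else 0)" if "q' < ?m" for q q'
		using u that by (simp add: N_def lookup_single when_def)
	\<comment> \<open>The component of \<open>a\<close> in the saturation, left after its quotient
	  coordinates are removed.\<close>
	define s where "s a = a - (\<Sum>q<?m. frag_cmul (N q a) (u q))" for a
	have lookup_s: "coord (s a) j = coord a j - (\<Sum>q<?m. N q a * coord (u q) j)" for a j
		by (simp add: s_def lookup_minus lookup_sum)
	have s_sat: "s a \<in> sat" if a: "a \<in> carrier M" for a
	proof (rule sat_if)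
		show sM: "s a \<in> carrier M" using a u unfolding int_lattice_carrier_iff lookup_s by simp
		fix q assume q: "q < ?m"
		have "N q (s a) = (\<Sum>j<n. coord a j * N q (frag_of j)) - (\<Sum>j<n. \<Sum>q'<?m. N q' a * coord (u q') j * N q (frag_of j))"
			unfolding Nlin[OF sM] lookup_s by (simp add: left_diff_distrib sum_subtractf sum_distrib_right)
		also have "(\<Sum>j<n. \<Sum>q'<?m. N q' a * coord (u q') j * N q (frag_of j)) = (\<Sum>q'<?m. N q' a * (\<Sum>j<n. coord (u q') j * N q (frag_of j)))"
			by (subst sum.swap) (simp add: sum_distrib_left mult.assoc)
		also have "\<dots> = (\<Sum>q'<?m. N q' a * N q (u q'))"
		proof (rule sum.cong[OF refl])
			fix q' assume "q' \<in> {..<?m}"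
			then have "u q' \<in> carrier M" using u by simp
			from Nlin[OF this, of q] show "N q' a * (\<Sum>j<n. coord (u q') j * N q (frag_of j)) = N q' a * N q (u q')" by (simp only:)
		qed
		also have "\<dots> = (\<Sum>q'<?m. if q' = q then N q' a else 0)" by (intro sum.cong refl) (simp add: Nu)
		also have "\<dots> = N q a" using q by simp
		also have "(\<Sum>j<n. coord a j * N q (frag_of j)) = N q a" by (rule Nlin[OF a, symmetric])
		finally show "N q (s a) = 0" by simp
	qed
	have lvec_split: "lvec a j = (\<Sum>q<?m. of_int (N q a) * lvec (u q) j) + lvec (s a) j" for a j
		by (simp add: cvec_apply lookup_s)
	obtain h where hh: "(\<exists>j<n. h j \<noteq> 0) \<and> (\<forall>i<n. dot h (moment w i) = 0)"
		using covector_exists[OF wr n_pos] by (rule exE)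
	note h = conjunct1[OF hh] and hm = conjunct2[OF hh]
	have hK: "dot h x = 0" if "x \<in> spanK" for x
		by (rule covector_vanishes_on_K[OF w that]) (use hm in blast)
	have Hs: "covec h a = (\<Sum>q<?m. covec h (u q) * of_int (N q a))" if "a \<in> carrier M" for a
	proof -
		have "covec h a = (\<Sum>j<n. \<Sum>q<?m. h j * (of_int (N q a) * lvec (u q) j)) + covec h (s a)"
			unfolding sum.distrib[symmetric] by (rule sum.cong[OF refl], subst lvec_split) (simp only: distrib_left sum_distrib_left)
		also have "covec h (s a) = 0" using s_sat[OF that] by (intro hK) (simp only: sat_def mem_Collect_eq)
		also have "(\<Sum>j<n. \<Sum>q<?m. h j * (of_int (N q a) * lvec (u q) j)) = (\<Sum>q<?m. covec h (u q) * of_int (N q a))"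
			by (subst sum.swap) (intro sum.cong refl, simp only: sum_distrib_right, intro sum.cong refl, simp only: ac_simps)
		finally show ?thesis by simp
	qed
	define T where "T i q = coord (\<phi> (t i)) q" for i q
	have NT: "(\<forall>q<?m. N q a + T i q = 0) \<or> (\<exists>q0<?m. \<forall>q<?m. N q a + T i q = (if q = q0 then 1 else 0))"
		if i: "i \<in> ?J" "a \<in> A i" for i a
	proof -
		have aM: "a \<in> carrier M" using i by (intro A_in_M) auto
		have e: "N q a + T i q = coord (\<phi> (proj a \<otimes>\<^bsub>Q\<^esub> t i)) q" for q
			unfolding hom[OF projQ[OF aM] t[rule_format, OF i(1)]] by (simp add: N_def T_def lookup_add)
		have "\<phi> (proj a \<otimes>\<^bsub>Q\<^esub> t i) \<in> insert 0 (frag_of ` {..<?m})" using i by (intro img) simp_all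
		then show ?thesis
		proof
			assume "\<phi> (proj a \<otimes>\<^bsub>Q\<^esub> t i) = 0"
			then show ?thesis unfolding e by simp
		next
			assume "\<phi> (proj a \<otimes>\<^bsub>Q\<^esub> t i) \<in> frag_of ` {..<?m}"
			then obtain q0 where "q0 < ?m" "\<phi> (proj a \<otimes>\<^bsub>Q\<^esub> t i) = frag_of q0" by auto
			then show ?thesis unfolding e by (intro disjI2 exI[of _ q0]) (simp add: lookup_single when_def)
		qed
	qed
	\<comment> \<open>Chosen so that h + \<open>\<eta> i\<close> is the combination of the translated
	  coordinates.\<close>
	define \<eta> where "\<eta> i = (\<Sum>q<?m. covec h (u q) * of_int (T i q))" for i
	\<comment> \<open>Where coordinate q is nonzero it is 1 and the others are 0, so h +
	  \<open>\<eta> i\<close> reduces to the value of \<open>h\<close> at \<open>u q\<close>.\<close>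
	have \<Theta>: "(covec h a + \<eta> i) * of_int (N q a + T i q) = covec h (u q) * of_int (N q a + T i q)"
		if i: "i \<in> ?J" "a \<in> A i" and q: "q < ?m" for i a q
	proof -
		have aM: "a \<in> carrier M" using i by (intro A_in_M) auto
		have e: "covec h a + \<eta> i = (\<Sum>q<?m. covec h (u q) * of_int (N q a + T i q))"
			unfolding Hs[OF aM] \<eta>_def by (simp add: distrib_left sum.distrib)
		show ?thesis
		proof (cases "N q a + T i q = 0")
			case False
			then have nz: "\<not> (\<forall>q<?m. N q a + T i q = 0)" using q by (intro notI) simp
			from NT[OF i] have "\<exists>q0<?m. \<forall>q<?m. N q a + T i q = (if q = q0 then 1 else 0)" by (rule disjE) (rule notE[OF nz], assumption, assumption)
			then obtain q0 where q0: "\<forall>q<?m. N q a + T i q = (if q = q0 then 1 else 0)" by (elim exE conjE)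
			have "N q a + T i q = (if q = q0 then 1 else 0)" using q0[THEN spec, THEN mp, OF q] .
			then have "q = q0" using False by (cases "q = q0") (simp_all only: if_False)
			have "covec h a + \<eta> i = (\<Sum>q'<?m. if q' = q then covec h (u q') else 0)" unfolding e
			proof (rule sum.cong[OF refl])
				fix q' assume "q' \<in> {..<?m}"
				then have "N q' a + T i q' = (if q' = q0 then 1 else 0)" using q0[rule_format, of q'] by simp
				then show "covec h (u q') * of_int (N q' a + T i q') = (if q' = q then covec h (u q') else 0)"
					unfolding \<open>q = q0\<close> by (cases "q' = q0") (simp_all only: refl if_True if_False of_int_0 of_int_1 mult_1_right mult_zero_right)
			qed
			also have "\<dots> = covec h (u q)" using q by simp
			finally show ?thesis by (simp only:)
		qed simp
	qed
	define c where "c p = w p * (covec h (snd p) + \<eta> (fst p))" for p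
	have w0: "(\<Sum>a\<in>A i. w (i, a)) = 0" if "i < n" for i using wr that by (simp add: relations_def)
	have wh: "(\<Sum>a\<in>A i. w (i, a) * covec h a) = 0" if "i < n" for i unfolding pairing_moment using hm that by simp
	have c0: "(\<Sum>a\<in>A i. c (i, a)) = 0" if i: "i < n" for i
	proof -
		have "(\<Sum>a\<in>A i. c (i, a)) = (\<Sum>a\<in>A i. w (i, a) * covec h a) + (\<Sum>a\<in>A i. w (i, a)) * \<eta> i"
			by (simp add: c_def distrib_left sum.distrib sum_distrib_right)
		then show ?thesis unfolding wh[OF i] w0[OF i] by simp
	qed
	have wN: "(\<Sum>i\<in>?J. \<Sum>a\<in>A i. w (i, a) * of_int (N q a)) = 0" for q
	proof -
		let ?g = "\<lambda>i. \<Sum>a\<in>A i. w (i, a) * of_int (N q a)"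
		have "(\<Sum>i<n. ?g i) = (\<Sum>p\<in>P. w p * covec (\<lambda>j. of_int (N q (frag_of j))) (snd p))" unfolding sum_P
		proof (intro sum.cong refl)
			fix i a assume "i \<in> {..<n}" "a \<in> A i"
			then have "a \<in> carrier M" by (intro A_in_M) auto
			then show "w (i, a) * of_int (N q a) = w (i, a) * covec (\<lambda>j. of_int (N q (frag_of j))) (snd (i, a))"
				by (subst Nlin) (simp_all add: cvec_apply mult.commute)
		qed
		also have "\<dots> = 0" by (rule relations_pairing[OF wr linear_on_P_covec])
		finally have 0: "(\<Sum>i<n. ?g i) = 0" .
		have K0: "?g i = 0" if i: "i \<in> K" for i
		proof -
			obtain a0 where a0: "a0 \<in> A i" using A_nonempty[OF K_less[OF i]] by auto
			have e: "N q a = N q a0" if a: "a \<in> A i" for a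
			proof -
				have aM: "a \<in> carrier M" "a0 \<in> carrier M" using A_in_M[OF K_less[OF i]] a a0 by blast+
				have "a - a0 \<in> carrier M" using aM unfolding int_lattice_carrier_iff by (simp add: lookup_minus)
				then have sat: "a - a0 \<in> sat" unfolding sat_def using cfun.span_base[OF lvec_diffs[OF i a a0]] by simp
				have "N q (a - a0 + a0) = N q (a - a0) + N q a0" using sat aM(2) by (intro Nadd) (simp_all only: sat_def mem_Collect_eq)
				then show ?thesis unfolding N_sat[OF sat] by simp
			qed
			have "?g i = (\<Sum>a\<in>A i. w (i, a)) * of_int (N q a0)" unfolding sum_distrib_right by (rule sum.cong[OF refl]) (simp only: e)
			then show ?thesis unfolding w0[OF K_less[OF i]] by simp
		qed
		have "(\<Sum>i<n. ?g i) = (\<Sum>i\<in>?J. ?g i) + (\<Sum>i\<in>K. ?g i)"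
			by (rule sum.subset_diff[OF psubset_imp_subset[OF K_psubset]]) simp
		then show ?thesis unfolding 0 by (simp add: K0)
	qed
	\<comment> \<open>The translation \<open>T i q\<close> may be inserted and removed because the
	  block sums of \<open>c\<close> and of \<open>w\<close> are zero.\<close>
	have cN: "(\<Sum>i\<in>?J. \<Sum>a\<in>A i. c (i, a) * of_int (N q a)) = 0" if q: "q < ?m" for q
	proof -
		have "(\<Sum>a\<in>A i. c (i, a) * of_int (N q a)) = covec h (u q) * (\<Sum>a\<in>A i. w (i, a) * of_int (N q a))" if i: "i \<in> ?J" for i
		proof -
			have i': "i < n" using i by simp
			have "(\<Sum>a\<in>A i. c (i, a) * of_int (N q a)) = (\<Sum>a\<in>A i. c (i, a) * of_int (N q a + T i q)) - (\<Sum>a\<in>A i. c (i, a)) * of_int (T i q)"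
				by (simp add: distrib_left sum.distrib sum_distrib_right)
			also have "\<dots> = (\<Sum>a\<in>A i. c (i, a) * of_int (N q a + T i q))" unfolding c0[OF i'] by simp
			also have "\<dots> = (\<Sum>a\<in>A i. covec h (u q) * (w (i, a) * of_int (N q a + T i q)))"
			proof (rule sum.cong[OF refl])
				fix a assume "a \<in> A i"
				have "c (i, a) * of_int (N q a + T i q) = w (i, a) * ((covec h a + \<eta> i) * of_int (N q a + T i q))"
					by (simp only: c_def fst_conv snd_conv mult.assoc)
				also have "\<dots> = covec h (u q) * (w (i, a) * of_int (N q a + T i q))"
					unfolding \<Theta>[OF i \<open>a \<in> A i\<close> q] by (rule mult.left_commute)
				finally show "c (i, a) * of_int (N q a + T i q) = covec h (u q) * (w (i, a) * of_int (N q a + T i q))" .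
			qed
			also have "\<dots> = covec h (u q) * ((\<Sum>a\<in>A i. w (i, a) * of_int (N q a)) + (\<Sum>a\<in>A i. w (i, a)) * of_int (T i q))"
				unfolding sum_distrib_left[symmetric] by (simp add: distrib_left sum.distrib sum_distrib_right)
			finally show ?thesis unfolding w0[OF i'] by simp
		qed
		then have "(\<Sum>i\<in>?J. \<Sum>a\<in>A i. c (i, a) * of_int (N q a)) = covec h (u q) * (\<Sum>i\<in>?J. \<Sum>a\<in>A i. w (i, a) * of_int (N q a))"
			by (simp only: sum_distrib_left[of "covec h (u q)" _ ?J] cong: sum.cong)
		then show ?thesis unfolding wN by simp
	qed
	define y where "y j = (\<Sum>i\<in>?J. \<Sum>a\<in>A i. c (i, a) * lvec a j)" for j
	have "y = (\<Sum>i\<in>?J. \<Sum>a\<in>A i. (\<lambda>j. c (i, a) * lvec (s a) j))"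
	proof
		fix j
		have "y j = (\<Sum>i\<in>?J. \<Sum>a\<in>A i. (\<Sum>q<?m. c (i, a) * of_int (N q a) * lvec (u q) j) + c (i, a) * lvec (s a) j)"
			unfolding y_def by (intro sum.cong refl, subst lvec_split) (simp only: distrib_left sum_distrib_left mult.assoc)
		also have "\<dots> = (\<Sum>i\<in>?J. \<Sum>a\<in>A i. \<Sum>q<?m. c (i, a) * of_int (N q a) * lvec (u q) j) + (\<Sum>i\<in>?J. \<Sum>a\<in>A i. c (i, a) * lvec (s a) j)"
			by (simp only: sum.distrib)
		also have "(\<Sum>i\<in>?J. \<Sum>a\<in>A i. \<Sum>q<?m. c (i, a) * of_int (N q a) * lvec (u q) j) = (\<Sum>q<?m. (\<Sum>i\<in>?J. \<Sum>a\<in>A i. c (i, a) * of_int (N q a)) * lvec (u q) j)"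
		proof -
			have "(\<Sum>i\<in>?J. \<Sum>a\<in>A i. \<Sum>q<?m. c (i, a) * of_int (N q a) * lvec (u q) j) = (\<Sum>i\<in>?J. \<Sum>q<?m. \<Sum>a\<in>A i. c (i, a) * of_int (N q a) * lvec (u q) j)"
				by (intro sum.cong refl) (rule sum.swap)
			also have "\<dots> = (\<Sum>q<?m. \<Sum>i\<in>?J. \<Sum>a\<in>A i. c (i, a) * of_int (N q a) * lvec (u q) j)" by (rule sum.swap)
			finally show ?thesis by (simp only: sum_distrib_right)
		qed
		also have "\<dots> = 0" by (rule sum.neutral) (simp add: cN)
		finally show "y j = (\<Sum>i\<in>?J. \<Sum>a\<in>A i. (\<lambda>j. c (i, a) * lvec (s a) j)) j" by (simp add: sum_fun_apply)
	qed
	also have "\<dots> \<in> spanK"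
	proof (intro cfun.span_sum cfun.span_scale)
		fix i a assume "i \<in> ?J" "a \<in> A i"
		then have "a \<in> carrier M" by (intro A_in_M) auto
		then show "lvec (s a) \<in> spanK" using s_sat by (simp add: sat_def)
	qed
	finally have yK: "y \<in> spanK" .
	obtain e where e: "\<forall>j. y j = (\<Sum>i\<in>K. e i * moment w i j)" using moment_span_K[OF w yK] by (elim exE)
	have "\<forall>i. \<exists>a. i < n --> a \<in> A i" using A_nonempty by blast
	from choice[OF this] obtain a0 where a0: "\<forall>i. i < n --> a0 i \<in> A i" by (elim exE)
	\<comment> \<open>On a block of \<open>K\<close>, where \<open>h\<close> is constant, \<theta>
	  becomes - e i; this cancels the moment \<open>y\<close> of the other blocks.\<close>
	define \<eta>' where "\<eta>' i = (if i \<in> K then - e i - covec h (a0 i) else \<eta> i)" for i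
	define \<theta> where "\<theta> p = covec h (snd p) + \<eta>' (fst p)" for p
	have \<theta>K: "\<theta> (i, a) = - e i" if i: "i \<in> K" "a \<in> A i" for i a
	proof -
		have "covec h a - covec h (a0 i) = covec h (a - a0 i)"
			by (simp add: lvec_diff right_diff_distrib sum_subtractf)
		also have "\<dots> = 0" using lvec_diffs[OF i a0[rule_format, OF K_less[OF i(1)]]] by (intro hK cfun.span_base)
		finally show ?thesis using i(1) by (simp add: \<theta>_def \<eta>'_def)
	qed
	have \<theta>J: "w (i, a) * \<theta> (i, a) = c (i, a)" if "i \<in> ?J" for i a using that by (simp add: \<theta>_def c_def \<eta>'_def)
	have \<theta>lin: "linear_on_P \<theta>"
		unfolding linear_on_P_def by (intro exI[of _ h] exI[of _ \<eta>']) (simp add: \<theta>_def)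
	have sumJK: "(\<Sum>i<n. g i) = (\<Sum>i\<in>?J. g i) + (\<Sum>i\<in>K. g i)" for g :: "nat => complex"
		by (rule sum.subset_diff[OF psubset_imp_subset[OF K_psubset]]) simp
	have null: "\<theta> \<in> null_functions w"
	proof -
		have wt: "(\<lambda>p. w p * \<theta> p) \<in> relations" unfolding relations_def
		proof (intro CollectI conjI allI impI)
			show "(\<lambda>p. w p * \<theta> p) \<in> coeff_space P" using relations_coeff_space[OF wr] by (simp add: coeff_space_def)
			show "(\<Sum>a\<in>A i. w (i, a) * \<theta> (i, a)) = 0" if i: "i < n" for i
			proof -
				have "(\<Sum>a\<in>A i. w (i, a) * \<theta> (i, a)) = (\<Sum>a\<in>A i. w (i, a) * covec h a) + (\<Sum>a\<in>A i. w (i, a)) * \<eta>' i"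
					by (simp add: \<theta>_def distrib_left sum.distrib sum_distrib_right)
				then show ?thesis unfolding wh[OF i] w0[OF i] by simp
			qed
			fix j assume "j < n"
			have "(\<Sum>i\<in>?J. moment (\<lambda>p. w p * \<theta> p) i j) = y j"
				unfolding y_def moment_def by (intro sum.cong refl) (simp only: \<theta>J)
			moreover have "(\<Sum>i\<in>K. moment (\<lambda>p. w p * \<theta> p) i j) = - y j"
				unfolding e[rule_format] moment_def sum_negf[symmetric] sum_distrib_left
			proof (intro sum.cong refl)
				fix i a assume "i \<in> K" "a \<in> A i"
				then show "w (i, a) * \<theta> (i, a) * lvec a j = - (e i * (w (i, a) * lvec a j))" by (simp add: \<theta>K)
			qed
			ultimately show "(\<Sum>i<n. moment (\<lambda>p. w p * \<theta> p) i j) = 0" unfolding sumJK by simp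
		qed
		show ?thesis unfolding null_functions_def using \<theta>lin relations_pairing[OF wt] by simp
	qed
	have "nonconstant \<theta>"
	proof (rule ccontr)
		assume nc: "\<not> nonconstant \<theta>"
		obtain j0 where j0: "j0 < n" "h j0 \<noteq> 0" using h by (elim exE conjE)
		have "h j0 = 0"
		proof (rule functional_zero_on_differences[OF _ j0(1)])
			fix i a a' assume "i < n" "a \<in> A i" "a' \<in> A i"
			then have "(i, a) \<in> P" "(i, a') \<in> P" by (simp_all add: mem_P_iff)
			then have "\<theta> (i, a) = \<theta> (i, a')" using nc unfolding nonconstant_def by metis
			then show "covec h a = covec h a'" by (simp add: \<theta>_def)
		qed
		then show False using j0(2) by simp
	qed
	then show "\<exists>\<theta>\<in>null_functions w. nonconstant \<theta>" using null by (rule bexI)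
qed

end

text \<open>Half of rank-nullity, for spanning sets: a basis of the image lifts to \<open>X\<close>
  and, joined with a basis of \<open>Y\<close>, spans everything once the kernel inside the span of
  \<open>X\<close> lies in the span of \<open>Y\<close>.\<close>

lemma cdim_kernel_le:
	fixes f :: "(nat => complex) => nat => complex"
	assumes add: "\<And>x y. f (x + y) = f x + f y" and scale: "\<And>c x. f (\<lambda>i. c * x i) = (\<lambda>i. c * f x i)"
		and Y: "Y \<subseteq> cvec_space n" and fX: "f ` X \<subseteq> cvec_space m"
		and ker: "\<And>x. x \<in> cfun.span X ==> f x = 0 ==> x \<in> cfun.span Y"
	shows "cfun.dim (X \<union> Y) \<le> cfun.dim (f ` X) + cfun.dim Y"
proof -
	obtain B where B: "B \<subseteq> f ` X" "cfun.independent B" "f ` X \<subseteq> cfun.span B" "card B = cfun.dim (f ` X)"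
		by (rule cfun.basis_exists)
	obtain C where C: "C \<subseteq> Y" "cfun.independent C" "Y \<subseteq> cfun.span C" "card C = cfun.dim Y"
		by (rule cfun.basis_exists)
	have fin: "finite B" "finite C"
		using finite_indep_cvec_space(1)[OF B(2) subset_trans[OF B(1) fX]] finite_indep_cvec_space(1)[OF C(2) subset_trans[OF C(1) Y]] by simp_all
	obtain D where D: "D \<subseteq> X" "inj_on f D" "B = f ` D" using B(1) unfolding subset_image_inj by (elim exE conjE)
	have finD: "finite D" using fin(1) D(2,3) by (simp add: finite_image_iff)
	have f0: "f 0 = 0" using add[of 0 0] by simp
	have lift: "\<exists>d\<in>cfun.span D. f d = x" if "x \<in> cfun.span (f ` D)" for x using that
	proof (induction rule: cfun.span_induct_alt)
		case base
		show ?case using f0 cfun.span_zero[of D] by (intro bexI[of _ 0])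
	next
		case (step c x y)
		obtain d where d: "d \<in> D" "x = f d" using step(1) by (rule imageE)
		obtain e where e: "e \<in> cfun.span D" "f e = y" using step(2) by (rule bexE)
		show ?case by (rule bexI[of _ "(\<lambda>i. c * d i) + e"])
				(simp_all only: add scale d(2) e(2) cfun.span_add cfun.span_scale cfun.span_base d(1) e(1))
	qed
	have uminus: "f (- x) = - f x" for x
	proof -
		have "(\<lambda>i. - 1 * x i) = - x" "(\<lambda>i. - 1 * f x i) = - f x" by (simp_all add: fun_eq_iff)
		then show ?thesis using scale[of "- 1" x] by (simp only:)
	qed
	have "x \<in> cfun.span (D \<union> C)" if x: "x \<in> X" for x
	proof -
		have "f x \<in> cfun.span (f ` D)" using B(3) x D(3) by auto
		from lift[OF this] obtain d where d: "d \<in> cfun.span D" "f d = f x" by (rule bexE)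
		have "d \<in> cfun.span X" using d(1) cfun.span_mono[OF D(1)] by (rule subsetD[rotated])
		then have "x - d \<in> cfun.span X" by (rule cfun.span_diff[OF cfun.span_base[OF x]])
		moreover have "f (x - d) = 0" using add[of x "- d"] by (simp only: uminus d(2) add_uminus_conv_diff diff_self)
		ultimately have "x - d \<in> cfun.span Y" by (rule ker)
		also have "cfun.span Y \<subseteq> cfun.span C" by (rule cfun.span_minimal[OF C(3) cfun.subspace_span])
		finally have "x - d \<in> cfun.span (D \<union> C)" using cfun.span_mono[of C "D \<union> C"] by blast
		moreover have "d \<in> cfun.span (D \<union> C)" using d(1) cfun.span_mono[of D "D \<union> C"] by blast
		ultimately have "(x - d) + d \<in> cfun.span (D \<union> C)" by (rule cfun.span_add)
		then show ?thesis by simp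
	qed
	moreover have "Y \<subseteq> cfun.span (D \<union> C)" using C(3) cfun.span_mono[of C "D \<union> C"] by blast
	ultimately have "X \<union> Y \<subseteq> cfun.span (D \<union> C)" by blast
	then have "cfun.dim (X \<union> Y) \<le> card (D \<union> C)" by (rule cfun.dim_le_card) (simp add: finD fin)
	also have "\<dots> \<le> card D + card C" by (rule card_Un_le)
	also have "card D = card B" using D(2,3) by (simp add: card_image)
	finally show ?thesis by (simp only: B(4) C(4))
qed

text \<open>The other half: lifts of a basis of the image stay independent modulo the span of
  \<open>Y\<close>, which \<open>f\<close> kills.\<close>

lemma cdim_kernel_ge:
	fixes f :: "(nat => complex) => nat => complex"
	assumes add: "\<And>x y. f (x + y) = f x + f y" and scale: "\<And>c x. f (\<lambda>i. c * x i) = (\<lambda>i. c * f x i)"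
		and X: "X \<subseteq> cvec_space n" and Y: "Y \<subseteq> cvec_space n" and fX: "f ` X \<subseteq> cvec_space m"
		and ker: "\<And>y. y \<in> Y ==> f y = 0"
	shows "cfun.dim (f ` X) + cfun.dim Y \<le> cfun.dim (X \<union> Y)"
proof -
	obtain B where B: "B \<subseteq> f ` X" "cfun.independent B" "f ` X \<subseteq> cfun.span B" "card B = cfun.dim (f ` X)"
		by (rule cfun.basis_exists)
	obtain C where C: "C \<subseteq> Y" "cfun.independent C" "Y \<subseteq> cfun.span C" "card C = cfun.dim Y"
		by (rule cfun.basis_exists)
	have fin: "finite B" "finite C"
		using finite_indep_cvec_space(1)[OF B(2) subset_trans[OF B(1) fX]] finite_indep_cvec_space(1)[OF C(2) subset_trans[OF C(1) Y]] by simp_all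
	obtain D where D: "D \<subseteq> X" "inj_on f D" "B = f ` D" using B(1) unfolding subset_image_inj by (elim exE conjE)
	have finD: "finite D" using fin(1) D(2,3) by (simp add: finite_image_iff)
	have f0: "f 0 = 0" using add[of 0 0] by simp
	have img: "f x \<in> cfun.span (f ` E)" if "x \<in> cfun.span (E \<union> C)" for x E using that
	proof (induction rule: cfun.span_induct_alt)
		case base
		show ?case by (simp only: f0 cfun.span_zero)
	next
		case (step c x y)
		have "f x \<in> cfun.span (f ` E)"
		proof (cases "x \<in> E")
			case False
			then have "f x = 0" using step(1) C(1) by (intro ker) auto
			then show ?thesis by (simp only: cfun.span_zero)
		qed (intro cfun.span_base imageI)
		then show ?case unfolding add scale by (intro cfun.span_add cfun.span_scale step.IH)
	qed
	have "cfun.independent (E \<union> C) \<and> card (E \<union> C) = card E + card C" if "finite E" "E \<subseteq> D" for E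
		using that
	proof (induction E rule: finite_induct)
		case empty
		show ?case by (simp add: C(2))
	next
		case (insert d E)
		have ED: "insert d E \<subseteq> D" by (rule insert.prems)
		have "f ` insert d E \<subseteq> B" using ED D(3) by auto
		then have "cfun.independent (insert (f d) (f ` E))" using cfun.independent_mono[OF B(2)] by simp
		moreover have "f d \<notin> f ` E" using D(2) ED insert.hyps(2) by (auto simp: inj_on_def)
		ultimately have "f d \<notin> cfun.span (f ` E)" by (simp add: cfun.independent_insert)
		then have dn: "d \<notin> cfun.span (E \<union> C)" using img by auto
		have IH: "cfun.independent (E \<union> C)" "card (E \<union> C) = card E + card C" using insert.IH ED by simp_all
		have "d \<notin> E \<union> C" using dn by (rule contrapos_nn) (rule cfun.span_base)
		then show ?case using cfun.independent_insertI[OF dn IH(1)] IH(2) insert.hyps fin(2) by simp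
	qed
	from this[OF finD subset_refl] have ind: "cfun.independent (D \<union> C)" and c: "card (D \<union> C) = card D + card C" by simp_all
	have "card (D \<union> C) \<le> cfun.dim (X \<union> Y)"
	proof (rule indep_card_le_dim[OF ind])
		have "D \<union> C \<subseteq> X \<union> Y" using D(1) C(1) by auto
		then show "D \<union> C \<subseteq> cfun.span (X \<union> Y)" using cfun.span_superset by (rule subset_trans)
		show "X \<union> Y \<subseteq> cvec_space n" using X Y by simp
	qed
	moreover have "card D = card B" using D(2,3) by (simp add: card_image)
	ultimately show ?thesis by (simp only: c B(4) C(4))
qed

section \<open>Level sets of a generic null function\<close>

context simple_finite_tuple
begin

lemma differences_induct:
	assumes "a \<in> carrier M" and diff: "\<And>i a a'. i < n ==> a \<in> A i ==> a' \<in> A i ==> R (a - a')"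
		and zero: "R 0" and add: "\<And>x y. R x ==> R y ==> R (x + y)" and neg: "\<And>x. R x ==> R (- x)"
	shows "R a"
proof -
	let ?X = "differences {..<n}"
	have X: "R x \<and> x \<in> carrier M" if "x \<in> ?X" for x
	proof -
		from that obtain i where i: "i \<in> {..<n}" and x: "x \<in> diff_set i" by (rule UN_E)
		from x obtain a a' where a: "a \<in> A i" "a' \<in> A i" and x: "x = a \<otimes>\<^bsub>M\<^esub> inv\<^bsub>M\<^esub> a'" by (elim CollectE exE conjE)
		have i': "i < n" using i by simp
		have c: "a \<in> carrier M" "a' \<in> carrier M" using A_in_M[OF i'] a by blast+
		then have "x = a - a'" by (simp add: x)
		moreover have "x \<in> carrier M" unfolding x
			by (rule monoid.m_closed[OF group.is_monoid[OF group_free_Abelian_group] c(1) group.inv_closed[OF group_free_Abelian_group c(2)]])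
		ultimately show ?thesis using diff[OF i' a] by simp
	qed
	have "a \<in> generate M ?X" using assms(1) span_A by (simp only: tuple_span_def)
	then show ?thesis
	proof induction
		case one
		show ?case by (simp add: zero)
	next
		case (incl h)
		then show ?case using X by blast
	next
		case (inv h)
		then have "R h" "h \<in> carrier M" using X by blast+
		then show ?case using neg by simp
	next
		case (eng h1 h2)
		then show ?case using add by simp
	qed
qed

lemma ex_not_in_span_K: "\<exists>b\<in>cvec_space n. b \<notin> spanK"
proof (rule ccontr)
	assume "\<not> ?thesis"
	then have "cvec_space n \<subseteq> spanK" by blast
	then have "diffs {..<n} \<subseteq> spanK" using diffs_cvec_space[OF subset_refl] by (rule subset_trans[rotated])
	then have "cfun.dim (diffs {..<n}) \<le> cfun.dim (diffs K)" by (rule cdim_mono[OF _ diffs_K_cvec_space])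
	then show False using psubset_card_mono[OF _ K_psubset] dim_diffs_all K_BK by simp
qed

text \<open>The relation w is taken transversal to a vector outside the span of K in the kernel of the
	indicator functions of every family of subsets of P for which such a vector exists; so the
	kernel of the indicators of the level sets of a null function of w, on which its covector
	vanishes, lies in the span of K.\<close>

lemma degenerate_level_sets:
	assumes deg: degenerate
	shows "\<exists>(\<theta> :: term_index => complex) Z \<kappa>.
		(\<forall>r. \<forall>i<n. \<forall>a\<in>A i. covec (Z r) a + \<kappa> r i = (if \<theta> (i, a) = r then 1 else 0)) \<and>
		(\<forall>b\<in>cvec_space n. (\<forall>r\<in>\<theta> ` P. (\<Sum>j<n. Z r j * b j) = 0) --> b \<in> spanK) \<and>
		(\<forall>r. \<forall>x\<in>spanK. (\<Sum>j<n. Z r j * x j) = 0)"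
proof -
	let ?ind = "\<lambda>S p. if p \<in> S then 1 else 0 :: complex"
	have "\<forall>S\<in>{S. linear_on_P (?ind S)}. \<exists>zk. \<forall>p\<in>P. ?ind S p = affine_form (fst zk) (snd zk) p"
	proof
		fix S assume "S \<in> {S. linear_on_P (?ind S)}"
		then obtain Z1 K1 where "\<forall>p\<in>P. ?ind S p = affine_form Z1 K1 p"
			using linear_on_P_obtain_affine_form[of "?ind S"] by (elim CollectE meta_impE exE)
		then show "\<exists>zk. \<forall>p\<in>P. ?ind S p = affine_form (fst zk) (snd zk) p"
			by (intro exI[of _ "(Z1, K1)"]) (simp only: fst_conv snd_conv)
	qed
	from bchoice[OF this] obtain zk where
		zk: "\<forall>S\<in>{S. linear_on_P (?ind S)}. \<forall>p\<in>P. ?ind S p = affine_form (fst (zk S)) (snd (zk S)) p"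
		by (elim exE)
	\<comment> \<open>Common kernel of the linear parts of a family of affine indicators.\<close>
	define N where "N \<F> = {b \<in> cvec_space n. \<forall>S\<in>\<F>. (\<Sum>j<n. fst (zk S) j * b j) = 0}" for \<F>
	have "\<forall>\<F>. \<exists>b. b \<in> cvec_space n \<and> b \<notin> spanK \<and> (\<not> N \<F> \<subseteq> spanK --> b \<in> N \<F>)"
	proof
		fix \<F>
		show "\<exists>b. b \<in> cvec_space n \<and> b \<notin> spanK \<and> (\<not> N \<F> \<subseteq> spanK --> b \<in> N \<F>)"
		proof (cases "N \<F> \<subseteq> spanK")
			case True
			obtain b where "b \<in> cvec_space n" "b \<notin> spanK" using ex_not_in_span_K by (rule bexE)
			then show ?thesis using True by (intro exI[of _ b] conjI impI) simp_all
		next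
			case False
			then have "\<exists>b. b \<in> N \<F> \<and> b \<notin> spanK" by (simp only: subset_iff not_all not_imp)
			then obtain b where b: "b \<in> N \<F>" "b \<notin> spanK" by (elim exE conjE)
			moreover have "b \<in> cvec_space n" using b(1) unfolding N_def by simp
			ultimately show ?thesis by (intro exI[of _ b] conjI impI)
		qed
	qed
	from choice[OF this] obtain bs where bs: "\<forall>\<F>. bs \<F> \<in> cvec_space n \<and> bs \<F> \<notin> spanK \<and> (\<not> N \<F> \<subseteq> spanK --> bs \<F> \<in> N \<F>)"
		by (elim exE)
	have "\<exists>w\<in>relations. \<forall>b\<in>bs ` Pow (Pow P). transversal b w"
	proof (rule transversal_generic)
		show "finite (bs ` Pow (Pow P))" by simp
		fix b assume "b \<in> bs ` Pow (Pow P)"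
		then show "\<exists>w\<in>relations. transversal b w" using bs by (elim imageE) (simp add: transversal_exists)
	qed
	then obtain w where wr: "w \<in> relations" and tr: "\<forall>b\<in>bs ` Pow (Pow P). transversal b w" by (rule bexE)
	have tr': "transversal (bs \<F>) w" if "\<F> \<subseteq> Pow P" for \<F> using tr that by simp
	have w: "w \<in> proper_relations" by (rule transversal_proper[OF wr tr'[of "{}"]]) simp
	obtain \<theta> where \<theta>: "\<theta> \<in> null_functions w" "nonconstant \<theta>" using deg w unfolding degenerate_def by (auto simp: Bex_def)
	obtain \<xi> \<eta> j1 where rep: "\<And>i a. i < n ==> a \<in> A i ==> \<theta> (i, a) = \<eta> i + covec \<xi> a"
		and j1: "j1 < n" "\<xi> j1 \<noteq> 0" and cov: "\<And>i. i < n ==> dot \<xi> (moment w i) = 0"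
		by (rule null_functionE[OF w \<theta>]) (rule that)
	define L where "L r = {p \<in> P. \<theta> p = r}" for r
	define Z where "Z r = fst (zk (L r))" for r
	define \<kappa> where "\<kappa> r = snd (zk (L r))" for r
	have ind: "covec (Z r) a + \<kappa> r i = (if \<theta> (i, a) = r then 1 else 0)" if ia: "i < n" "a \<in> A i" for r i a
	proof -
		have "linear_on_P (?ind (L r))"
		proof (subst linear_on_P_cong[where g = "\<lambda>p. if \<theta> p = r then 1 else 0"])
			show "linear_on_P (\<lambda>p. if \<theta> p = r then 1 else 0)"
				by (rule degenerate_compose[OF n_pos deg w \<theta>, of "\<lambda>x. if x = r then 1 else 0"])
		qed (simp add: L_def)
		moreover have p: "(i, a) \<in> P" using ia by (simp add: mem_P_iff)
		ultimately have "(if (i, a) \<in> L r then 1 else 0) = affine_form (Z r) (\<kappa> r) (i, a)"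
			using zk unfolding Z_def \<kappa>_def by blast
		then show ?thesis using p by (simp add: L_def affine_form_def add.commute)
	qed
	have xi: "\<xi> j = (\<Sum>r\<in>\<theta> ` P. r * Z r j)" if "j < n" for j
		by (rule indicator_combination[OF rep ind that])
	have kernel: "b \<in> spanK" if b: "b \<in> cvec_space n" "\<forall>r\<in>\<theta> ` P. (\<Sum>j<n. Z r j * b j) = 0" for b
	proof -
		let ?F = "L ` (\<theta> ` P)"
		have FP: "?F \<subseteq> Pow P" unfolding L_def by (rule image_subsetI) simp
		have "N ?F \<subseteq> spanK"
		proof (rule ccontr)
			assume "\<not> N ?F \<subseteq> spanK"
			then have bN: "bs ?F \<in> N ?F" and bc: "bs ?F \<in> cvec_space n" using bs by blast+
			have z: "(\<Sum>j<n. Z r j * bs ?F j) = 0" if "r \<in> \<theta> ` P" for r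
				using bN that unfolding N_def Z_def by blast
			\<comment> \<open>The covector of \<theta> is the combination of the \<open>Z r\<close> with
			  weights r, so it would kill a vector to which \<open>w\<close> is transversal.\<close>
			have "(\<Sum>j<n. \<xi> j * bs ?F j) = (\<Sum>r\<in>\<theta> ` P. r * (\<Sum>j<n. Z r j * bs ?F j))"
			proof -
				have "(\<Sum>j<n. \<xi> j * bs ?F j) = (\<Sum>j<n. \<Sum>r\<in>\<theta> ` P. r * (Z r j * bs ?F j))"
					by (rule sum.cong[OF refl]) (simp only: xi lessThan_iff sum_distrib_right mult.assoc)
				then show ?thesis unfolding sum_distrib_left by (subst sum.swap)
			qed
			also have "\<dots> = 0" by (rule sum.neutral) (simp add: z)
			finally show False
				using transversal_covector[where h = \<xi> and w = w, OF n_pos wr tr'[OF FP] bc j1 cov] by simp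
		qed
		moreover have "b \<in> N ?F" using b unfolding N_def Z_def by blast
		ultimately show ?thesis by (rule subsetD)
	qed
	have xK: "dot \<xi> x = 0" if "x \<in> spanK" for x by (rule covector_vanishes_on_K[OF w that cov])
	\<comment> \<open>The covector is constant on each set of \<open>K\<close>; hence so is \<theta>,
	  and with it every level indicator.\<close>
	have vanish: "(\<Sum>j<n. Z r j * x j) = 0" if x: "x \<in> spanK" for r x using x
	proof (rule functional_span_zero[rotated])
		fix y assume "y \<in> diffs K"
		then obtain i a a' where i: "i \<in> K" "a \<in> A i" "a' \<in> A i" and y: "y = (\<lambda>j. lvec a j - lvec a' j)"
			unfolding diffs_def by auto
		have yK: "y \<in> spanK" using \<open>y \<in> diffs K\<close> by (rule cfun.span_base)
		have d: "dot g y = covec g a - covec g a'" for g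
			unfolding y by (simp add: right_diff_distrib sum_subtractf)
		have "covec \<xi> a = covec \<xi> a'" using xK[OF yK] unfolding d by simp
		then have "\<theta> (i, a) = \<theta> (i, a')" unfolding rep[OF K_less[OF i(1)] i(2)] rep[OF K_less[OF i(1)] i(3)] by simp
		then have "covec (Z r) a + \<kappa> r i = covec (Z r) a' + \<kappa> r i"
			unfolding ind[OF K_less[OF i(1)] i(2)] ind[OF K_less[OF i(1)] i(3)] by (simp only:)
		then show "(\<Sum>j<n. Z r j * y j) = 0" unfolding d by simp
	qed
	show ?thesis
		by (rule exI[of _ \<theta>], rule exI[of _ Z], rule exI[of _ \<kappa>], intro conjI allI impI ballI)
			(rule ind, assumption, assumption, rule kernel, assumption, assumption, rule vanish, assumption)
qed

end

section \<open>Simplex coordinates from level sets\<close>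

locale level_sets = simple_finite_tuple +
	fixes \<theta> :: "term_index => complex" and Z :: "complex => nat => complex" and \<kappa> :: "complex => nat => complex"
	assumes indicator: "i < n ==> a \<in> A i ==> covec (Z r) a + \<kappa> r i = (if \<theta> (i, a) = r then 1 else 0)"
		and kernel: "b \<in> cvec_space n ==> (\<And>r. r \<in> \<theta> ` P ==> (\<Sum>j<n. Z r j * b j) = 0) ==> b \<in> spanK"
		and vanish: "x \<in> spanK ==> (\<Sum>j<n. Z r j * x j) = 0"
begin

lemma covec_add: "covec h (a + b) = covec h a + covec h b"
	by (simp add: lvec_add distrib_left sum.distrib)

lemma covec_uminus: "covec h (- a) = - covec h a" by (simp add: lvec_uminus sum_negf)

lemma covec_diff: "covec h (a - b) = covec h a - covec h b"
	by (simp add: lvec_diff right_diff_distrib sum_subtractf)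

lemma covec_zero: "covec h 0 = 0" by (simp add: lvec_zero)

lemma indicator_diff:
	assumes "i < n" "a \<in> A i" "a' \<in> A i"
	shows "covec (Z r) (a - a') = (if \<theta> (i, a) = r then 1 else 0) - (if \<theta> (i, a') = r then 1 else 0)"
	unfolding covec_diff indicator[OF assms(1,2), symmetric] indicator[OF assms(1,3), symmetric] by simp

text \<open>On the differences, which generate the lattice, the linear part of an indicator takes
  the values 0, 1 and -1.\<close>

lemma covec_Ints: "a \<in> carrier M ==> covec (Z r) a \<in> \<int>"
	by (erule differences_induct) (simp_all only: indicator_diff covec_zero covec_add covec_uminus Ints_add Ints_diff Ints_minus Ints_0 Ints_1 simp_thms split: if_split)

definition level_coord :: "complex => (nat \<Rightarrow>\<^sub>0 int) => int" where
	"level_coord r a = \<lfloor>Re (covec (Z r) a)\<rfloor>"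

lemma level_coord:
	assumes "a \<in> carrier M"
	shows "of_int (level_coord r a) = covec (Z r) a"
proof -
	obtain z where "covec (Z r) a = of_int z" using covec_Ints[OF assms] by (rule Ints_cases)
	then show ?thesis unfolding level_coord_def by (simp only: complex_Re_of_int floor_of_int)
qed

abbreviation R where "R \<equiv> \<theta> ` P"

text \<open>Levels as vertices: two are joined when the difference of their unit vectors is the
  level vector of a lattice point. This is an equivalence relation, and the levels on one set of the
  tuple belong to one class.\<close>

definition linked :: "complex => complex => bool" where
	"linked r r' \<longleftrightarrow> (\<exists>a\<in>carrier M. \<forall>s\<in>R. covec (Z s) a = (if r = s then 1 else 0) - (if r' = s then 1 else 0))"

lemma M_closed: "a \<in> carrier M ==> b \<in> carrier M ==> a + b \<in> carrier M" "a \<in> carrier M ==> - a \<in> carrier M"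
		"a \<in> carrier M ==> b \<in> carrier M ==> a - b \<in> carrier M" "0 \<in> carrier M"
	by (simp_all only: int_lattice_carrier_iff lookup_add lookup_uminus lookup_minus lookup_zero) simp_all

lemma linked_refl: "linked r r"
	unfolding linked_def by (rule bexI[OF _ M_closed(4)]) (simp add: covec_zero)

lemma linked_sym: "linked r r' ==> linked r' r"
proof -
	assume "linked r r'"
	then obtain a where a: "a \<in> carrier M" "\<forall>s\<in>R. covec (Z s) a = (if r = s then 1 else 0) - (if r' = s then 1 else 0)"
		unfolding linked_def by (rule bexE)
	show "linked r' r" unfolding linked_def
		by (rule bexI[OF _ M_closed(2)[OF a(1)]], rule ballI) (simp only: covec_uminus a(2) minus_diff_eq)
qed

lemma linked_trans: "linked r r' ==> linked r' r'' ==> linked r r''"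
proof -
	assume "linked r r'" "linked r' r''"
	then obtain a b where a: "a \<in> carrier M" "\<forall>s\<in>R. covec (Z s) a = (if r = s then 1 else 0) - (if r' = s then 1 else 0)"
		and b: "b \<in> carrier M" "\<forall>s\<in>R. covec (Z s) b = (if r' = s then 1 else 0) - (if r'' = s then 1 else 0)"
		unfolding linked_def by (elim bexE)
	show "linked r r''" unfolding linked_def
		by (rule bexI[OF _ M_closed(1)[OF a(1) b(1)]], rule ballI) (simp only: covec_add a(2) b(2) diff_add_cancel add_diff_eq)
qed

lemma linked_levels: "i < n ==> a \<in> A i ==> a' \<in> A i ==> linked (\<theta> (i, a)) (\<theta> (i, a'))"
	unfolding linked_def by (rule bexI[of _ "a - a'"]) (simp_all only: indicator_diff M_closed A_in_M, simp)

definition level_root :: "complex => complex" where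
	"level_root r = (SOME r'. r' \<in> R \<and> linked r r')"

lemma level_root:
	assumes "r \<in> R"
	shows "level_root r \<in> R \<and> linked r (level_root r)" unfolding level_root_def
	by (rule someI[where P = "\<lambda>r'. r' \<in> R \<and> linked r r'" and x = r], rule conjI[OF assms linked_refl])

lemma level_root_eq: "linked r r' ==> level_root r = level_root r'"
proof -
	assume l: "linked r r'"
	have "linked r s \<longleftrightarrow> linked r' s" for s using linked_trans[OF l, of s] linked_trans[OF linked_sym[OF l], of s] by blast
	then have "(\<lambda>s. s \<in> R \<and> linked r s) = (\<lambda>s. s \<in> R \<and> linked r' s)" by (intro ext) (simp only:)
	then show ?thesis unfolding level_root_def by (rule arg_cong)
qed

text \<open>One level per class is dropped and becomes the vertex 0 of the simplex. The linear parts
  sum to zero over a class (\<open>class_sum_zero\<close>), so those of the remaining levels carry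
  all the information and serve as coordinates of the quotient.\<close>

definition nonroots :: "complex set" where
	"nonroots = {r \<in> R. level_root r \<noteq> r}"

lemma finite_nonroots: "finite nonroots" unfolding nonroots_def by simp

lemma level_root_root: "r \<in> R ==> level_root (level_root r) = level_root r"
	using level_root_eq[of r "level_root r"] level_root[of r] by simp

text \<open>A lattice point linking r to its root has as level vector the difference of the two unit
  vectors, and the root is not among the coordinates.\<close>

lemma ex_unit: "r \<in> nonroots ==> \<exists>u\<in>carrier M. \<forall>s\<in>nonroots. covec (Z s) u = (if r = s then 1 else 0)"
proof -
	assume r: "r \<in> nonroots"
	then have rR: "r \<in> R" by (simp only: nonroots_def mem_Collect_eq)
	obtain a where a: "a \<in> carrier M" "\<forall>s\<in>R. covec (Z s) a = (if r = s then 1 else 0) - (if level_root r = s then 1 else 0)"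
		using conjunct2[OF level_root[OF rR]] unfolding linked_def by (rule bexE)
	have "covec (Z s) a = (if r = s then 1 else 0)" if s: "s \<in> nonroots" for s
	proof -
		have "s \<in> R" "level_root s \<noteq> s" using s by (simp_all add: nonroots_def)
		moreover have "level_root r \<noteq> s" using level_root_root[OF rR] \<open>level_root s \<noteq> s\<close> by metis
		ultimately show ?thesis using bspec[OF a(2) \<open>s \<in> R\<close>] by simp
	qed
	then show ?thesis using a(1) by (intro bexI[of _ a] ballI)
qed

text \<open>Each set of the tuple meets a single class, so the indicator of a class is constant on
  it; the linear part of that indicator is therefore zero.\<close>

lemma class_sum_zero:
	assumes j: "j < n"
	shows "(\<Sum>s\<in>{s \<in> R. level_root s = c}. Z s j) = 0"
proof (rule functional_zero_on_differences[OF _ j])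
	fix i a a' assume ia: "i < n" "a \<in> A i" "a' \<in> A i"
	let ?S = "{s \<in> R. level_root s = c}"
	have e: "(\<Sum>j<n. (\<Sum>s\<in>?S. Z s j) * lvec x j) = (\<Sum>s\<in>?S. covec (Z s) x)" for x
		unfolding sum_distrib_right by (rule sum.swap)
	have v: "(\<Sum>s\<in>?S. covec (Z s) x) + (\<Sum>s\<in>?S. \<kappa> s i) = (if level_root (\<theta> (i, x)) = c then 1 else 0)" if x: "x \<in> A i" for x
	proof -
		have xR: "\<theta> (i, x) \<in> R" using ia(1) x by (intro imageI) (simp add: mem_P_iff)
		have "(\<Sum>s\<in>?S. covec (Z s) x) + (\<Sum>s\<in>?S. \<kappa> s i) = (\<Sum>s\<in>?S. if \<theta> (i, x) = s then 1 else 0)"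
			unfolding sum.distrib[symmetric] by (rule sum.cong[OF refl]) (rule indicator[OF ia(1) x])
		also have "\<dots> = (if \<theta> (i, x) \<in> ?S then 1 else 0)" by (rule sum.delta'[OF finite_subset[of _ R]]) auto
		finally show ?thesis using xR by simp
	qed
	have "level_root (\<theta> (i, a)) = level_root (\<theta> (i, a'))" by (rule level_root_eq[OF linked_levels[OF ia]])
	then have "(\<Sum>s\<in>?S. covec (Z s) a) + (\<Sum>s\<in>?S. \<kappa> s i) = (\<Sum>s\<in>?S. covec (Z s) a') + (\<Sum>s\<in>?S. \<kappa> s i)"
		unfolding v[OF ia(2)] v[OF ia(3)] by (simp only:)
	then show "(\<Sum>j<n. (\<Sum>s\<in>?S. Z s j) * lvec a j) = (\<Sum>j<n. (\<Sum>s\<in>?S. Z s j) * lvec a' j)"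
		unfolding e by simp
qed

lemma kernel_nonroots:
	assumes b: "b \<in> cvec_space n" "\<And>r. r \<in> nonroots ==> (\<Sum>j<n. Z r j * b j) = 0"
	shows "b \<in> spanK"
proof (rule kernel[OF b(1)])
	fix r assume r: "r \<in> R"
	show "(\<Sum>j<n. Z r j * b j) = 0"
	proof (cases "r \<in> nonroots")
		case False
		then have rr: "level_root r = r" using r by (simp add: nonroots_def)
		let ?S = "{s \<in> R. level_root s = r}"
		have rS: "r \<in> ?S" using r rr by simp
		have finS: "finite ?S" by simp
		have "0 = (\<Sum>j<n. (\<Sum>s\<in>?S. Z s j) * b j)" by (rule sum.neutral[symmetric]) (simp add: class_sum_zero)
		also have "\<dots> = (\<Sum>s\<in>?S. \<Sum>j<n. Z s j * b j)" unfolding sum_distrib_right by (rule sum.swap)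
		also have "\<dots> = (\<Sum>j<n. Z r j * b j) + (\<Sum>s\<in>?S - {r}. \<Sum>j<n. Z s j * b j)" by (rule sum.remove[OF finS rS])
		also have "(\<Sum>s\<in>?S - {r}. \<Sum>j<n. Z s j * b j) = 0"
		proof (rule sum.neutral, rule ballI)
			fix s assume "s \<in> ?S - {r}"
			then have "s \<in> nonroots" by (auto simp: nonroots_def)
			then show "(\<Sum>j<n. Z s j * b j) = 0" by (rule b(2))
		qed
		finally show ?thesis by simp
	qed (rule b(2))
qed

abbreviation m where "m \<equiv> card nonroots"

definition level :: "nat => complex" where
	"level = (SOME g. bij_betw g {0..<m} nonroots)"

lemma level_bij: "bij_betw level {0..<m} nonroots"
	unfolding level_def by (rule someI_ex[OF ex_bij_betw_nat_finite[OF finite_nonroots]])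

lemma level_nonroots: "s < m ==> level s \<in> nonroots" using bij_betwE[OF level_bij] by simp

lemma level_eq_iff: "s < m ==> s' < m ==> level s = level s' \<longleftrightarrow> s = s'"
	using inj_on_eq_iff[OF bij_betw_imp_inj_on[OF level_bij], of s s'] by simp

definition levels :: "(nat => complex) => nat => complex" where
	"levels b s = (if s < m then \<Sum>j<n. Z (level s) j * b j else 0)"

lemma levels_add: "levels (x + y) = levels x + levels y"
	by (rule ext) (simp add: levels_def distrib_left sum.distrib)

lemma levels_scale: "levels (\<lambda>i. c * x i) = (\<lambda>i. c * levels x i)"
	by (rule ext) (simp add: levels_def sum_distrib_left mult.left_commute)

lemma levels_cvec_space: "levels ` X \<subseteq> cvec_space m"
	by (rule image_subsetI) (simp add: cvec_space_def levels_def)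

lemma levels_kernel: "b \<in> cvec_space n ==> levels b = 0 ==> b \<in> spanK"
proof (erule kernel_nonroots)
	fix r assume z: "levels b = 0" and "r \<in> nonroots"
	then obtain s where s: "s \<in> {0..<m}" "r = level s" using bij_betw_imp_surj_on[OF level_bij] by (metis imageE)
	have "levels b s = 0" using z by simp
	then show "(\<Sum>j<n. Z r j * b j) = 0" using s by (simp add: levels_def)
qed

lemma levels_vanish: "x \<in> spanK ==> levels x = 0" by (rule ext) (simp add: levels_def vanish)

lemma ex_units: "\<exists>u. \<forall>s\<in>{..<m}. u s \<in> carrier M \<and> (\<forall>s'<m. covec (Z (level s')) (u s) = (if s = s' then 1 else 0))"
proof (rule bchoice, rule ballI)
	fix s assume "s \<in> {..<m}"
	then have s: "s < m" by simp
	obtain u where u: "u \<in> carrier M" "\<forall>r\<in>nonroots. covec (Z r) u = (if level s = r then 1 else 0)"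
		using ex_unit[OF level_nonroots[OF s]] by (rule bexE)
	have "covec (Z (level s')) u = (if s = s' then 1 else 0)" if s': "s' < m" for s'
		using u(2) level_nonroots[OF s'] level_eq_iff[OF s s'] by simp
	then show "\<exists>u. u \<in> carrier M \<and> (\<forall>s'<m. covec (Z (level s')) u = (if s = s' then 1 else 0))"
		using u(1) by (intro exI[of _ u] conjI allI impI)
qed

text \<open>Rank-nullity for \<open>levels\<close>: the kernel is \<open>spanK\<close>, of dimension
  card K, the units make the image of dimension \<open>m\<close>, and the total is n.\<close>

lemma m_eq: "m = card ({..<n} - K)"
proof -
	let ?X = "lvec ` carrier M"
	have X: "?X \<subseteq> cvec_space n" by (rule image_subsetI) (rule lvec_cvec_space)
	have XK: "?X \<union> diffs K \<subseteq> cvec_space n" using X diffs_K_cvec_space by simp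
	have "diffs {..<n} \<subseteq> ?X"
	proof
		fix x assume "x \<in> diffs {..<n}"
		then obtain i a a' where i: "i < n" "a \<in> A i" "a' \<in> A i" and x: "x = (\<lambda>j. lvec a j - lvec a' j)"
			unfolding diffs_def by auto
		have "x = lvec (a - a')" unfolding x lvec_diff by (simp add: fun_eq_iff)
		then show "x \<in> ?X" by (rule image_eqI) (rule M_closed(3)[OF A_in_M[OF i(1,2)] A_in_M[OF i(1,3)]])
	qed
	then have "cfun.dim (diffs {..<n}) \<le> cfun.dim (?X \<union> diffs K)"
		by (intro cdim_mono[OF _ XK] subset_trans[OF _ cfun.span_superset]) auto
	then have 1: "n \<le> cfun.dim (?X \<union> diffs K)" by (simp only: dim_diffs_all)
	have 2: "cfun.dim (?X \<union> diffs K) \<le> n" by (rule cdim_le[OF XK])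
	have "x \<in> spanK" if "x \<in> cfun.span ?X" "levels x = 0" for x
		using subsetD[OF span_subset_cvec_space[OF X] that(1)] that(2) by (rule levels_kernel)
	then have 3: "cfun.dim (?X \<union> diffs K) \<le> cfun.dim (levels ` ?X) + cfun.dim (diffs K)"
		by (rule cdim_kernel_le[OF levels_add levels_scale diffs_K_cvec_space levels_cvec_space])
	have 4: "cfun.dim (levels ` ?X) + cfun.dim (diffs K) \<le> cfun.dim (?X \<union> diffs K)"
		by (rule cdim_kernel_ge[OF levels_add levels_scale X diffs_K_cvec_space levels_cvec_space levels_vanish[OF cfun.span_base]])
	have 5: "cfun.dim (levels ` ?X) \<le> m" by (rule cdim_le[OF levels_cvec_space])
	have 6: "m \<le> cfun.dim (levels ` ?X)"
	proof -
		define e :: "nat => nat => complex" where "e s = (\<lambda>j. if j = s then 1 else 0)" for s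
		obtain u where u: "\<forall>s\<in>{..<m}. u s \<in> carrier M \<and> (\<forall>s'<m. covec (Z (level s')) (u s) = (if s = s' then 1 else 0))"
			using ex_units by (rule exE)
		have ind: "indep_family UNIV {..<m} e"
		proof (rule indep_familyI)
			fix c i assume c: "\<And>j. j \<in> UNIV ==> (\<Sum>s<m. c s * e s j) = 0" and i: "i \<in> {..<m}"
			have "(\<Sum>s<m. c s * e s i) = c i" using i by (simp add: e_def if_distrib[of "\<lambda>x. _ * x"] cong: if_cong)
			then show "c i = 0" using c[of i] by simp
		qed
		then have "inj_on e {..<m}" "cfun.independent (e ` {..<m})" by (simp_all add: indep_family_iff_independent)
		moreover have "e ` {..<m} \<subseteq> levels ` ?X"
		proof (rule image_subsetI)
			fix s assume s: "s \<in> {..<m}"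
			then have us: "u s \<in> carrier M" "\<forall>s'<m. covec (Z (level s')) (u s) = (if s = s' then 1 else 0)" using u by blast+
			have "e s j = levels (lvec (u s)) j" for j
				using us(2) s by (cases "j < m") (auto simp: e_def levels_def)
			then have es: "e s = levels (lvec (u s))" by (rule ext)
			show "e s \<in> levels ` ?X" unfolding es by (rule imageI[OF imageI[OF us(1)]])
		qed
		ultimately have "card (e ` {..<m}) \<le> cfun.dim (levels ` ?X)"
			by (intro indep_card_le_dim[OF _ _ levels_cvec_space] subset_trans[OF _ cfun.span_superset])
		then show ?thesis using card_image[OF \<open>inj_on e {..<m}\<close>] by simp
	qed
	have "card ({..<n} - K) = n - card K"
		using psubset_imp_subset[OF K_psubset] by (simp add: card_Diff_subset finite_subset)
	then show ?thesis using 1 2 3 4 5 6 K_BK by simp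
qed

text \<open>The representative of the coset is arbitrary: the linear parts vanish on the
  saturation.\<close>

definition quotient_map :: "(nat \<Rightarrow>\<^sub>0 int) set => nat \<Rightarrow>\<^sub>0 int" where
	"quotient_map X = (\<Sum>s<m. frag_cmul (level_coord (level s) (SOME a. a \<in> carrier M \<and> proj a = X)) (frag_of s))"

lemma quotient_map:
	assumes a: "a \<in> carrier M"
	shows "of_int (coord (quotient_map (proj a)) s) = levels (lvec a) s"
proof -
	define b where "b = (SOME b. b \<in> carrier M \<and> proj b = proj a)"
	have "b \<in> carrier M \<and> proj b = proj a" unfolding b_def by (rule someI[of _ a]) (simp only: a simp_thms)
	then have b: "b \<in> carrier M" "proj b = proj a" by (rule conjunct1, rule conjunct2)
	have "a - b \<in> sat" using proj_eq_iff[OF a b(1)] b(2) by simp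
	then have "covec (Z r) (a - b) = 0" for r unfolding sat_def by (intro vanish) simp
	then have "covec (Z r) b = covec (Z r) a" for r unfolding covec_diff by simp
	then show ?thesis
		unfolding quotient_map_def b_def[symmetric] lookup_frag_combination levels_def by (simp add: level_coord[OF b(1)])
qed

lemma quotient_map_eqI:
	assumes "a \<in> carrier M" "\<And>s. levels (lvec a) s = of_int (coord z s)"
	shows "quotient_map (proj a) = z"
	by (rule poly_mapping_eqI) (use quotient_map[OF assms(1)] assms(2) in simp)

lemma quotient_map_iso: "quotient_map \<in> iso Q (int_lattice m)"
proof -
	have hom: "quotient_map \<in> hom Q (int_lattice m)"
	proof (rule homI)
		fix X assume "X \<in> carrier Q"
		show "quotient_map X \<in> carrier (int_lattice m)"
			unfolding int_lattice_carrier_iff quotient_map_def lookup_frag_combination by simp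
		fix Y assume "Y \<in> carrier Q"
		obtain a b where ab: "a \<in> carrier M" "b \<in> carrier M" and XY: "X = proj a" "Y = proj b"
			using \<open>X \<in> carrier Q\<close> \<open>Y \<in> carrier Q\<close> unfolding carrier_Q by (elim imageE)
		show "quotient_map (X \<otimes>\<^bsub>Q\<^esub> Y) = quotient_map X \<otimes>\<^bsub>int_lattice m\<^esub> quotient_map Y"
			unfolding XY proj_add[OF ab] mult_free_Abelian_group
			by (rule quotient_map_eqI[OF M_closed(1)[OF ab]]) (simp add: lookup_add quotient_map[OF ab(1)] quotient_map[OF ab(2)] lvec_add levels_add)
	qed
	have inj: "inj_on quotient_map (carrier Q)"
	proof (rule inj_onI)
		fix X Y assume "X \<in> carrier Q" "Y \<in> carrier Q" and eq: "quotient_map X = quotient_map Y"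
		then obtain a b where ab: "a \<in> carrier M" "b \<in> carrier M" and XY: "X = proj a" "Y = proj b"
			unfolding carrier_Q by (elim imageE)
		have "levels (lvec a) = levels (lvec b)"
			by (rule ext) (use quotient_map[OF ab(1)] quotient_map[OF ab(2)] eq XY in simp)
		then have "levels (lvec (a - b)) = 0"
			using levels_add[of "lvec (a - b)" "lvec b"] by (simp add: lvec_diff)
		then have "lvec (a - b) \<in> spanK" by (rule levels_kernel[OF lvec_cvec_space[OF M_closed(3)[OF ab]]])
		then have "a - b \<in> sat" using M_closed(3)[OF ab] by (simp only: sat_def mem_Collect_eq simp_thms)
		then show "X = Y" unfolding XY using proj_eq_iff[OF ab] by simp
	qed
	have "carrier (int_lattice m) \<subseteq> quotient_map ` carrier Q"
	proof
		fix z assume z: "z \<in> carrier (int_lattice m)"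
		obtain u where u: "\<forall>s\<in>{..<m}. u s \<in> carrier M \<and> (\<forall>s'<m. covec (Z (level s')) (u s) = (if s = s' then 1 else 0))"
			using ex_units by (rule exE)
		define a where "a = (\<Sum>s<m. frag_cmul (coord z s) (u s))"
		have la: "lvec a j = (\<Sum>s<m. of_int (coord z s) * lvec (u s) j)" for j
			unfolding a_def cvec_apply lookup_sum by simp
		have aM: "a \<in> carrier M" unfolding int_lattice_carrier_iff a_def lookup_sum
		proof (intro allI impI)
			fix j assume "n \<le> j"
			then have "coord (u s) j = 0" if "s < m" for s using u that unfolding int_lattice_carrier_iff by blast
			then show "(\<Sum>s<m. coord (frag_cmul (coord z s) (u s)) j) = 0" by simp
		qed
		have "quotient_map (proj a) = z"
		proof (rule quotient_map_eqI[OF aM])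
			fix s
			show "levels (lvec a) s = of_int (coord z s)"
			proof (cases "s < m")
				case True
				have "levels (lvec a) s = (\<Sum>s'<m. of_int (coord z s') * covec (Z (level s)) (u s'))"
					using True unfolding levels_def la sum_distrib_left by (subst sum.swap) (simp add: mult.left_commute)
				also have "\<dots> = (\<Sum>s'<m. if s' = s then of_int (coord z s') else 0)"
					by (rule sum.cong[OF refl]) (use u True in simp)
				also have "\<dots> = of_int (coord z s)" using True by simp
				finally show ?thesis .
			next
				case False
				then have "coord z s = 0" using z unfolding int_lattice_carrier_iff by simp
				then show ?thesis using False by (simp add: levels_def)
			qed
		qed
		then show "z \<in> quotient_map ` carrier Q" unfolding carrier_Q using aM by blast
	qed
	moreover have "quotient_map ` carrier Q \<subseteq> carrier (int_lattice m)"
		using hom by (auto simp: hom_def)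
	ultimately show ?thesis using hom inj by (simp add: iso_def bij_betw_def)
qed

text \<open>The rank of the image of \<open>C\<close> in the quotient is at least the rank of C
  \<union> K minus card K, hence at least card C by independence of the original tuple. Equality for
  all blocks outside \<open>K\<close> is the count in \<open>m_eq\<close>.\<close>

lemma BK_quotient: "BK_tuple Q (\<lambda>i. proj ` A i) ({..<n} - K)"
proof -
	let ?J = "{..<n} - K"
	have Qe: "Q\<lparr>carrier := carrier Q\<rparr> = Q" by simp
	have "lattice_dim Q (carrier Q) = m"
		by (rule lattice_dim_eqI) (simp_all only: Qe group_Q is_isoI[OF quotient_map_iso])
	then have d0: "defect Q (\<lambda>i. proj ` A i) ?J = 0" unfolding defect_def tuple_span_Q m_eq by simp
	have "0 \<le> defect Q (\<lambda>i. proj ` A i) C" if C: "C \<subseteq> ?J" for C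
	proof -
		have Cn: "C \<subseteq> {..<n}" using C by auto
		let ?D = "differences C"
		have mem: "a - a' \<in> ?D" if i: "i \<in> C" "a \<in> A i" "a' \<in> A i" for i a a'
		proof -
			have "i < n" using i Cn by auto
			then have "a' \<in> carrier M" using i(3) by (rule A_in_M)
			then have "a - a' = a \<otimes>\<^bsub>M\<^esub> inv\<^bsub>M\<^esub> a'" by simp
			then show ?thesis using i by blast
		qed
		have D: "?D \<subseteq> carrier M"
		proof (rule UN_least, rule subsetI)
			fix i x assume i: "i \<in> C" and "x \<in> diff_set i"
			then obtain a a' where a: "a \<in> A i" "a' \<in> A i" and x: "x = a \<otimes>\<^bsub>M\<^esub> inv\<^bsub>M\<^esub> a'" by (elim CollectE exE conjE)
			have "i < n" using i Cn by auto
			then show "x \<in> carrier M" unfolding x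
				by (intro monoid.m_closed[OF group.is_monoid[OF group_free_Abelian_group]] group.inv_closed[OF group_free_Abelian_group] A_in_M[of i] a)
		qed
		have pD: "proj ` ?D \<subseteq> carrier Q" unfolding carrier_Q by (rule image_mono[OF D])
		have "lattice_dim Q (generate Q (proj ` ?D)) = cfun.dim ((\<lambda>X. cvec (coord (quotient_map X))) ` proj ` ?D)"
		proof (rule lattice_dim_generate(2)[OF group_Q pD])
			show "coord (quotient_map (X \<otimes>\<^bsub>Q\<^esub> Y)) = coord (quotient_map X) + coord (quotient_map Y)"
				if "X \<in> carrier Q" "Y \<in> carrier Q" for X Y
				using quotient_map_iso that hom_mult[of quotient_map Q "int_lattice m"] by (simp add: iso_def fun_eq_iff lookup_add)
			have "inj_on quotient_map (carrier Q)" using quotient_map_iso by (simp add: iso_def bij_betw_def)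
			then show "inj_on (\<lambda>X. coord (quotient_map X)) (carrier Q)"
				by (simp add: inj_on_def lookup_inject)
			show "coord (quotient_map X) j = 0" if "m \<le> j" for X j
				using that unfolding quotient_map_def lookup_frag_combination by simp
		qed
		then have dim: "lattice_dim Q (tuple_span Q (\<lambda>i. proj ` A i) C) = cfun.dim ((\<lambda>X. cvec (coord (quotient_map X))) ` proj ` ?D)"
			unfolding tuple_span_def proj_differences[OF Cn] .
		have e: "cvec (coord (quotient_map (proj a))) = levels (lvec a)" if "a \<in> carrier M" for a
			by (rule ext) (simp only: cvec_apply quotient_map[OF that])
		have "levels ` diffs C \<subseteq> (\<lambda>X. cvec (coord (quotient_map X))) ` proj ` ?D"
		proof (rule image_subsetI)
			fix x assume "x \<in> diffs C"
			then obtain i a a' where i: "i \<in> C" "a \<in> A i" "a' \<in> A i" and x: "x = (\<lambda>j. lvec a j - lvec a' j)"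
				unfolding diffs_def by auto
			have xe: "x = lvec (a - a')" unfolding x lvec_diff by (simp add: fun_eq_iff)
			have "a - a' \<in> ?D" by (rule mem[OF i])
			then show "levels x \<in> (\<lambda>X. cvec (coord (quotient_map X))) ` proj ` ?D"
				unfolding xe using e[OF subsetD[OF D]] by (metis (no_types, lifting) imageI)
		qed
		then have "cfun.dim (levels ` diffs C) \<le> lattice_dim Q (tuple_span Q (\<lambda>i. proj ` A i) C)"
			unfolding dim
		proof (intro cdim_mono[where n = m] subset_trans[OF _ cfun.span_superset])
			show "(\<lambda>X. cvec (coord (quotient_map X))) ` proj ` ?D \<subseteq> cvec_space m"
				unfolding quotient_map_def lookup_frag_combination by (rule image_subsetI) (simp add: cvec_space_def cvec_apply)
		qed
		moreover have "cfun.dim (diffs C \<union> diffs K) \<le> cfun.dim (levels ` diffs C) + cfun.dim (diffs K)"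
		proof (rule cdim_kernel_le[OF levels_add levels_scale diffs_K_cvec_space levels_cvec_space])
			fix x assume "x \<in> cfun.span (diffs C)" "levels x = 0"
			then show "x \<in> spanK"
				using span_subset_cvec_space[OF diffs_cvec_space[OF Cn]] by (intro levels_kernel) auto
		qed
		moreover have "card (C \<union> K) \<le> cfun.dim (diffs (C \<union> K))"
			using Cn psubset_imp_subset[OF K_psubset] by (intro card_le_dim_diffs) simp
		moreover have "card (C \<union> K) = card C + card K"
			using C psubset_imp_subset[OF K_psubset] finite_subset[OF Cn] by (intro card_Un_disjoint) (auto intro: finite_subset)
		ultimately show ?thesis unfolding defect_def diffs_Un K_BK by simp
	qed
	then show ?thesis using d0 by (simp add: BK_tuple_def independent_tuple_def)
qed

text \<open>If a reference point \<open>a0\<close> of the set is translated to the vertex of its own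
  level, every point goes to the vertex of its level: a unit vector, or 0 if the level is a
  root.\<close>

lemma linear_quotient: "linear_BK_tuple Q (\<lambda>i. proj ` A i) ({..<n} - K)"
proof -
	let ?J = "{..<n} - K"
	have Qe: "Q\<lparr>carrier := carrier Q\<rparr> = Q" by simp
	have "\<forall>i\<in>{..<n}. \<exists>t. t \<in> carrier M \<and> (\<forall>a\<in>A i. quotient_map (proj (a + t)) \<in> insert 0 (frag_of ` {..<m}))"
	proof
		fix i assume "i \<in> {..<n}"
		then have i: "i < n" by simp
		obtain a0 where a0: "a0 \<in> A i" using A_nonempty[OF i] by auto
		have "\<exists>u\<in>carrier M. \<forall>s\<in>nonroots. covec (Z s) u = (if \<theta> (i, a0) = s then 1 else 0)"
		proof (cases "\<theta> (i, a0) \<in> nonroots")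
			case False
			then show ?thesis by (intro bexI[OF _ M_closed(4)] ballI) (auto simp: covec_zero)
		qed (rule ex_unit)
		then obtain u where u: "u \<in> carrier M" "\<forall>s\<in>nonroots. covec (Z s) u = (if \<theta> (i, a0) = s then 1 else 0)" by (rule bexE)
		have tM: "u - a0 \<in> carrier M" by (rule M_closed(3)[OF u(1) A_in_M[OF i a0]])
		have "quotient_map (proj (a + (u - a0))) \<in> insert 0 (frag_of ` {..<m})" if a: "a \<in> A i" for a
		proof -
			have aM: "a + (u - a0) \<in> carrier M" by (rule M_closed(1)[OF A_in_M[OF i a] tM])
			have v: "levels (lvec (a + (u - a0))) s = (if s < m \<and> \<theta> (i, a) = level s then 1 else 0)" for s
			proof (cases "s < m")
				case True
				have "covec (Z (level s)) (a + (u - a0)) = covec (Z (level s)) u + covec (Z (level s)) (a - a0)"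
					unfolding covec_add covec_diff by simp
				also have "\<dots> = (if \<theta> (i, a) = level s then 1 else 0)"
					unfolding indicator_diff[OF i a a0] bspec[OF u(2) level_nonroots[OF True]] by (simp only: add_diff_eq add.commute add_diff_cancel_left')
				finally show ?thesis using True by (simp add: levels_def)
			qed (simp add: levels_def)
			show ?thesis
			proof (cases "\<theta> (i, a) \<in> nonroots")
				case True
				then obtain s0 where s0: "s0 < m" "\<theta> (i, a) = level s0"
					using bij_betw_imp_surj_on[OF level_bij] by (metis atLeastLessThan_iff imageE)
				have "quotient_map (proj (a + (u - a0))) = frag_of s0"
					by (rule quotient_map_eqI[OF aM], unfold v s0(2)) (use level_eq_iff[OF s0(1)] s0(1) in \<open>auto simp: lookup_single when_def\<close>)
				then show ?thesis using s0(1) by simp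
			next
				case False
				then have "\<not> (s < m \<and> \<theta> (i, a) = level s)" for s using level_nonroots by auto
				then have "quotient_map (proj (a + (u - a0))) = 0"
					by (intro quotient_map_eqI[OF aM]) (simp add: v)
				then show ?thesis by simp
			qed
		qed
		then show "\<exists>t. t \<in> carrier M \<and> (\<forall>a\<in>A i. quotient_map (proj (a + t)) \<in> insert 0 (frag_of ` {..<m}))"
			using tM by (intro exI[of _ "u - a0"] conjI ballI)
	qed
	from bchoice[OF this] obtain t where t: "\<forall>i\<in>{..<n}. t i \<in> carrier M \<and> (\<forall>a\<in>A i. quotient_map (proj (a + t i)) \<in> insert 0 (frag_of ` {..<m}))"
		by (elim exE)
	have "(\<forall>i\<in>?J. proj (t i) \<in> carrier Q) \<and> quotient_map \<in> iso Q (int_lattice (card ?J)) \<and>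
		(\<forall>i\<in>?J. \<forall>c\<in>proj ` A i. c \<otimes>\<^bsub>Q\<^esub> proj (t i) \<in> carrier Q \<and> quotient_map (c \<otimes>\<^bsub>Q\<^esub> proj (t i)) \<in> insert 0 (frag_of ` {..<card ?J}))"
	proof (intro conjI ballI)
		fix i assume "i \<in> ?J"
		then have i: "i < n" by simp
		then have ti: "t i \<in> carrier M" using t by simp
		then show "proj (t i) \<in> carrier Q" unfolding carrier_Q by (rule imageI)
		fix c assume "c \<in> proj ` A i"
		then obtain a where a: "a \<in> A i" "c = proj a" by (rule imageE)
		have e: "c \<otimes>\<^bsub>Q\<^esub> proj (t i) = proj (a + t i)" unfolding a(2) by (rule proj_add[OF A_in_M[OF i a(1)] ti])
		show "c \<otimes>\<^bsub>Q\<^esub> proj (t i) \<in> carrier Q" unfolding e carrier_Q by (rule imageI[OF M_closed(1)[OF A_in_M[OF i a(1)] ti]])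
		show "quotient_map (c \<otimes>\<^bsub>Q\<^esub> proj (t i)) \<in> insert 0 (frag_of ` {..<card ?J})"
			unfolding e m_eq[symmetric] using t i a(1) by (simp only: lessThan_iff)
	next
		show "quotient_map \<in> iso Q (int_lattice (card ?J))" unfolding m_eq[symmetric] by (rule quotient_map_iso)
	qed
	then show ?thesis unfolding linear_BK_tuple_def tuple_span_Q Qe using BK_quotient
		by (intro conjI exI[of _ "\<lambda>i. proj (t i)"] exI[of _ quotient_map]) simp_all
qed

end

lemma (in simple_finite_tuple) prelinear_iff_degenerate: "prelinear M A {..<n} \<longleftrightarrow> degenerate"
	unfolding prelinear_iff
proof
	assume degenerate
	from degenerate_level_sets[OF this] obtain \<theta> Z \<kappa> where
		ind: "\<forall>r. \<forall>i<n. \<forall>a\<in>A i. covec (Z r) a + \<kappa> r i = (if (\<theta> :: term_index => complex) (i, a) = r then 1 else 0)"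
		and ker: "\<forall>b\<in>cvec_space n. (\<forall>r\<in>\<theta> ` P. (\<Sum>j<n. Z r j * b j) = 0) --> b \<in> spanK"
		and van: "\<forall>r. \<forall>x\<in>spanK. (\<Sum>j<n. Z r j * x j) = 0" by (elim exE conjE)
	interpret level_sets n A \<theta> Z \<kappa> by unfold_locales (use ind ker van in simp_all)
	show "linear_BK_tuple Q (\<lambda>i. proj ` A i) ({..<n} - K)" by (rule linear_quotient)
qed (rule linear_imp_degenerate)

section \<open>Systems and discriminants\<close>

lemma wedge_permute:
	assumes f: "f permutes {..<k}"
	shows "wedge k (\<lambda>i. F (f i)) v = of_int (sign f) * wedge k F v"
proof -
	let ?S = "{p. p permutes {..<k}}"
	have "wedge k (\<lambda>i. F (f i)) v = (\<Sum>p\<in>?S. of_int (sign (p \<circ> f)) * (\<Prod>i<k. F (f i) (v ((p \<circ> f) i))))"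
		unfolding wedge_def by (rule sum_permutations_compose_right[OF f])
	also have "\<dots> = (\<Sum>p\<in>?S. of_int (sign f) * (of_int (sign p) * (\<Prod>i<k. F i (v (p i)))))"
	proof (rule sum.cong[OF refl])
		fix p assume "p \<in> ?S"
		then have p: "p permutes {..<k}" by simp
		have "permutation p" "permutation f" using p f by (auto intro: permutes_imp_permutation[OF finite_lessThan])
		then have s: "sign (p \<circ> f) = sign p * sign f" by (rule sign_compose)
		have "(\<Prod>i<k. F (f i) (v ((p \<circ> f) i))) = (\<Prod>i<k. (\<lambda>i. F i (v (p i))) (f i))" by simp
		also have "\<dots> = (\<Prod>i<k. F i (v (p i)))" by (rule prod.permute[OF f, unfolded comp_def, symmetric])
		finally show "of_int (sign (p \<circ> f)) * (\<Prod>i<k. F (f i) (v ((p \<circ> f) i))) = of_int (sign f) * (of_int (sign p) * (\<Prod>i<k. F i (v (p i))))"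
			unfolding s by (simp add: mult.left_commute)
	qed
	finally show ?thesis by (simp only: wedge_def sum_distrib_left)
qed

lemma wedge_alternating:
	assumes "i < k" "i' < k" "i \<noteq> i'" "F i = F i'"
	shows "wedge k F v = 0"
proof -
	have "F (Transposition.transpose i i' l) = F l" for l using assms(4) by (cases "l = i"; cases "l = i'") (simp_all add: Transposition.transpose_def)
	then have "wedge k F v = of_int (sign (Transposition.transpose i i')) * wedge k F v"
		using wedge_permute[of "Transposition.transpose i i'" k F v] assms(1,2) permutes_swap_id[of i "{..<k}" i'] by simp
	also have "sign (Transposition.transpose i i') = - 1" using assms(3) by (simp add: sign_swap_id)
	finally show ?thesis by simp
qed

lemma wedge_linear:
	assumes "r < k"
	shows "wedge k (F(r := (\<lambda>x. \<Sum>l\<in>L. c l * N l x))) v = (\<Sum>l\<in>L. c l * wedge k (F(r := N l)) v)"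
proof -
	have split: "(\<Prod>i<k. (F(r := g)) i (v (p i))) = g (v (p r)) * (\<Prod>i\<in>{..<k} - {r}. F i (v (p i)))" for g p
	proof -
		have "(\<Prod>i<k. (F(r := g)) i (v (p i))) = (F(r := g)) r (v (p r)) * (\<Prod>i\<in>{..<k} - {r}. (F(r := g)) i (v (p i)))"
			using assms by (intro prod.remove) simp_all
		also have "(\<Prod>i\<in>{..<k} - {r}. (F(r := g)) i (v (p i))) = (\<Prod>i\<in>{..<k} - {r}. F i (v (p i)))"
			by (rule prod.cong) auto
		finally show ?thesis by simp
	qed
	show ?thesis unfolding wedge_def split sum_distrib_left sum_distrib_right
		by (subst sum.swap) (intro sum.cong refl, simp only: mult.left_commute mult.assoc mult.commute)
qed

text \<open>Replacing row r by the vanishing combination gives 0, while the multilinear expansion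
  leaves only \<open>u r\<close> times the determinant, all other terms having two equal
  rows.\<close>

lemma wedge_zero_if_dependent:
	assumes "linearly_dependent_forms {..<k} F"
	shows "wedge k F v = 0"
proof -
	obtain u where u: "(\<exists>i\<in>{..<k}. u i \<noteq> 0) \<and> (\<forall>x. (\<Sum>i<k. u i * F i x) = 0)"
		using assms unfolding linearly_dependent_forms_def by (rule exE)
	obtain r where r: "r \<in> {..<k}" "u r \<noteq> 0" using conjunct1[OF u] by (rule bexE)
	have u0: "(\<Sum>i<k. u i * F i x) = 0" for x using u by simp
	have rk: "r < k" using r(1) by simp
	have "(\<Sum>i<k. u i * wedge k (F(r := F i)) v) = wedge k (F(r := (\<lambda>x. \<Sum>i<k. u i * F i x))) v"
		by (rule wedge_linear[OF rk, symmetric])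
	also have "\<dots> = wedge k (F(r := (\<lambda>x. 0))) v" by (simp only: u0)
	also have "\<dots> = 0" using wedge_linear[OF rk, where L = "{} :: nat set" and F = F and v = v] by simp
	also have "(\<Sum>i<k. u i * wedge k (F(r := F i)) v) = u r * wedge k F v"
	proof -
		have "u i * wedge k (F(r := F i)) v = (if i = r then u i * wedge k F v else 0)" if "i < k" for i
			using wedge_alternating[OF that rk, of "F(r := F i)" v] by (cases "i = r") simp_all
		then have "(\<Sum>i<k. u i * wedge k (F(r := F i)) v) = (\<Sum>i<k. if i = r then u i * wedge k F v else 0)"
			by (intro sum.cong refl) simp
		then show ?thesis using rk by simp
	qed
	finally show ?thesis using r(2) by simp
qed

lemma wedge_identity:
	assumes "\<And>i j. i < k ==> j < k ==> F i (v j) = (if i = j then 1 else 0)"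
	shows "wedge k F v = 1"
proof -
	let ?S = "{p. p permutes {..<k}}"
	have "(\<Prod>i<k. F i (v (p i))) = (if p = id then 1 else 0)" if p: "p \<in> ?S" for p
	proof (cases "p = id")
		case True
		then show ?thesis using assms by simp
	next
		case False
		then obtain i where i: "p i \<noteq> i" by (auto simp: fun_eq_iff)
		have "i < k" using i p by (metis mem_Collect_eq permutes_def lessThan_iff)
		moreover have "p i < k" using permutes_in_image[of p "{..<k}" i] p \<open>i < k\<close> by simp
		ultimately have "F i (v (p i)) = 0" using assms i by simp
		then have "(\<Prod>i<k. F i (v (p i))) = 0" using \<open>i < k\<close> by (intro prod_zero) auto
		then show ?thesis using False by simp
	qed
	then have "wedge k F v = (\<Sum>p\<in>?S. if p = id then of_int (sign p) else 0)" unfolding wedge_def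
	proof (intro sum.cong refl)
		fix p assume p: "p \<in> ?S"
		show "of_int (sign p) * (\<Prod>i<k. F i (v (p i))) = (if p = id then of_int (sign p) else 0)"
			if "\<And>p. p \<in> ?S ==> (\<Prod>i<k. F i (v (p i))) = (if p = id then 1 else 0)"
			unfolding that[OF p] by (cases "p = id") (simp_all only: refl if_True if_False mult_1_right mult_zero_right)
	qed
	also have "\<dots> = (if id \<in> ?S then of_int (sign (id :: nat => nat)) else 0)"
		by (rule sum.delta[OF finite_permutations[OF finite_lessThan]])
	also have "\<dots> = (1::complex)" by (simp add: permutes_id sign_id)
	finally show ?thesis .
qed

text \<open>If the rows of the matrix were independent, the unit vectors would be combinations of them,
	and expanding the determinant of the unit matrix multilinearly would give zero.\<close>

lemma dependent_if_wedge_zero: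
	assumes "wedge k F v = 0"
	shows "\<exists>u. (\<exists>i<k. u i \<noteq> 0) \<and> (\<forall>j<k. (\<Sum>i<k. u i * F i (v j)) = 0)"
proof (rule ccontr)
	assume contra: "\<not> ?thesis"
	have ind: "u i = 0" if "\<And>j. j < k ==> (\<Sum>i<k. u i * F i (v j)) = 0" "i < k" for u i
		using contra that by blast
	\<comment> \<open>Independent rows of a square matrix have independent columns: by counting, some
	  nonzero u kills all columns but j; a column dependence with nonzero coefficient at j makes u kill
	  column j too.\<close>
	have cols: "y j = 0" if y: "\<And>i. i < k ==> (\<Sum>j<k. y j * F i (v j)) = 0" and j: "j < k" for y j
	proof (rule ccontr)
		assume "y j \<noteq> 0"
		have "\<exists>u. (\<exists>i\<in>{..<k}. u i \<noteq> 0) \<and> (\<forall>l\<in>{..<k} - {j}. (\<Sum>i\<in>{..<k}. F i (v l) * u i) = 0)"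
			by (rule homogeneous_system_nontrivial) (use j in simp_all)
		then obtain u where "(\<exists>i\<in>{..<k}. u i \<noteq> 0) \<and> (\<forall>l\<in>{..<k} - {j}. (\<Sum>i\<in>{..<k}. F i (v l) * u i) = 0)"
			by (rule exE)
		then have u: "\<exists>i\<in>{..<k}. u i \<noteq> 0" and ul: "\<And>l. l \<in> {..<k} - {j} ==> (\<Sum>i<k. u i * F i (v l)) = 0"
			by (simp_all add: mult.commute)
		have "0 = (\<Sum>i<k. u i * (\<Sum>l<k. y l * F i (v l)))" using y by simp
		also have "\<dots> = (\<Sum>l<k. y l * (\<Sum>i<k. u i * F i (v l)))"
			unfolding sum_distrib_left by (subst sum.swap) (simp only: mult.left_commute)
		also have "\<dots> = y j * (\<Sum>i<k. u i * F i (v j)) + (\<Sum>l\<in>{..<k} - {j}. y l * (\<Sum>i<k. u i * F i (v l)))"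
			using j by (intro sum.remove) simp_all
		also have "(\<Sum>l\<in>{..<k} - {j}. y l * (\<Sum>i<k. u i * F i (v l))) = 0" by (rule sum.neutral) (simp add: ul)
		finally have uj: "(\<Sum>i<k. u i * F i (v j)) = 0" using \<open>y j \<noteq> 0\<close> by simp
		have "(\<Sum>i<k. u i * F i (v l)) = 0" if "l < k" for l
			using uj ul[of l] that by (cases "l = j") simp_all
		then have "\<forall>i<k. u i = 0" using ind by blast
		then show False using u by auto
	qed
	have "\<exists>c. \<forall>r\<in>{..<k}. \<forall>j\<in>{..<k}. (if j = r then 1 else 0) = (\<Sum>i\<in>{..<k}. c r i * F i (v j))"
		by (rule dual_coefficients, simp, simp) (rule cols, simp_all)
	then obtain c where c: "\<forall>r\<in>{..<k}. \<forall>j\<in>{..<k}. (if j = r then 1 else 0) = (\<Sum>i\<in>{..<k}. c r i * F i (v j))" by (rule exE)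
	define e where "e r x = (\<Sum>i<k. c r i * F i x)" for r x
	have zero: "wedge k (\<lambda>i. F (f i)) v = 0" if f: "f ` {..<k} \<subseteq> {..<k}" for f
	proof (cases "inj_on f {..<k}")
		case True
		define g where "g i = (if i < k then f i else i)" for i
		have gp: "g permutes {..<k}"
		proof (rule bij_imp_permutes)
			have "bij_betw f {..<k} {..<k}" using True f by (simp add: bij_betw_def endo_inj_surj)
			then show "bij_betw g {..<k} {..<k}" by (rule bij_betw_cong[THEN iffD1, rotated]) (simp add: g_def)
		qed (simp add: g_def)
		have "wedge k (\<lambda>i. F (f i)) v = wedge k (\<lambda>i. F (g i)) v"
			unfolding wedge_def by (intro sum.cong refl arg_cong2[where f = "(*)"] prod.cong) (simp add: g_def)
		then show ?thesis unfolding wedge_permute[OF gp] assms by simp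
	next
		case False
		then obtain i i' where "i < k" "i' < k" "i \<noteq> i'" "f i = f i'" by (auto simp: inj_on_def)
		then show ?thesis by (intro wedge_alternating[of i k i']) simp_all
	qed
	\<comment> \<open>Rows are replaced by unit rows one at a time; the expansion turns the remaining
	  rows into F (f i) with arbitrary indices, whence the general f.\<close>
	have "wedge k (\<lambda>i. if i < r then e i else F (f i)) v = 0" if "r \<le> k" "f ` {..<k} \<subseteq> {..<k}" for r f
		using that
	proof (induction r arbitrary: f)
		case 0
		then show ?case using zero by simp
	next
		case (Suc r)
		let ?\<rho> = "\<lambda>i. if i < r then e i else F (f i)"
		have rk: "r < k" using Suc.prems by simp
		have "(\<lambda>i. if i < Suc r then e i else F (f i)) = ?\<rho>(r := (\<lambda>x. \<Sum>i<k. c r i * F i x))"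
			by (rule ext) (simp add: e_def[abs_def])
		then have "wedge k (\<lambda>i. if i < Suc r then e i else F (f i)) v = (\<Sum>i<k. c r i * wedge k (?\<rho>(r := F i)) v)"
			by (simp only: wedge_linear[OF rk])
		also have "\<dots> = 0"
		proof (rule sum.neutral, rule ballI)
			fix l assume l: "l \<in> {..<k}"
			have "?\<rho>(r := F l) = (\<lambda>i. if i < r then e i else F ((f(r := l)) i))" by (rule ext) simp
			moreover have "(f(r := l)) ` {..<k} \<subseteq> {..<k}" using Suc.prems(2) l by auto
			ultimately show "c r l * wedge k (?\<rho>(r := F l)) v = 0" using Suc.IH[of "f(r := l)"] Suc.prems(1) by simp
		qed
		finally show ?case .
	qed
	from this[of k "\<lambda>i. i"] have "wedge k (\<lambda>i. if i < k then e i else F i) v = 0" by simp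
	moreover have "wedge k (\<lambda>i. if i < k then e i else F i) v = 1"
	proof (rule wedge_identity)
		fix i j assume "i < k" "j < k"
		then have "(if j = i then 1 else 0) = e i (v j)" using c unfolding e_def by simp
		then show "(if i < k then e i else F i) (v j) = (if i = j then 1 else 0)" using \<open>i < k\<close> by auto
	qed
	ultimately show False by simp
qed

section \<open>Characters and differentials in logarithmic coordinates\<close>

lemma character_derivative:
	assumes x: "x \<in> torus n" and j: "j < n"
	shows "((\<lambda>z. character n a (x(j := z))) has_field_derivative
		character n a x * of_int (coord a j) / x j) (at (x j))"
proof -
	have xj: "x j \<noteq> 0" using x j by (auto simp: torus_def)
	let ?c = "\<Prod>i\<in>{..<n} - {j}. x i powi coord a i"
	have split: "character n a (x(j := z)) = z powi coord a j * ?c" for z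
	proof -
		have "character n a (x(j := z)) = (x(j := z)) j powi coord a j * (\<Prod>i\<in>{..<n} - {j}. (x(j := z)) i powi coord a i)"
			unfolding character_def using j by (intro prod.remove) simp_all
		also have "(\<Prod>i\<in>{..<n} - {j}. (x(j := z)) i powi coord a i) = ?c" by (rule prod.cong) auto
		finally show ?thesis by (simp only: fun_upd_same)
	qed
	have "((\<lambda>z. z powi coord a j * ?c) has_field_derivative
			of_int (coord a j) * x j powi (coord a j - 1) * 1 * ?c) (at (x j))"
		using xj by (intro DERIV_cmult_right DERIV_power_int DERIV_ident) simp
	moreover have "of_int (coord a j) * x j powi (coord a j - 1) * 1 * ?c
			= character n a x * of_int (coord a j) / x j"
		using split[of "x j"] xj by (simp add: power_int_diff)
	ultimately show ?thesis unfolding split by (simp only:)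
qed

lemma differential_laurent:
	assumes x: "x \<in> torus n"
	shows "differential n (laurent n S c) x v =
		(\<Sum>j<n. (\<Sum>a\<in>S. c a * character n a x * of_int (coord a j)) * (v j / x j))"
	unfolding differential_def
proof (rule sum.cong[OF refl])
	fix j assume "j \<in> {..<n}"
	then have j: "j < n" by simp
	have "((\<lambda>z. laurent n S c (x(j := z))) has_field_derivative
			(\<Sum>a\<in>S. c a * (character n a x * of_int (coord a j) / x j))) (at (x j))"
		unfolding laurent_def by (intro DERIV_sum DERIV_cmult character_derivative[OF x j])
	from DERIV_imp_deriv[OF this]
	show "deriv (\<lambda>z. laurent n S c (x(j := z))) (x j) * v j
			= (\<Sum>a\<in>S. c a * character n a x * of_int (coord a j)) * (v j / x j)"
		by (simp add: sum_distrib_right sum_divide_distrib mult.assoc)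
qed

lemma character_exp: "character n a (restrict (\<lambda>j. exp (\<zeta> j)) {..<n}) = exp (\<Sum>j<n. \<zeta> j * of_int (coord a j))"
proof -
	have "exp (\<zeta> j) powi k = exp (\<zeta> j * of_int k)" for j k
	proof (cases k)
		case (nonneg l)
		then show ?thesis by (simp add: exp_of_nat_mult[symmetric] mult.commute)
	next
		case (neg l)
		have "exp (\<zeta> j) powi - int (Suc l) = inverse (exp (\<zeta> j) ^ Suc l)" by (simp only: power_int_minus power_int_of_nat)
		also have "\<dots> = exp (- (of_nat (Suc l) * \<zeta> j))" by (simp only: exp_of_nat_mult[symmetric] exp_minus)
		finally show ?thesis unfolding neg by (simp only: of_int_minus of_int_of_nat_eq mult_minus_right mult.commute)
	qed
	then show ?thesis unfolding character_def exp_sum[OF finite_lessThan] by (intro prod.cong refl) simp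
qed

lemma exp_torus: "restrict (\<lambda>j. exp (\<zeta> j)) {..<n} \<in> torus n" by (simp add: torus_def)

lemma torus_exp: "x \<in> torus n ==> \<exists>\<zeta>. x = restrict (\<lambda>j. exp (\<zeta> j)) {..<n}"
proof (rule exI[of _ "\<lambda>j. Ln (x j)"])
	assume x: "x \<in> torus n"
	show "x = restrict (\<lambda>j. exp (Ln (x j))) {..<n}"
	proof
		fix j
		show "x j = restrict (\<lambda>j. exp (Ln (x j))) {..<n} j"
			using PiE_mem[OF x[unfolded torus_def], of j] PiE_arb[OF x[unfolded torus_def], of j] by (cases "j < n") simp_all
	qed
qed

text \<open>\<Phi> has a polynomial left inverse \<Psi>, so polynomials vanishing on either set can
  be pulled back to polynomials vanishing on the other.\<close>

lemma zariski_closure_transport: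
	assumes X: "X \<subseteq> coeff_space J" and c: "c \<in> coeff_space J"
		and \<Phi>: "\<And>b. (\<lambda>c. \<Phi> c b) \<in> polys" "\<And>c. c \<in> coeff_space J ==> \<Phi> c \<in> coeff_space J'"
		and \<Psi>: "\<And>p. (\<lambda>g. \<Psi> g p) \<in> polys" "\<And>c. c \<in> coeff_space J ==> \<Psi> (\<Phi> c) = c"
	shows "\<Phi> c \<in> (zariski J') closure_of (\<Phi> ` X) \<longleftrightarrow> c \<in> (zariski J) closure_of X"
proof -
	have \<Phi>X: "\<Phi> ` X \<subseteq> coeff_space J'" using X \<Phi>(2) by (intro image_subsetI) auto
	show ?thesis unfolding in_zariski_closure_iff[OF X] in_zariski_closure_iff[OF \<Phi>X]
	proof (intro iffI conjI ballI impI)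
		assume L: "\<Phi> c \<in> coeff_space J' \<and> (\<forall>p\<in>polynomial_functions. (\<forall>x\<in>\<Phi> ` X. p x = 0) --> p (\<Phi> c) = 0)"
		fix p assume p: "p \<in> polys" "\<forall>x\<in>X. p x = 0"
		have a: "(\<lambda>g. p (\<Psi> g)) \<in> polys" by (rule polynomial_functions_compose[OF p(1) \<Psi>(1)])
		have b: "\<forall>x\<in>\<Phi> ` X. p (\<Psi> x) = 0" using p(2) \<Psi>(2) X by (intro ballI) (elim imageE, auto)
		have "p (\<Psi> (\<Phi> c)) = 0" by (rule mp[OF bspec[OF conjunct2[OF L] a] b])
		then show "p c = 0" by (simp only: \<Psi>(2)[OF c])
	next
		assume R: "c \<in> coeff_space J \<and> (\<forall>p\<in>polynomial_functions. (\<forall>x\<in>X. p x = 0) --> p c = 0)"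
		fix p assume p: "p \<in> polys" "\<forall>x\<in>\<Phi> ` X. p x = 0"
		have a: "(\<lambda>c. p (\<Phi> c)) \<in> polys" by (rule polynomial_functions_compose[OF p(1) \<Phi>(1)])
		have b: "\<forall>x\<in>X. p (\<Phi> x) = 0" using p(2) by (intro ballI) (erule bspec, rule imageI)
		show "p (\<Phi> c) = 0" by (rule mp[OF bspec[OF conjunct2[OF R] a] b])
	qed (simp_all only: c \<Phi>(2))
qed

lemma sum_lessThan_add: "(\<Sum>j<n + m. f j) = (\<Sum>j<n. f j) + (\<Sum>l<m. f (n + l))"
	for f :: "nat => 'a::comm_monoid_add" by (induction m) (simp_all add: add.assoc)

section \<open>Multiple roots and proper relations\<close>

context finite_tuple
begin

lemma system_poly_exp:
	"system_poly n A c i (restrict (\<lambda>j. exp (\<zeta> j)) {..<n}) = (\<Sum>a\<in>A i. c (i, a) * exp (covec \<zeta> a))"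
	by (simp only: system_poly_def laurent_def character_exp cvec_apply)

lemma differential_system:
	assumes x: "x = restrict (\<lambda>j. exp (\<zeta> j)) {..<n}"
	shows "differential n (system_poly n A c i) x v
		= (\<Sum>j<n. moment (\<lambda>p. c p * exp (covec \<zeta> (snd p))) i j * (v j / x j))"
proof -
	have "x \<in> torus n" unfolding x by (rule exp_torus)
	from differential_laurent[OF this, of "A i" "\<lambda>a. c (i, a)" v]
	show ?thesis unfolding system_poly_def moment_def snd_conv cvec_apply by (simp only: x character_exp)
qed

text \<open>The tangent vectors x_l e_l extract the coordinates of the moments of the terms, so the
  differentials and the moments have the same dependences.\<close>

lemma dependent_system_iff:
	assumes x: "x = restrict (\<lambda>j. exp (\<zeta> j)) {..<n}" and u: "u = (\<lambda>p. c p * exp (covec \<zeta> (snd p)))"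
	shows "linearly_dependent_forms S (\<lambda>i. differential n (system_poly n A c i) x)
		\<longleftrightarrow> (\<exists>\<mu>. (\<exists>i\<in>S. \<mu> i \<noteq> 0) \<and> (\<forall>j<n. (\<Sum>i\<in>S. \<mu> i * moment u i j) = 0))"
proof -
	have d: "differential n (system_poly n A c i) x v = (\<Sum>j<n. moment u i j * (v j / x j))" for i v
		unfolding u by (rule differential_system[OF x])
	have x0: "x j \<noteq> 0" if "j < n" for j using that by (simp add: x)
	have unit: "(\<Sum>j<n. moment u i j * ((if j = l then x l else 0) / x j)) = moment u i l" if "l < n" for i l
	proof -
		have "(\<Sum>j<n. moment u i j * ((if j = l then x l else 0) / x j)) = (\<Sum>j<n. if j = l then moment u i j else 0)"
			using x0[OF that] by (intro sum.cong refl) simp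
		then show ?thesis using that by simp
	qed
	have swap: "(\<Sum>i\<in>S. \<mu> i * (\<Sum>j<n. moment u i j * (v j / x j))) = (\<Sum>j<n. (\<Sum>i\<in>S. \<mu> i * moment u i j) * (v j / x j))" for \<mu> v
		unfolding sum_distrib_left sum_distrib_right by (subst sum.swap) (simp only: mult.assoc)
	have "(\<forall>v. (\<Sum>i\<in>S. \<mu> i * (\<Sum>j<n. moment u i j * (v j / x j))) = 0) \<longleftrightarrow> (\<forall>j<n. (\<Sum>i\<in>S. \<mu> i * moment u i j) = 0)" for \<mu>
	proof (intro iffI allI impI)
		fix l assume z: "\<forall>v. (\<Sum>i\<in>S. \<mu> i * (\<Sum>j<n. moment u i j * (v j / x j))) = 0" and l: "l < n"
		from z[rule_format, of "\<lambda>j. if j = l then x l else 0"]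
		show "(\<Sum>i\<in>S. \<mu> i * moment u i l) = 0" by (simp only: unit[OF l])
	next
		fix v assume "\<forall>j<n. (\<Sum>i\<in>S. \<mu> i * moment u i j) = 0"
		then show "(\<Sum>i\<in>S. \<mu> i * (\<Sum>j<n. moment u i j * (v j / x j))) = 0" unfolding swap by (intro sum.neutral) simp
	qed
	then show ?thesis unfolding linearly_dependent_forms_def d by simp
qed

text \<open>In a dependence among the differentials all coefficients are nonzero, by non-degeneracy,
  hence of the form exp \<kappa>; scaling the blocks by them makes the total moment zero.
  Conversely, a dependence among fewer differentials would, after the scaling is undone, be one
  among fewer moments of a proper relation.\<close>

lemma multiple_root_iff:
	assumes n: "0 < n" and c: "c \<in> coeff_space P" and x: "x = restrict (\<lambda>j. exp (\<zeta> j)) {..<n}"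
	shows "nondegenerate_multiple_root n n A c x \<longleftrightarrow> (\<exists>\<kappa>. (\<lambda>p. c p * exp (affine_form \<zeta> \<kappa> p)) \<in> proper_relations)"
proof -
	let ?w = "\<lambda>\<kappa> p. c p * exp (affine_form \<zeta> \<kappa> p)"
	define u where "u = (\<lambda>p. c p * exp (covec \<zeta> (snd p)))"
	let ?W = "\<lambda>i. differential n (system_poly n A c i) x"
	note dep = dependent_system_iff[OF x u_def]
	have xt: "x \<in> torus n" unfolding x by (rule exp_torus)
	have val: "system_poly n A c i x = (\<Sum>a\<in>A i. u (i, a))" for i
		unfolding x system_poly_exp u_def snd_conv ..
	have w: "c p * exp (affine_form \<zeta> \<kappa> p) = exp (\<kappa> (fst p)) * u p" for \<kappa> p
		by (simp add: u_def affine_form_def exp_add mult.left_commute)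
	have mw: "moment (?w \<kappa>) i j = exp (\<kappa> i) * moment u i j" for \<kappa> i j
		unfolding moment_def w sum_distrib_left fst_conv by (simp only: mult.assoc)
	have sw: "(\<Sum>a\<in>A i. c (i, a) * exp (affine_form \<zeta> \<kappa> (i, a))) = exp (\<kappa> i) * (\<Sum>a\<in>A i. u (i, a))" for \<kappa> i
		unfolding w sum_distrib_left fst_conv ..
	show ?thesis
	proof
		assume "nondegenerate_multiple_root n n A c x"
		then have deg: "degenerate_root n n A c x" and nd: "\<forall>S. S \<subset> {..<n} --> \<not> linearly_dependent_forms S ?W"
			unfolding nondegenerate_multiple_root_def by (rule conjunct1, rule conjunct2)
		have u0: "(\<Sum>a\<in>A i. u (i, a)) = 0" if "i < n" for i
			using deg that val unfolding degenerate_root_def by simp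
		have "wedge n ?W (\<lambda>l j. if j = l then x l else 0) = 0" using deg unfolding degenerate_root_def by simp
		from dependent_if_wedge_zero[OF this] obtain \<mu> where
			\<mu>: "(\<exists>i<n. \<mu> i \<noteq> 0) \<and> (\<forall>l<n. (\<Sum>i<n. \<mu> i * ?W i (\<lambda>j. if j = l then x l else 0)) = 0)" by (rule exE)
		have W: "?W i (\<lambda>j. if j = l then x l else 0) = moment u i l" if l: "l < n" for i l
		proof -
			have "?W i (\<lambda>j. if j = l then x l else 0) = (\<Sum>j<n. moment u i j * ((if j = l then x l else 0) / x j))"
				unfolding u_def by (rule differential_system[OF x])
			also have "\<dots> = (\<Sum>j<n. if j = l then moment u i j else 0)"
				by (intro sum.cong refl) (simp add: x)
			finally show ?thesis using l by simp
		qed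
		have \<mu>0: "(\<Sum>i<n. \<mu> i * moment u i l) = 0" if "l < n" for l
			using conjunct2[OF \<mu>, THEN spec, THEN mp, OF that] unfolding W[OF that] .
		have \<mu>nz: "\<mu> i \<noteq> 0" if i: "i < n" for i
		proof
			assume z: "\<mu> i = 0"
			let ?S = "{i. i < n \<and> \<mu> i \<noteq> 0}"
			have "?S \<subset> {..<n}" using i z by auto
			moreover have "linearly_dependent_forms ?S ?W" unfolding dep
			proof (rule exI[of _ \<mu>], intro conjI allI impI)
				show "\<exists>i\<in>?S. \<mu> i \<noteq> 0" using conjunct1[OF \<mu>] by auto
				fix l assume "l < n"
				have "(\<Sum>i\<in>?S. \<mu> i * moment u i l) = (\<Sum>i<n. \<mu> i * moment u i l)"
					by (rule sum.mono_neutral_left) auto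
				then show "(\<Sum>i\<in>?S. \<mu> i * moment u i l) = 0" by (simp only: \<mu>0[OF \<open>l < n\<close>])
			qed
			ultimately show False using nd by blast
		qed
		define \<kappa> where "\<kappa> i = Ln (\<mu> i)" for i
		have e: "exp (\<kappa> i) = \<mu> i" if "i < n" for i using \<mu>nz[OF that] by (simp add: \<kappa>_def exp_Ln)
		have rel: "?w \<kappa> \<in> relations" unfolding relations_def
		proof (intro CollectI conjI allI impI)
			show "?w \<kappa> \<in> coeff_space P" using c by (simp add: coeff_space_def)
			show "(\<Sum>a\<in>A i. c (i, a) * exp (affine_form \<zeta> \<kappa> (i, a))) = 0" if "i < n" for i
				unfolding sw u0[OF that] by simp
			show "(\<Sum>i<n. moment (?w \<kappa>) i j) = 0" if "j < n" for j
			proof -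
				have "(\<Sum>i<n. moment (?w \<kappa>) i j) = (\<Sum>i<n. \<mu> i * moment u i j)"
					unfolding mw by (intro sum.cong refl) (simp add: e)
				then show ?thesis by (simp only: \<mu>0[OF that])
			qed
		qed
		have "indep_family UNIV {1..<n} (moment (?w \<kappa>))"
		proof (rule indep_familyI)
			fix y i assume y: "\<And>j. j \<in> UNIV ==> (\<Sum>i\<in>{1..<n}. y i * moment (?w \<kappa>) i j) = 0"
				and i: "i \<in> {1..<n}"
			have nd1: "\<not> linearly_dependent_forms {1..<n} ?W" by (rule nd[rule_format, OF tail_psubset[OF n]])
			have z: "(\<Sum>i\<in>{1..<n}. y i * exp (\<kappa> i) * moment u i j) = 0" for j
				using y[of j] unfolding mw by (simp only: mult.assoc UNIV_I simp_thms)
			have "\<not> (\<exists>i\<in>{1..<n}. y i * exp (\<kappa> i) \<noteq> 0)"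
			proof
				assume ex: "\<exists>i\<in>{1..<n}. y i * exp (\<kappa> i) \<noteq> 0"
				have "linearly_dependent_forms {1..<n} ?W"
					unfolding dep by (rule exI[of _ "\<lambda>i. y i * exp (\<kappa> i)"], rule conjI[OF ex], intro allI impI) (rule z)
				then show False using nd1 by (rule notE[rotated])
			qed
			then show "y i = 0" using i by simp
		qed
		then have "?w \<kappa> \<in> proper_relations" by (rule proper_relationsI[OF rel])
		then show "\<exists>\<kappa>. ?w \<kappa> \<in> proper_relations" by (rule exI[of _ \<kappa>])
	next
		assume "\<exists>\<kappa>. ?w \<kappa> \<in> proper_relations"
		then obtain \<kappa> where pr: "?w \<kappa> \<in> proper_relations" by (rule exE)
		then have rel: "?w \<kappa> \<in> relations" by (simp add: proper_relations_def)
		have "(\<Sum>a\<in>A i. u (i, a)) = 0" if "i < n" for i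
			using rel that sw[of i \<kappa>] by (simp add: relations_def)
		moreover have "linearly_dependent_forms {..<n} ?W" unfolding dep
		proof (rule exI[of _ "\<lambda>i. exp (\<kappa> i)"], intro conjI allI impI)
			show "\<exists>i\<in>{..<n}. exp (\<kappa> i) \<noteq> 0" using n by auto
			show "(\<Sum>i<n. exp (\<kappa> i) * moment u i j) = 0" if "j < n" for j
				unfolding mw[symmetric] using rel that by (simp add: relations_def)
		qed
		then have "\<forall>v. wedge n ?W v = 0" by (intro allI wedge_zero_if_dependent)
		ultimately have "degenerate_root n n A c x" unfolding degenerate_root_def using xt val by simp
		moreover have "\<not> linearly_dependent_forms S ?W" if S: "S \<subset> {..<n}" for S
		proof
			assume "linearly_dependent_forms S ?W"
			then obtain \<mu> where \<mu>: "(\<exists>i\<in>S. \<mu> i \<noteq> 0) \<and> (\<forall>j<n. (\<Sum>i\<in>S. \<mu> i * moment u i j) = 0)"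
				unfolding dep by (rule exE)
			have ind: "indep_family UNIV S (moment (?w \<kappa>))" by (rule proper_relations_indep[OF pr S])
			have "\<mu> i * exp (- \<kappa> i) = 0" if i: "i \<in> S" for i
			proof (rule indep_familyD[OF ind _ i, where u = "\<lambda>i. \<mu> i * exp (- \<kappa> i)"])
				fix j
				have "(\<Sum>i\<in>S. \<mu> i * exp (- \<kappa> i) * moment (?w \<kappa>) i j) = (\<Sum>i\<in>S. \<mu> i * moment u i j)"
					unfolding mw by (intro sum.cong refl) (simp add: exp_minus)
				also have "\<dots> = 0"
				proof (cases "j < n")
					case True
					then show ?thesis using conjunct2[OF \<mu>] by simp
				next
					case False
					have "moment u i j = 0" if "i \<in> S" for i
						unfolding moment_def using that S False by (intro sum.neutral) (auto simp: cvec_apply lookup_A)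
					then show ?thesis by (intro sum.neutral) simp
				qed
				finally show "(\<Sum>i\<in>S. \<mu> i * exp (- \<kappa> i) * moment (?w \<kappa>) i j) = 0" .
			qed
			then show False using conjunct1[OF \<mu>] by simp
		qed
		ultimately show "nondegenerate_multiple_root n n A c x" unfolding nondegenerate_multiple_root_def by blast
	qed
qed

lemma multiple_root_systems:
	assumes n: "0 < n"
	shows "{c \<in> coeff_space P. \<exists>x. nondegenerate_multiple_root n n A c x} = mix_points"
proof (intro equalityI subsetI)
	fix c assume "c \<in> {c \<in> coeff_space P. \<exists>x. nondegenerate_multiple_root n n A c x}"
	then obtain x where c: "c \<in> coeff_space P" and x: "nondegenerate_multiple_root n n A c x" by (elim CollectE exE conjE)
	have "x \<in> torus n" using x by (simp add: nondegenerate_multiple_root_def degenerate_root_def)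
	from torus_exp[OF this] obtain \<zeta> where \<zeta>: "x = restrict (\<lambda>j. exp (\<zeta> j)) {..<n}" by (rule exE)
	obtain \<kappa> where w: "(\<lambda>p. c p * exp (affine_form \<zeta> \<kappa> p)) \<in> proper_relations"
		using x unfolding multiple_root_iff[OF n c \<zeta>] by (rule exE)
	have "c = horn (\<lambda>p. c p * exp (affine_form \<zeta> \<kappa> p)) \<zeta> \<kappa>" by (rule ext) (simp add: horn_def exp_minus)
	then show "c \<in> mix_points" unfolding mix_points_def using w by (intro CollectI exI conjI)
next
	fix c assume "c \<in> mix_points"
	then obtain w \<zeta> \<kappa> where w: "w \<in> proper_relations" and cw: "c = horn w \<zeta> \<kappa>"
		unfolding mix_points_def by (elim CollectE exE conjE)
	have c: "c \<in> coeff_space P" unfolding cw using w by (intro horn_coeff_space) (simp add: proper_relations_def)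
	have "(\<lambda>p. c p * exp (affine_form \<zeta> \<kappa> p)) = w" by (rule ext) (simp add: cw horn_def exp_minus)
	then have "nondegenerate_multiple_root n n A c (restrict (\<lambda>j. exp (\<zeta> j)) {..<n})"
		unfolding multiple_root_iff[OF n c refl] using w by (intro exI[of _ \<kappa>]) simp
	then show "c \<in> {c \<in> coeff_space P. \<exists>x. nondegenerate_multiple_root n n A c x}" using c by (intro CollectI conjI exI)
qed

section \<open>The Cayley polynomial and its singular points\<close>

definition cayley_exponent :: "term_index => nat \<Rightarrow>\<^sub>0 int" where
	"cayley_exponent p = snd p + frag_of (n + fst p)"

lemma lookup_cayley_exponent:
	assumes "p \<in> P"
	shows "j < n ==> coord (cayley_exponent p) j = coord (snd p) j"
		and "coord (cayley_exponent p) (n + l) = (if fst p = l then 1 else 0)"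
proof -
	obtain i a where p: "p = (i, a)" by (cases p)
	have ia: "i < n" "a \<in> A i" using assms by (simp_all add: p mem_P_iff)
	show "j < n ==> coord (cayley_exponent p) j = coord (snd p) j"
		by (simp add: cayley_exponent_def lookup_add lookup_single when_def)
	show "coord (cayley_exponent p) (n + l) = (if fst p = l then 1 else 0)"
		using lookup_A[OF ia, of "n + l"] by (simp add: p cayley_exponent_def lookup_add lookup_single when_def)
qed

lemma cayley_exponent_inj: "inj_on cayley_exponent P"
proof (rule inj_onI)
	fix p q assume p: "p \<in> P" and q: "q \<in> P" and e: "cayley_exponent p = cayley_exponent q"
	have "(if fst p = fst p then 1 else 0 :: int) = (if fst q = fst p then 1 else 0)"
		unfolding lookup_cayley_exponent(2)[OF p, symmetric] lookup_cayley_exponent(2)[OF q, symmetric] e ..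
	then have f: "fst q = fst p" by (simp split: if_splits)
	then have "snd p = snd q" using e by (simp add: cayley_exponent_def)
	then show "p = q" using f by (simp add: prod_eq_iff)
qed

lemma cayley_set_eq: "cayley_set n n A = cayley_exponent ` P"
	unfolding cayley_set_def system_index_def cayley_exponent_def by force

lemma cayley_poly_exponent: "p \<in> P ==> cayley_poly n n A c (cayley_exponent p) = c p"
proof -
	assume p: "p \<in> P"
	have "cayley_poly n n A c (cayley_exponent p) = (\<Sum>q\<in>P. if cayley_exponent p = cayley_exponent q then c q else 0)"
		unfolding cayley_poly_def sum_P cayley_exponent_def[of "(_, _)"] by simp
	also have "\<dots> = (\<Sum>q\<in>P. if q = p then c q else 0)"
		by (intro sum.cong refl) (use inj_on_eq_iff[OF cayley_exponent_inj p] in auto)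
	also have "\<dots> = c p" using p by simp
	finally show ?thesis .
qed

lemma cayley_poly_coeff_space: "cayley_poly n n A c \<in> coeff_space (cayley_set n n A)"
proof -
	have "cayley_poly n n A c b = 0" if "b \<notin> cayley_exponent ` P" for b
	proof -
		have "cayley_poly n n A c b = (\<Sum>q\<in>P. if b = cayley_exponent q then c q else 0)"
			unfolding cayley_poly_def sum_P by (simp add: cayley_exponent_def)
		also have "\<dots> = 0" using that by (intro sum.neutral) auto
		finally show ?thesis .
	qed
	then show ?thesis unfolding cayley_set_eq coeff_space_def by simp
qed

definition cayley_pullback :: "((nat \<Rightarrow>\<^sub>0 int) => complex) => term_index => complex" where
	"cayley_pullback g p = (if p \<in> P then g (cayley_exponent p) else 0)"

lemma cayley_pullback_poly: "c \<in> coeff_space P ==> cayley_pullback (cayley_poly n n A c) = c"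
	by (rule ext) (auto simp: cayley_pullback_def cayley_poly_exponent coeff_space_def)

lemma cayley_poly_pullback:
	assumes "g \<in> coeff_space (cayley_set n n A)"
	shows "cayley_poly n n A (cayley_pullback g) = g"
proof
	fix b
	show "cayley_poly n n A (cayley_pullback g) b = g b"
	proof (cases "b \<in> cayley_exponent ` P")
		case True
		then obtain p where p: "p \<in> P" "b = cayley_exponent p" by auto
		then show ?thesis by (simp add: cayley_poly_exponent cayley_pullback_def)
	next
		case False
		then have "b \<notin> cayley_set n n A" by (simp add: cayley_set_eq)
		then show ?thesis using assms cayley_poly_coeff_space[of "cayley_pullback g"] by (simp add: coeff_space_def)
	qed
qed

abbreviation cayley_singular :: "((nat \<Rightarrow>\<^sub>0 int) => complex) => (nat => complex) => bool" where
	"cayley_singular g y \<equiv> laurent (n + n) (cayley_set n n A) g y = 0 \<and>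
		(\<forall>v. differential (n + n) (laurent (n + n) (cayley_set n n A) g) y v = 0)"

text \<open>In logarithmic coordinates the first n partial derivatives of the Cayley polynomial are
  the coordinates of the total moment of its terms, and the last n are their block sums.\<close>

lemma cayley_singular_iff:
	assumes c: "c \<in> coeff_space P" and y: "y = restrict (\<lambda>j. exp (Z j)) {..<n + n}"
	shows "cayley_singular (cayley_poly n n A c) y
		\<longleftrightarrow> (\<lambda>p. c p * exp (affine_form Z (\<lambda>i. Z (n + i)) p)) \<in> relations"
proof -
	let ?e = "\<lambda>p. exp (affine_form Z (\<lambda>i. Z (n + i)) p)"
	define u where "u = (\<lambda>p. c p * ?e p)"
	let ?s = "\<lambda>l. \<Sum>p\<in>P. u p * of_int (coord (cayley_exponent p) l)"
	let ?L = "laurent (n + n) (cayley_set n n A) (cayley_poly n n A c)"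
	have yt: "y \<in> torus (n + n)" unfolding y by (rule exp_torus)
	have y0: "y j \<noteq> 0" if "j < n + n" for j using that by (simp add: y)
	have char: "character (n + n) (cayley_exponent p) y = ?e p" if p: "p \<in> P" for p
	proof -
		have fp: "fst p < n" using p by (auto simp: system_index_def)
		have "(\<Sum>l<n. Z (n + l) * of_int (coord (cayley_exponent p) (n + l))) = (\<Sum>l<n. if l = fst p then Z (n + l) else 0)"
			by (intro sum.cong refl) (simp add: lookup_cayley_exponent(2)[OF p])
		also have "\<dots> = Z (n + fst p)" using fp by simp
		finally show ?thesis unfolding y character_exp sum_lessThan_add affine_form_def
			by (simp add: lookup_cayley_exponent(1)[OF p] cvec_apply add.commute)
	qed
	have lau: "?L y = (\<Sum>p\<in>P. u p)"
		unfolding laurent_def cayley_set_eq sum.reindex[OF cayley_exponent_inj] u_def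
		by (intro sum.cong refl) (simp add: cayley_poly_exponent char)
	have diff: "differential (n + n) ?L y v
			= (\<Sum>l<n + n. ?s l * (v l / y l))" for v
		unfolding differential_laurent[OF yt] cayley_set_eq sum.reindex[OF cayley_exponent_inj] u_def
		by (intro sum.cong refl arg_cong2[where f = "(*)"]) (simp add: cayley_poly_exponent char)
	have uP: "u \<in> coeff_space P" using c by (simp add: u_def coeff_space_def)
	show ?thesis unfolding lau diff u_def[symmetric]
	proof
		assume L: "(\<Sum>p\<in>P. u p) = 0 \<and> (\<forall>v. (\<Sum>l<n + n. ?s l * (v l / y l)) = 0)"
		have z: "?s l = 0" if l: "l < n + n" for l
		proof -
			have "0 = (\<Sum>j<n + n. ?s j * ((if j = l then y l else 0) / y j))"
				by (rule conjunct2[OF L, rule_format, symmetric])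
			also have "\<dots> = (\<Sum>j<n + n. if j = l then ?s j else 0)" using y0 by (intro sum.cong refl) simp
			finally show ?thesis using l by simp
		qed
		show "u \<in> relations" unfolding relations_def
		proof (intro CollectI conjI uP allI impI)
			fix i assume i: "i < n"
			have "?s (n + i) = (\<Sum>p\<in>P. if fst p = i then u p else 0)"
				by (intro sum.cong refl) (simp add: lookup_cayley_exponent(2))
			also have "\<dots> = (\<Sum>l<n. if l = i then (\<Sum>a\<in>A l. u (l, a)) else 0)"
				unfolding sum_P by (intro sum.cong refl) simp
			also have "\<dots> = (\<Sum>a\<in>A i. u (i, a))" using i by simp
			finally show "(\<Sum>a\<in>A i. u (i, a)) = 0" using z[of "n + i"] i by simp
		next
			fix j assume j: "j < n"
			have "?s j = (\<Sum>p\<in>P. u p * lvec (snd p) j)"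
				by (intro sum.cong refl) (simp add: lookup_cayley_exponent(1)[OF _ j] cvec_apply)
			then have "(\<Sum>p\<in>P. u p * lvec (snd p) j) = 0" using z[of j] j by simp
			then show "(\<Sum>i<n. moment u i j) = 0" by (simp add: sum_P moment_def)
		qed
	next
		assume rel: "u \<in> relations"
		have "linear_on_P (\<lambda>p. of_int (coord (cayley_exponent p) l))" if l: "l < n + n" for l
		proof (cases "l < n")
			case True
			have "linear_on_P (basis_fun (Inr l))" by (rule linear_on_P_basis_single[OF InrI]) (simp add: True)
			moreover have "of_int (coord (cayley_exponent p) l) = basis_fun (Inr l) p" if "p \<in> P" for p
				by (simp add: lookup_cayley_exponent(1)[OF that True] basis_fun_def cvec_apply)
			ultimately show ?thesis by (subst linear_on_P_cong)
		next
			case False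
			define i where "i = l - n"
			have i: "l = n + i" "i < n" using False l by (simp_all add: i_def)
			have "linear_on_P (basis_fun (Inl i))" by (rule linear_on_P_basis_single[OF InlI]) (simp add: i(2))
			moreover have "of_int (coord (cayley_exponent p) l) = basis_fun (Inl i) p" if "p \<in> P" for p
				by (simp add: i(1) lookup_cayley_exponent(2)[OF that] basis_fun_def)
			ultimately show ?thesis by (subst linear_on_P_cong)
		qed
		then have "?s l = 0" if "l < n + n" for l using that by (intro relations_pairing[OF rel])
		moreover have "(\<Sum>p\<in>P. u p) = 0" using relations_pairing[OF rel linear_on_P_const[of 1]] by simp
		ultimately show "(\<Sum>p\<in>P. u p) = 0 \<and> (\<forall>v. (\<Sum>l<n + n. ?s l * (v l / y l)) = 0)" by simp
	qed
qed

lemma cayley_singular_systems: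
	"{g \<in> coeff_space (cayley_set n n A). \<exists>y \<in> torus (n + n). cayley_singular g y} = cayley_poly n n A ` cay_points"
proof (intro equalityI subsetI)
	fix g assume "g \<in> {g \<in> coeff_space (cayley_set n n A). \<exists>y \<in> torus (n + n). cayley_singular g y}"
	then obtain y where g: "g \<in> coeff_space (cayley_set n n A)" and yt: "y \<in> torus (n + n)"
		and s: "cayley_singular g y" by (elim CollectE bexE conjE) (rule that, simp_all)
	obtain Z where Z: "y = restrict (\<lambda>j. exp (Z j)) {..<n + n}" using torus_exp[OF yt] by (rule exE)
	let ?c = "cayley_pullback g" and ?\<kappa> = "\<lambda>i. Z (n + i)"
	have c: "?c \<in> coeff_space P" by (simp add: coeff_space_def cayley_pullback_def)
	have gc: "cayley_poly n n A ?c = g" by (rule cayley_poly_pullback[OF g])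
	have "(\<lambda>p. ?c p * exp (affine_form Z ?\<kappa> p)) \<in> relations"
		using s unfolding cayley_singular_iff[OF c Z, unfolded gc] .
	then have "horn (\<lambda>p. ?c p * exp (affine_form Z ?\<kappa> p)) Z ?\<kappa> \<in> cay_points" by (rule cay_pointsI)
	moreover have "horn (\<lambda>p. ?c p * exp (affine_form Z ?\<kappa> p)) Z ?\<kappa> = ?c" by (rule ext) (simp add: horn_def exp_minus)
	ultimately have "?c \<in> cay_points" by simp
	then show "g \<in> cayley_poly n n A ` cay_points" using gc by (intro image_eqI[of g _ ?c]) simp_all
next
	fix g assume "g \<in> cayley_poly n n A ` cay_points"
	then obtain c where gc: "g = cayley_poly n n A c" and "c \<in> cay_points" by (rule imageE)
	then obtain w \<zeta> \<kappa> where w: "w \<in> relations" and cw: "c = horn w \<zeta> \<kappa>" unfolding cay_points_def by (elim CollectE exE conjE)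
	have c: "c \<in> coeff_space P" unfolding cw by (rule horn_coeff_space[OF w])
	define Z where "Z j = (if j < n then \<zeta> j else \<kappa> (j - n))" for j
	have "(\<lambda>p. c p * exp (affine_form Z (\<lambda>i. Z (n + i)) p)) = w"
	proof
		fix p
		have "affine_form Z (\<lambda>i. Z (n + i)) p = affine_form \<zeta> \<kappa> p" by (simp add: affine_form_def Z_def)
		then show "c p * exp (affine_form Z (\<lambda>i. Z (n + i)) p) = w p" by (simp add: cw horn_def exp_minus)
	qed
	then have s: "cayley_singular (cayley_poly n n A c) (restrict (\<lambda>j. exp (Z j)) {..<n + n})"
		unfolding cayley_singular_iff[OF c refl] using w by simp
	show "g \<in> {g \<in> coeff_space (cayley_set n n A). \<exists>y \<in> torus (n + n). cayley_singular g y}"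
		unfolding gc
		by (rule CollectI, rule conjI[OF cayley_poly_coeff_space], rule bexI[where x = "restrict (\<lambda>j. exp (Z j)) {..<n + n}"],
			rule s, rule exp_torus)
qed

lemma cayley_discriminant_eq: "cayley_discriminant n n A = (zariski P) closure_of cay_points"
proof -
	have \<Phi>: "(\<lambda>c. cayley_poly n n A c b) \<in> polys" for b
	proof -
		have "(\<lambda>c. if b = a + frag_of (n + i) then c (i, a) else 0) \<in> polys" for i a
			by (cases "b = a + frag_of (n + i)") (simp_all add: polynomial_functions.coord polynomial_functions.const)
		then show ?thesis unfolding cayley_poly_def by (intro polynomial_functions_sum)
	qed
	have \<Psi>: "(\<lambda>g. cayley_pullback g p) \<in> polys" for p
		by (cases "p \<in> P") (simp_all add: cayley_pullback_def polynomial_functions.coord polynomial_functions.const)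
	have "cayley_poly n n A c \<in> (zariski (cayley_set n n A)) closure_of (cayley_poly n n A ` cay_points) \<longleftrightarrow> c \<in> (zariski P) closure_of cay_points"
		if "c \<in> coeff_space P" for c
		by (rule zariski_closure_transport[OF cay_points_coeff_space that \<Phi> cayley_poly_coeff_space \<Psi> cayley_pullback_poly])
	moreover have "(zariski P) closure_of cay_points \<subseteq> coeff_space P"
		using closure_of_subset_topspace[of "zariski P" cay_points] by simp
	ultimately show ?thesis unfolding cayley_discriminant_def cayley_singular_systems by blast
qed

lemma mixed_discriminant_eq: "0 < n ==> mixed_discriminant n n A = (zariski P) closure_of mix_points"
	unfolding mixed_discriminant_def by (simp only: multiple_root_systems)

end

theorem theorem1p8:
  fixes n k :: nat and A :: "nat \<Rightarrow> (nat \<Rightarrow>\<^sub>0 int) set"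
  assumes sets: "\<And>i. i < k \<Longrightarrow> finite (A i) \<and> A i \<noteq> {} \<and> A i \<subseteq> carrier (int_lattice n)"
    and span: "tuple_span (int_lattice n) A {..<k} = carrier (int_lattice n)"
    and BK: "BK_tuple (int_lattice n) A {..<k}"
  shows "(\<not> simple_BK_tuple (int_lattice n) A {..<k} \<longrightarrow> mixed_discriminant n k A = {}) \<and>
    (simple_BK_tuple (int_lattice n) A {..<k} \<and> \<not> prelinear (int_lattice n) A {..<k} \<longrightarrow>
       hypersurface (zariski (system_index k A)) (mixed_discriminant n k A)) \<and>
    (simple_BK_tuple (int_lattice n) A {..<k} \<and> prelinear (int_lattice n) A {..<k} \<longrightarrow>
       irreducible_closedin (zariski (system_index k A)) (mixed_discriminant n k A) \<and>
       codimension (zariski (system_index k A)) (mixed_discriminant n k A) = 2) \<and>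
    (simple_BK_tuple (int_lattice n) A {..<k} \<longrightarrow>
       mixed_discriminant n k A = cayley_discriminant n k A)"
proof -
	have e: "(int_lattice n)\<lparr>carrier := carrier (int_lattice n)\<rparr> = int_lattice n" by simp
	have "lattice_dim (int_lattice n) (carrier (int_lattice n)) = n"
		by (rule lattice_dim_eqI) (simp_all only: e iso_refl group_free_Abelian_group)
	\<comment> \<open>The lattice spanned has rank n, and zero defect makes this the number of
	  sets.\<close>
	then have kn: "k = n" using BK span by (simp add: BK_tuple_def defect_def)
	note sets = sets[unfolded kn] and span = span[unfolded kn] and BK = BK[unfolded kn]
	interpret BK_finite_tuple n A by unfold_locales (use sets span BK in simp_all)
	have empty: "mixed_discriminant n n A = {}" if ns: "\<not> simple_BK_tuple (int_lattice n) A {..<n}"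
	proof (cases "0 < n")
		case True
		have "mix_points = {}" unfolding mix_points_def not_simple_imp_no_proper_relations[OF ns True] by simp
		then show ?thesis unfolding mixed_discriminant_eq[OF True] by simp
	next
		case False
		then have n0: "n = 0" by simp
		\<comment> \<open>For n = 0 the exterior product of no forms is 1, so there is no degenerate root
		  at all and the discriminant of the empty tuple, which is not simple, is empty.\<close>
		have "wedge 0 F v = 1" for F :: "nat => (nat => complex) => complex" and v by (rule wedge_identity) simp
		then have "\<not> nondegenerate_multiple_root n n A c x" for c x
			unfolding nondegenerate_multiple_root_def degenerate_root_def n0 by simp
		then have "{c \<in> coeff_space P. \<exists>x. nondegenerate_multiple_root n n A c x} = {}" by blast
		then show ?thesis unfolding mixed_discriminant_def by (simp only: closure_of_empty)
	qed
	have simple: "mixed_discriminant n n A = cayley_discriminant n n A \<and>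
			(\<not> prelinear (int_lattice n) A {..<n} --> hypersurface (zariski P) (cayley_discriminant n n A)) \<and>
			(prelinear (int_lattice n) A {..<n} --> irreducible_closedin (zariski P) (cayley_discriminant n n A) \<and>
				codimension (zariski P) (cayley_discriminant n n A) = 2)"
		if s: "simple_BK_tuple (int_lattice n) A {..<n}"
	proof -
		interpret simple_finite_tuple n A by unfold_locales (rule s)
		have ne: "proper_relations \<noteq> {}" using transversal_vectors_exist by auto
		have eq: "mixed_discriminant n n A = cayley_discriminant n n A"
			unfolding mixed_discriminant_eq[OF n_pos] cayley_discriminant_eq by (rule closure_mix_eq_closure_cay[OF ne n_pos])
		show ?thesis unfolding eq prelinear_iff_degenerate cayley_discriminant_eq
			using hypersurface_closure_cay[OF n_pos] codimension_two_closure_cay[OF n_pos _ ne] irreducible_cay by blast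
	qed
	show ?thesis unfolding kn using empty simple by metis
qed

end
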